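(* Suppose regularity conditions R1–R5 (listed in the context) hold. Fix an area $i$. Then, under the three-level hierarchical model M2 with prior $p(\beta,A)\propto\pi(A)$, the posterior coverage of the interval $I_i^{\mathrm N}:\ \tilde\theta_i\pm z\,\tilde\delta_i$ satisfies, as $m\to\infty$, $$P^{\pi}(\theta_i\in I_i^{\mathrm N}\mid y)=1-\alpha+\phi(z)\,\hat c_i+o_p(m^{-1}),$$ where $$\hat c_i=\frac{2z\hat B_i}{\hat A\,\mathrm{tr}[\hat V^{-2}]}\left[\hat l_i^{(1)}-\frac12\left\{\left(\frac{\hat B_i}{2}-2\right)\frac1{\hat A}+4\,\frac{\mathrm{tr}[\hat V^{-3}]}{\mathrm{tr}[\hat V^{-2}]}\right\}-\hat\rho_1-\left(\frac{y_i-x_i'\hat\beta}{\hat A+D_i}\right)^2-\frac{z^2\hat B_i}{4\hat A}\right],$$ $$\hat l_i^{(1)}=\frac{2}{\hat A+D_i}+\frac{(1+z^2)D_i}{4\hat A(\hat A+D_i)},\qquad \hat\rho_1=\frac{\partial}{\partial A}\log\pi(A)\Big|_{A=\hat A}.$$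
   Context: Models. For $i=1,\dots,m$: Level 1: $y_i\mid\theta_i\sim N(\theta_i,D_i)$ independently, with known $D_i>0$; Level 2: $\theta_i\mid\beta,A\sim N(x_i'\beta,A)$ independently, with known $x_i\in\mathbb R^p$, $p<m$, unknown $\beta\in\mathbb R^p$ and $A>0$. Levels 1 and 2 form model M1. Model M2 adds Level 3: a prior with density $p(\beta,A)\propto\pi(A)$ (flat in $\beta$), $\beta\in\mathbb R^p$, $A>0$. $P^\pi(\cdot\mid y)$ is posterior probability under M2. Notation. $y=(y_1,\dots,y_m)'$; $X=(x_1,\dots,x_m)'$; $V=V(A)=\mathrm{diag}(A+D_1,\dots,A+D_m)$; $B_i=B_i(A)=D_i/(A+D_i)$; $r_i=r_i(A)=x_i'(X'V^{-1}X)^{-1}x_i$; $q_i=x_i'(X'X)^{-1}x_i$; $g_{1i}=AD_i/(A+D_i)$; $g_{2i}=B_i^2r_i$; $\delta_i=\delta_i(A)=\sqrt{g_{1i}+g_{2i}}$; $\bar\beta(A)=(X'V^{-1}X)^{-1}X'V^{-1}y$; $P=V^{-1}-V^{-1}X(X'V^{-1}X)^{-1}X'V^{-1}$. The residual likelihood is $L_{\mathrm{RE}}(A)=|V|^{-1/2}|X'V^{-1}X|^{-1/2}\exp(-\tfrac12y'Py)$. $\alpha\in(0,1)$, $z=z_{\alpha/2}$ is the upper $100(\alpha/2)\%$ point of $N(0,1)$, and $\phi$ is the $N(0,1)$ density. Estimators. $\hat A$ is the REML estimator of $A$ (maximizer of $L_{\mathrm{RE}}$); $\hat V=V(\hat A)$,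 $\hat B_i=B_i(\hat A)$, $\hat\beta=\bar\beta(\hat A)$. $\tilde A_i$ is the adjusted maximum likelihood (AML) estimator of $A$, i.e. the maximizer of $h_i(A)L_{\mathrm{RE}}(A)$, with $h_i(A)=A^{(1+z^2)/4}(A+D_i)^{(7-z^2)/4}$. Also $h_{i;\mathrm{YL}}(A)=h_i(A)\exp\left[\int\frac{r_i}{2}\mathrm{tr}[V^{-2}]\,dA\right]$. Put $\tilde B_i=B_i(\tilde A_i)$, $\tilde\beta=\bar\beta(\tilde A_i)$, $\tilde\delta_i=\delta_i(\tilde A_i)$, $\tilde\theta_i=(1-\tilde B_i)y_i+\tilde B_ix_i'\tilde\beta$. Regularity conditions. R1: $\log h_i$ and $\log h_{i;\mathrm{YL}}$ are free of $y$ and four times continuously differentiable in $A$, and their derivatives in $A$ of orders $k=0,1,2,3$ are $O(1)$ for large $m$. R2: $|\tilde A_i|<Cm^\lambda$ with $C$ a generic positive constant and $\lambda$ a small positive constant. R3: $\mathrm{rank}(X)=p$. R4: the elements of $X$ are uniformly bounded, implying $\sup_{j\ge1}q_j=O(m^{-1})$. R5: $0<\inf_{j\ge1}D_j\le\sup_{j\ge1}D_j<\infty$, $A\in(0,\infty)$. Asymptotics are as $m\to\infty$ with $i$, $p$, $\alpha$ fixed; stochastic orders refer to the law of $y$ under M1 with fixed $(\beta,A)$.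
   Formalization: The prior density π is assumed positive and continuously differentiable on (0,∞) with a proper posterior for all large m; the bound sup q_j = O(1/m) in R4 is assumed together with boundedness of X, which alone does not imply it. *)

theory Defs
  imports "HOL-Probability.Probability" "HOL-Library.Landau_Symbols"
begin

text \<open>
  Areas are numbered from 0, so the data of size \<open>m\<close> are those of the areas \<open>j < m\<close>; the
  arguments \<open>x\<close>, \<open>D\<close>, \<open>y\<close> are infinite sequences of which only the first \<open>m\<close> terms are used.
  The matrix \<open>X\<close> has the rows \<open>x 0, \<dots>, x (m - 1)\<close>. Since \<open>m\<close> varies while \<open>p\<close> is fixed, only the
  \<open>p \<times> p\<close> and \<open>p\<close>-dimensional objects are library matrices and vectors; the diagonal \<open>m \<times> m\<close>
  matrix \<open>V\<close> is written out by its entries \<open>A + D j\<close>.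
\<close>

text \<open>
  Model M1: the pairs (theta_j, y_j) are independent, and the joint density of a pair is the
  level 2 density of theta_j times the level 1 conditional density of y_j given theta_j.
\<close>

definition model_M1 ::
  "'w measure \<Rightarrow> (nat \<Rightarrow> 'w \<Rightarrow> real) \<Rightarrow> (nat \<Rightarrow> 'w \<Rightarrow> real) \<Rightarrow> (nat \<Rightarrow> real ^ 'p)
    \<Rightarrow> (nat \<Rightarrow> real) \<Rightarrow> real ^ 'p \<Rightarrow> real \<Rightarrow> bool" where
  "model_M1 M \<Theta> Y x D \<beta> A \<longleftrightarrow>
     prob_space M \<and>
     prob_space.indep_vars M (\<lambda>_. borel \<Otimes>\<^sub>M borel) (\<lambda>j \<omega>. (\<Theta> j \<omega>, Y j \<omega>)) UNIV \<and>
     (\<forall>j. distributed M (lborel \<Otimes>\<^sub>M lborel) (\<lambda>\<omega>. (\<Theta> j \<omega>, Y j \<omega>))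
        (\<lambda>(t, u). ennreal (normal_density (x j \<bullet> \<beta>) (sqrt A) t * normal_density t (sqrt (D j)) u)))"

text \<open>
  Model M2 for given data \<open>y\<close>: the unnormalised joint measure of the unknowns
  (theta_0, ..., theta_{m-1}), beta and A. The prior density is proportional to \<open>prior A\<close> on
  \<open>A > 0\<close> (flat in beta) and may be improper; values of \<open>prior\<close> at \<open>A \<le> 0\<close> are irrelevant.
\<close>

definition joint_M2 ::
  "(nat \<Rightarrow> real ^ 'p) \<Rightarrow> (nat \<Rightarrow> real) \<Rightarrow> (real \<Rightarrow> real) \<Rightarrow> nat \<Rightarrow> (nat \<Rightarrow> real)
    \<Rightarrow> ((nat \<Rightarrow> real) \<times> (real ^ 'p) \<times> real) measure" where
  "joint_M2 x D prior m y =
     density ((\<Pi>\<^sub>M j\<in>{..<m}. lborel) \<Otimes>\<^sub>M (lborel \<Otimes>\<^sub>M lborel))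
       (\<lambda>(\<theta>, \<beta>, A). ennreal (
          (\<Prod>j<m. normal_density (\<theta> j) (sqrt (D j)) (y j)) *
          (\<Prod>j<m. normal_density (x j \<bullet> \<beta>) (sqrt A) (\<theta> j)) *
          (prior A * indicator {0<..} A)))"

definition posterior_proper ::
  "(nat \<Rightarrow> real ^ 'p) \<Rightarrow> (nat \<Rightarrow> real) \<Rightarrow> (real \<Rightarrow> real) \<Rightarrow> nat \<Rightarrow> (nat \<Rightarrow> real) \<Rightarrow> bool" where
  "posterior_proper x D prior m y \<longleftrightarrow>
     emeasure (joint_M2 x D prior m y) (space (joint_M2 x D prior m y)) < \<infinity>"

definition posterior_prob ::
  "(nat \<Rightarrow> real ^ 'p) \<Rightarrow> (nat \<Rightarrow> real) \<Rightarrow> (real \<Rightarrow> real) \<Rightarrow> nat \<Rightarrow> (nat \<Rightarrow> real) \<Rightarrow> nat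
    \<Rightarrow> real set \<Rightarrow> real" where
  "posterior_prob x D prior m y i S =
     measure (joint_M2 x D prior m y)
       {(\<theta>, \<beta>, A) \<in> space (joint_M2 x D prior m y). \<theta> i \<in> S} /
     measure (joint_M2 x D prior m y) (space (joint_M2 x D prior m y))"

definition trVinv :: "(nat \<Rightarrow> real) \<Rightarrow> nat \<Rightarrow> nat \<Rightarrow> real \<Rightarrow> real" where
  "trVinv D m k A = (\<Sum>j<m. 1 / (A + D j) ^ k)"  (* tr[V^{-k}] *)

definition XtX :: "(nat \<Rightarrow> real ^ 'p) \<Rightarrow> nat \<Rightarrow> real ^ 'p ^ 'p" where
  "XtX x m = (\<chi> k l. \<Sum>j<m. x j $ k * x j $ l)"

definition XtVX :: "(nat \<Rightarrow> real ^ 'p) \<Rightarrow> (nat \<Rightarrow> real) \<Rightarrow> nat \<Rightarrow> real \<Rightarrow> real ^ 'p ^ 'p" where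
  "XtVX x D m A = (\<chi> k l. \<Sum>j<m. x j $ k * x j $ l / (A + D j))"  (* X'V^{-1}X *)

definition lev :: "(nat \<Rightarrow> real ^ 'p::finite) \<Rightarrow> nat \<Rightarrow> nat \<Rightarrow> real" where
  "lev x m i = x i \<bullet> (matrix_inv (XtX x m) *v x i)"  (* q_i *)

definition r_fun ::
  "(nat \<Rightarrow> real ^ 'p::finite) \<Rightarrow> (nat \<Rightarrow> real) \<Rightarrow> nat \<Rightarrow> nat \<Rightarrow> real \<Rightarrow> real" where
  "r_fun x D m i A = x i \<bullet> (matrix_inv (XtVX x D m A) *v x i)"

definition B_fun :: "(nat \<Rightarrow> real) \<Rightarrow> nat \<Rightarrow> real \<Rightarrow> real" where
  "B_fun D i A = D i / (A + D i)"

definition g1 :: "(nat \<Rightarrow> real) \<Rightarrow> nat \<Rightarrow> real \<Rightarrow> real" where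
  "g1 D i A = A * D i / (A + D i)"

definition g2 ::
  "(nat \<Rightarrow> real ^ 'p::finite) \<Rightarrow> (nat \<Rightarrow> real) \<Rightarrow> nat \<Rightarrow> nat \<Rightarrow> real \<Rightarrow> real" where
  "g2 x D m i A = (B_fun D i A)\<^sup>2 * r_fun x D m i A"

definition delta ::
  "(nat \<Rightarrow> real ^ 'p::finite) \<Rightarrow> (nat \<Rightarrow> real) \<Rightarrow> nat \<Rightarrow> nat \<Rightarrow> real \<Rightarrow> real" where
  "delta x D m i A = sqrt (g1 D i A + g2 x D m i A)"

definition beta_bar ::
  "(nat \<Rightarrow> real ^ 'p::finite) \<Rightarrow> (nat \<Rightarrow> real) \<Rightarrow> nat \<Rightarrow> (nat \<Rightarrow> real) \<Rightarrow> real \<Rightarrow> real ^ 'p" where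
  "beta_bar x D m y A =
     matrix_inv (XtVX x D m A) *v (\<Sum>j<m. (y j / (A + D j)) *\<^sub>R x j)"

definition P_entry ::
  "(nat \<Rightarrow> real ^ 'p::finite) \<Rightarrow> (nat \<Rightarrow> real) \<Rightarrow> nat \<Rightarrow> real \<Rightarrow> nat \<Rightarrow> nat \<Rightarrow> real" where
  "P_entry x D m A j k =
     (if j = k then 1 / (A + D j) else 0) -
     (x j \<bullet> (matrix_inv (XtVX x D m A) *v x k)) / ((A + D j) * (A + D k))"

definition L_RE ::
  "(nat \<Rightarrow> real ^ 'p::finite) \<Rightarrow> (nat \<Rightarrow> real) \<Rightarrow> nat \<Rightarrow> (nat \<Rightarrow> real) \<Rightarrow> real \<Rightarrow> real" where
  "L_RE x D m y A =
     (\<Prod>j<m. A + D j) powr (-1/2) * det (XtVX x D m A) powr (-1/2) *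
     exp (- (1/2) * (\<Sum>j<m. \<Sum>k<m. y j * P_entry x D m A j k * y k))"

definition h_adj :: "(nat \<Rightarrow> real) \<Rightarrow> real \<Rightarrow> nat \<Rightarrow> real \<Rightarrow> real" where
  "h_adj D z i A = A powr ((1 + z\<^sup>2) / 4) * (A + D i) powr ((7 - z\<^sup>2) / 4)"

text \<open>
  The indefinite integral in the definition of h_YL is taken to be the one vanishing at 0.
\<close>

definition h_YL ::
  "(nat \<Rightarrow> real ^ 'p::finite) \<Rightarrow> (nat \<Rightarrow> real) \<Rightarrow> real \<Rightarrow> nat \<Rightarrow> nat \<Rightarrow> real \<Rightarrow> real" where
  "h_YL x D z m i A =
     h_adj D z i A * exp (integral {0..A} (\<lambda>a. r_fun x D m i a / 2 * trVinv D m 2 a))"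

text \<open>
  Maximisation is over the closed half-line: the residual likelihood may be maximal at
  \<open>A = 0\<close> for some data. The adjusted likelihood vanishes at 0, so its maximiser is positive.
\<close>

definition is_REML ::
  "(nat \<Rightarrow> real ^ 'p::finite) \<Rightarrow> (nat \<Rightarrow> real) \<Rightarrow> nat \<Rightarrow> (nat \<Rightarrow> real) \<Rightarrow> real \<Rightarrow> bool" where
  "is_REML x D m y a \<longleftrightarrow> is_arg_max (L_RE x D m y) (\<lambda>A. 0 \<le> A) a"

definition is_AML ::
  "(nat \<Rightarrow> real ^ 'p::finite) \<Rightarrow> (nat \<Rightarrow> real) \<Rightarrow> real \<Rightarrow> nat \<Rightarrow> nat \<Rightarrow> (nat \<Rightarrow> real)
    \<Rightarrow> real \<Rightarrow> bool" where
  "is_AML x D z m i y a \<longleftrightarrow>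
     is_arg_max (\<lambda>A. h_adj D z i A * L_RE x D m y A) (\<lambda>A. 0 \<le> A) a"

definition theta_tilde ::
  "(nat \<Rightarrow> real ^ 'p::finite) \<Rightarrow> (nat \<Rightarrow> real) \<Rightarrow> nat \<Rightarrow> nat \<Rightarrow> (nat \<Rightarrow> real) \<Rightarrow> real \<Rightarrow> real" where
  "theta_tilde x D m i y A =
     (1 - B_fun D i A) * y i + B_fun D i A * (x i \<bullet> beta_bar x D m y A)"

definition interval_N ::
  "(nat \<Rightarrow> real ^ 'p::finite) \<Rightarrow> (nat \<Rightarrow> real) \<Rightarrow> real \<Rightarrow> nat \<Rightarrow> nat \<Rightarrow> (nat \<Rightarrow> real)
    \<Rightarrow> real \<Rightarrow> real set" where
  "interval_N x D z m i y A =
     {theta_tilde x D m i y A - z * delta x D m i A .. theta_tilde x D m i y A + z * delta x D m i A}"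

definition l1 :: "(nat \<Rightarrow> real) \<Rightarrow> real \<Rightarrow> nat \<Rightarrow> real \<Rightarrow> real" where
  "l1 D z i A = 2 / (A + D i) + (1 + z\<^sup>2) * D i / (4 * A * (A + D i))"

definition rho1 :: "(real \<Rightarrow> real) \<Rightarrow> real \<Rightarrow> real" where
  "rho1 prior A = deriv (\<lambda>a. ln (prior a)) A"

definition c_hat ::
  "(nat \<Rightarrow> real ^ 'p::finite) \<Rightarrow> (nat \<Rightarrow> real) \<Rightarrow> (real \<Rightarrow> real) \<Rightarrow> real \<Rightarrow> nat \<Rightarrow> nat
    \<Rightarrow> (nat \<Rightarrow> real) \<Rightarrow> real \<Rightarrow> real" where
  "c_hat x D prior z m i y A =
     2 * z * B_fun D i A / (A * trVinv D m 2 A) *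
     (l1 D z i A
      - 1/2 * ((B_fun D i A / 2 - 2) * (1 / A) + 4 * (trVinv D m 3 A / trVinv D m 2 A))
      - rho1 prior A
      - ((y i - x i \<bullet> beta_bar x D m y A) / (A + D i))\<^sup>2
      - z\<^sup>2 * B_fun D i A / (4 * A))"

text \<open>\<open>S\<close> is meant to be open, since \<open>deriv\<close> is the two-sided derivative.\<close>

definition Ck_on :: "nat \<Rightarrow> (real \<Rightarrow> real) \<Rightarrow> real set \<Rightarrow> bool" where
  "Ck_on k f S \<longleftrightarrow>
     (\<forall>j<k. \<forall>a\<in>S. (deriv ^^ j) f field_differentiable (at a)) \<and> continuous_on S ((deriv ^^ k) f)"

text \<open>
  The outer probability of \<open>E m\<close> tends to 0. For measurable \<open>E m\<close> this says that the probability
  of \<open>E m\<close> tends to 0; the cover avoids that non-measurable sets have \<open>measure\<close> 0 by convention.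
\<close>

definition asymp_null :: "'w measure \<Rightarrow> (nat \<Rightarrow> 'w set) \<Rightarrow> bool" where
  "asymp_null M E \<longleftrightarrow>
     (\<exists>F. (\<forall>m. F m \<in> sets M \<and> E m \<subseteq> F m) \<and> (\<lambda>m. measure M (F m)) \<longlonglongrightarrow> 0)"

definition small_op :: "'w measure \<Rightarrow> (nat \<Rightarrow> 'w \<Rightarrow> real) \<Rightarrow> (nat \<Rightarrow> real) \<Rightarrow> bool" where
  "small_op M R s \<longleftrightarrow> (\<forall>\<epsilon>>0. asymp_null M (\<lambda>m. {\<omega> \<in> space M. \<bar>R m \<omega>\<bar> > \<epsilon> * s m}))"

end

theory Submission
  imports Defs "HOL-Real_Asymp.Real_Asymp"
begin

text \<open>
  Integrating \<open>\<theta>\<close> and \<open>\<beta>\<close> out of M2, the posterior density of \<open>A\<close> is proportional to the prior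
  times \<open>L_RE\<close>, and given \<open>A\<close> the effect \<open>\<theta> i\<close> is normal with mean \<open>theta_tilde\<close> and standard
  deviation \<open>delta\<close>. The posterior coverage is therefore the posterior mean over \<open>A\<close> of a smooth
  function, whose second-order expansion around \<open>A_tilde\<close> involves only the posterior mean of
  \<open>s = A - A_tilde\<close> and of \<open>s^2\<close> up to \<open>o(1/m)\<close>. No Laplace expansion of the integrals is needed:
  integrating the derivatives of \<open>s^k * prior * L_RE\<close> over a fixed neighbourhood of the true \<open>A0\<close>
  gives linear relations between these moments, because the score is quadratic in \<open>s\<close> up to a
  small error. The mass outside the neighbourhood is exponentially small.

  Everything up to this point is proved for deterministic sequences of data along which
  countably many averages converge; Chebyshev's inequality and a diagonal argument then give
  the statement in probability.
\<close>

text \<open>The delicate quantity is the error of the expansion of the score at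
  \<open>A_tilde\<close>. Apart from a cubic term it has the order
  \<open>(\<tau>^2/m + m*(A_tilde - A0)^2 + 1)*|s|\<close>, where \<open>\<tau>\<close> is the size
  of the noise sums at \<open>A0\<close>. Since \<open>s\<close> is of order m^(-1/2) under the
  posterior, this is harmless when the bracket is o(sqrt m), which asks for noise sums o(m^(3/4))
  and for \<open>A_tilde - A0\<close> = o(m^(-1/4)). Chebyshev's inequality gives sums of order
  m^(1/2); normalised by m^(3/4) they tend to 0 in probability and in turn yield the rate of
  \<open>A_tilde\<close>. This is the origin of the exponent 3/4. The adjustment factor acts through
  the stationarity of \<open>A_tilde\<close>: there the score of \<open>L_RE\<close> is
  \<open>- l1\<close>, and so \<open>l1\<close> reaches the posterior mean of \<open>s\<close>. For
  \<open>A_hat\<close> consistency is enough, as \<open>c_hat\<close> is itself of order 1/m. The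
  normalised traces of V^{-k} need not converge, so quantities are compared with bounded sequences
  instead of limits. The tail of the prior is controlled through properness of the posterior for the
  data \<open>y = 0\<close>.\<close>

abbreviation (input) eventually_seq (binder "EV " 10) where "EV n. P n \<equiv> eventually P sequentially"

section \<open>Gaussian integrals\<close>

text \<open>Every square matrix is a product of elementary ones (diagonal matrices, swaps, shears,
  matrices with a zero row), and the claim is multiplicative in the matrix. A zero row means
  determinant 0, so there the implication in \<open>?P\<close> is vacuous. Nonnegative Borel
  functions avoid all integrability conditions.\<close>

lemma nn_integral_linear_change:
 fixes M :: "real^'n^'n" and f :: "real^'n \<Rightarrow> ennreal"
 assumes "det M \<noteq> 0" and "f \<in> borel_measurable borel"
 shows "(\<integral>\<^sup>+v. f v \<partial>lborel) = ennreal \<bar>det M\<bar>*(\<integral>\<^sup>+u. f (M *v u) \<partial>lborel)"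
proof -
 let ?P = "\<lambda>M::real^'n^'n. det M \<noteq> 0 \<longrightarrow> (\<forall>f\<in>borel_measurable borel.
  (\<integral>\<^sup>+v. f v \<partial>lborel) = ennreal \<bar>det M\<bar>*(\<integral>\<^sup>+u. f (M *v u) \<partial>lborel))"
 have mb: "(*v) (B::real^'n^'n) \<in> borel_measurable borel" for B
  by (intro borel_measurable_continuous_onI) (rule matrix_vector_mult_linear_continuous_on)
 have box_prod: "(\<Prod>b\<in>Basis. (v - w) \<bullet> b) = (\<Prod>i\<in>UNIV. v$i - w$i)" for v w :: "real^'n"
 proof -
  have "(\<Prod>b\<in>Basis. (v - w) \<bullet> b) = (\<Prod>b\<in>(\<lambda>i. axis i 1)`(UNIV::'n set). (v - w) \<bullet> b)"
   by (rule prod.cong) (auto simp: Basis_vec_def)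
  also have "\<dots> = (\<Prod>i\<in>UNIV. v$i - w$i)"
   by (subst prod.reindex) (auto simp: inj_on_def axis_eq_axis inner_axis)
  finally show ?thesis .
 qed
 have "?P M"
 proof (rule induct_matrix_elementary_alt[of ?P])
  fix A B :: "real^'n^'n"
  assume A: "?P A" and B: "?P B"
  show "?P (A ** B)"
  proof (intro impI ballI)
   fix f :: "real^'n \<Rightarrow> ennreal"
   assume d: "det (A ** B) \<noteq> 0" and f: "f \<in> borel_measurable borel"
   then have dA: "det A \<noteq> 0" and dB: "det B \<noteq> 0" by (auto simp: det_mul)
   have fA: "(\<lambda>v. f (A *v v)) \<in> borel_measurable borel"
    using measurable_compose[OF mb f] .
   show "(\<integral>\<^sup>+v. f v \<partial>lborel) = ennreal \<bar>det (A ** B)\<bar>*(\<integral>\<^sup>+u. f ((A ** B) *v u) \<partial>lborel)"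
    using A[rule_format, OF dA f] B[rule_format, OF dB fA]
    by (simp add: det_mul abs_mult ennreal_mult mult.assoc matrix_vector_mul_assoc)
  qed
 next
  fix A :: "real^'n^'n" and i assume "row i A = 0"
  then show "?P A" using det_zero_row by blast
 next
  fix A :: "real^'n^'n" assume A: "\<And>i j. i \<noteq> j \<Longrightarrow> A$i$j = 0"
  show "?P A"
  proof (intro impI ballI)
   fix f :: "real^'n \<Rightarrow> ennreal"
   assume d: "det A \<noteq> 0" and f[measurable]: "f \<in> borel_measurable borel"
   have dA: "det A = (\<Prod>i\<in>UNIV. A$i$i)" using A by (rule det_diagonal)
   then have nz: "A$i$i \<noteq> 0" for i using d by auto
   \<comment> \<open>\<open>c\<close> sends the unit vector \<open>axis i 1\<close> to the diagonal
     entry \<open>A$i$i\<close>; this is the scaling factor indexed by \<open>Basis\<close> that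
     \<open>lborel_affine_euclidean\<close> expects.\<close>
   define c where "c b = (\<Sum>i\<in>UNIV. A$i$i*b$i)" for b :: "real^'n"
   have c_axis: "c (axis i 1) = A$i$i" for i
    unfolding c_def axis_def by (simp add: if_distrib if_distribR sum.delta cong: if_cong)
   have T: "0 + (\<Sum>j\<in>Basis. (c j*(x \<bullet> j)) *\<^sub>R j) = A *v x" for x
   proof -
    have "(\<Sum>j\<in>Basis. (c j*(x \<bullet> j)) *\<^sub>R j) = (\<Sum>j\<in>(\<lambda>i. axis i 1)`(UNIV::'n set). (c j*(x \<bullet> j)) *\<^sub>R j)"
     by (rule sum.cong) (auto simp: Basis_vec_def)
    also have "\<dots> = (\<Sum>i\<in>UNIV. (A$i$i*x$i) *\<^sub>R axis i 1)"
     by (subst sum.reindex) (auto simp: inj_on_def axis_eq_axis inner_axis c_axis)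
    also have "\<dots> = A *v x"
    proof (subst vec_eq_iff, intro allI)
     fix k
     have "(A *v x) $ k = (\<Sum>j\<in>UNIV. A$k$j*x$j)" by (simp add: matrix_vector_mult_def)
     also have "\<dots> = (\<Sum>j\<in>UNIV. if j = k then A$k$k*x$k else 0)"
      by (rule sum.cong) (use A in auto)
     finally show "(\<Sum>i\<in>UNIV. (A$i$i*x$i) *\<^sub>R axis i 1) $ k = (A *v x) $ k"
      by (simp add: axis_def if_distrib sum.delta cong: if_cong)
    qed
    finally show ?thesis by simp
   qed
   have cd: "(\<Prod>j\<in>Basis. \<bar>c j\<bar>) = \<bar>det A\<bar>"
   proof -
    have "(\<Prod>j\<in>Basis. \<bar>c j\<bar>) = (\<Prod>j\<in>(\<lambda>i. axis i 1)`(UNIV::'n set). \<bar>c j\<bar>)"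
     by (rule prod.cong) (auto simp: Basis_vec_def)
    also have "\<dots> = (\<Prod>i\<in>UNIV. \<bar>A$i$i\<bar>)"
     by (subst prod.reindex) (auto simp: inj_on_def axis_eq_axis c_axis)
    finally show ?thesis by (simp add: dA abs_prod)
   qed
   have "lborel = density (distr lborel borel (\<lambda>x. 0 + (\<Sum>j\<in>Basis. (c j*(x \<bullet> j)) *\<^sub>R j))) (\<lambda>_. (\<Prod>j\<in>Basis. \<bar>c j\<bar>))"
    by (rule lborel_affine_euclidean) (auto simp: Basis_vec_def c_axis nz)
   then have L: "lborel = density (distr lborel borel ((*v) A)) (\<lambda>_. ennreal \<bar>det A\<bar>)"
    unfolding T cd .
   have "(\<integral>\<^sup>+v. f v \<partial>lborel) = (\<integral>\<^sup>+v. f v \<partial>density (distr lborel borel ((*v) A)) (\<lambda>_. ennreal \<bar>det A\<bar>))"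
    using L by simp
   also have "\<dots> = (\<integral>\<^sup>+v. ennreal \<bar>det A\<bar>*f v \<partial>distr lborel borel ((*v) A))"
    by (rule nn_integral_density) (auto simp: f)
   also have "\<dots> = (\<integral>\<^sup>+v. ennreal \<bar>det A\<bar>*f (A *v v) \<partial>lborel)"
    by (rule nn_integral_distr) (use mb f in auto)
   also have "\<dots> = ennreal \<bar>det A\<bar>*(\<integral>\<^sup>+v. f (A *v v) \<partial>lborel)"
    by (rule nn_integral_cmult) (use measurable_compose[OF mb f] in auto)
   finally show "(\<integral>\<^sup>+v. f v \<partial>lborel) = ennreal \<bar>det A\<bar>*(\<integral>\<^sup>+v. f (A *v v) \<partial>lborel)" .
  qed
 next
  fix m n :: 'n assume mn: "m \<noteq> n"
  let ?\<tau> = "Transposition.transpose m n"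
  let ?A = "\<chi> i j. (mat 1 :: real^'n^'n) $ i $ ?\<tau> j"
  have Av: "?A *v v = (\<chi> i. v $ ?\<tau> i)" for v
  proof -
   have "(\<Sum>j\<in>UNIV. (mat 1 :: real^'n^'n) $ i $ ?\<tau> j * v $ j) = v $ ?\<tau> i" for i
   proof -
    have "(\<Sum>j\<in>UNIV. (mat 1 :: real^'n^'n) $ i $ ?\<tau> j * v $ j) = (\<Sum>j\<in>UNIV. if j = ?\<tau> i then v $ j else 0)"
     by (rule sum.cong) (auto simp: mat_def)
    then show ?thesis by simp
   qed
   then show ?thesis by (simp add: matrix_vector_mult_def vec_eq_iff)
  qed
  \<comment> \<open>A measure that agrees with \<open>lborel\<close> on open boxes equals it; a swap
    maps boxes to boxes with permuted side lengths.\<close>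
  have L: "lborel = distr lborel borel ((*v) ?A)"
  proof (rule lborel_eqI)
   fix l u :: "real^'n" assume lu: "\<And>b. b \<in> Basis \<Longrightarrow> l \<bullet> b \<le> u \<bullet> b"
   have lu': "l $ i \<le> u $ i" for i using lu[of "axis i 1"] by (auto simp: Basis_vec_def inner_axis)
   let ?s = "\<lambda>v::real^'n. \<chi> i. v $ ?\<tau> i"
   have "(*v) ?A -` box l u = box (?s l) (?s u)"
    unfolding Av vimage_def
    by (auto simp: mem_box_cart) (metis transpose_involutory)+
   then have "emeasure (distr lborel borel ((*v) ?A)) (box l u) = emeasure lborel (box (?s l) (?s u))"
    by (subst emeasure_distr) (use mb in auto)
   also have "\<dots> = ennreal (\<Prod>b\<in>Basis. (?s u - ?s l) \<bullet> b)"
    by (rule emeasure_lborel_box) (auto simp: Basis_vec_def inner_axis lu')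
   also have "(\<Prod>b\<in>Basis. (?s u - ?s l) \<bullet> b) = (\<Prod>b\<in>Basis. (u - l) \<bullet> b)"
    unfolding box_prod
    using prod.reindex_bij_betw[OF permutes_bij[OF permutes_swap_id[of m UNIV n]], of "\<lambda>i. u$i - l$i"] by simp
   finally show "emeasure (distr lborel borel ((*v) ?A)) (box l u) = (\<Prod>b\<in>Basis. (u - l) \<bullet> b)" .
  qed simp
  have "det ?A = - 1"
  proof -
   have "?A = (\<chi> i. (mat 1 :: real^'n^'n) $ ?\<tau> i)"
    by (auto simp: vec_eq_iff mat_def)
   then show ?thesis
    using det_permute_rows[of ?\<tau> "mat 1 :: real^'n^'n"] mn
    by (simp add: permutes_swap_id sign_swap_id)
  qed
  then show "?P ?A"
   using mb by (subst (1) L) (auto simp: nn_integral_distr)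
 next
  fix m n :: 'n assume mn: "m \<noteq> n"
  let ?A = "(\<chi> i j. of_bool (i = m \<and> j = n \<or> i = j)) :: real^'n^'n"
  \<comment> \<open>\<open>?S\<close> is the inverse of the shear \<open>?h\<close>: the preimage of
    a box under \<open>?S\<close> is its image under \<open>?h\<close>, whose volume is
    known.\<close>
  let ?S = "\<lambda>v::real^'n. \<chi> i. if i = m then v$m - v$n else v$i"
  let ?h = "\<lambda>v::real^'n. \<chi> i. if i = m then v$m + v$n else v$i"
  have Av: "?A *v v = ?h v" for v
  proof -
   have "(\<Sum>j\<in>UNIV. of_bool (i = m \<and> j = n \<or> i = j) * v $ j) = (if i = m then v$m + v$n else v$i)" for i
   proof (cases "i = m")
    case True
    have "(\<Sum>j\<in>UNIV. of_bool (i = m \<and> j = n \<or> i = j) * v $ j) = (\<Sum>j\<in>UNIV. (if j = n then v$n else 0) + (if j = m then v$m else 0))"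
     by (rule sum.cong) (use True mn in auto)
    then show ?thesis using True by (simp add: sum.distrib)
   next
    case False
    have "(\<Sum>j\<in>UNIV. of_bool (i = m \<and> j = n \<or> i = j) * v $ j) = (\<Sum>j\<in>UNIV. (if j = i then v$i else 0))"
     by (rule sum.cong) (use False mn in auto)
    then show ?thesis using False by simp
   qed
   then show ?thesis by (simp add: matrix_vector_mult_def vec_eq_iff)
  qed
  have lin: "linear ?h" by (rule linearI) (auto simp: vec_eq_iff algebra_simps)
  have Sb: "?S \<in> borel_measurable borel"
  proof -
   have "linear ?S" by (rule linearI) (auto simp: vec_eq_iff algebra_simps)
   then show ?thesis by (intro borel_measurable_continuous_onI linear_continuous_on) (simp add: linear_conv_bounded_linear)
  qed
  have meq: "measure lebesgue (?h ` cbox a b) = 1*measure lebesgue (cbox a b)" for a b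
  proof (cases "cbox a b = {}")
   case False
   \<comment> \<open>The volume formula for sheared boxes is applied to a box with lower corner 0;
     translation reduces the general box to it.\<close>
   have e1: "cbox a b = (+) a ` cbox 0 (b - a)" by (subst cbox_translation[symmetric]) simp
   have e2: "?h ` cbox a b = (+) (?h a) ` ?h ` cbox 0 (b - a)"
    unfolding e1 image_comp by (rule image_cong) (auto simp: vec_eq_iff)
   have "cbox 0 (b - a) \<noteq> {}" using False e1 by auto
   then have "measure lebesgue (?h ` cbox 0 (b - a)) = measure lebesgue (cbox 0 (b - a))"
    by (rule measure_shear_interval[OF mn]) simp
   then show ?thesis unfolding e2 measure_translation by (simp add: e1 measure_translation)
  qed auto
  have L: "lborel = distr lborel borel ?S"
  proof (rule lborel_eqI)
   fix l u :: "real^'n" assume lu: "\<And>b. b \<in> Basis \<Longrightarrow> l \<bullet> b \<le> u \<bullet> b"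
   have "?S -` box l u = ?h ` box l u"
   proof (intro equalityI subsetI)
    fix v assume "v \<in> ?S -` box l u"
    moreover have "v = ?h (?S v)" using mn by (simp add: vec_eq_iff)
    ultimately show "v \<in> ?h ` box l u" by blast
   next
    fix v assume "v \<in> ?h ` box l u"
    then obtain w where w: "w \<in> box l u" "v = ?h w" by blast
    moreover have "?S (?h w) = w" using mn by (simp add: vec_eq_iff)
    ultimately show "v \<in> ?S -` box l u" by simp
   qed
   then have 1: "emeasure (distr lborel borel ?S) (box l u) = emeasure lborel (?h ` box l u)" and sb: "?h ` box l u \<in> sets borel"
    using measurable_sets[OF Sb, of "box l u"] by (auto simp: emeasure_distr Sb)
   have 2: "?h ` box l u \<in> lmeasurable \<and> 1*measure lebesgue (box l u) = measure lebesgue (?h ` box l u)"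
    by (rule measure_linear_sufficient[OF lin _ meq]) simp
   have "emeasure lborel (?h ` box l u) = emeasure lebesgue (?h ` box l u)" using sb by simp
   also have "\<dots> = ennreal (measure lebesgue (?h ` box l u))"
    using 2 by (simp add: emeasure_eq_measure2 fmeasurableD2)
   also have "\<dots> = ennreal (measure lborel (box l u))" using 2 by simp
   also have "\<dots> = emeasure lborel (box l u)"
    by (rule emeasure_eq_ennreal_measure[symmetric]) (use emeasure_lborel_box_finite[of l u] in auto)
   also have "\<dots> = (\<Prod>b\<in>Basis. (u - l) \<bullet> b)" using lu by (rule emeasure_lborel_box)
   finally show "emeasure (distr lborel borel ?S) (box l u) = (\<Prod>b\<in>Basis. (u - l) \<bullet> b)" using 1 by simp
  qed simp
  have dA: "det ?A = 1"
  proof -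
   have "?A = (\<chi> k. if k = m then row m (mat 1 :: real^'n^'n) + 1 *s row n (mat 1) else row k (mat 1))"
    using mn by (auto simp: vec_eq_iff mat_def row_def)
   then show ?thesis using det_row_operation[OF mn, of "mat 1 :: real^'n^'n" 1] by simp
  qed
  show "?P ?A"
  proof (intro impI ballI)
   fix f :: "real^'n \<Rightarrow> ennreal" assume f: "f \<in> borel_measurable borel"
   have "(*v) ?A = ?h" by (rule ext) (rule Av)
   with mb[of ?A] have hb: "?h \<in> borel_measurable borel" by (simp only:)
   have fh: "(\<lambda>v. f (?h v)) \<in> borel_measurable borel" using measurable_compose[OF hb f] .
   have "(\<integral>\<^sup>+u. f (?h u) \<partial>lborel) = (\<integral>\<^sup>+u. f (?h u) \<partial>distr lborel borel ?S)" using L by simp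
   also have "\<dots> = (\<integral>\<^sup>+u. f (?h (?S u)) \<partial>lborel)"
    by (rule nn_integral_distr) (use Sb fh in auto)
   also have "\<dots> = (\<integral>\<^sup>+u. f u \<partial>lborel)"
   proof (rule nn_integral_cong)
    fix u :: "real^'n"
    have "?h (?S u) = u" using mn by (simp add: vec_eq_iff)
    then show "f (?h (?S u)) = f u" by (simp only:)
   qed
   finally show "(\<integral>\<^sup>+v. f v \<partial>lborel) = ennreal \<bar>det ?A\<bar>*(\<integral>\<^sup>+u. f (?A *v u) \<partial>lborel)"
    unfolding Av dA by simp
  qed
 qed
 then show ?thesis using assms by blast
qed

text \<open>Gram-Schmidt for the inner product of \<open>Q\<close>, started in the direction of \<open>Q\<^sup>-\<^sup>1 x\<close>.\<close>

lemma exists_orthonormalising_matrix: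
 fixes Q :: "real^'n^'n" and x :: "real^'n"
 assumes sym: "transpose Q = Q" and pd: "\<And>v. v \<noteq> 0 \<Longrightarrow> 0 < v \<bullet> (Q *v v)"
  and y: "Q *v y = x"
 obtains M k where "\<And>u. (M *v u) \<bullet> (Q *v (M *v u)) = u \<bullet> u" "(det M)^2*det Q = 1"
  "\<And>u. x \<bullet> (M *v u) = sqrt (x \<bullet> y)*u $ k"
proof -
 obtain k0 :: 'n where True by simp
 have symd: "v \<bullet> (Q *v w) = w \<bullet> (Q *v v)" for v w
  by (metis sym dot_lmul_matrix inner_commute vector_transpose_matrix)
 \<comment> \<open>For \<open>x = 0\<close> the third claim is trivial and any nonzero first vector
   will do; otherwise the first vector is proportional to the solution \<open>y\<close> of
   \<open>Q *v y = x\<close>.\<close>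
 define v0 where "v0 = (if x = 0 then axis k0 1 else y)"
 have v0: "v0 \<noteq> 0" using y by (auto simp: v0_def axis_eq_0_iff)
 define v1 where "v1 = (1/sqrt (v0 \<bullet> (Q *v v0))) *\<^sub>R v0"
 have norm1: "\<And>v. v \<noteq> 0 \<Longrightarrow> ((1/sqrt (v \<bullet> (Q *v v))) *\<^sub>R v) \<bullet> (Q *v ((1/sqrt (v \<bullet> (Q *v v))) *\<^sub>R v)) = 1"
 proof -
  fix v :: "real^'n" assume "v \<noteq> 0"
  then have p: "0 < v \<bullet> (Q *v v)" by (rule pd)
  have "((1/sqrt (v \<bullet> (Q *v v))) *\<^sub>R v) \<bullet> (Q *v ((1/sqrt (v \<bullet> (Q *v v))) *\<^sub>R v))
    = (1/sqrt (v \<bullet> (Q *v v)))*((1/sqrt (v \<bullet> (Q *v v)))*(v \<bullet> (Q *v v)))"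
   by (simp only: matrix_vector_mult_scaleR inner_scaleR_left inner_scaleR_right)
  also have "\<dots> = 1" using p by (simp add: field_simps)
  finally show "((1/sqrt (v \<bullet> (Q *v v))) *\<^sub>R v) \<bullet> (Q *v ((1/sqrt (v \<bullet> (Q *v v))) *\<^sub>R v)) = 1" .
 qed
 have "\<exists>b::'n \<Rightarrow> real^'n. b k0 = v1 \<and> (\<forall>i\<in>insert k0 K. \<forall>j\<in>insert k0 K. b i \<bullet> (Q *v b j) = of_bool (i = j))"
  if "k0 \<notin> K" for K
  using finite[of K] that
 proof (induction K rule: finite_induct)
  case empty
  then show ?case using norm1[OF v0] by (intro exI[of _ "\<lambda>_. v1"]) (auto simp: v1_def)
 next
  case (insert a K)
  then have "k0 \<notin> K" by simp
  from insert.IH[OF this] obtain b where b0: "b k0 = v1"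
   and b': "\<forall>i\<in>insert k0 K. \<forall>j\<in>insert k0 K. b i \<bullet> (Q *v b j) = of_bool (i = j)" by blast
  have b: "\<And>i j. i\<in>insert k0 K \<Longrightarrow> j\<in>insert k0 K \<Longrightarrow> b i \<bullet> (Q *v b j) = of_bool (i = j)"
   using b' by blast
  \<comment> \<open>Fewer vectors \<open>Q *v b i\<close> than the dimension are given, so some
    \<open>z \<noteq> 0\<close> is orthogonal to all of them, which is orthogonality to the
    \<open>b i\<close> in the inner product of \<open>Q\<close>; normalising \<open>z\<close> gives
    the next member.\<close>
  let ?S = "(\<lambda>i. Q *v b i) ` insert k0 K"
  have "dim ?S \<le> card ?S" by (rule dim_le_card') simp
  also have "\<dots> \<le> card (insert k0 K)" by (rule card_image_le) simp
  also have "\<dots> < card (insert a (insert k0 K))" using insert by (subst card_insert_disjoint[of _ a]) auto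
  also have "\<dots> \<le> card (UNIV::'n set)" by (rule card_mono) auto
  finally have "dim ?S < DIM(real^'n)" by simp
  then obtain z where z: "z \<noteq> 0" "\<And>w. w \<in> span ?S \<Longrightarrow> orthogonal z w" by (rule orthogonal_to_subspace_exists) blast
  have z0: "z \<bullet> (Q *v b i) = 0" if "i \<in> insert k0 K" for i
   using z(2)[OF span_base, of "Q *v b i"] that by (auto simp: orthogonal_def)
  define z' where "z' = (1/sqrt (z \<bullet> (Q *v z))) *\<^sub>R z"
  have z'1: "z' \<bullet> (Q *v z') = 1" unfolding z'_def by (rule norm1[OF z(1)])
  have z'0: "z' \<bullet> (Q *v b i) = 0" "b i \<bullet> (Q *v z') = 0" if "i \<in> insert k0 K" for i
   using z0[OF that] symd[of "b i" z'] by (simp_all add: z'_def)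
  show ?case
   by (rule exI[of _ "b(a := z')"]) (use insert b0 b z'1 z'0 in auto)
 qed
 from this[of "UNIV - {k0}"] obtain b where b0: "b k0 = v1" and b: "\<And>i j. b i \<bullet> (Q *v b j) = of_bool (i = j)"
  by auto
 define M :: "real^'n^'n" where "M = (\<chi> i j. b j $ i)"
 have Mu: "M *v u = (\<Sum>j\<in>UNIV. (u$j) *\<^sub>R b j)" for u
  by (simp add: M_def vec_eq_iff matrix_vector_mult_def mult.commute)
 \<comment> \<open>The columns of \<open>M\<close> are the \<open>b j\<close>, so orthonormality
   says that \<open>M\<close> carries \<open>Q\<close> to the identity; both the quadratic form and
   the determinant are read off from this.\<close>
 have QM: "transpose M ** Q ** M = mat 1"
 proof -
  have "(transpose M ** Q ** M) $ i $ j = b i \<bullet> (Q *v b j)" for i j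
   by (simp add: M_def transpose_def matrix_matrix_mult_def inner_vec_def matrix_vector_mult_def
     sum_distrib_left sum_distrib_right) (subst sum.swap, simp add: mult_ac)
  then show ?thesis by (simp add: b vec_eq_iff mat_def)
 qed
 show ?thesis
 proof (rule that[of M k0])
  show "(M *v u) \<bullet> (Q *v (M *v u)) = u \<bullet> u" for u
  proof -
   have "(M *v u) \<bullet> (Q *v (M *v u)) = u \<bullet> ((transpose M ** Q ** M) *v u)"
    by (metis dot_lmul_matrix matrix_vector_mul_assoc inner_commute vector_transpose_matrix transpose_transpose)
   then show ?thesis by (simp add: QM)
  qed
  have "det (transpose M ** Q ** M) = 1" by (simp add: QM)
  then show "(det M)^2*det Q = 1" by (simp add: det_mul power2_eq_square mult_ac)
  show "x \<bullet> (M *v u) = sqrt (x \<bullet> y)*u $ k0" for u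
  proof (cases "x = 0")
   case False
   have xy: "x \<bullet> y = y \<bullet> (Q *v y)" using y by (simp add: inner_commute)
   have y0: "y \<noteq> 0" using y False by auto
   then have pos: "0 < x \<bullet> y" using pd xy by simp
   have bk: "b k0 = (1/sqrt (x \<bullet> y)) *\<^sub>R y" using False xy by (simp add: b0 v1_def v0_def)
   have "x = sqrt (x \<bullet> y) *\<^sub>R (Q *v b k0)" using pos by (simp add: bk y matrix_vector_mult_scaleR)
   then have xb: "x \<bullet> b j = sqrt (x \<bullet> y) * of_bool (k0 = j)" for j
    using b[of k0 j] symd[of "b j" "b k0"] by (metis inner_commute inner_scaleR_left)
   have "(\<Sum>j\<in>UNIV. u$j*(x \<bullet> b j)) = (\<Sum>j\<in>UNIV. if j = k0 then u$k0 * sqrt (x \<bullet> y) else 0)"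
    by (rule sum.cong) (auto simp: xb)
   then show ?thesis by (simp add: Mu inner_sum_right)
  qed simp
 qed
qed

text \<open>Substituting \<open>v = c + M *v u\<close> with the matrix of
  \<open>exists_orthonormalising_matrix\<close> turns the exponent into
  \<open>- (u \<bullet> u)/2\<close> and makes \<open>x \<bullet> v\<close> depend on the single
  coordinate \<open>u $ k\<close>; the integral then factorises. The vector \<open>y\<close> stands
  for the inverse of \<open>Q\<close> applied to \<open>x\<close>, so \<open>x \<bullet> y\<close>
  is the variance of \<open>x \<bullet> v\<close>.\<close>

lemma nn_integral_gaussian_vec:
 fixes Q :: "real^'n^'n" and x y c :: "real^'n" and f :: "real \<Rightarrow> ennreal"
 assumes sym: "transpose Q = Q" and pd: "\<And>v. v \<noteq> 0 \<Longrightarrow> 0 < v \<bullet> (Q *v v)"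
  and y: "Q *v y = x" and f[measurable]: "f \<in> borel_measurable borel"
 shows "(\<integral>\<^sup>+v. ennreal (exp (- ((v - c) \<bullet> (Q *v (v - c)))/2))*f (x \<bullet> v) \<partial>lborel) =
  ennreal (sqrt (2*pi)^CARD('n)*det Q powr (-1/2)) *
  (\<integral>\<^sup>+u. ennreal (std_normal_density u)*f (x \<bullet> c + sqrt (x \<bullet> y)*u) \<partial>lborel)"
  and "0 < det Q"
proof -
 obtain M k where M: "\<And>u. (M *v u) \<bullet> (Q *v (M *v u)) = u \<bullet> u" "(det M)^2*det Q = 1"
  "\<And>u. x \<bullet> (M *v u) = sqrt (x \<bullet> y)*u $ k"
  using exists_orthonormalising_matrix[OF sym pd y] by blast
 have dM: "det M \<noteq> 0" using M(2) by auto
 then have "0 < (det M)^2" by simp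
 with M(2) show dQ: "0 < det Q" by (metis zero_less_mult_pos zero_less_one)
 have adM: "\<bar>det M\<bar> = det Q powr (-1/2)"
 proof -
  have "det Q = 1/(det M)^2" using M(2) dM by (simp add: field_simps)
  then have "det Q powr (-1/2) = (1/(det M)^2) powr (-1/2)" by simp
  also have "\<dots> = sqrt ((det M)^2)" using dM
   by (simp add: powr_half_sqrt[symmetric] powr_minus powr_divide field_simps)
  finally show ?thesis by simp
 qed
 let ?g = "\<lambda>v. ennreal (exp (- ((v - c) \<bullet> (Q *v (v - c)))/2))*f (x \<bullet> v)"
 have mb: "(*v) B \<in> borel_measurable borel" for B :: "real^'n^'n"
  by (intro borel_measurable_continuous_onI) (rule matrix_vector_mult_linear_continuous_on)
 have [measurable]: "(\<lambda>v. Q *v (v - c)) \<in> borel_measurable borel"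
  by (rule measurable_compose[OF _ mb]) simp
 have gm[measurable]: "?g \<in> borel_measurable borel" by measurable
 have gm2: "(\<lambda>v. ?g (c + v)) \<in> borel_measurable borel" by measurable
 have "(\<integral>\<^sup>+v. ?g v \<partial>lborel) = (\<integral>\<^sup>+v. ?g (c + v) \<partial>lborel)"
 proof -
  have "(lborel::(real^'n) measure) = distr lborel borel (\<lambda>x. c + x)"
   using lborel_affine[of 1 c] by (simp add: density_1)
  then have "(\<integral>\<^sup>+v. ?g v \<partial>lborel) = (\<integral>\<^sup>+v. ?g v \<partial>distr lborel borel (\<lambda>x. c + x))" by simp
  also have "\<dots> = (\<integral>\<^sup>+v. ?g (c + v) \<partial>lborel)" by (rule nn_integral_distr) auto
  finally show ?thesis .
 qed
 also have "\<dots> = ennreal \<bar>det M\<bar>*(\<integral>\<^sup>+u. ?g (c + M *v u) \<partial>lborel)"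
  by (rule nn_integral_linear_change[OF dM gm2])
 also have "(\<integral>\<^sup>+u. ?g (c + M *v u) \<partial>lborel) =
  ennreal (sqrt (2*pi)^CARD('n))*(\<integral>\<^sup>+u. ennreal (std_normal_density u)*f (x \<bullet> c + sqrt (x \<bullet> y)*u) \<partial>lborel)"
 proof -
  \<comment> \<open>Every coordinate carries a standard normal density; \<open>f\<close> is attached
    to coordinate \<open>k\<close> alone, so all other factors integrate to 1.\<close>
  let ?h = "\<lambda>(b::real^'n) t. ennreal (std_normal_density t)*(if b = axis k 1 then f (x \<bullet> c + sqrt (x \<bullet> y)*t) else 1)"
  have Bc: "card (Basis :: (real^'n) set) = CARD('n)" by simp
  have kB: "axis k 1 \<in> (Basis :: (real^'n) set)" by (auto simp: Basis_vec_def)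
  have e: "exp (- t\<^sup>2/2) = sqrt (2*pi) * std_normal_density t" for t
   by (simp add: std_normal_density_def)
  have "?g (c + M *v u) = ennreal (sqrt (2*pi)^CARD('n))*(\<Prod>b\<in>Basis. ?h b (u \<bullet> b))" for u
  proof -
   have "exp (- ((M *v u) \<bullet> (Q *v (M *v u)))/2) = (\<Prod>b\<in>Basis. exp (- (u \<bullet> b)\<^sup>2/2))"
    by (subst exp_sum[symmetric]) (simp_all add: M(1) euclidean_inner[of u u] power2_eq_square sum_negf sum_divide_distrib)
   also have "\<dots> = sqrt (2*pi)^CARD('n)*(\<Prod>b\<in>Basis. std_normal_density (u \<bullet> b))"
    unfolding e by (simp add: prod.distrib)
   finally have 1: "exp (- ((M *v u) \<bullet> (Q *v (M *v u)))/2) = sqrt (2*pi)^CARD('n)*(\<Prod>b\<in>Basis. std_normal_density (u \<bullet> b))" .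
   have 2: "f (x \<bullet> (c + M *v u)) = (\<Prod>b\<in>Basis. (if b = axis k 1 then f (x \<bullet> c + sqrt (x \<bullet> y)*(u \<bullet> b)) else 1))"
    using kB by (simp add: inner_add_right M(3) inner_axis)
   show ?thesis
    unfolding prod.distrib 2[symmetric] add_diff_cancel_left'
    by (simp only: 1) (simp add: ennreal_mult prod_nonneg prod_ennreal mult.assoc)
  qed
  then have "(\<integral>\<^sup>+u. ?g (c + M *v u) \<partial>lborel) = (\<integral>\<^sup>+u. ennreal (sqrt (2*pi)^CARD('n))*(\<Prod>b\<in>Basis. ?h b (u \<bullet> b)) \<partial>lborel)"
   by simp
  also have "\<dots> = ennreal (sqrt (2*pi)^CARD('n))*(\<integral>\<^sup>+u. (\<Prod>b\<in>Basis. ?h b (u \<bullet> b)) \<partial>lborel)"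
   by (rule nn_integral_cmult) simp
  also have "(\<integral>\<^sup>+u. (\<Prod>b\<in>Basis. ?h b (u \<bullet> b)) \<partial>lborel) = (\<Prod>b\<in>Basis. (\<integral>\<^sup>+t. ?h b t \<partial>lborel))"
   by (rule nn_integral_lborel_prod) auto
  also have "\<dots> = (\<Prod>b\<in>Basis. if b = (axis k 1::real^'n) then (\<integral>\<^sup>+u. ennreal (std_normal_density u)*f (x \<bullet> c + sqrt (x \<bullet> y)*u) \<partial>lborel) else 1)"
   by (rule prod.cong) (auto simp: nn_integral_eq_integral)
  also have "\<dots> = (\<integral>\<^sup>+u. ennreal (std_normal_density u)*f (x \<bullet> c + sqrt (x \<bullet> y)*u) \<partial>lborel)"
   using kB by simp
  finally show ?thesis .
 qed
 finally show "(\<integral>\<^sup>+v. ?g v \<partial>lborel) = ennreal (sqrt (2*pi)^CARD('n)*det Q powr (-1/2)) *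
  (\<integral>\<^sup>+u. ennreal (std_normal_density u)*f (x \<bullet> c + sqrt (x \<bullet> y)*u) \<partial>lborel)"
  unfolding adM by (simp add: ennreal_mult mult_ac)
qed

section \<open>Weighted Gram matrices and the residual likelihood\<close>

text \<open>With \<open>w = 1\<close> this is X'X and with weights \<open>1/(A + D j)\<close> it is
  X'V^{-1}X, so positivity, determinants and monotonicity can be treated once for general
  weights.\<close>

definition wgram :: "(nat \<Rightarrow> real^'p) \<Rightarrow> nat \<Rightarrow> (nat \<Rightarrow> real) \<Rightarrow> real^'p^'p" where
 "wgram x m w = (\<chi> k l. \<Sum>j<m. w j*(x j $ k*x j $ l))"

lemma XtVX_eq_wgram: "XtVX x D m A = wgram x m (\<lambda>j. 1/(A + D j))"
 by (simp add: XtVX_def wgram_def)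

lemma XtX_eq_wgram: "XtX x m = wgram x m (\<lambda>j. 1)"
 by (simp add: XtX_def wgram_def)

lemma wgram_mult: "wgram x m w *v u = (\<Sum>j<m. (w j*(x j \<bullet> u)) *\<^sub>R x j)"
proof -
 have "(wgram x m w *v u) $ k = (\<Sum>j<m. (w j*(x j \<bullet> u)) *\<^sub>R x j) $ k" for k
 proof -
  have "(wgram x m w *v u) $ k = (\<Sum>l\<in>UNIV. \<Sum>j<m. w j*(x j $ k*x j $ l)*u $ l)"
   by (simp add: wgram_def matrix_vector_mult_def sum_distrib_right)
  also have "\<dots> = (\<Sum>j<m. \<Sum>l\<in>UNIV. w j*(x j $ k*x j $ l)*u $ l)" by (rule sum.swap)
  also have "\<dots> = (\<Sum>j<m. (w j*(x j \<bullet> u)) *\<^sub>R x j) $ k"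
   by (simp add: inner_vec_def sum_distrib_left sum_distrib_right mult_ac)
  finally show ?thesis .
 qed
 then show ?thesis by (simp add: vec_eq_iff)
qed

lemma wgram_quad: "v \<bullet> (wgram x m w *v u) = (\<Sum>j<m. w j*(x j \<bullet> v)*(x j \<bullet> u))"
 by (simp add: wgram_mult inner_sum_right inner_commute mult_ac)

lemma transpose_wgram: "transpose (wgram x m w) = wgram x m w"
 by (simp add: wgram_def transpose_def vec_eq_iff mult_ac)

lemma full_rank_inner_zero:
 fixes x :: "nat \<Rightarrow> real^'p::finite"
 assumes R: "dim (x ` {..<m}) = CARD('p)" and 0: "\<And>j. j < m \<Longrightarrow> x j \<bullet> v = 0"
 shows "v = 0"
proof -
 have "span (x ` {..<m}) = UNIV" using R dim_eq_full[of "x ` {..<m}"] by simp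
 then have "v \<in> span (x ` {..<m})" by simp
 moreover have "orthogonal v y" if "y \<in> span (x ` {..<m})" for y
  by (rule orthogonal_to_span[OF that]) (use 0 in \<open>auto simp: orthogonal_def inner_commute\<close>)
 ultimately have "orthogonal v v" by blast
 then show ?thesis by (simp add: orthogonal_def)
qed

lemma wgram_pos_def:
 fixes x :: "nat \<Rightarrow> real^'p::finite"
 assumes R: "dim (x ` {..<m}) = CARD('p)" and w: "\<And>j. j < m \<Longrightarrow> 0 < w j" and v: "v \<noteq> 0"
 shows "0 < v \<bullet> (wgram x m w *v v)"
proof -
 obtain j where j: "j < m" "x j \<bullet> v \<noteq> 0" using full_rank_inner_zero[OF R] v by blast
 have "0 < (\<Sum>j<m. w j*((x j \<bullet> v)*(x j \<bullet> v)))"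
  by (rule sum_pos2[of _ j]) (use w j in \<open>auto intro!: mult_pos_pos mult_nonneg_nonneg simp: less_imp_le zero_less_mult_iff\<close>)
 then show ?thesis by (simp add: wgram_quad mult.assoc)
qed

text \<open>\<open>matrix_inv\<close> is defined by choice; it is a genuine two-sided inverse once
  the kernel is trivial.\<close>

lemma pos_def_invertible:
 fixes Q :: "real^'n^'n"
 assumes pd: "\<And>v. v \<noteq> 0 \<Longrightarrow> 0 < v \<bullet> (Q *v v)"
 shows "Q *v (matrix_inv Q *v u) = u" "matrix_inv Q *v (Q *v u) = u"
proof -
 have "\<forall>v. Q *v v = 0 \<longrightarrow> v = 0" using pd by (metis inner_zero_right less_irrefl)
 then have "\<exists>B. B ** Q = mat 1" by (simp only: matrix_left_invertible_ker)
 then have "invertible Q" by (simp add: invertible_left_inverse)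
 then have "Q ** matrix_inv Q = mat 1 \<and> matrix_inv Q ** Q = mat 1"
  unfolding invertible_def matrix_inv_def by (rule someI_ex)
 then show "Q *v (matrix_inv Q *v u) = u" "matrix_inv Q *v (Q *v u) = u"
  by (simp_all add: matrix_vector_mul_assoc)
qed

text \<open>Multilinearity of the determinant in its rows, expanded completely: one summand for each
  choice of a term in every row.\<close>

lemma det_rows_sum_maps:
 fixes a :: "'n::finite \<Rightarrow> 'b \<Rightarrow> real^'n"
 assumes "finite S"
 shows "det (\<chi> i. \<Sum>j\<in>S. a i j) = (\<Sum>f | \<forall>i. f i \<in> S. det (\<chi> i. a i (f i)))"
proof -
 have E: "(UNIV \<rightarrow>\<^sub>E S) = {f::'n \<Rightarrow> 'b. \<forall>i. f i \<in> S}" by (auto simp: PiE_def Pi_def)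
 have "det (\<chi> i. \<Sum>j\<in>S. a i j) = (\<Sum>p | p permutes UNIV. of_int (sign p)*(\<Prod>i\<in>UNIV. \<Sum>j\<in>S. a i j $ p i))"
  by (simp add: det_def)
 also have "\<dots> = (\<Sum>p | p permutes UNIV. of_int (sign p)*(\<Sum>f | \<forall>i. f i \<in> S. \<Prod>i\<in>UNIV. a i (f i) $ p i))"
  using assms by (subst prod_sum_PiE) (auto simp: E)
 also have "\<dots> = (\<Sum>f | \<forall>i. f i \<in> S. det (\<chi> i. a i (f i)))"
  unfolding det_def sum_distrib_left by (subst sum.swap) simp
 finally show ?thesis .
qed

text \<open>The Cauchy-Binet formula, summed over all maps instead of over subsets.\<close>

definition cb_coeff :: "(nat \<Rightarrow> real^'p) \<Rightarrow> ('p::finite \<Rightarrow> nat) \<Rightarrow> real" where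
 "cb_coeff x f = (det (\<chi> k. x (f k)))^2/fact CARD('p)"

lemma cb_coeff_nonneg: "0 \<le> cb_coeff x f"
 by (simp add: cb_coeff_def)

lemma finite_maps_lessThan: "finite {f::'p::finite \<Rightarrow> nat. \<forall>k. f k \<in> {..<m}}"
proof -
 have "{f::'p \<Rightarrow> nat. \<forall>k. f k \<in> {..<m}} = UNIV \<rightarrow>\<^sub>E {..<m}" by (auto simp: PiE_def Pi_def)
 then show ?thesis by (simp add: finite_PiE)
qed

text \<open>Multilinearity gives one term per map \<open>f\<close>, with the product of the entries
  \<open>x (f k) $ k\<close> in front of \<open>det (?X f)\<close>. Composing \<open>f\<close> with
  a permutation only permutes the summands, so the sum equals each of its permuted versions;
  averaging over all \<open>fact CARD('p)\<close> permutations replaces that product by a second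
  copy of the determinant. The weights enter each term as a plain product with a nonnegative
  coefficient, which is what later controls the determinant as a function of
  \<open>A\<close>.\<close>

lemma det_wgram:
 fixes x :: "nat \<Rightarrow> real^'p::finite"
 shows "det (wgram x m w) = (\<Sum>f | \<forall>k. f k \<in> {..<m}. cb_coeff x f*(\<Prod>k\<in>UNIV. w (f k)))"
proof -
 let ?F = "{f::'p \<Rightarrow> nat. \<forall>k. f k \<in> {..<m}}"
 let ?S = "{\<sigma>. \<sigma> permutes (UNIV::'p set)}"
 let ?X = "\<lambda>f::'p \<Rightarrow> nat. (\<chi> k. x (f k)) :: real^'p^'p"
 have 1: "det (wgram x m w) = (\<Sum>f\<in>?F. (\<Prod>k\<in>UNIV. w (f k))*(\<Prod>k\<in>UNIV. x (f k) $ k)*det (?X f))"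
 proof -
  have "wgram x m w = (\<chi> k. \<Sum>j<m. (w j*x j $ k) *s x j)"
   by (simp add: wgram_def vec_eq_iff mult_ac)
  then have "det (wgram x m w) = (\<Sum>f\<in>?F. det (\<chi> k. (w (f k)*x (f k) $ k) *s x (f k)))"
   by (simp only: det_rows_sum_maps[OF finite_lessThan])
  also have "\<dots> = (\<Sum>f\<in>?F. (\<Prod>k\<in>UNIV. w (f k)*x (f k) $ k)*det (?X f))"
   by (simp only: det_rows_mul)
  finally show ?thesis by (simp add: prod.distrib)
 qed
 have 2: "det (wgram x m w) = (\<Sum>f\<in>?F. (\<Prod>k\<in>UNIV. w (f k))*det (?X f)*(of_int (sign \<sigma>)*(\<Prod>k\<in>UNIV. x (f (\<sigma> k)) $ k)))"
  if s: "\<sigma> permutes UNIV" for \<sigma>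
 proof -
  have b: "bij \<sigma>" using s by (rule permutes_bij)
  have "bij_betw (\<lambda>f. f \<circ> \<sigma>) ?F ?F"
  proof (rule bij_betw_byWitness[where f' = "\<lambda>f. f \<circ> inv \<sigma>"])
   show "\<forall>f\<in>?F. f \<circ> \<sigma> \<circ> inv \<sigma> = f" "\<forall>f\<in>?F. f \<circ> inv \<sigma> \<circ> \<sigma> = f"
    using b by (auto simp: fun_eq_iff bij_is_surj surj_f_inv_f bij_is_inj)
  qed auto
  then have "det (wgram x m w) = (\<Sum>f\<in>?F. (\<Prod>k\<in>UNIV. w ((f \<circ> \<sigma>) k))*(\<Prod>k\<in>UNIV. x ((f \<circ> \<sigma>) k) $ k)*det (?X (f \<circ> \<sigma>)))"
   unfolding 1 by (rule sum.reindex_bij_betw[symmetric])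
  also have "\<dots> = (\<Sum>f\<in>?F. (\<Prod>k\<in>UNIV. w (f k))*det (?X f)*(of_int (sign \<sigma>)*(\<Prod>k\<in>UNIV. x (f (\<sigma> k)) $ k)))"
  proof (rule sum.cong[OF refl])
   fix f
   have "(\<Prod>k\<in>UNIV. w ((f \<circ> \<sigma>) k)) = (\<Prod>k\<in>UNIV. w (f k))"
    using prod.reindex_bij_betw[OF b, of "\<lambda>k. w (f k)"] by simp
   moreover have "det (?X (f \<circ> \<sigma>)) = of_int (sign \<sigma>)*det (?X f)"
    using det_permute_rows[OF s, of "?X f"] by simp
   ultimately show "(\<Prod>k\<in>UNIV. w ((f \<circ> \<sigma>) k))*(\<Prod>k\<in>UNIV. x ((f \<circ> \<sigma>) k) $ k)*det (?X (f \<circ> \<sigma>))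
    = (\<Prod>k\<in>UNIV. w (f k))*det (?X f)*(of_int (sign \<sigma>)*(\<Prod>k\<in>UNIV. x (f (\<sigma> k)) $ k))"
    by simp
  qed
  finally show ?thesis .
 qed
 have dT: "(\<Sum>\<sigma>\<in>?S. of_int (sign \<sigma>)*(\<Prod>k\<in>UNIV. x (f (\<sigma> k)) $ k)) = det (?X f)" for f
 proof -
  have "det (transpose (?X f)) = (\<Sum>\<sigma>\<in>?S. of_int (sign \<sigma>)*(\<Prod>k\<in>UNIV. x (f (\<sigma> k)) $ k))"
   by (simp add: det_def transpose_def)
  then show ?thesis by (simp add: det_transpose)
 qed
 have "fact CARD('p)*det (wgram x m w) = (\<Sum>\<sigma>\<in>?S. det (wgram x m w))"
  by (simp add: card_permutations)
 also have "\<dots> = (\<Sum>\<sigma>\<in>?S. \<Sum>f\<in>?F. (\<Prod>k\<in>UNIV. w (f k))*det (?X f)*(of_int (sign \<sigma>)*(\<Prod>k\<in>UNIV. x (f (\<sigma> k)) $ k)))"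
  by (rule sum.cong) (use 2 in auto)
 also have "\<dots> = (\<Sum>f\<in>?F. \<Sum>\<sigma>\<in>?S. (\<Prod>k\<in>UNIV. w (f k))*det (?X f)*(of_int (sign \<sigma>)*(\<Prod>k\<in>UNIV. x (f (\<sigma> k)) $ k)))"
  by (rule sum.swap)
 also have "\<dots> = (\<Sum>f\<in>?F. (\<Prod>k\<in>UNIV. w (f k))*(det (?X f))^2)"
  by (simp only: sum_distrib_left[symmetric] dT power2_eq_square mult.assoc)
 finally have "det (wgram x m w) = (\<Sum>f\<in>?F. (\<Prod>k\<in>UNIV. w (f k))*(det (?X f))^2)/fact CARD('p)"
  by (simp add: field_simps)
 then show ?thesis
  by (simp add: cb_coeff_def sum_divide_distrib mult_ac)
qed

text \<open>All coefficients \<open>cb_coeff\<close> are nonnegative, so larger weights or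
  additional areas enlarge the sum term by term.\<close>

lemma det_wgram_mono:
 fixes x :: "nat \<Rightarrow> real^'p::finite"
 assumes "m \<le> m'" "\<And>j. j < m \<Longrightarrow> 0 \<le> w j \<and> w j \<le> w' j" "\<And>j. j < m' \<Longrightarrow> 0 \<le> w' j"
 shows "det (wgram x m w) \<le> det (wgram x m' w')"
proof -
 have "det (wgram x m w) \<le> (\<Sum>f | \<forall>k. f k \<in> {..<m}. cb_coeff x f*(\<Prod>k\<in>UNIV. w' (f k)))"
  unfolding det_wgram
  by (intro sum_mono mult_left_mono prod_mono) (use assms in \<open>auto simp: cb_coeff_nonneg\<close>)
 also have "\<dots> \<le> det (wgram x m' w')"
  unfolding det_wgram
  by (rule sum_mono2[OF finite_maps_lessThan])
   (use assms in \<open>auto intro!: mult_nonneg_nonneg prod_nonneg simp: cb_coeff_nonneg intro: order_less_le_trans\<close>)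
 finally show ?thesis .
qed

lemma det_wgram_scale:
 fixes x :: "nat \<Rightarrow> real^'p::finite"
 shows "det (wgram x m (\<lambda>j. c*w j)) = c^CARD('p)*det (wgram x m w)"
 by (simp add: det_wgram sum_distrib_left prod.distrib mult_ac)

section \<open>Generalised least squares and the quadratic form y'Py\<close>

definition yPy :: "(nat \<Rightarrow> real^'p::finite) \<Rightarrow> (nat \<Rightarrow> real) \<Rightarrow> nat \<Rightarrow> (nat \<Rightarrow> real) \<Rightarrow> real \<Rightarrow> real" where
 "yPy x D m y A = (\<Sum>j<m. \<Sum>k<m. y j*P_entry x D m A j k*y k)"

lemma yPy_eq:
 "yPy x D m y A = (\<Sum>j<m. (y j)^2/(A + D j)) -
  (\<Sum>j<m. (y j/(A + D j)) *\<^sub>R x j) \<bullet> beta_bar x D m y A"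
proof -
 let ?s = "\<Sum>j<m. (y j/(A + D j)) *\<^sub>R x j"
 let ?Q = "matrix_inv (XtVX x D m A)"
 have "?s \<bullet> beta_bar x D m y A = (\<Sum>j<m. \<Sum>k<m. (y j/(A + D j))*((y k/(A + D k))*(x j \<bullet> (?Q *v x k))))"
 proof -
  have "?Q *v ?s = (\<Sum>k<m. (y k/(A + D k)) *\<^sub>R (?Q *v x k))"
   by (simp add: linear_sum[OF matrix_vector_mul_linear] matrix_vector_mult_scaleR)
  then show ?thesis
   by (simp only: beta_bar_def inner_sum_left inner_sum_right inner_scaleR_left inner_scaleR_right sum_distrib_left)
    (subst sum.swap, auto intro!: sum.cong simp: mult_ac)
 qed
 moreover have "(\<Sum>j<m. (y j)^2/(A + D j)) = (\<Sum>j<m. \<Sum>k<m. if k = j then (y j)^2/(A + D j) else 0)"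
  by simp
 moreover have "y j*P_entry x D m A j k*y k = (if k = j then (y j)^2/(A + D j) else 0) -
   (y j/(A + D j))*((y k/(A + D k))*(x j \<bullet> (?Q *v x k)))" for j k
  by (simp add: P_entry_def algebra_simps power2_eq_square)
 ultimately show ?thesis
  unfolding yPy_def by (simp only: sum_subtractf)
qed

text \<open>Pythagoras in the norm weighted by V^{-1}: the weighted sum of squares is minimal at
  \<open>beta_bar\<close>, where it equals y'Py, and the excess at \<open>v\<close> is the quadratic
  form of the deviation. It serves both to integrate beta out and to compare the likelihood at
  different \<open>A\<close>.\<close>

lemma gls_decomposition:
 fixes x :: "nat \<Rightarrow> real^'p::finite"
 assumes R: "dim (x ` {..<m}) = CARD('p)" and t: "\<And>j. j < m \<Longrightarrow> 0 < A + D j"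
 shows "(\<Sum>j<m. (y j - x j \<bullet> v)^2/(A + D j)) = yPy x D m y A +
  (v - beta_bar x D m y A) \<bullet> (XtVX x D m A *v (v - beta_bar x D m y A))"
proof -
 let ?Q = "XtVX x D m A" and ?b = "beta_bar x D m y A"
 let ?s = "\<Sum>j<m. (y j/(A + D j)) *\<^sub>R x j"
 have pd: "\<And>v. v \<noteq> 0 \<Longrightarrow> 0 < v \<bullet> (?Q *v v)"
  unfolding XtVX_eq_wgram by (rule wgram_pos_def[OF R]) (use t in auto)
 have Qb: "?Q *v ?b = ?s" unfolding beta_bar_def by (rule pos_def_invertible[OF pd])
 have sym: "u \<bullet> (?Q *v w) = w \<bullet> (?Q *v u)" for u w
  unfolding XtVX_eq_wgram wgram_quad by (simp add: mult_ac)
 have sv: "?s \<bullet> v = (\<Sum>j<m. y j*(x j \<bullet> v)/(A + D j))"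
  by (simp add: inner_sum_left)
 have "(v - ?b) \<bullet> (?Q *v (v - ?b)) = v \<bullet> (?Q *v v) - 2*(v \<bullet> ?s) + ?b \<bullet> ?s"
  using sym[of ?b v] by (simp add: matrix_vector_mult_diff_distrib inner_diff_left inner_diff_right Qb)
 also have "v \<bullet> (?Q *v v) = (\<Sum>j<m. (x j \<bullet> v)^2/(A + D j))"
  unfolding XtVX_eq_wgram wgram_quad by (simp add: power2_eq_square)
 finally show ?thesis
  unfolding yPy_eq inner_commute[of v ?s] sv
  by (simp add: inner_commute power2_diff diff_divide_distrib add_divide_distrib sum.distrib sum_subtractf sum_distrib_left mult.assoc)
qed

lemma L_RE_eq: "L_RE x D m y A = (\<Prod>j<m. A + D j) powr (-1/2)*det (XtVX x D m A) powr (-1/2)*exp (- (1/2)*yPy x D m y A)"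
 by (simp add: L_RE_def yPy_def)

section \<open>The posterior under M2\<close>

text \<open>Completing the square in \<open>t\<close>. The first factor on the right is the marginal
  density of \<open>y\<close>, the second the conditional density of theta given \<open>y\<close>:
  its mean is the shrinkage estimator with weight \<open>d/(A + d)\<close>, its variance is
  \<open>g1\<close>.\<close>

lemma normal_density_product:
 assumes "0 < A" "0 < d"
 shows "normal_density t (sqrt d) y*normal_density \<mu> (sqrt A) t =
  normal_density \<mu> (sqrt (A + d)) y *
  normal_density ((1 - d/(A + d))*y + d/(A + d)*\<mu>) (sqrt (A*d/(A + d))) t"
proof -
 let ?c = "(1 - d/(A + d))*y + d/(A + d)*\<mu>"
 have Ad: "A + d > 0" using assms by simp
 have c: "?c = (A*y + d*\<mu>)/(A + d)"
 proof -
  have "1 - d/(A + d) = A/(A + d)" using Ad by (simp add: field_simps)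
  then show ?thesis by (simp add: add_divide_distrib)
 qed
 have e: "(y - t)^2/(2*d) + (t - \<mu>)^2/(2*A) =
   (y - \<mu>)^2/(2*(A + d)) + (t - ?c)^2/(2*(A*d/(A + d)))"
 proof -
  obtain S where S: "S = A + d" by simp
  have S0: "0 < S" using Ad S by simp
  \<comment> \<open>\<open>N/S\<close> is the deviation of \<open>t\<close> from the conditional
    mean; clearing denominators leaves the polynomial identity \<open>p\<close>.\<close>
  define N where "N = S*t - (A*y + d*\<mu>)"
  have tc: "t - ?c = N/S" unfolding c N_def S using Ad by (simp add: field_simps)
  have p: "A*S*(y - t)^2 + d*S*(t - \<mu>)^2 = A*d*(y - \<mu>)^2 + N^2"
   unfolding N_def S by (simp add: power2_eq_square algebra_simps)
  have "(y - t)^2/(2*d) + (t - \<mu>)^2/(2*A) = (A*S*(y - t)^2 + d*S*(t - \<mu>)^2)/(2*A*d*S)"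
   using assms S0 by (simp add: field_simps)
  also have "\<dots> = (y - \<mu>)^2/(2*S) + (N/S)^2/(2*(A*d/S))"
   unfolding p using assms S0 by (simp add: add_divide_distrib power_divide power2_eq_square)
  finally show ?thesis unfolding tc S .
 qed
 have s: "sqrt (2*pi*d) * sqrt (2*pi*A) = sqrt (2*pi*(A + d)) * sqrt (2*pi*(A*d/(A + d)))"
  using Ad by (simp add: real_sqrt_mult[symmetric] field_simps)
 have nd: "normal_density c (sqrt v) u = 1/sqrt (2*pi * v)*exp (- ((u - c)^2/(2 * v)))" if "0 < v" for c u v
  using that by (simp add: normal_density_def)
 have g: "(1/a*exp (- u))*(1/b*exp (- v)) = 1/(a*b)*exp (- (u + v))" for a b u v :: real
  by (simp only: minus_add_distrib exp_add) simp
 have q: "0 < A*d/(A + d)" using assms Ad by simp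
 show ?thesis
  unfolding nd[OF assms(1)] nd[OF assms(2)] nd[OF Ad] nd[OF q] g s e by (rule refl)
qed

lemma nn_integral_normal_density: "0 < \<sigma> \<Longrightarrow> (\<integral>\<^sup>+t. ennreal (normal_density \<mu> \<sigma> t) \<partial>lborel) = 1"
 by (simp add: nn_integral_eq_integral)

text \<open>This is the law of a sum of independent normal variables with standard deviations
  \<open>\<sigma>\<close> and \<open>\<bar>k\<bar>\<close>; for \<open>k = 0\<close> the second one
  degenerates, hence the case distinction.\<close>

lemma normal_mixture:
 assumes "0 < \<sigma>"
 shows "(\<integral>\<^sup>+u. ennreal (std_normal_density u)*ennreal (normal_density (c + k*u) \<sigma> t) \<partial>lborel) =
  ennreal (normal_density c (sqrt (\<sigma>^2 + k^2)) t)"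
proof (cases "k = 0")
 case True
 then show ?thesis using assms
  by (simp add: nn_integral_multc nn_integral_normal_density)
next
 case False
 let ?\<tau> = "\<bar>k\<bar>"
 have t: "0 < ?\<tau>" using False by simp
 have "normal_density c (sqrt (\<sigma>^2 + k^2)) t = normal_density 0 (sqrt (\<sigma>^2 + ?\<tau>^2)) (t - c)"
  by (simp add: normal_density_def)
 also have "ennreal \<dots> = (\<integral>\<^sup>+y. ennreal (normal_density 0 \<sigma> (t - c - y)*normal_density 0 ?\<tau> y) \<partial>lborel)"
  using fun_cong[OF conv_normal_density_zero_mean[OF assms t], of "t - c"] by simp
 also have "\<dots> = ennreal \<bar>k\<bar>*(\<integral>\<^sup>+u. ennreal (normal_density 0 \<sigma> (t - c - (0 + k*u))*normal_density 0 ?\<tau> (0 + k*u)) \<partial>lborel)"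
  by (rule nn_integral_real_affine[OF _ False]) auto
 also have "\<dots> = (\<integral>\<^sup>+u. ennreal \<bar>k\<bar>*ennreal (normal_density 0 \<sigma> (t - c - (0 + k*u))*normal_density 0 ?\<tau> (0 + k*u)) \<partial>lborel)"
  by (rule nn_integral_cmult[symmetric]) auto
 also have "\<dots> = (\<integral>\<^sup>+u. ennreal (std_normal_density u)*ennreal (normal_density (c + k*u) \<sigma> t) \<partial>lborel)"
 proof (rule nn_integral_cong)
  fix u
  have 1: "normal_density 0 \<sigma> (t - c - (0 + k*u)) = normal_density (c + k*u) \<sigma> t"
   by (simp add: normal_density_def algebra_simps)
  have "\<bar>k\<bar>*normal_density 0 ?\<tau> (0 + k*u) = std_normal_density u"
   using False by (simp add: normal_density_def real_sqrt_mult power_mult_distrib field_simps)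
  then have "std_normal_density u*normal_density (c + k*u) \<sigma> t = \<bar>k\<bar>*(normal_density 0 \<sigma> (t - c - (0 + k*u))*normal_density 0 ?\<tau> (0 + k*u))"
   unfolding 1 by (metis mult.assoc mult.commute)
  then show "ennreal \<bar>k\<bar>*ennreal (normal_density 0 \<sigma> (t - c - (0 + k*u))*normal_density 0 ?\<tau> (0 + k*u))
    = ennreal (std_normal_density u)*ennreal (normal_density (c + k*u) \<sigma> t)"
   by (simp add: ennreal_mult[symmetric])
 qed
 finally show ?thesis by simp
qed

lemma r_fun_nonneg:
 fixes x :: "nat \<Rightarrow> real^'p::finite"
 assumes R: "dim (x ` {..<m}) = CARD('p)" and t: "\<And>j. j < m \<Longrightarrow> 0 < A + D j"
 shows "0 \<le> r_fun x D m i A"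
proof -
 let ?Q = "XtVX x D m A"
 have pd: "\<And>v. v \<noteq> 0 \<Longrightarrow> 0 < v \<bullet> (?Q *v v)"
  unfolding XtVX_eq_wgram by (rule wgram_pos_def[OF R]) (use t in auto)
 have "r_fun x D m i A = (matrix_inv ?Q *v x i) \<bullet> (?Q *v (matrix_inv ?Q *v x i))"
  by (simp add: r_fun_def pos_def_invertible[OF pd] inner_commute)
 then show ?thesis using pd[of "matrix_inv ?Q *v x i"] by (cases "matrix_inv ?Q *v x i = 0") auto
qed

text \<open>Given \<open>A\<close>, the flat prior makes beta normal with mean
  \<open>beta_bar\<close> and precision X'V^{-1}X, so \<open>x i \<bullet> \<beta>\<close> has
  variance \<open>r_fun\<close>. Mixing the conditional law of theta over it adds \<open>g2\<close>
  to the variance \<open>g1\<close>. The remaining factor is \<open>L_RE\<close> up to powers of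
  \<open>2*pi\<close>.\<close>

lemma integrate_out_beta:
 fixes x :: "nat \<Rightarrow> real^'p::finite" and g :: "real \<Rightarrow> ennreal"
 assumes R: "dim (x ` {..<m}) = CARD('p)" and A: "0 < A" and D: "\<And>j. 0 < D j"
  and g[measurable]: "g \<in> borel_measurable borel"
 shows "(\<integral>\<^sup>+\<beta>. (\<Prod>j<m. ennreal (normal_density (x j \<bullet> \<beta>) (sqrt (A + D j)) (y j))) *
   (\<integral>\<^sup>+t. ennreal (normal_density ((1 - B_fun D i A)*y i + B_fun D i A*(x i \<bullet> \<beta>)) (sqrt (g1 D i A)) t)*g t \<partial>lborel) \<partial>lborel)
  = ennreal (sqrt (2*pi)^CARD('p)/sqrt (2*pi)^m*L_RE x D m y A) *
   (\<integral>\<^sup>+t. ennreal (normal_density (theta_tilde x D m i y A) (delta x D m i A) t)*g t \<partial>lborel)"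
proof -
 let ?Q = "XtVX x D m A" and ?b = "beta_bar x D m y A" and ?B = "B_fun D i A"
 let ?\<sigma> = "sqrt (g1 D i A)"
 have t: "0 < A + D j" for j using A D[of j] by simp
 have pd: "\<And>v. v \<noteq> 0 \<Longrightarrow> 0 < v \<bullet> (?Q *v v)"
  unfolding XtVX_eq_wgram by (rule wgram_pos_def[OF R]) (use t in auto)
 have sym: "transpose ?Q = ?Q" unfolding XtVX_eq_wgram by (rule transpose_wgram)
 have yQ: "?Q *v (matrix_inv ?Q *v x i) = x i" by (rule pos_def_invertible[OF pd])
 have s0: "0 < ?\<sigma>" using A D[of i] t[of i] by (simp add: g1_def)
 have r: "x i \<bullet> (matrix_inv ?Q *v x i) = r_fun x D m i A" by (simp add: r_fun_def)
 have r0: "0 \<le> r_fun x D m i A" by (rule r_fun_nonneg[OF R t])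
 \<comment> \<open>\<open>K\<close> is the part of the likelihood that is free of \<open>v\<close>
   after \<open>gls_decomposition\<close>; the missing factor \<open>det ?Q powr (-1/2)\<close> of
   \<open>L_RE\<close> comes from the Gaussian integral.\<close>
 define K where "K = 1/sqrt (2*pi)^m*(\<Prod>j<m. A + D j) powr (-1/2)*exp (- (1/2)*yPy x D m y A)"
 have pd0: "0 < det ?Q" by (rule nn_integral_gaussian_vec(2)[OF sym pd yQ]) measurable
 have K0: "0 \<le> K" by (simp add: K_def)
 have pt: "0 < (\<Prod>j<m. A + D j)" by (intro prod_pos) (use t in auto)
 have P: "(\<Prod>j<m. ennreal (normal_density (x j \<bullet> v) (sqrt (A + D j)) (y j))) =
   ennreal K*ennreal (exp (- ((v - ?b) \<bullet> (?Q *v (v - ?b)))/2))" for v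
 proof -
  have "(\<Prod>j<m. normal_density (x j \<bullet> v) (sqrt (A + D j)) (y j)) =
    (\<Prod>j<m. 1/sqrt (2*pi))*(\<Prod>j<m. 1/sqrt (A + D j))*(\<Prod>j<m. exp (- (1/2)*((y j - x j \<bullet> v)^2/(A + D j))))"
   unfolding prod.distrib[symmetric] using t
   by (intro prod.cong) (auto simp: normal_density_def real_sqrt_mult less_imp_le)
  also have "(\<Prod>j<m. 1/sqrt (A + D j)) = (\<Prod>j<m. A + D j) powr (-1/2)"
  proof -
   have "(\<Prod>j<m. 1/sqrt (A + D j)) = 1/sqrt (\<Prod>j<m. A + D j)"
    by (induction m) (simp_all add: real_sqrt_mult)
   also have "\<dots> = (\<Prod>j<m. A + D j) powr (-1/2)"
    using pt by (simp add: powr_minus powr_half_sqrt field_simps)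
   finally show ?thesis .
  qed
  also have "(\<Prod>j<m. exp (- (1/2)*((y j - x j \<bullet> v)^2/(A + D j)))) = exp (- (1/2)*(\<Sum>j<m. (y j - x j \<bullet> v)^2/(A + D j)))"
   by (simp add: exp_sum[symmetric] sum_distrib_left)
  also have "(\<Sum>j<m. (y j - x j \<bullet> v)^2/(A + D j)) = yPy x D m y A + (v - ?b) \<bullet> (?Q *v (v - ?b))"
   by (rule gls_decomposition[OF R t])
  also have "exp (- (1/2)*(yPy x D m y A + (v - ?b) \<bullet> (?Q *v (v - ?b)))) =
    exp (- (1/2)*yPy x D m y A)*exp (- ((v - ?b) \<bullet> (?Q *v (v - ?b)))/2)"
   by (simp add: exp_add[symmetric] algebra_simps)
  finally have "(\<Prod>j<m. normal_density (x j \<bullet> v) (sqrt (A + D j)) (y j)) = K*exp (- ((v - ?b) \<bullet> (?Q *v (v - ?b)))/2)"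
   by (simp add: K_def power_divide)
  then show ?thesis by (simp add: prod_ennreal ennreal_mult K0)
 qed
 define G where "G s = (\<integral>\<^sup>+t. ennreal (normal_density ((1 - ?B)*y i + ?B * s) ?\<sigma> t)*g t \<partial>lborel)" for s
 have G[measurable]: "G \<in> borel_measurable borel" unfolding G_def normal_density_def by measurable
 have mb: "(*v) ?Q \<in> borel_measurable borel"
  by (intro borel_measurable_continuous_onI) (rule matrix_vector_mult_linear_continuous_on)
 have [measurable]: "(\<lambda>v. ?Q *v (v - ?b)) \<in> borel_measurable borel"
  by (rule measurable_compose[OF _ mb]) simp
 have "(\<integral>\<^sup>+\<beta>. (\<Prod>j<m. ennreal (normal_density (x j \<bullet> \<beta>) (sqrt (A + D j)) (y j)))*G (x i \<bullet> \<beta>) \<partial>lborel)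
   = ennreal K*(\<integral>\<^sup>+v. ennreal (exp (- ((v - ?b) \<bullet> (?Q *v (v - ?b)))/2))*G (x i \<bullet> v) \<partial>lborel)"
  unfolding P mult.assoc by (rule nn_integral_cmult) measurable
 also have "\<dots> = ennreal K*(ennreal (sqrt (2*pi)^CARD('p)*det ?Q powr (-1/2)) *
  (\<integral>\<^sup>+u. ennreal (std_normal_density u)*G (x i \<bullet> ?b + sqrt (r_fun x D m i A)*u) \<partial>lborel))"
  using nn_integral_gaussian_vec(1)[OF sym pd yQ G, of ?b] unfolding r by simp
 also have "\<dots> = ennreal (sqrt (2*pi)^CARD('p)/sqrt (2*pi)^m*L_RE x D m y A) *
  (\<integral>\<^sup>+u. ennreal (std_normal_density u)*G (x i \<bullet> ?b + sqrt (r_fun x D m i A)*u) \<partial>lborel)"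
 proof -
  have "K*(sqrt (2*pi)^CARD('p)*det ?Q powr (-1/2)) = sqrt (2*pi)^CARD('p)/sqrt (2*pi)^m*L_RE x D m y A"
   by (simp add: K_def L_RE_eq)
  then show ?thesis
   by (simp only: mult.assoc[symmetric] ennreal_mult'[OF K0, symmetric])
 qed
 also have "(\<integral>\<^sup>+u. ennreal (std_normal_density u)*G (x i \<bullet> ?b + sqrt (r_fun x D m i A)*u) \<partial>lborel) =
  (\<integral>\<^sup>+u. (\<integral>\<^sup>+t. ennreal (std_normal_density u)*(ennreal (normal_density (theta_tilde x D m i y A + ?B * sqrt (r_fun x D m i A)*u) ?\<sigma> t)*g t) \<partial>lborel) \<partial>lborel)"
 proof (rule nn_integral_cong)
  fix u
  have "(1 - ?B)*y i + ?B*(x i \<bullet> ?b + sqrt (r_fun x D m i A)*u) = theta_tilde x D m i y A + ?B * sqrt (r_fun x D m i A)*u"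
   by (simp add: theta_tilde_def algebra_simps)
  then show "ennreal (std_normal_density u)*G (x i \<bullet> ?b + sqrt (r_fun x D m i A)*u) =
   (\<integral>\<^sup>+t. ennreal (std_normal_density u)*(ennreal (normal_density (theta_tilde x D m i y A + ?B * sqrt (r_fun x D m i A)*u) ?\<sigma> t)*g t) \<partial>lborel)"
   unfolding G_def by (simp only:) (rule nn_integral_cmult[symmetric], measurable)
 qed
 also have "\<dots> = (\<integral>\<^sup>+t. (\<integral>\<^sup>+u. ennreal (std_normal_density u)*(ennreal (normal_density (theta_tilde x D m i y A + ?B * sqrt (r_fun x D m i A)*u) ?\<sigma> t)*g t) \<partial>lborel) \<partial>lborel)"
  by (rule lborel_pair.Fubini') (unfold normal_density_def, measurable)
 also have "\<dots> = (\<integral>\<^sup>+t. (\<integral>\<^sup>+u. ennreal (std_normal_density u)*ennreal (normal_density (theta_tilde x D m i y A + ?B * sqrt (r_fun x D m i A)*u) ?\<sigma> t) \<partial>lborel)*g t \<partial>lborel)"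
  unfolding mult.assoc[symmetric]
  by (intro nn_integral_cong nn_integral_multc) (unfold normal_density_def, measurable)
 also have "\<dots> = (\<integral>\<^sup>+t. ennreal (normal_density (theta_tilde x D m i y A) (delta x D m i A) t)*g t \<partial>lborel)"
  unfolding normal_mixture[OF s0] using s0 r0
  by (simp add: delta_def g2_def power_mult_distrib)
 finally show ?thesis unfolding G_def .
qed

text \<open>Given beta and \<open>A\<close> the areas are independent, so the integral over the
  product space factorises; an area other than \<open>i\<close> contributes only its marginal
  density of \<open>y\<close>.\<close>

lemma integrate_out_theta:
 assumes i: "i < m" and A: "0 < A" and D: "\<And>j. 0 < D j" and g[measurable]: "g \<in> borel_measurable borel"
 shows "(\<integral>\<^sup>+\<theta>. ennreal ((\<Prod>j<m. normal_density (\<theta> j) (sqrt (D j)) (y j))*(\<Prod>j<m. normal_density (x j \<bullet> \<beta>) (sqrt A) (\<theta> j)))*g (\<theta> i)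
    \<partial>(\<Pi>\<^sub>M j\<in>{..<m}. lborel)) =
  (\<Prod>j<m. ennreal (normal_density (x j \<bullet> \<beta>) (sqrt (A + D j)) (y j))) *
   (\<integral>\<^sup>+t. ennreal (normal_density ((1 - B_fun D i A)*y i + B_fun D i A*(x i \<bullet> \<beta>)) (sqrt (g1 D i A)) t)*g t \<partial>lborel)"
proof -
 interpret product_sigma_finite "\<lambda>_::nat. lborel :: real measure" ..
 let ?N = "\<lambda>j. normal_density (x j \<bullet> \<beta>) (sqrt (A + D j)) (y j)"
 let ?c = "\<lambda>j t. normal_density ((1 - B_fun D j A)*y j + B_fun D j A*(x j \<bullet> \<beta>)) (sqrt (g1 D j A)) t"
 let ?f = "\<lambda>j t. ennreal (normal_density t (sqrt (D j)) (y j)*normal_density (x j \<bullet> \<beta>) (sqrt A) t)*(if j = i then g t else 1)"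
 have pr: "normal_density t (sqrt (D j)) (y j)*normal_density (x j \<bullet> \<beta>) (sqrt A) t = ?N j*?c j t" for j t
  using normal_density_product[OF A D[of j]] by (simp add: B_fun_def g1_def)
 have g1p: "0 < sqrt (g1 D j A)" for j using A D[of j] by (simp add: g1_def)
 have "(\<integral>\<^sup>+\<theta>. ennreal ((\<Prod>j<m. normal_density (\<theta> j) (sqrt (D j)) (y j))*(\<Prod>j<m. normal_density (x j \<bullet> \<beta>) (sqrt A) (\<theta> j)))*g (\<theta> i)
    \<partial>(\<Pi>\<^sub>M j\<in>{..<m}. lborel)) = (\<integral>\<^sup>+\<theta>. (\<Prod>j<m. ?f j (\<theta> j)) \<partial>(\<Pi>\<^sub>M j\<in>{..<m}. lborel))"
 proof (rule nn_integral_cong)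
  fix \<theta> :: "nat \<Rightarrow> real"
  have "(\<Prod>j<m. if j = i then g (\<theta> j) else 1) = g (\<theta> i)" using i by simp
  then show "ennreal ((\<Prod>j<m. normal_density (\<theta> j) (sqrt (D j)) (y j))*(\<Prod>j<m. normal_density (x j \<bullet> \<beta>) (sqrt A) (\<theta> j)))*g (\<theta> i) = (\<Prod>j<m. ?f j (\<theta> j))"
   by (simp add: prod.distrib[symmetric] prod_ennreal) (simp add: prod.distrib prod_ennreal prod_nonneg)
 qed
 also have "\<dots> = (\<Prod>j<m. (\<integral>\<^sup>+t. ?f j t \<partial>lborel))"
  by (rule product_nn_integral_prod) (auto simp: normal_density_def)
 also have "\<dots> = (\<Prod>j<m. ennreal (?N j)*(if j = i then (\<integral>\<^sup>+t. ennreal (?c i t)*g t \<partial>lborel) else 1))"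
 proof (rule prod.cong[OF refl])
  fix j
  have "(\<integral>\<^sup>+t. ?f j t \<partial>lborel) = ennreal (?N j)*(\<integral>\<^sup>+t. ennreal (?c j t)*(if j = i then g t else 1) \<partial>lborel)"
   unfolding pr by (subst nn_integral_cmult[symmetric]) (auto simp: ennreal_mult mult.assoc)
  then show "(\<integral>\<^sup>+t. ?f j t \<partial>lborel) = ennreal (?N j)*(if j = i then (\<integral>\<^sup>+t. ennreal (?c i t)*g t \<partial>lborel) else 1)"
   by (auto simp: nn_integral_normal_density[OF g1p])
 qed
 also have "\<dots> = (\<Prod>j<m. ennreal (?N j))*(\<integral>\<^sup>+t. ennreal (?c i t)*g t \<partial>lborel)"
  using i by (simp add: prod.distrib)
 finally show ?thesis .
qed

text \<open>Fubini with theta innermost and \<open>A\<close> outermost, so that the two preceding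
  integrations apply pointwise. Measurability of the final integrand is part of the conclusion,
  because \<open>theta_tilde\<close>, \<open>delta\<close> and \<open>L_RE\<close> involve
  \<open>matrix_inv\<close>, whose measurability in \<open>A\<close> is not evident from its
  definition.\<close>

lemma emeasure_joint_M2:
 fixes x :: "nat \<Rightarrow> real^'p::finite"
 assumes R: "dim (x ` {..<m}) = CARD('p)" and D: "\<And>j. 0 < D j" and i: "i < m"
  and S[measurable]: "S \<in> sets borel"
  and pm[measurable]: "(\<lambda>A. prior A*indicator {0<..} A) \<in> borel_measurable borel"
  and pp: "\<And>A. 0 < A \<Longrightarrow> 0 \<le> prior A"
 shows "emeasure (joint_M2 x D prior m y) {(\<theta>, \<beta>, A) \<in> space (joint_M2 x D prior m y). \<theta> i \<in> S} =
  ennreal (sqrt (2*pi)^CARD('p)/sqrt (2*pi)^m) *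
  (\<integral>\<^sup>+A. indicator {0<..} A*ennreal (prior A*L_RE x D m y A) *
   (\<integral>\<^sup>+t. ennreal (normal_density (theta_tilde x D m i y A) (delta x D m i A) t)*indicator S t \<partial>lborel) \<partial>lborel)" (is ?thesis1)
  and "(\<lambda>A. indicator {0<..} A*ennreal (prior A*L_RE x D m y A) *
   (\<integral>\<^sup>+t. ennreal (normal_density (theta_tilde x D m i y A) (delta x D m i A) t)*indicator S t \<partial>lborel)) \<in> borel_measurable borel" (is ?thesis2)
proof -
 let ?C = "sqrt (2*pi)^CARD('p)/sqrt (2*pi)^m"
 let ?T = "\<lambda>A. \<integral>\<^sup>+t. ennreal (normal_density (theta_tilde x D m i y A) (delta x D m i A) t)*indicator S t \<partial>lborel"
 let ?\<Psi> = "\<lambda>A. indicator {0<..} A*ennreal (prior A*L_RE x D m y A)*?T A"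
 interpret P: product_sigma_finite "\<lambda>_::nat. lborel :: real measure" ..
 let ?P = "(\<Pi>\<^sub>M j\<in>{..<m}. lborel) :: (nat \<Rightarrow> real) measure"
 let ?L = "lborel \<Otimes>\<^sub>M lborel :: ((real^'p) \<times> real) measure"
 interpret S1: sigma_finite_measure ?P by (rule P.sigma_finite) simp
 interpret S3: pair_sigma_finite ?P ?L ..
 let ?f = "\<lambda>(\<theta>, \<beta>, A). ennreal (
     (\<Prod>j<m. normal_density (\<theta> j) (sqrt (D j)) (y j)) *
     (\<Prod>j<m. normal_density (x j \<bullet> \<beta>) (sqrt A) (\<theta> j)) *
     (prior A*indicator {0<..} A))"
 let ?N = "?P \<Otimes>\<^sub>M ?L"
 have [measurable]: "(\<lambda>\<omega>. fst \<omega> j) \<in> borel_measurable ?N" if "j < m" for j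
 proof -
  have "(\<lambda>\<theta>. \<theta> j) \<in> borel_measurable ?P" using measurable_component_singleton[of j "{..<m}" "\<lambda>_. lborel"] that by simp
  from measurable_compose[OF measurable_fst this] show ?thesis .
 qed
 have fm[measurable]: "?f \<in> borel_measurable ?N"
  unfolding normal_density_def split_beta' by measurable
 have gm: "(\<lambda>\<omega>. indicator S (fst \<omega> i) :: ennreal) \<in> borel_measurable ?N"
  using i by measurable
 let ?E = "{(\<theta>, \<beta>, A) \<in> space (joint_M2 x D prior m y). \<theta> i \<in> S}"
 have E: "?E = {\<omega> \<in> space ?N. fst \<omega> i \<in> S}"
  by (auto simp: joint_M2_def)
 have Em: "?E \<in> sets ?N" unfolding E using i by measurable
 have Fm: "(\<lambda>\<xi>. (\<integral>\<^sup>+\<theta>. ?f (\<theta>, \<xi>)*indicator S (\<theta> i) \<partial>?P)) \<in> borel_measurable ?L"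
 proof (rule S1.borel_measurable_nn_integral)
  have "(\<lambda>\<omega>. ?f \<omega>*indicator S (fst \<omega> i)) \<in> borel_measurable ?N" using fm gm by (rule borel_measurable_times_ennreal)
  from measurable_compose[OF measurable_pair_swap' this]
  show "(\<lambda>(\<xi>, \<theta>). ?f (\<theta>, \<xi>)*indicator S (\<theta> i)) \<in> borel_measurable (?L \<Otimes>\<^sub>M ?P)"
   by (simp add: split_beta')
 qed
 have pw: "(\<integral>\<^sup>+\<beta>. (\<integral>\<^sup>+\<theta>. ?f (\<theta>, \<beta>, A)*indicator S (\<theta> i) \<partial>?P) \<partial>lborel) = ennreal ?C*?\<Psi> A" for A
  proof (cases "0 < A")
   case False then show ?thesis by simp
  next
   case True
   let ?H = "\<lambda>\<beta>. (\<Prod>j<m. ennreal (normal_density (x j \<bullet> \<beta>) (sqrt (A + D j)) (y j))) *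
   (\<integral>\<^sup>+t. ennreal (normal_density ((1 - B_fun D i A)*y i + B_fun D i A*(x i \<bullet> \<beta>)) (sqrt (g1 D i A)) t)*indicator S t \<partial>lborel)"
   have "(\<integral>\<^sup>+\<theta>. ?f (\<theta>, \<beta>, A)*indicator S (\<theta> i) \<partial>?P) = ennreal (prior A)*?H \<beta>" for \<beta>
   proof -
    have "(\<integral>\<^sup>+\<theta>. ?f (\<theta>, \<beta>, A)*indicator S (\<theta> i) \<partial>?P) = (\<integral>\<^sup>+\<theta>. ennreal (prior A)*(ennreal ((\<Prod>j<m. normal_density (\<theta> j) (sqrt (D j)) (y j))*(\<Prod>j<m. normal_density (x j \<bullet> \<beta>) (sqrt A) (\<theta> j)))*indicator S (\<theta> i)) \<partial>?P)"
     using True pp[OF True] by (intro nn_integral_cong) (simp add: ennreal_mult prod_nonneg mult_ac)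
    also have "\<dots> = ennreal (prior A)*(\<integral>\<^sup>+\<theta>. (ennreal ((\<Prod>j<m. normal_density (\<theta> j) (sqrt (D j)) (y j))*(\<Prod>j<m. normal_density (x j \<bullet> \<beta>) (sqrt A) (\<theta> j)))*indicator S (\<theta> i)) \<partial>?P)"
     by (rule nn_integral_cmult) (use i in \<open>unfold normal_density_def, measurable\<close>)
    finally show ?thesis by (simp add: integrate_out_theta[where D = D and g = "indicator S", OF i True D])
   qed
   then have "(\<integral>\<^sup>+\<beta>. (\<integral>\<^sup>+\<theta>. ?f (\<theta>, \<beta>, A)*indicator S (\<theta> i) \<partial>?P) \<partial>lborel) = (\<integral>\<^sup>+\<beta>. ennreal (prior A)*?H \<beta> \<partial>lborel)" by simp
   also have "\<dots> = ennreal (prior A)*(\<integral>\<^sup>+\<beta>. ?H \<beta> \<partial>lborel)"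
    by (rule nn_integral_cmult) (unfold normal_density_def, measurable)
   also have "(\<integral>\<^sup>+\<beta>. ?H \<beta> \<partial>lborel) = ennreal (?C*L_RE x D m y A)*?T A"
    by (rule integrate_out_beta[OF R True D]) simp
   finally have 1: "(\<integral>\<^sup>+\<beta>. (\<integral>\<^sup>+\<theta>. ?f (\<theta>, \<beta>, A)*indicator S (\<theta> i) \<partial>?P) \<partial>lborel)
    = ennreal (prior A)*(ennreal (?C*L_RE x D m y A)*?T A)" .
   have L0: "0 \<le> L_RE x D m y A" by (simp add: L_RE_def)
   have C0: "0 \<le> ?C" by simp
   have i1: "indicator {0<..} A = (1::ennreal)" using True by simp
   show ?thesis
    unfolding 1 ennreal_mult[OF C0 L0] ennreal_mult[OF pp[OF True] L0] i1 mult_1_left by (simp only: mult_ac)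
  qed
 \<comment> \<open>Up to the constant \<open>?C\<close> the integrand is an inner integral of
   Fubini's theorem; its measurability in \<open>A\<close> comes from there.\<close>
 show th2: ?thesis2
 proof -
  have "(\<lambda>(A, \<beta>). (\<integral>\<^sup>+\<theta>. ?f (\<theta>, \<beta>, A)*indicator S (\<theta> i) \<partial>?P)) \<in> borel_measurable (lborel \<Otimes>\<^sub>M lborel)"
   using measurable_compose[OF measurable_pair_swap' Fm] by (simp add: split_beta')
  then have m1: "(\<lambda>A. \<integral>\<^sup>+\<beta>. (\<integral>\<^sup>+\<theta>. ?f (\<theta>, \<beta>, A)*indicator S (\<theta> i) \<partial>?P) \<partial>lborel) \<in> borel_measurable lborel"
   by (rule lborel.borel_measurable_nn_integral)
  have "?\<Psi> A = ennreal (1/?C)*(ennreal ?C*?\<Psi> A)" for A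
  proof -
   have "ennreal (1/?C)*ennreal ?C = ennreal (1/?C*?C)" by (rule ennreal_mult'[symmetric]) simp
   also have "\<dots> = 1" by simp
   finally show ?thesis by (simp only: mult.assoc[symmetric]) simp
  qed
  then have "?\<Psi> = (\<lambda>A. ennreal (1/?C)*(\<integral>\<^sup>+\<beta>. (\<integral>\<^sup>+\<theta>. ?f (\<theta>, \<beta>, A)*indicator S (\<theta> i) \<partial>?P) \<partial>lborel))"
   unfolding pw by blast
  then show ?thesis using m1 by simp
 qed
 have "emeasure (joint_M2 x D prior m y) ?E = (\<integral>\<^sup>+\<omega>. ?f \<omega>*indicator ?E \<omega> \<partial>?N)"
  unfolding joint_M2_def[of x D prior m y] by (rule emeasure_density[OF fm]) (use Em in \<open>simp add: joint_M2_def\<close>)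
 also have "\<dots> = (\<integral>\<^sup>+\<omega>. ?f \<omega>*indicator S (fst \<omega> i) \<partial>?N)"
  by (rule nn_integral_cong) (auto simp: E indicator_def)
 also have "\<dots> = (\<integral>\<^sup>+\<xi>. (\<integral>\<^sup>+\<theta>. ?f (\<theta>, \<xi>)*indicator S (\<theta> i) \<partial>?P) \<partial>?L)"
  using S3.nn_integral_snd[of "\<lambda>\<omega>. ?f \<omega>*indicator S (fst \<omega> i)"] fm gm by simp
 also have "\<dots> = (\<integral>\<^sup>+A. (\<integral>\<^sup>+\<beta>. (\<integral>\<^sup>+\<theta>. ?f (\<theta>, \<beta>, A)*indicator S (\<theta> i) \<partial>?P) \<partial>lborel) \<partial>lborel)"
  by (rule lborel_pair.nn_integral_snd[symmetric, OF Fm])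
 also have "\<dots> = (\<integral>\<^sup>+A. ennreal ?C*?\<Psi> A \<partial>lborel)" by (simp only: pw)
 also have "\<dots> = ennreal ?C*(\<integral>\<^sup>+A. ?\<Psi> A \<partial>lborel)"
  by (rule nn_integral_cmult) (use th2 in simp)
 finally show ?thesis1 .
qed

section \<open>Moments of concentrated weights\<close>

text \<open>Applied to the posterior weight, this is the posterior mean of a function of
  \<open>A\<close> conditioned to \<open>{lo..hi}\<close>. The gauge integral fits the fundamental
  theorem of calculus, from which the moment identities come; a constant factor in \<open>w\<close>
  cancels, so the likelihood may be normalised at will.\<close>

definition wavg :: "(real \<Rightarrow> real) \<Rightarrow> real \<Rightarrow> real \<Rightarrow> (real \<Rightarrow> real) \<Rightarrow> real" where
 "wavg w lo hi f = integral {lo..hi} (\<lambda>a. f a*w a)/integral {lo..hi} w"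

context
 fixes w :: "real \<Rightarrow> real" and lo hi :: real
 assumes lh: "lo < hi" and wc: "continuous_on {lo..hi} w" and wp: "\<And>a. a \<in> {lo..hi} \<Longrightarrow> 0 < w a"
begin

lemma integral_weight_pos: "0 < integral {lo..hi} w"
proof -
 obtain a where a: "a \<in> {lo..hi}" "\<And>b. b \<in> {lo..hi} \<Longrightarrow> w a \<le> w b"
  using continuous_attains_inf[OF compact_Icc _ wc] lh by auto
 have "0 < w a*(hi - lo)" using wp[OF a(1)] lh by simp
 also have "\<dots> = integral {lo..hi} (\<lambda>_. w a)" using lh by simp
 also have "\<dots> \<le> integral {lo..hi} w"
  by (rule integral_le) (use a wc integrable_continuous_real in auto)
 finally show ?thesis .
qed

lemma wavg_int: "continuous_on {lo..hi} f \<Longrightarrow> (\<lambda>a. f a*w a) integrable_on {lo..hi}"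
 by (intro integrable_continuous_real continuous_intros wc)

lemma wavg_add:
 assumes "continuous_on {lo..hi} f" "continuous_on {lo..hi} g"
 shows "wavg w lo hi (\<lambda>a. f a + g a) = wavg w lo hi f + wavg w lo hi g"
 using Henstock_Kurzweil_Integration.integral_add[OF wavg_int[OF assms(1)] wavg_int[OF assms(2)]]
 by (simp add: wavg_def distrib_right add_divide_distrib)

lemma wavg_cmult: "wavg w lo hi (\<lambda>a. c*f a) = c*wavg w lo hi f"
 by (simp add: wavg_def mult.assoc)

lemma wavg_const: "wavg w lo hi (\<lambda>a. c) = c"
 using integral_weight_pos by (simp add: wavg_def)

lemma wavg_diff:
 assumes "continuous_on {lo..hi} f" "continuous_on {lo..hi} g"
 shows "wavg w lo hi (\<lambda>a. f a - g a) = wavg w lo hi f - wavg w lo hi g"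
 using Henstock_Kurzweil_Integration.integral_diff[OF wavg_int[OF assms(1)] wavg_int[OF assms(2)]]
 by (simp add: wavg_def left_diff_distrib diff_divide_distrib)

lemma wavg_mono:
 assumes "continuous_on {lo..hi} f" "continuous_on {lo..hi} g" "\<And>a. a \<in> {lo..hi} \<Longrightarrow> f a \<le> g a"
 shows "wavg w lo hi f \<le> wavg w lo hi g"
 unfolding wavg_def
 by (intro divide_right_mono integral_le wavg_int assms mult_right_mono)
  (use wp integral_weight_pos in \<open>auto intro: less_imp_le\<close>)

lemma wavg_nonneg:
 assumes "continuous_on {lo..hi} f" "\<And>a. a \<in> {lo..hi} \<Longrightarrow> 0 \<le> f a"
 shows "0 \<le> wavg w lo hi f"
 using wavg_mono[of "\<lambda>_. 0" f] assms by (simp add: wavg_const)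

lemma wavg_abs_diff:
 assumes "continuous_on {lo..hi} f" "continuous_on {lo..hi} g" "continuous_on {lo..hi} h"
  and "\<And>a. a \<in> {lo..hi} \<Longrightarrow> \<bar>f a - g a\<bar> \<le> h a"
 shows "\<bar>wavg w lo hi f - wavg w lo hi g\<bar> \<le> wavg w lo hi h"
proof -
 have "wavg w lo hi f - wavg w lo hi g \<le> wavg w lo hi h"
  unfolding wavg_diff[OF assms(1,2), symmetric]
  by (rule wavg_mono) (use assms(4) in \<open>auto intro!: continuous_intros assms(1-3) simp: abs_le_iff\<close>)
 moreover have "wavg w lo hi g - wavg w lo hi f \<le> wavg w lo hi h"
  unfolding wavg_diff[OF assms(2,1), symmetric]
  by (rule wavg_mono) (use assms(4) in \<open>auto intro!: continuous_intros assms(1-3) simp: abs_le_iff\<close>)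
 ultimately show ?thesis by (simp add: abs_le_iff)
qed

end

text \<open>Young's inequality in three instances. The weights \<open>sqrt m\<close> balance the two
  terms when \<open>s\<close> has the size \<open>1/sqrt m\<close> of a posterior deviation, so odd
  moments get the right order from even ones.\<close>

lemma abs_le_weighted_squares:
 fixes s :: real assumes "0 < m"
 shows "\<bar>s\<bar> \<le> (sqrt m * s^2 + 1/sqrt m)/2" "\<bar>s\<bar>^3 \<le> (sqrt m * s^4 + s^2/sqrt m)/2"
  "0 < c \<Longrightarrow> C*\<bar>s\<bar> \<le> c * s^2/2 + C^2/(2*c)"
proof -
 have q: "0 < sqrt m" using assms by simp
 have "0 \<le> (sqrt m*\<bar>s\<bar> - 1)^2/(2 * sqrt m)" using q by simp
 also have "\<dots> = (sqrt m * s^2 + 1/sqrt m)/2 - \<bar>s\<bar>"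
  using q by (simp add: field_simps power2_eq_square)
 finally show 1: "\<bar>s\<bar> \<le> (sqrt m * s^2 + 1/sqrt m)/2" by simp
 have "\<bar>s\<bar>^3 = s^2*\<bar>s\<bar>" by (simp add: power3_eq_cube power2_eq_square)
 also have "\<dots> \<le> s^2*((sqrt m * s^2 + 1/sqrt m)/2)" by (rule mult_left_mono[OF 1]) simp
 finally show "\<bar>s\<bar>^3 \<le> (sqrt m * s^4 + s^2/sqrt m)/2"
  by (simp add: algebra_simps power4_eq_xxxx power2_eq_square add_divide_distrib)
 assume c: "0 < c"
 have "0 \<le> (c*\<bar>s\<bar> - C)^2/(2*c)" using c by simp
 also have "\<dots> = c * s^2/2 + C^2/(2*c) - C*\<bar>s\<bar>"
  using c by (simp add: field_simps power2_eq_square)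
 finally show "C*\<bar>s\<bar> \<le> c * s^2/2 + C^2/(2*c)" by simp
qed

text \<open>Integrating the derivative of \<open>s^k*w\<close> gives identities between the moments of
 \<open>s = A - a\<close>; no Gaussian approximation of the weight is needed.\<close>

lemma moment_inequalities:
 fixes p p' l l' :: "real \<Rightarrow> real" and lo hi a A0 m c C N K \<tau> \<eta> C1 :: real
 defines "w \<equiv> \<lambda>A. p A*exp (l A - l a)"
 defines "E \<equiv> wavg w lo hi"
 assumes lh: "lo < hi"
  and p: "\<And>A. A \<in> {lo..hi} \<Longrightarrow> (p has_real_derivative p' A) (at A)" and p'c: "continuous_on {lo..hi} p'"
  and pp: "\<And>A. A \<in> {lo..hi} \<Longrightarrow> 0 < p A"
  and l: "\<And>A. A \<in> {lo..hi} \<Longrightarrow> (l has_real_derivative l' A) (at A)" and l'c: "continuous_on {lo..hi} l'"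
  and m: "0 < m" and c: "0 < c"
  and C1: "\<And>A. A \<in> {lo..hi} \<Longrightarrow> \<bar>l' a + p' A/p A\<bar> \<le> C1"
  and H3: "\<And>A. A \<in> {lo..hi} \<Longrightarrow> (A - a)*(l' A - l' a) \<le> - (c*m)*(A - a)^2"
  and H4: "\<And>A. A \<in> {lo..hi} \<Longrightarrow> \<bar>l' A - l' a + N*(A - a) - K/2*(A - a)^2\<bar> \<le> C*m*\<bar>A - a\<bar>^3 + \<tau> * sqrt m*\<bar>A - a\<bar>"
  and bd: "\<And>k. k \<le> 3 \<Longrightarrow> \<bar>(hi - a)^k*w hi - (lo - a)^k*w lo\<bar> \<le> \<eta>*integral {lo..hi} w"
 shows "c*m/2*E (\<lambda>A. (A - a)^2) \<le> 1 + \<eta> + C1^2/(2*(c*m))"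
  and "c*m/2*E (\<lambda>A. (A - a)^4) \<le> (3 + C1^2/(2*(c*m)))*E (\<lambda>A. (A - a)^2) + \<eta>"
  and "\<bar>N*E (\<lambda>A. (A - a)^2) - 1\<bar> \<le> \<eta> + C1*E (\<lambda>A. \<bar>A - a\<bar>) + \<bar>K\<bar>/2*E (\<lambda>A. \<bar>A - a\<bar>^3)
   + C*m*E (\<lambda>A. (A - a)^4) + \<tau> * sqrt m*E (\<lambda>A. (A - a)^2)"
  and "\<bar>l' a + p' A0/p A0 - N*E (\<lambda>A. A - a) + K/2*E (\<lambda>A. (A - a)^2)\<bar> \<le>
   \<eta> + E (\<lambda>A. \<bar>p' A/p A - p' A0/p A0\<bar>) + C*m*E (\<lambda>A. \<bar>A - a\<bar>^3) + \<tau> * sqrt m*E (\<lambda>A. \<bar>A - a\<bar>)"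
proof -
 let ?r = "\<lambda>A. p' A/p A"
 have pc: "continuous_on {lo..hi} p"
  using p by (meson DERIV_isCont continuous_at_imp_continuous_on)
 have lc: "continuous_on {lo..hi} l"
  using l by (meson DERIV_isCont continuous_at_imp_continuous_on)
 have wc: "continuous_on {lo..hi} w" unfolding w_def by (intro continuous_intros pc lc)
 have wp: "\<And>A. A \<in> {lo..hi} \<Longrightarrow> 0 < w A" unfolding w_def using pp by simp
 have rc: "continuous_on {lo..hi} ?r" using pp by (intro continuous_intros pc p'c) (auto simp: less_imp_neq[symmetric])
 note cont = continuous_intros pc lc wc rc l'c p'c
 note add = wavg_add[OF lh wc wp, folded E_def]
 note diff = wavg_diff[OF lh wc wp, folded E_def]
 note cmult = wavg_cmult[OF lh wc wp, folded E_def]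
 note const = wavg_const[OF lh wc wp, folded E_def]
 note mono = wavg_mono[OF lh wc wp, folded E_def]
 note absd = wavg_abs_diff[OF lh wc wp, folded E_def]
 have W: "0 < integral {lo..hi} w" by (rule integral_weight_pos[OF lh wc wp])
 have wd: "(w has_real_derivative (l' A + ?r A)*w A) (at A)" if "A \<in> {lo..hi}" for A
  unfolding w_def by (rule derivative_eq_intros p[OF that] l[OF that] refl)+ (use pp[OF that] in \<open>simp add: field_simps\<close>)
 \<comment> \<open>Fundamental theorem of calculus for \<open>(A - a)^k * w A\<close>; by
   \<open>bd\<close> the boundary values are negligible. For \<open>k = 0\<close> the truncated
   exponent \<open>k - 1\<close> is harmless because its factor is 0.\<close>
 have id: "\<bar>E (\<lambda>A. real k*(A - a)^(k - 1) + (A - a)^k*(l' A + ?r A))\<bar> \<le> \<eta>" if "k \<le> 3" for k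
 proof -
  have "((\<lambda>A. (real k*(A - a)^(k - 1) + (A - a)^k*(l' A + ?r A))*w A) has_integral
    (hi - a)^k*w hi - (lo - a)^k*w lo) {lo..hi}"
  proof (rule fundamental_theorem_of_calculus)
   fix A assume A: "A \<in> {lo..hi}"
   have "((\<lambda>A. (A - a)^k*w A) has_real_derivative (real k*(A - a)^(k - 1) + (A - a)^k*(l' A + ?r A))*w A) (at A)"
    by (rule derivative_eq_intros wd[OF A] refl)+ (simp add: algebra_simps)
   then show "((\<lambda>A. (A - a)^k*w A) has_vector_derivative (real k*(A - a)^(k - 1) + (A - a)^k*(l' A + ?r A))*w A) (at A within {lo..hi})"
    by (simp add: has_real_derivative_iff_has_vector_derivative has_vector_derivative_at_within)
  qed (use lh in simp)
  then have "E (\<lambda>A. real k*(A - a)^(k - 1) + (A - a)^k*(l' A + ?r A)) = ((hi - a)^k*w hi - (lo - a)^k*w lo)/integral {lo..hi} w"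
   unfolding E_def wavg_def by (simp add: integral_unique)
  then show ?thesis using bd[OF that] W by (simp add: abs_divide pos_divide_le_eq)
 qed
 have cm: "0 < c*m" using c m by simp
 \<comment> \<open>By \<open>H3\<close> the score pulls back towards \<open>a\<close> with strength
   \<open>c*m\<close>; half of it absorbs the bounded term \<open>l' a + p' A/p A\<close>, at the
   price of a constant of order \<open>1/m\<close>.\<close>
 have sg: "(A - a)*(l' A + ?r A) \<le> - (c*m/2)*(A - a)^2 + C1^2/(2*(c*m))" if A: "A \<in> {lo..hi}" for A
 proof -
  have "(A - a)*(l' A + ?r A) = (A - a)*(l' A - l' a) + (A - a)*(l' a + ?r A)" by (simp add: algebra_simps)
  also have "\<dots> \<le> - (c*m)*(A - a)^2 + \<bar>A - a\<bar>*C1"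
  proof (rule add_mono[OF H3[OF A]])
   have "(A - a)*(l' a + ?r A) \<le> \<bar>A - a\<bar>*\<bar>l' a + ?r A\<bar>" by (metis abs_ge_self abs_mult)
   also have "\<dots> \<le> \<bar>A - a\<bar>*C1" by (rule mult_left_mono[OF C1[OF A]]) simp
   finally show "(A - a)*(l' a + ?r A) \<le> \<bar>A - a\<bar>*C1" .
  qed
  also have "\<dots> \<le> - (c*m/2)*(A - a)^2 + C1^2/(2*(c*m))"
   using abs_le_weighted_squares(3)[OF m cm, of C1 "A - a"] by (simp add: algebra_simps)
  finally show ?thesis .
 qed
 \<comment> \<open>\<open>k = 1\<close>: the integrand is 1 plus \<open>s\<close> times the score of
   the weight, and \<open>sg\<close> bounds it by a constant minus a multiple of
   \<open>s^2\<close>.\<close>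
 show "c*m/2*E (\<lambda>A. (A - a)^2) \<le> 1 + \<eta> + C1^2/(2*(c*m))"
 proof -
  have "- \<eta> \<le> E (\<lambda>A. real 1*(A - a)^(1 - 1) + (A - a)^1*(l' A + ?r A))" using id[of 1] by (simp add: abs_le_iff)
  also have "\<dots> \<le> E (\<lambda>A. (1 + C1^2/(2*(c*m))) - (c*m/2)*(A - a)^2)"
  proof (rule mono)
   fix A assume "A \<in> {lo..hi}" from sg[OF this]
   show "real 1*(A - a)^(1 - 1) + (A - a)^1*(l' A + ?r A) \<le> (1 + C1^2/(2*(c*m))) - (c*m/2)*(A - a)^2" by simp
  qed (auto intro!: cont)
  also have "\<dots> = (1 + C1^2/(2*(c*m))) - (c*m/2)*E (\<lambda>A. (A - a)^2)"
   by (simp only: diff const cmult cont)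
  finally show ?thesis by simp
 qed
 \<comment> \<open>\<open>k = 3\<close>, with \<open>sg\<close> multiplied by
   \<open>s^2\<close>.\<close>
 show "c*m/2*E (\<lambda>A. (A - a)^4) \<le> (3 + C1^2/(2*(c*m)))*E (\<lambda>A. (A - a)^2) + \<eta>"
 proof -
  have "- \<eta> \<le> E (\<lambda>A. real 3*(A - a)^(3 - 1) + (A - a)^3*(l' A + ?r A))" using id[of 3] by (simp add: abs_le_iff)
  also have "\<dots> \<le> E (\<lambda>A. (3 + C1^2/(2*(c*m)))*(A - a)^2 - (c*m/2)*(A - a)^4)"
  proof (rule mono)
   fix A assume "A \<in> {lo..hi}"
   have gen: "real 3 * s^(3 - 1) + s^3*t \<le> (3 + q) * s^2 - k * s^4" if "s^2*(s*t) \<le> s^2*(- k * s^2 + q)" for s t k q :: real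
    using that by (simp add: algebra_simps power2_eq_square power3_eq_cube power4_eq_xxxx)
   from mult_left_mono[OF sg[OF \<open>A \<in> {lo..hi}\<close>], of "(A - a)^2"]
   show "real 3*(A - a)^(3 - 1) + (A - a)^3*(l' A + ?r A) \<le> (3 + C1^2/(2*(c*m)))*(A - a)^2 - (c*m/2)*(A - a)^4"
    by (intro gen) simp
  qed (auto intro!: cont)
  also have "\<dots> = (3 + C1^2/(2*(c*m)))*E (\<lambda>A. (A - a)^2) - (c*m/2)*E (\<lambda>A. (A - a)^4)"
   by (simp only: diff const cmult cont)
  finally show ?thesis by simp
 qed
 \<comment> \<open>Again \<open>k = 1\<close>, now with the expansion \<open>H4\<close> in place of
   the one-sided bound: the integrand is \<open>1 - N * s^2\<close> up to terms of higher
   order.\<close>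
 show "\<bar>N*E (\<lambda>A. (A - a)^2) - 1\<bar> \<le> \<eta> + C1*E (\<lambda>A. \<bar>A - a\<bar>) + \<bar>K\<bar>/2*E (\<lambda>A. \<bar>A - a\<bar>^3)
   + C*m*E (\<lambda>A. (A - a)^4) + \<tau> * sqrt m*E (\<lambda>A. (A - a)^2)"
 proof -
  let ?e = "E (\<lambda>A. real 1*(A - a)^(1 - 1) + (A - a)^1*(l' A + ?r A))"
  have "\<bar>?e - E (\<lambda>A. 1 - N*(A - a)^2)\<bar> \<le> E (\<lambda>A. C1*\<bar>A - a\<bar> + (\<bar>K\<bar>/2*\<bar>A - a\<bar>^3 + (C*m*(A - a)^4 + \<tau> * sqrt m*(A - a)^2)))"
  proof (rule absd)
   fix A assume A: "A \<in> {lo..hi}"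
   let ?s = "A - a"
   have gen: "real 1 * s^(1 - 1) + s^1*(u + r) - (1 - N * s^2) =
    s*(v + r) + K/2 * s^3 + s*(u - v + N * s - K/2 * s^2)" for s u v r :: real
    by (simp add: algebra_simps power2_eq_square power3_eq_cube)
   have "real 1*?s^(1 - 1) + ?s^1*(l' A + ?r A) - (1 - N*?s^2) =
    ?s*(l' a + ?r A) + K/2*?s^3 + ?s*(l' A - l' a + N*?s - K/2*?s^2)"
    by (rule gen)
   also have "\<bar>\<dots>\<bar> \<le> \<bar>?s\<bar>*\<bar>l' a + ?r A\<bar> + \<bar>K\<bar>/2*\<bar>?s\<bar>^3 + \<bar>?s\<bar>*\<bar>l' A - l' a + N*?s - K/2*?s^2\<bar>"
    by (simp only: abs_mult[symmetric] power_abs[symmetric]) (intro order.trans[OF abs_triangle_ineq] add_mono, auto simp: abs_mult power_abs)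
   also have "\<dots> \<le> \<bar>?s\<bar>*C1 + \<bar>K\<bar>/2*\<bar>?s\<bar>^3 + \<bar>?s\<bar>*(C*m*\<bar>?s\<bar>^3 + \<tau> * sqrt m*\<bar>?s\<bar>)"
    by (intro add_mono mult_left_mono C1 H4 A) auto
   also have "\<dots> = C1*\<bar>?s\<bar> + (\<bar>K\<bar>/2*\<bar>?s\<bar>^3 + (C*m*?s^4 + \<tau> * sqrt m*?s^2))"
   proof -
    have "\<bar>?s\<bar>*\<bar>?s\<bar>^3 = ?s^4" "\<bar>?s\<bar>*\<bar>?s\<bar> = ?s^2"
     by (simp_all add: power2_eq_square power4_eq_xxxx power3_eq_cube abs_mult[symmetric])
    then show ?thesis by (simp add: algebra_simps)
   qed
   finally show "\<bar>real 1*?s^(1 - 1) + ?s^1*(l' A + ?r A) - (1 - N*?s^2)\<bar> \<le> C1*\<bar>?s\<bar> + (\<bar>K\<bar>/2*\<bar>?s\<bar>^3 + (C*m*?s^4 + \<tau> * sqrt m*?s^2))" .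
  qed (auto intro!: cont)
  also have "\<dots> = C1*E (\<lambda>A. \<bar>A - a\<bar>) + (\<bar>K\<bar>/2*E (\<lambda>A. \<bar>A - a\<bar>^3)
   + (C*m*E (\<lambda>A. (A - a)^4) + \<tau> * sqrt m*E (\<lambda>A. (A - a)^2)))"
   by (simp only: cmult add cont)
  also have "E (\<lambda>A. 1 - N*(A - a)^2) = 1 - N*E (\<lambda>A. (A - a)^2)"
   by (simp only: diff const cmult cont)
  finally show ?thesis using id[of 1] by (simp add: abs_le_iff)
 qed
 \<comment> \<open>\<open>k = 0\<close>: the mean of the score of the weight is a boundary term,
   hence negligible; this gives a linear relation between the first and the second moment.\<close>
 show "\<bar>l' a + p' A0/p A0 - N*E (\<lambda>A. A - a) + K/2*E (\<lambda>A. (A - a)^2)\<bar> \<le>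
   \<eta> + E (\<lambda>A. \<bar>p' A/p A - p' A0/p A0\<bar>) + C*m*E (\<lambda>A. \<bar>A - a\<bar>^3) + \<tau> * sqrt m*E (\<lambda>A. \<bar>A - a\<bar>)"
 proof -
  let ?e = "E (\<lambda>A. real 0*(A - a)^(0 - 1) + (A - a)^0*(l' A + ?r A))"
  let ?g = "\<lambda>A. ((l' a + ?r A0) - N*(A - a)) + K/2*(A - a)^2"
  have "\<bar>?e - E ?g\<bar> \<le> E (\<lambda>A. \<bar>?r A - ?r A0\<bar> + (C*m*\<bar>A - a\<bar>^3 + \<tau> * sqrt m*\<bar>A - a\<bar>))"
  proof (rule absd)
   fix A assume A: "A \<in> {lo..hi}"
   from H4[OF A] show "\<bar>real 0*(A - a)^(0 - 1) + (A - a)^0*(l' A + ?r A) - ?g A\<bar> \<le> \<bar>?r A - ?r A0\<bar> + (C*m*\<bar>A - a\<bar>^3 + \<tau> * sqrt m*\<bar>A - a\<bar>)"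
    by (simp add: abs_if split: if_splits)
  qed (auto intro!: cont)
  also have "\<dots> = E (\<lambda>A. \<bar>?r A - ?r A0\<bar>) + (C*m*E (\<lambda>A. \<bar>A - a\<bar>^3) + \<tau> * sqrt m*E (\<lambda>A. \<bar>A - a\<bar>))"
   by (simp only: cmult add cont)
  also have "E ?g = l' a + ?r A0 - N*E (\<lambda>A. A - a) + K/2*E (\<lambda>A. (A - a)^2)"
   by (simp only: cmult add diff cont const)
  finally show ?thesis using id[of 0] by (simp add: abs_le_iff)
 qed
qed


text \<open>Subtracting the linear term at \<open>a\<close> and adding the parabola leaves a
  function \<open>f\<close> whose derivative has the sign opposite to \<open>B - a\<close>, so
  \<open>f\<close> is maximal at \<open>a\<close>.\<close>

lemma log_concave_upper_bound:
 fixes l l' :: "real \<Rightarrow> real"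
 assumes l: "\<And>A. A \<in> {lo..hi} \<Longrightarrow> (l has_real_derivative l' A) (at A)"
  and H3: "\<And>A. A \<in> {lo..hi} \<Longrightarrow> (A - a)*(l' A - l' a) \<le> - k*(A - a)^2"
  and a: "a \<in> {lo..hi}" and A: "A \<in> {lo..hi}"
 shows "l A - l a \<le> l' a*(A - a) - k/2*(A - a)^2"
proof -
 define f where "f B = l B - l' a*(B - a) + k/2*(B - a)^2" for B
 have fd: "(f has_real_derivative (l' B - l' a + k*(B - a))) (at B)" if "B \<in> {lo..hi}" for B
  unfolding f_def by (rule derivative_eq_intros l[OF that] refl)+ simp
 have sg: "(B - a)*(l' B - l' a + k*(B - a)) \<le> 0" if "B \<in> {lo..hi}" for B
  using H3[OF that] by (simp add: algebra_simps power2_eq_square)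
 have "f A \<le> f a"
 proof (cases "a \<le> A")
  case True
  show ?thesis
  proof (rule DERIV_nonpos_imp_nonincreasing[OF True])
   fix B assume B: "a \<le> B" "B \<le> A"
   then have Bin: "B \<in> {lo..hi}" using a A by auto
   show "\<exists>y. (f has_real_derivative y) (at B) \<and> y \<le> 0"
   proof (cases "B = a")
    case False
    then have "l' B - l' a + k*(B - a) \<le> 0" using sg[OF Bin] B by (simp add: mult_le_0_iff)
    then show ?thesis using fd[OF Bin] by blast
   qed (use fd[OF Bin] in auto)
  qed
 next
  case False
  then have le: "A \<le> a" by simp
  show ?thesis
  proof (rule DERIV_nonneg_imp_nondecreasing[OF le])
   fix B assume B: "A \<le> B" "B \<le> a"
   then have Bin: "B \<in> {lo..hi}" using a A by auto
   show "\<exists>y. (f has_real_derivative y) (at B) \<and> 0 \<le> y"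
   proof (cases "B = a")
    case False
    then have "0 \<le> l' B - l' a + k*(B - a)" using sg[OF Bin] B by (simp add: mult_le_0_iff)
    then show ?thesis using fd[OF Bin] by blast
   qed (use fd[OF Bin] in auto)
  qed
 qed
 then show ?thesis by (simp add: f_def)
qed

section \<open>Limits of the posterior moments\<close>

lemma tendsto_power_mult_exp_neg:
 fixes m :: "nat \<Rightarrow> real"
 assumes m: "filterlim m at_top sequentially" and k: "0 < k"
 shows "(\<lambda>n. m n^j*exp (- k*m n)) \<longlonglongrightarrow> 0"
proof -
 have "filterlim (\<lambda>n. k*m n) at_top sequentially"
  using m k by (simp add: filterlim_tendsto_pos_mult_at_top[OF tendsto_const])
 then have "(\<lambda>n. (k*m n)^j/exp (k*m n)) \<longlonglongrightarrow> 0"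
  by (rule filterlim_compose[OF tendsto_power_div_exp_0])
 then have "(\<lambda>n. (1/k^j)*((k*m n)^j/exp (k*m n))) \<longlonglongrightarrow> 0"
  by (rule tendsto_mult_right_zero)
 then show ?thesis using k by (simp add: power_mult_distrib exp_minus field_simps)
qed

text \<open>The inequalities of \<open>moment_inequalities\<close> are read along a sequence. Crude
  bounds for the second and fourth moments give the odd moments; the sharp relations then yield E
  s^2 ~ 1/N and, through N E s = l'(a) + p'/p + (K/2) E s^2, the first moment up to o(1/m). The
  lower bound for the normalising integral is needed in order to divide by it: it is polynomial in
  1/m, while the competing boundary terms are exponentially small.\<close>

lemma posterior_moments:
 fixes l l' :: "nat \<Rightarrow> real \<Rightarrow> real" and a m N K \<tau> :: "nat \<Rightarrow> real" and p p' :: "real \<Rightarrow> real" and lo hi A0 c C :: real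
 defines "w \<equiv> \<lambda>n A. p A*exp (l n A - l n (a n))"
 defines "E \<equiv> \<lambda>n. wavg (w n) lo hi"
 assumes A0: "lo < A0" "A0 < hi"
  and p: "\<And>A. A \<in> {lo..hi} \<Longrightarrow> (p has_real_derivative p' A) (at A)" and p'c: "continuous_on {lo..hi} p'"
  and pp: "\<And>A. A \<in> {lo..hi} \<Longrightarrow> 0 < p A"
  and l: "EV n. \<forall>A\<in>{lo..hi}. (l n has_real_derivative l' n A) (at A)"
  and l'c: "EV n. continuous_on {lo..hi} (l' n)"
  and m: "filterlim m at_top sequentially" and c: "0 < c" and a: "a \<longlonglongrightarrow> A0"
  and la: "EV n. \<bar>l' n (a n)\<bar> \<le> C"
  and H3: "EV n. \<forall>A\<in>{lo..hi}. (A - a n)*(l' n A - l' n (a n)) \<le> - (c*m n)*(A - a n)^2"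
  and H4: "EV n. \<forall>A\<in>{lo..hi}. \<bar>l' n A - l' n (a n) + N n*(A - a n) - K n/2*(A - a n)^2\<bar>
    \<le> C*m n*\<bar>A - a n\<bar>^3 + \<tau> n * sqrt (m n)*\<bar>A - a n\<bar>"
  and t0: "\<tau> \<longlonglongrightarrow> 0"
  and NK: "EV n. c*m n \<le> N n \<and> N n \<le> C*m n \<and> \<bar>K n\<bar> \<le> C*m n"
 shows "\<exists>c'>0. EV n. c'/m n \<le> integral {lo..hi} (w n)"
  and "\<exists>C'. EV n. E n (\<lambda>A. (A - a n)^2) \<le> C'/m n \<and> E n (\<lambda>A. (A - a n)^4) \<le> C'/(m n)^2"
  and "(\<lambda>n. m n*E n (\<lambda>A. (A - a n)^2) - m n/N n) \<longlonglongrightarrow> 0"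
  and "(\<lambda>n. m n*E n (\<lambda>A. A - a n) - m n/N n*(l' n (a n) + p' A0/p A0 + K n/(2*N n))) \<longlonglongrightarrow> 0"
proof -
 let ?J = "{lo..hi}"
 have lh: "lo < hi" using A0 by simp
 have pc: "continuous_on ?J p" using p by (meson DERIV_isCont continuous_at_imp_continuous_on)
 obtain pmin where pmin: "0 < pmin" "\<And>A. A \<in> ?J \<Longrightarrow> pmin \<le> p A"
 proof -
  obtain b where "b \<in> ?J" "\<And>A. A \<in> ?J \<Longrightarrow> p b \<le> p A"
   using continuous_attains_inf[OF compact_Icc _ pc] lh by auto
  then show ?thesis using that[of "p b"] pp by blast
 qed
 obtain pmax where pmax: "\<And>A. A \<in> ?J \<Longrightarrow> p A \<le> pmax"
  using continuous_attains_sup[OF compact_Icc _ pc] lh by (metis atLeastAtMost_iff less_imp_le order_refl empty_iff)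
 let ?r = "\<lambda>A. p' A/p A"
 have rc: "continuous_on ?J ?r" using pp by (intro continuous_intros pc p'c) (auto simp: less_imp_neq[symmetric])
 obtain Cr where Cr: "\<And>A. A \<in> ?J \<Longrightarrow> \<bar>?r A\<bar> \<le> Cr"
 proof -
  have ac: "continuous_on ?J (\<lambda>A. \<bar>?r A\<bar>)" by (intro continuous_intros rc)
  show ?thesis using continuous_attains_sup[OF compact_Icc _ ac] lh that
   by (metis atLeastAtMost_iff less_imp_le order_refl empty_iff)
 qed
 have Cr0: "0 \<le> Cr" using order_trans[OF abs_ge_zero Cr[of A0]] A0 by simp
 have m1: "EV n. 1 \<le> m n" using m by (simp add: filterlim_at_top)
 have C0: "0 \<le> C"
 proof -
  have "EV n. 0 \<le> C" using la by eventually_elim (rule order_trans[OF abs_ge_zero])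
  then show ?thesis by simp
 qed
 \<comment> \<open>Half the distance from \<open>A0\<close> to the boundary: once \<open>a n\<close>
   is within \<open>d\<close> of \<open>A0\<close>, both endpoints are at least \<open>d\<close>
   away from \<open>a n\<close>.\<close>
 define d where "d = min (A0 - lo) (hi - A0)/2"
 have d0: "0 < d" using A0 by (simp add: d_def)
 have ad: "EV n. \<bar>a n - A0\<bar> < d" using tendstoD[OF a d0] by (simp add: dist_real_def)
 have aJ: "EV n. a n \<in> ?J \<and> d \<le> hi - a n \<and> d \<le> a n - lo"
  using ad
 proof eventually_elim
  case (elim n)
  have "d \<le> (A0 - lo)/2" "d \<le> (hi - A0)/2" by (simp_all add: d_def)
  with elim d0 show ?case by (auto simp: abs_less_iff)
 qed
 have t1: "EV n. \<bar>\<tau> n\<bar> \<le> 1"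
  using tendstoD[OF t0, of 1] by (simp add: dist_real_def) (erule eventually_mono, simp)
 have md: "EV n. 1/d \<le> m n" using m by (simp add: filterlim_at_top)
 \<comment> \<open>On an interval of length \<open>1/m n\<close> to the right of \<open>a n\<close>
   the score is at least \<open>- (4*C + 1)\<close>: the value at \<open>a n\<close>, the linear,
   the quadratic and the cubic term contribute at most \<open>C\<close> each, the
   \<open>\<tau>\<close> term at most 1. The interval is much shorter than the width of the weight,
   but a lower bound of order \<open>1/m n\<close> suffices.\<close>
 define c' where "c' = pmin*exp (- (4*C + 1))"
 have c'0: "0 < c'" using pmin by (simp add: c'_def)
 have Wlow: "EV n. c'/m n \<le> integral ?J (w n)"
  using l m1 la H4 NK aJ t1 md l'c
 proof eventually_elim
  case (elim n)
  have mp: "0 < m n" using elim(2) by simp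
  let ?b = "a n + 1/m n"
  have dm: "1/m n \<le> d" using elim(8) d0 mp by (simp add: field_simps)
  have sub: "{a n..?b} \<subseteq> ?J" using elim(6) dm by auto
  have low: "- (4*C + 1) \<le> l n A - l n (a n)" if A: "A \<in> {a n..?b}" for A
  proof (cases "A = a n")
   case True then show ?thesis using C0 by simp
  next
   case False
   then have aA: "a n < A" using A by simp
   have "\<exists>\<xi>>a n. \<xi> < A \<and> l n A - l n (a n) = (A - a n)*l' n \<xi>"
    by (rule MVT2[OF aA]) (use elim(1) A sub in \<open>auto simp: subset_iff\<close>)
   then obtain \<xi> where x: "a n < \<xi>" "\<xi> < A" "l n A - l n (a n) = (A - a n)*l' n \<xi>" by blast
   define s where "s = \<xi> - a n"
   have s: "0 \<le> s" "s \<le> 1/m n" using x A by (auto simp: s_def)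
   have s1: "s \<le> 1" using s(2) elim(2) by (simp add: order_trans)
   have ms: "m n * s \<le> 1" using s(2) mp by (simp add: field_simps)
   have xJ: "\<xi> \<in> ?J" using x A sub by (auto simp: subset_iff)
   have h: "\<bar>l' n \<xi> - l' n (a n) + N n * s - K n/2 * s^2\<bar> \<le> C*m n * s^3 + \<tau> n * sqrt (m n) * s"
    using bspec[OF elim(4) xJ] s(1) by (simp add: s_def)
   have b1: "N n * s \<le> C"
    using mult_right_mono[of "N n" "C*m n" s] elim(5) s(1) mult_left_mono[OF ms C0] by (simp add: mult.assoc)
   have b0: "0 \<le> N n * s" using elim(5) s(1) c mp by (smt (verit) mult_nonneg_nonneg mult_pos_pos)
   have ss: "m n * s^2 \<le> 1" "m n * s^3 \<le> 1"
   proof -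
    have "m n * s^2 = (m n * s) * s" by (simp add: power2_eq_square)
    also have "\<dots> \<le> 1*1" by (rule mult_mono) (use ms s s1 mp in auto)
    finally show q: "m n * s^2 \<le> 1" by simp
    have "m n * s^3 = (m n * s^2) * s" by (simp add: power2_eq_square power3_eq_cube)
    also have "\<dots> \<le> 1*1" by (rule mult_mono) (use q s s1 mp in auto)
    finally show "m n * s^3 \<le> 1" by simp
   qed
   have b2: "\<bar>K n/2 * s^2\<bar> \<le> C"
   proof -
    have "\<bar>K n/2 * s^2\<bar> = \<bar>K n\<bar> * s^2/2" by (simp add: abs_mult)
    also have "\<dots> \<le> C*m n * s^2/2" using elim(5) by (intro divide_right_mono mult_right_mono) auto
    also have "\<dots> \<le> C" using mult_left_mono[OF ss(1) C0] C0 by (simp add: mult.assoc)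
    finally show ?thesis .
   qed
   have b3: "C*m n * s^3 \<le> C" using mult_left_mono[OF ss(2) C0] by (simp add: mult.assoc)
   have b4: "\<tau> n * sqrt (m n) * s \<le> 1"
   proof -
    have "sqrt (m n) \<le> m n" using elim(2) by (simp add: real_le_lsqrt power2_eq_square)
    then have "sqrt (m n) * s \<le> 1" using ms mult_right_mono[of "sqrt (m n)" "m n" s] s(1) by linarith
    moreover have "0 \<le> sqrt (m n) * s" using s(1) mp by simp
    ultimately have "\<bar>\<tau> n\<bar>*(sqrt (m n) * s) \<le> 1*1" by (intro mult_mono) (use elim(7) in auto)
    moreover have "\<tau> n*(sqrt (m n) * s) \<le> \<bar>\<tau> n\<bar>*(sqrt (m n) * s)"
     using \<open>0 \<le> sqrt (m n) * s\<close> by (intro mult_right_mono) auto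
    ultimately show ?thesis by (simp add: mult.assoc)
   qed
   have lx: "- (4*C + 1) \<le> l' n \<xi>" using h b0 b1 b2 b3 b4 elim(3) C0 by (simp only: abs_le_iff) linarith
   have "1/m n \<le> 1" using elim(2) by simp
   then have "0 \<le> A - a n" "A - a n \<le> 1" using A by auto
   then have "- (4*C + 1) \<le> (A - a n)*l' n \<xi>"
    using lx C0 by (smt (verit) mult_left_le_one_le mult_nonneg_nonneg mult_minus_right)
   then show ?thesis using x(3) by simp
  qed
  have lcn: "continuous_on ?J (l n)" using elim(1) by (meson DERIV_isCont continuous_at_imp_continuous_on)
  have wc: "continuous_on ?J (w n)" unfolding w_def by (intro continuous_intros pc lcn)
  have "c'/m n = integral {a n..?b} (\<lambda>_. c')" using mp by simp
  also have "\<dots> \<le> integral {a n..?b} (w n)"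
  proof (rule integral_le)
   show "w n integrable_on {a n..?b}"
    by (rule integrable_continuous_real[OF continuous_on_subset[OF wc sub]])
   fix A assume A: "A \<in> {a n..?b}"
   have "exp (- (4*C + 1)) \<le> exp (l n A - l n (a n))" using low[OF A] by simp
   then show "c' \<le> w n A" unfolding c'_def w_def
    by (intro mult_mono) (use pmin pp A sub in \<open>auto simp: subset_iff intro: less_imp_le\<close>)
  qed (simp add: integrable_const_ivl)
  also have "\<dots> \<le> integral ?J (w n)"
  proof (rule integral_subset_le[OF sub])
   show "w n integrable_on {a n..?b}"
    by (rule integrable_continuous_real[OF continuous_on_subset[OF wc sub]])
   show "w n integrable_on ?J" by (rule integrable_continuous_real[OF wc])
   show "\<forall>x\<in>?J. 0 \<le> w n x" using pp by (auto simp: w_def intro: less_imp_le)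
  qed
  finally show ?case .
 qed
 then show "\<exists>c'>0. EV n. c'/m n \<le> integral {lo..hi} (w n)" using c'0 by blast

 \<comment> \<open>By log-concavity the weight at an endpoint is at most
   \<open>pmax*exp (C*(hi - lo) - c*d^2/2*m n)\<close>. The factor 2 counts the endpoints, the cube
   bounds the powers up to 3, and \<open>m n/c'\<close> comes from dividing by the integral of the
   weight.\<close>
 define G where "G = 2*(1 + (hi - lo))^3*pmax*exp (C*(hi - lo))/c'"
 define \<eta> where "\<eta> n = G*(m n*exp (- (c*d^2/2)*m n))" for n
 have kd: "0 < c*d^2/2" using c d0 by simp
 have e0: "\<eta> \<longlonglongrightarrow> 0"
  unfolding \<eta>_def using tendsto_mult_right_zero[OF tendsto_power_mult_exp_neg[OF m kd, of 1]] by simp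
 have "(\<lambda>n. \<eta> n*m n) \<longlonglongrightarrow> 0"
 proof -
  have "(\<lambda>n. G*(m n^2*exp (- (c*d^2/2)*m n))) \<longlonglongrightarrow> 0"
   by (rule tendsto_mult_right_zero[OF tendsto_power_mult_exp_neg[OF m kd]])
  then show ?thesis by (simp add: \<eta>_def power2_eq_square mult_ac)
 qed
 then have em: "EV n. \<bar>\<eta> n*m n\<bar> < 1"
  using tendstoD[of "\<lambda>n. \<eta> n*m n" 0 _ 1] by simp
 have pmax0: "0 < pmax" using order_less_le_trans[OF pmin(1) order_trans[OF pmin(2) pmax], of A0] A0 by simp
 have G0: "0 \<le> G" using pmax0 c'0 lh by (simp add: G_def)
 have bd: "EV n. \<forall>k\<le>3. \<bar>(hi - a n)^k*w n hi - (lo - a n)^k*w n lo\<bar> \<le> \<eta> n*integral ?J (w n)"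
  using l m1 la H3 aJ Wlow
 proof eventually_elim
  case (elim n)
  have mp: "0 < m n" using elim(2) by simp
  let ?B = "pmax*exp (C*(hi - lo) - c*d^2/2*m n)"
  have W: "\<bar>w n A\<bar> \<le> ?B" if A: "A \<in> ?J" and dA: "d \<le> \<bar>A - a n\<bar>" for A
  proof -
   have "l n A - l n (a n) \<le> l' n (a n)*(A - a n) - c*m n/2*(A - a n)^2"
    by (rule log_concave_upper_bound[where lo=lo and hi=hi]) (use elim A in auto)
   also have "\<dots> \<le> C*(hi - lo) - c*d^2/2*m n"
   proof -
    have "l' n (a n)*(A - a n) \<le> \<bar>l' n (a n)\<bar>*\<bar>A - a n\<bar>" by (metis abs_ge_self abs_mult)
    also have "\<dots> \<le> C*(hi - lo)" by (rule mult_mono) (use elim A C0 in auto)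
    finally have 1: "l' n (a n)*(A - a n) \<le> C*(hi - lo)" .
    have "d^2 \<le> (A - a n)^2" using power_mono[OF dA, of 2] d0 by simp
    then have "c*m n/2*d^2 \<le> c*m n/2*(A - a n)^2" using c mp by (intro mult_left_mono) auto
    then show ?thesis using 1 by (simp add: mult_ac)
   qed
   finally have "exp (l n A - l n (a n)) \<le> exp (C*(hi - lo) - c*d^2/2*m n)" by simp
   then have "p A*exp (l n A - l n (a n)) \<le> ?B"
    by (intro mult_mono) (use pmax[OF A] pmax0 in auto)
   moreover have "0 \<le> w n A" using pp[OF A] by (simp add: w_def)
   ultimately show ?thesis by (simp add: w_def)
  qed
  show ?case
  proof (intro allI impI)
   fix k :: nat assume k: "k \<le> 3"
   have pk: "\<bar>(A - a n)^k\<bar> \<le> (1 + (hi - lo))^3" if A: "A \<in> ?J" for A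
   proof -
    have "\<bar>A - a n\<bar> \<le> 1 + (hi - lo)" using A elim(5) by auto
    then have "\<bar>A - a n\<bar>^k \<le> (1 + (hi - lo))^k" by (rule power_mono) simp
    also have "\<dots> \<le> (1 + (hi - lo))^3" by (rule power_increasing[OF k]) (use lh in simp)
    finally show ?thesis by (simp add: power_abs)
   qed
   have "\<bar>(hi - a n)^k*w n hi - (lo - a n)^k*w n lo\<bar> \<le> \<bar>(hi - a n)^k\<bar>*\<bar>w n hi\<bar> + \<bar>(lo - a n)^k\<bar>*\<bar>w n lo\<bar>"
    by (metis abs_mult abs_triangle_ineq4)
   also have "\<dots> \<le> (1 + (hi - lo))^3*?B + (1 + (hi - lo))^3*?B"
    by (intro add_mono mult_mono pk W) (use lh elim(5) in auto)
   also have "\<dots> = \<eta> n*(c'/m n)"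
   proof -
    have ex: "exp (C*(hi - lo) - c*d^2/2*m n) = exp (C*(hi - lo))*exp (- (c*d^2/2)*m n)"
     by (simp only: exp_add[symmetric]) simp
    have gen: "(h*(P*(X*Y)) + h*(P*(X*Y))) = (2*h*P*X/c')*(m n*Y)*(c'/m n)" for h P X Y
     using c'0 mp by (simp add: field_simps)
    show ?thesis unfolding \<eta>_def G_def ex by (rule gen)
   qed
   also have "\<dots> \<le> \<eta> n*integral ?J (w n)"
    by (rule mult_left_mono[OF elim(6)]) (use G0 mp in \<open>simp add: \<eta>_def\<close>)
   finally show "\<bar>(hi - a n)^k*w n hi - (lo - a n)^k*w n lo\<bar> \<le> \<eta> n*integral ?J (w n)" .
  qed
 qed
 define C1 where "C1 = C + Cr"
 have C1_0: "0 \<le> C1" using C0 Cr0 by (simp add: C1_def)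
 define e1 e2 e3 e4 er es where "e1 n = E n (\<lambda>A. \<bar>A - a n\<bar>)" and "e2 n = E n (\<lambda>A. (A - a n)^2)"
  and "e3 n = E n (\<lambda>A. \<bar>A - a n\<bar>^3)" and "e4 n = E n (\<lambda>A. (A - a n)^4)"
  and "er n = E n (\<lambda>A. \<bar>?r A - ?r A0\<bar>)" and "es n = E n (\<lambda>A. A - a n)" for n
 have main: "EV n. c*m n/2*e2 n \<le> 1 + \<eta> n + C1^2/(2*(c*m n)) \<and>
  c*m n/2*e4 n \<le> (3 + C1^2/(2*(c*m n)))*e2 n + \<eta> n \<and>
  \<bar>N n*e2 n - 1\<bar> \<le> \<eta> n + C1*e1 n + \<bar>K n\<bar>/2*e3 n + C*m n*e4 n + \<tau> n * sqrt (m n)*e2 n \<and>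
  \<bar>l' n (a n) + ?r A0 - N n*es n + K n/2*e2 n\<bar> \<le> \<eta> n + er n + C*m n*e3 n + \<tau> n * sqrt (m n)*e1 n"
  using l m1 la H3 aJ H4 bd l'c
 proof eventually_elim
  case (elim n)
  have "0 < m n" using elim(2) by simp
  moreover have "\<And>A. A \<in> ?J \<Longrightarrow> \<bar>l' n (a n) + ?r A\<bar> \<le> C1"
   unfolding C1_def by (rule order_trans[OF abs_triangle_ineq add_mono[OF elim(3) Cr]])
  ultimately have mp: "0 < m n" and c1: "\<And>A. A \<in> ?J \<Longrightarrow> \<bar>l' n (a n) + ?r A\<bar> \<le> C1" by blast+
  have h: "\<And>A. A \<in> ?J \<Longrightarrow> (l n has_real_derivative l' n A) (at A)"
   "\<And>A. A \<in> ?J \<Longrightarrow> (A - a n)*(l' n A - l' n (a n)) \<le> - (c*m n)*(A - a n)^2"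
   "\<And>A. A \<in> ?J \<Longrightarrow> \<bar>l' n A - l' n (a n) + N n*(A - a n) - K n/2*(A - a n)^2\<bar>
    \<le> C*m n*\<bar>A - a n\<bar>^3 + \<tau> n * sqrt (m n)*\<bar>A - a n\<bar>"
   "\<And>k. k \<le> 3 \<Longrightarrow> \<bar>(hi - a n)^k*(p hi*exp (l n hi - l n (a n))) - (lo - a n)^k*(p lo*exp (l n lo - l n (a n)))\<bar>
    \<le> \<eta> n*integral ?J (\<lambda>A. p A*exp (l n A - l n (a n)))"
   using elim(1,4,6,7) by (auto simp: w_def)
  note mi = moment_inequalities[OF lh p p'c pp h(1) elim(8) mp c c1 h(2,3,4)]
  show ?case
   unfolding e1_def e2_def e3_def e4_def er_def es_def E_def w_def
   using mi(1,2,3) mi(4)[of A0] by (intro conjI)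
 qed
 have cont: "EV n. continuous_on ?J (w n) \<and> (\<forall>A\<in>?J. 0 < w n A)"
  using l
 proof eventually_elim
  case (elim n)
  have "continuous_on ?J (l n)" using elim by (meson DERIV_isCont continuous_at_imp_continuous_on)
  then have "continuous_on ?J (w n)" unfolding w_def by (intro continuous_intros pc)
  then show ?case using pp by (simp add: w_def)
 qed
 have e13: "EV n. e1 n \<le> (sqrt (m n)*e2 n + 1/sqrt (m n))/2 \<and>
  e3 n \<le> (sqrt (m n)*e4 n + e2 n/sqrt (m n))/2 \<and> 0 \<le> e1 n \<and> 0 \<le> e2 n \<and> 0 \<le> e3 n \<and> 0 \<le> e4 n"
  using cont m1
 proof eventually_elim
  case (elim n)
  then have wc: "continuous_on ?J (w n)" and wp: "\<And>A. A \<in> ?J \<Longrightarrow> 0 < w n A" and mp: "0 < m n" by auto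
  note W = lh wc wp
  have "e1 n \<le> E n (\<lambda>A. sqrt (m n)/2*(A - a n)^2 + 1/(2 * sqrt (m n)))"
   unfolding e1_def E_def
  proof (rule wavg_mono[OF W])
   fix A show "\<bar>A - a n\<bar> \<le> sqrt (m n)/2*(A - a n)^2 + 1/(2 * sqrt (m n))"
    using abs_le_weighted_squares(1)[OF mp, of "A - a n"] by (simp add: add_divide_distrib mult.commute)
  qed (auto intro!: continuous_intros)
  also have "\<dots> = sqrt (m n)/2*e2 n + 1/(2 * sqrt (m n))"
   unfolding E_def e2_def by (simp only: wavg_add[OF W] wavg_cmult[OF W] wavg_const[OF W] continuous_intros)
  finally have 1: "e1 n \<le> sqrt (m n)/2*e2 n + 1/(2 * sqrt (m n))" .
  have "e3 n \<le> E n (\<lambda>A. sqrt (m n)/2*(A - a n)^4 + 1/(2 * sqrt (m n))*(A - a n)^2)"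
   unfolding e3_def E_def
  proof (rule wavg_mono[OF W])
   fix A show "\<bar>A - a n\<bar>^3 \<le> sqrt (m n)/2*(A - a n)^4 + 1/(2 * sqrt (m n))*(A - a n)^2"
    using abs_le_weighted_squares(2)[OF mp, of "A - a n"] by (simp add: add_divide_distrib mult.commute)
  qed (use mp in \<open>auto intro!: continuous_intros\<close>)
  also have "\<dots> = sqrt (m n)/2*e4 n + 1/(2 * sqrt (m n))*e2 n"
   unfolding E_def e2_def e4_def by (simp only: wavg_add[OF W] wavg_cmult[OF W] wavg_const[OF W] continuous_intros)
  finally have 2: "e3 n \<le> sqrt (m n)/2*e4 n + 1/(2 * sqrt (m n))*e2 n" .
  have "0 \<le> e1 n" "0 \<le> e2 n" "0 \<le> e3 n" "0 \<le> e4 n" unfolding e1_def e2_def e3_def e4_def E_def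
   by (rule wavg_nonneg[OF W]; auto intro!: continuous_intros)+
  then show ?case using 1 2 by (simp add: add_divide_distrib mult_ac)
 qed
 \<comment> \<open>The first two moment inequalities, solved for the moments with the help of
   \<open>1 \<le> m n\<close> and \<open>\<eta> n*m n < 1\<close>.\<close>
 define C2 where "C2 = 2/c*(2 + C1^2/(2*c))"
 define C4 where "C4 = 2/c*((3 + C1^2/(2*c))*C2 + 1)"
 have C2_0: "0 \<le> C2" using c by (simp add: C2_def)
 have C4_0: "0 \<le> C4" using c C2_0 by (simp add: C4_def)
 have e24: "EV n. e2 n \<le> C2/m n \<and> e4 n \<le> C4/(m n)^2"
  using main em m1 e13
 proof eventually_elim
  case (elim n)
  have mp: "0 < m n" using elim by simp
  have en: "\<eta> n \<le> 1/m n" using elim(2) mp by (simp add: field_simps)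
  have e1': "\<eta> n \<le> 1" using en elim(3) mp by (meson divide_le_eq_1_pos dual_order.trans)
  have q: "C1^2/(2*(c*m n)) \<le> C1^2/(2*c)"
   by (rule divide_left_mono) (use c elim(3) in \<open>auto intro!: mult_pos_pos\<close>)
  have "c*m n/2*e2 n \<le> 2 + C1^2/(2*c)" using elim(1) q e1' by linarith
  then have A: "e2 n \<le> C2/m n" unfolding C2_def using c mp by (simp add: field_simps)
  have "c*m n/2*e4 n \<le> (3 + C1^2/(2*(c*m n)))*e2 n + \<eta> n" using elim(1) by blast
  also have "\<dots> \<le> (3 + C1^2/(2*c))*(C2/m n) + 1/m n"
   by (intro add_mono mult_mono en A) (use q elim(4) c in auto)
  finally have "c*m n/2*e4 n \<le> ((3 + C1^2/(2*c))*C2 + 1)/m n" by (simp add: add_divide_distrib)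
  moreover have "X \<le> (2/c*Y)/(m n)^2" if "c*m n/2*X \<le> Y/m n" for X Y
   using that c mp by (simp add: field_simps power2_eq_square)
  ultimately have "e4 n \<le> C4/(m n)^2" unfolding C4_def by blast
  with A show ?case by simp
 qed
 show "\<exists>C'. EV n. E n (\<lambda>A. (A - a n)^2) \<le> C'/m n \<and> E n (\<lambda>A. (A - a n)^4) \<le> C'/(m n)^2"
 proof (intro exI[of _ "max C2 C4"])
  show "EV n. E n (\<lambda>A. (A - a n)^2) \<le> max C2 C4/m n \<and> E n (\<lambda>A. (A - a n)^4) \<le> max C2 C4/(m n)^2"
   using e24 m1 unfolding e2_def e4_def
  proof eventually_elim
   case (elim n)
   have "C2/m n \<le> max C2 C4/m n" "C4/(m n)^2 \<le> max C2 C4/(m n)^2"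
    using elim(2) by (auto intro!: divide_right_mono)
   then show ?case using elim(1) by linarith
  qed
 qed
 have sq_inf: "filterlim (\<lambda>n. sqrt (m n)) at_top sequentially"
  by (rule filterlim_compose[OF sqrt_at_top m])
 have inv0: "(\<lambda>n. 1/sqrt (m n)) \<longlonglongrightarrow> 0"
  using filterlim_compose[OF tendsto_inverse_0_at_top[OF filterlim_ident] sq_inf] by (simp add: inverse_eq_divide)
 have inv1: "(\<lambda>n. 1/m n) \<longlonglongrightarrow> 0"
  using filterlim_compose[OF tendsto_inverse_0_at_top[OF filterlim_ident] m] by (simp add: inverse_eq_divide)
 have sq: "EV n. sqrt (m n)*e1 n \<le> (C2 + 1)/2 \<and> e1 n \<le> (C2 + 1)/2*(1/sqrt (m n)) \<and>
   m n*e3 n \<le> (C4 + C2)/2*(1/sqrt (m n)) \<and> m n*e4 n \<le> C4*(1/sqrt (m n)) \<and> sqrt (m n)*e2 n \<le> C2*(1/sqrt (m n))"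
  using e24 e13 m1
 proof eventually_elim
  case (elim n)
  obtain q where q_def: "q = sqrt (m n)" by simp
  have q: "0 < q" "1 \<le> q" "m n = q^2" using elim(3) by (auto simp: q_def)
  have a2: "e2 n \<le> C2/q^2" and a4: "e4 n \<le> C4/q^4" using elim(1) by (auto simp: q(3) power_mult[symmetric])
  have b1: "q*e2 n \<le> C2/q"
   using mult_left_mono[OF a2, of q] q(1) by (simp add: power2_eq_square field_simps)
  have b4: "q*e4 n \<le> C4/q^3"
   using mult_left_mono[OF a4, of q] q(1) by (simp add: power3_eq_cube power4_eq_xxxx field_simps)
  have x1: "e1 n \<le> (q*e2 n + 1/q)/2" and x3: "e3 n \<le> (q*e4 n + e2 n/q)/2" using elim(2) by (auto simp: q_def)
  have y1: "e1 n \<le> (C2 + 1)/2*(1/q)"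
  proof -
   have "(C2 + 1)/2*(1/q) = (C2/q + 1/q)/2" by (simp add: add_divide_distrib)
   moreover have "x \<le> (u' + v)/2" if "x \<le> (u + v)/2" "u \<le> u'" for x u v u' :: real using that by simp
   ultimately show ?thesis using x1 b1 by presburger
  qed
  have "q*e1 n \<le> q*((C2 + 1)/2*(1/q))" using y1 q(1) by (intro mult_left_mono) auto
  then have y1': "q*e1 n \<le> (C2 + 1)/2" using q(1) by simp
  have "e2 n/q \<le> C2/q^3" using divide_right_mono[OF a2, of q] q(1) by (simp add: power2_eq_square power3_eq_cube)
  moreover have "x \<le> (u' + v')/2" if "x \<le> (u + v)/2" "u \<le> u'" "v \<le> v'" for x u v u' v' :: real using that by simp
  ultimately have "e3 n \<le> (C4/q^3 + C2/q^3)/2" using x3 b4 by blast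
  then have "q^2*e3 n \<le> q^2*((C4/q^3 + C2/q^3)/2)" by (rule mult_left_mono) simp
  also have "\<dots> = (C4 + C2)/2*(1/q)" using q(1) by (simp add: power2_eq_square power3_eq_cube field_simps)
  finally have y3: "q^2*e3 n \<le> (C4 + C2)/2*(1/q)" .
  have "q^2*e4 n \<le> q^2*(C4/q^4)" using a4 by (rule mult_left_mono) simp
  also have "\<dots> = C4/q^2" using q(1) by (simp add: power2_eq_square power4_eq_xxxx field_simps)
  also have "\<dots> \<le> C4/q" by (rule divide_left_mono) (use q C4_0 in \<open>auto simp: power2_eq_square\<close>)
  finally have y4: "q^2*e4 n \<le> C4*(1/q)" by simp
  have b1': "q*e2 n \<le> C2*(1/q)" using b1 by simp
  have sqq: "sqrt (q^2) = q" using q(1) by simp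
  show ?case unfolding q(3) sqq using y1' y1 y3 y4 b1' by blast
 qed
 \<comment> \<open>Every error term of the third inequality is of order \<open>1/sqrt (m n)\<close>,
   except the exponentially small \<open>\<eta>\<close>.\<close>
 have z2: "(\<lambda>n. N n*e2 n - 1) \<longlonglongrightarrow> 0"
 proof (rule Lim_null_comparison)
  define G1 where "G1 = C1*((C2 + 1)/2) + C/2*((C4 + C2)/2) + C*C4 + C2"
  show "EV n. norm (N n*e2 n - 1) \<le> \<eta> n + G1*(1/sqrt (m n))"
   using main sq e13 NK t1 m1
  proof eventually_elim
   case (elim n)
   have q: "0 < sqrt (m n)" using elim(6) by simp
   have 1: "C1*e1 n \<le> C1*((C2 + 1)/2*(1/sqrt (m n)))" by (rule mult_left_mono) (use elim C1_0 in auto)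
   have "\<bar>K n\<bar>/2*e3 n \<le> (C*m n)/2*e3 n" by (intro mult_right_mono divide_right_mono) (use elim in auto)
   also have "\<dots> = C/2*(m n*e3 n)" by simp
   also have "\<dots> \<le> C/2*((C4 + C2)/2*(1/sqrt (m n)))" by (rule mult_left_mono) (use elim C0 in auto)
   finally have 2: "\<bar>K n\<bar>/2*e3 n \<le> C/2*((C4 + C2)/2*(1/sqrt (m n)))" .
   have 3: "C*m n*e4 n \<le> C*(C4*(1/sqrt (m n)))" using mult_left_mono[of "m n*e4 n" "C4*(1/sqrt (m n))" C] elim(2) C0
    by (simp only: mult.assoc)
   have s0: "0 \<le> sqrt (m n)*e2 n" using elim by simp
   have "\<tau> n*(sqrt (m n)*e2 n) \<le> 1*(sqrt (m n)*e2 n)" by (rule mult_right_mono) (use elim(5) s0 in auto)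
   then have 4: "\<tau> n * sqrt (m n)*e2 n \<le> C2*(1/sqrt (m n))" using elim(2) by (simp add: mult.assoc)
   have g: "G1*x = C1*((C2 + 1)/2*x) + C/2*((C4 + C2)/2*x) + C*(C4*x) + C2*x" for x
    unfolding G1_def by (simp only: distrib_right mult.assoc)
   show ?case unfolding g using elim(1) 1 2 3 4 by simp
  qed
  show "(\<lambda>n. \<eta> n + G1*(1/sqrt (m n))) \<longlonglongrightarrow> 0"
   using tendsto_add[OF e0 tendsto_mult_right_zero[OF inv0, of G1]] by simp
 qed
 have Nb: "EV n. norm (m n/N n) \<le> 1/c"
  using NK m1
 proof eventually_elim
  case (elim n)
  then have "0 < c*m n" using c by simp
  then have "0 < N n" using elim by linarith
  then show ?case using elim c by (simp add: field_simps)
 qed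
 have Bz: "(\<lambda>n. (m n/N n)*f n) \<longlonglongrightarrow> 0" if "f \<longlonglongrightarrow> 0" for f :: "nat \<Rightarrow> real"
 proof (rule Lim_null_comparison)
  show "EV n. norm ((m n/N n)*f n) \<le> 1/c*norm (f n)"
   using Nb by eventually_elim (simp only: norm_mult, intro mult_right_mono, auto)
  show "(\<lambda>n. 1/c*norm (f n)) \<longlonglongrightarrow> 0" using that by (intro tendsto_mult_right_zero tendsto_norm_zero)
 qed
 have N0: "EV n. N n \<noteq> 0"
  using NK m1 by eventually_elim (use c in \<open>smt (verit) mult_pos_pos\<close>)
 show c3: "(\<lambda>n. m n*E n (\<lambda>A. (A - a n)^2) - m n/N n) \<longlonglongrightarrow> 0"
 proof (rule Lim_transform_eventually[OF Bz[OF z2]])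
  show "EV n. m n/N n*(N n*e2 n - 1) = m n*E n (\<lambda>A. (A - a n)^2) - m n/N n"
   using N0 by eventually_elim (simp add: e2_def field_simps)
 qed
 \<comment> \<open>Continuity of \<open>p'/p\<close> at \<open>A0\<close> and its boundedness on the
   interval combine to a quadratic majorant, whose mean is small because \<open>a n\<close> tends to
   \<open>A0\<close> and the second moment tends to 0.\<close>
 have er0: "er \<longlonglongrightarrow> 0"
 proof (rule tendstoI)
  fix \<epsilon> :: real assume ep: "0 < \<epsilon>"
  have "continuous (at A0 within ?J) ?r" using rc A0 by (auto simp: continuous_on_eq_continuous_within)
  then obtain \<delta> where \<delta>: "0 < \<delta>" "\<And>A. A \<in> ?J \<Longrightarrow> \<bar>A - A0\<bar> < \<delta> \<Longrightarrow> \<bar>?r A - ?r A0\<bar> < \<epsilon>/2"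
   using ep unfolding continuous_within_eps_delta dist_real_def by (metis half_gt_zero)
  let ?Q = "2*Cr/\<delta>^2"
  have pw: "\<bar>?r A - ?r A0\<bar> \<le> \<epsilon>/2 + ?Q*(A - A0)^2" if A: "A \<in> ?J" for A
  proof (cases "\<bar>A - A0\<bar> < \<delta>")
   case True
   have "0 \<le> ?Q*(A - A0)^2" using Cr0 by simp
   then show ?thesis using \<delta>(2)[OF A True] by linarith
  next
   case False
   then have "\<delta>^2 \<le> (A - A0)^2" using power_mono[of \<delta> "\<bar>A - A0\<bar>" 2] \<delta>(1) by simp
   then have "1 \<le> (A - A0)^2/\<delta>^2" using \<delta>(1) by simp
   then have "2*Cr \<le> 2*Cr*((A - A0)^2/\<delta>^2)" using Cr0 by (intro mult_le_cancel_left1[THEN iffD2]) auto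
   moreover have "\<bar>?r A - ?r A0\<bar> \<le> 2*Cr"
    using order_trans[OF abs_triangle_ineq4 add_mono[OF Cr[OF A] Cr[of A0]]] A0 by simp
   ultimately show ?thesis using ep by simp
  qed
  have le: "EV n. er n \<le> \<epsilon>/2 + ?Q*(2*(C2*(1/m n)) + 2*(a n - A0)^2) \<and> 0 \<le> er n"
   using cont e24
  proof eventually_elim
   case (elim n)
   then have wc: "continuous_on ?J (w n)" and wp: "\<And>A. A \<in> ?J \<Longrightarrow> 0 < w n A" by auto
   note W = lh wc wp
   have "er n \<le> E n (\<lambda>A. (\<epsilon>/2 + ?Q*(2*(a n - A0)^2)) + (?Q*2)*(A - a n)^2)"
    unfolding er_def E_def
   proof (rule wavg_mono[OF W])
    show "continuous_on ?J (\<lambda>A. (\<epsilon>/2 + ?Q*(2*(a n - A0)^2)) + (?Q*2)*(A - a n)^2)"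
     by (intro continuous_intros) (use \<delta> in auto)
    show "continuous_on ?J (\<lambda>A. \<bar>?r A - ?r A0\<bar>)" by (intro continuous_intros rc)
    fix A assume A: "A \<in> ?J"
    have "0 \<le> ((A - a n) - (a n - A0))^2" by simp
    then have "(A - A0)^2 \<le> 2*(A - a n)^2 + 2*(a n - A0)^2" by (simp add: power2_eq_square algebra_simps)
    then have "?Q*(A - A0)^2 \<le> ?Q*(2*(A - a n)^2 + 2*(a n - A0)^2)" by (rule mult_left_mono) (use Cr0 in simp)
    then have "\<bar>?r A - ?r A0\<bar> \<le> \<epsilon>/2 + ?Q*(2*(A - a n)^2 + 2*(a n - A0)^2)" using pw[OF A] by linarith
    then show "\<bar>?r A - ?r A0\<bar> \<le> (\<epsilon>/2 + ?Q*(2*(a n - A0)^2)) + (?Q*2)*(A - a n)^2"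
     by (simp only: distrib_left mult.assoc)
   qed
   also have "\<dots> = (\<epsilon>/2 + ?Q*(2*(a n - A0)^2)) + (?Q*2)*e2 n"
    unfolding E_def e2_def by (simp only: wavg_add[OF W] wavg_cmult[OF W] wavg_const[OF W] continuous_intros)
   also have "\<dots> \<le> (\<epsilon>/2 + ?Q*(2*(a n - A0)^2)) + (?Q*2)*(C2*(1/m n))"
    by (intro add_left_mono mult_left_mono) (use elim Cr0 in auto)
   finally have "er n \<le> \<epsilon>/2 + ?Q*(2*(C2*(1/m n)) + 2*(a n - A0)^2)"
    by (simp only: distrib_left mult.assoc)
   moreover have "0 \<le> er n" unfolding er_def E_def by (rule wavg_nonneg[OF W]) (auto intro!: continuous_intros rc)
   ultimately show ?case by simp
  qed
  have "(\<lambda>n. ?Q*(2*(C2*(1/m n)) + 2*(a n - A0)^2)) \<longlonglongrightarrow> ?Q*(2*(C2*0) + 2*(A0 - A0)^2)"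
   by (intro tendsto_intros inv1 a)
  then have "EV n. \<bar>?Q*(2*(C2*(1/m n)) + 2*(a n - A0)^2)\<bar> < \<epsilon>/2"
   using tendstoD[of "\<lambda>n. ?Q*(2*(C2*(1/m n)) + 2*(a n - A0)^2)" 0 sequentially "\<epsilon>/2"] ep by (simp add: dist_real_def)
  with le show "EV n. dist (er n) 0 < \<epsilon>"
   by eventually_elim (simp add: dist_real_def abs_if split: if_splits)
 qed
 \<comment> \<open>Here convergence of \<open>\<tau>\<close> to 0 matters, since
   \<open>sqrt (m n)*e1 n\<close> is only bounded.\<close>
 have z1: "(\<lambda>n. l' n (a n) + ?r A0 - N n*es n + K n/2*e2 n) \<longlonglongrightarrow> 0"
 proof (rule Lim_null_comparison)
  show "EV n. norm (l' n (a n) + ?r A0 - N n*es n + K n/2*e2 n) \<le> \<eta> n + er n + C*((C4 + C2)/2)*(1/sqrt (m n)) + \<bar>\<tau> n\<bar>*((C2 + 1)/2)"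
   using main sq e13 m1
  proof eventually_elim
   case (elim n)
   have 1: "C*m n*e3 n \<le> C*((C4 + C2)/2)*(1/sqrt (m n))"
    using mult_left_mono[of "m n*e3 n" _ C] elim(2) C0 by (simp only: mult.assoc)
   have s0: "0 \<le> sqrt (m n)*e1 n" using elim by simp
   have "\<tau> n*(sqrt (m n)*e1 n) \<le> \<bar>\<tau> n\<bar>*(sqrt (m n)*e1 n)" by (rule mult_right_mono) (use s0 in auto)
   also have "\<dots> \<le> \<bar>\<tau> n\<bar>*((C2 + 1)/2)" by (rule mult_left_mono) (use elim in auto)
   finally have 2: "\<tau> n * sqrt (m n)*e1 n \<le> \<bar>\<tau> n\<bar>*((C2 + 1)/2)" by (simp only: mult.assoc)
   show ?case using elim(1) 1 2 unfolding real_norm_def by linarith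
  qed
  have "(\<lambda>n. \<eta> n + er n + C*((C4 + C2)/2)*(1/sqrt (m n)) + \<bar>\<tau> n\<bar>*((C2 + 1)/2)) \<longlonglongrightarrow> 0 + 0 + C*((C4 + C2)/2)*0 + \<bar>0\<bar>*((C2 + 1)/2)"
   by (intro tendsto_intros e0 er0 inv0 t0)
  then show "(\<lambda>n. \<eta> n + er n + C*((C4 + C2)/2)*(1/sqrt (m n)) + \<bar>\<tau> n\<bar>*((C2 + 1)/2)) \<longlonglongrightarrow> 0" by simp
 qed
 have z3: "(\<lambda>n. K n/(2*N n)*(N n*e2 n - 1)) \<longlonglongrightarrow> 0"
 proof (rule Lim_null_comparison)
  show "EV n. norm (K n/(2*N n)*(N n*e2 n - 1)) \<le> C/(2*c)*norm (N n*e2 n - 1)"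
   using NK m1
  proof eventually_elim
   case (elim n)
   have "0 < c*m n" using c elim by simp
   then have "\<bar>K n\<bar>/(2*N n) \<le> (C*m n)/(2*(c*m n))" using elim C0 by (intro frac_le) auto
   also have "\<dots> = C/(2*c)" using elim by simp
   finally have "\<bar>K n/(2*N n)\<bar> \<le> C/(2*c)" using \<open>0 < c*m n\<close> elim by (simp add: abs_divide abs_mult)
   then show ?case unfolding real_norm_def abs_mult by (rule mult_right_mono) simp
  qed
  show "(\<lambda>n. C/(2*c)*norm (N n*e2 n - 1)) \<longlonglongrightarrow> 0" by (intro tendsto_mult_right_zero tendsto_norm_zero z2)
 qed
 \<comment> \<open>Eliminates the second moment: \<open>K n/2*e2 n\<close> is replaced by
   \<open>K n/(2*N n)\<close> at the cost of \<open>z3\<close>.\<close>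
 have z4: "(\<lambda>n. K n/(2*N n)*(N n*e2 n - 1) - (l' n (a n) + ?r A0 - N n*es n + K n/2*e2 n)) \<longlonglongrightarrow> 0"
  using tendsto_diff[OF z3 z1] by simp
 show "(\<lambda>n. m n*E n (\<lambda>A. A - a n) - m n/N n*(l' n (a n) + p' A0/p A0 + K n/(2*N n))) \<longlonglongrightarrow> 0"
 proof (rule Lim_transform_eventually[OF Bz[OF z4]])
  show "EV n. m n/N n*(K n/(2*N n)*(N n*e2 n - 1) - (l' n (a n) + ?r A0 - N n*es n + K n/2*e2 n))
   = m n*E n (\<lambda>A. A - a n) - m n/N n*(l' n (a n) + p' A0/p A0 + K n/(2*N n))"
   using N0
  proof eventually_elim
   case (elim n)
   have "K n/(2*N n)*(N n*e2 n - 1) - (l' n (a n) + ?r A0 - N n*es n + K n/2*e2 n)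
    = N n*es n - (l' n (a n) + ?r A0 + K n/(2*N n))" using elim by (simp add: right_diff_distrib)
   then have "m n/N n*(K n/(2*N n)*(N n*e2 n - 1) - (l' n (a n) + ?r A0 - N n*es n + K n/2*e2 n))
    = m n/N n*(N n*es n - (l' n (a n) + ?r A0 + K n/(2*N n)))" by (simp only:)
   also have "\<dots> = m n*es n - m n/N n*(l' n (a n) + p' A0/p A0 + K n/(2*N n))"
    using elim by (simp only: right_diff_distrib) simp
   finally show ?case by (simp only: es_def)
  qed
 qed
qed

section \<open>Expansion of the coverage\<close>

text \<open>The standard normal distribution function minus 1/2. Starting the integral at 0 keeps
  its range finite, and only differences of values are used.\<close>

definition \<Phi> :: "real \<Rightarrow> real" where
 "\<Phi> u = (LBINT y=ereal 0..ereal u. std_normal_density y)"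

lemma \<Phi>_deriv:
 "(\<Phi> has_real_derivative std_normal_density u) (at u)"
proof -
 let ?a = "- \<bar>u\<bar> - 1" and ?b = "\<bar>u\<bar> + 1"
 have c: "continuous_on {?a..?b} std_normal_density"
  unfolding normal_density_def by (intro continuous_intros) auto
 have "((\<lambda>u. LBINT y=ereal 0..ereal u. std_normal_density y) has_vector_derivative std_normal_density u) (at u within {?a..?b})"
  by (rule interval_integral_FTC2[OF _ _ c]) auto
 then have "(\<Phi> has_vector_derivative std_normal_density u) (at u within {?a..?b})"
  by (simp add: \<Phi>_def[abs_def])
 moreover have "at u within {?a..?b} = at u" by (rule at_within_interior) auto
 ultimately show ?thesis by (simp add: has_real_derivative_iff_has_vector_derivative)
qed

lemma std_normal_density_deriv:
 "(std_normal_density has_real_derivative - u * std_normal_density u) (at u)"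
 unfolding normal_density_def by (auto intro!: derivative_eq_intros simp: power2_eq_square field_simps)

text \<open>The bounded quantity is the third derivative of \<open>\<Phi>\<close>. With
  \<open>x = u^2/2\<close> it suffices that \<open>exp x\<close> dominates
  \<open>\<bar>2*x - 1\<bar>\<close>, which follows from
  \<open>exp x \<ge> 1 + x + x^2/2\<close>.\<close>

lemma std_normal_third_deriv_bound: "\<bar>(u^2 - 1) * std_normal_density u\<bar> \<le> 1"
proof -
 have "1 \<le> 2*pi" using pi_gt3 by linarith
 then have "1 \<le> sqrt (2*pi)" by simp
 then have d: "std_normal_density u \<le> exp (- u\<^sup>2/2)"
  by (simp add: std_normal_density_def divide_le_eq mult_le_cancel_left1)
 have "\<bar>u^2 - 1\<bar>*exp (- u\<^sup>2/2) \<le> 1"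
 proof -
  have "\<bar>u^2 - 1\<bar> \<le> exp (u^2/2)"
  proof -
   define x where "x = u^2/2"
   have x: "0 \<le> x" by (simp add: x_def)
   have "1 + x + x^2/2 \<le> exp x" using exp_lower_Taylor_quadratic[OF x(1)] by simp
   moreover have "2*x - 1 \<le> 1 + x + x^2/2"
   proof -
    have "0 \<le> (x - 1)^2/2" by simp
    then show ?thesis by (simp add: power2_eq_square algebra_simps)
   qed
   ultimately have "\<bar>2*x - 1\<bar> \<le> exp x" using x by (auto simp: abs_le_iff intro: order_trans[of _ 1])
   then show ?thesis by (simp add: x_def)
  qed
  then have "\<bar>u^2 - 1\<bar>*exp (- u\<^sup>2/2) \<le> exp (u^2/2)*exp (- u\<^sup>2/2)" by (rule mult_right_mono) simp
  then show ?thesis by (simp add: exp_add[symmetric])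
 qed
 moreover have "\<bar>u^2 - 1\<bar> * std_normal_density u \<le> \<bar>u^2 - 1\<bar>*exp (- u\<^sup>2/2)" by (rule mult_left_mono[OF d]) simp
 ultimately show ?thesis by (simp add: abs_mult)
qed

lemma \<Phi>_taylor:
 "\<bar>\<Phi> (z + h) - \<Phi> z - std_normal_density z*h + z * std_normal_density z/2*h^2\<bar> \<le> \<bar>h\<bar>^3"
proof (cases "h = 0")
 case False
 define diff where "diff k = (if k = 0 then \<Phi> else if k = 1 then std_normal_density
  else if k = 2 then (\<lambda>u. - u * std_normal_density u) else (\<lambda>u. (u^2 - 1) * std_normal_density u))" for k :: nat
 have d3: "((\<lambda>u. - u * std_normal_density u) has_real_derivative (u^2 - 1) * std_normal_density u) (at u)" for u
  by (rule derivative_eq_intros std_normal_density_deriv refl)+ (simp add: power2_eq_square algebra_simps)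
 have der: "\<forall>k t. k < 3 \<and> min z (z + h) \<le> t \<and> t \<le> max z (z + h) \<longrightarrow> (diff k has_real_derivative diff (Suc k) t) (at t)"
  using \<Phi>_deriv std_normal_density_deriv d3
  by (auto simp: diff_def less_Suc_eq numeral_3_eq_3 numeral_2_eq_2)
 have "\<exists>t. (if z + h < z then z + h < t \<and> t < z else z < t \<and> t < z + h) \<and>
  diff 0 (z + h) = (\<Sum>k<3. diff k z/fact k*(z + h - z)^k) + diff 3 t/fact 3*(z + h - z)^3"
  by (rule Taylor[of 3 diff "diff 0" "min z (z + h)" "max z (z + h)" z "z + h"]) (use der False in \<open>auto simp: min_def max_def\<close>)
 then obtain t where t: "diff 0 (z + h) = (\<Sum>k<3. diff k z/fact k*h^k) + diff 3 t/fact 3*h^3" by auto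
 have "\<Phi> (z + h) - \<Phi> z - std_normal_density z*h + z * std_normal_density z/2*h^2 = (t^2 - 1) * std_normal_density t*(h^3/6)"
  using t by (simp add: diff_def numeral_3_eq_3 lessThan_Suc fact_numeral power2_eq_square)
 also have "\<bar>\<dots>\<bar> \<le> 1*\<bar>h^3/6\<bar>" unfolding abs_mult[of _ "h^3/6"]
  by (rule mult_right_mono[OF std_normal_third_deriv_bound]) simp
 also have "\<dots> \<le> \<bar>h\<bar>^3" by (simp add: power_abs)
 finally show ?thesis .
qed simp

text \<open>The endpoints, plus and minus \<open>z\<close>, are rescaled by \<open>1 + \<nu>\<close>
  and shifted by \<open>k\<close>. The density is even and its derivative odd, so the linear term in
  \<open>k\<close> and the mixed term cancel between the endpoints and only \<open>k^2\<close>
  survives.\<close>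

lemma coverage_taylor:
 "\<bar>\<Phi> (z*(1 + \<nu>) + k) - \<Phi> (- z*(1 + \<nu>) + k)
   - (\<Phi> z - \<Phi> (- z))
   - std_normal_density z*z*(2*\<nu> - z^2*\<nu>^2 - k^2)\<bar> \<le> 2*(\<bar>z*\<nu>\<bar> + \<bar>k\<bar>)^3"
proof -
 let ?P = \<Phi>
 have s: "std_normal_density (- z) = std_normal_density z" by (simp add: std_normal_density_def)
 have 1: "\<bar>?P (z + (z*\<nu> + k)) - ?P z - std_normal_density z*(z*\<nu> + k) + z * std_normal_density z/2*(z*\<nu> + k)^2\<bar> \<le> \<bar>z*\<nu> + k\<bar>^3"
  by (rule \<Phi>_taylor)
 have 2: "\<bar>?P (- z + (k - z*\<nu>)) - ?P (- z) - std_normal_density z*(k - z*\<nu>) - z * std_normal_density z/2*(k - z*\<nu>)^2\<bar> \<le> \<bar>k - z*\<nu>\<bar>^3"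
  using \<Phi>_taylor[of "- z" "k - z*\<nu>"] unfolding s by simp
 have b: "\<bar>z*\<nu> + k\<bar>^3 \<le> (\<bar>z*\<nu>\<bar> + \<bar>k\<bar>)^3" "\<bar>k - z*\<nu>\<bar>^3 \<le> (\<bar>z*\<nu>\<bar> + \<bar>k\<bar>)^3"
  by (rule power_mono; simp)+
 have e: "z + (z*\<nu> + k) = z*(1 + \<nu>) + k" "- z + (k - z*\<nu>) = - z*(1 + \<nu>) + k" by (simp_all add: algebra_simps)
 have f: "std_normal_density z*z*(2*\<nu> - z^2*\<nu>^2 - k^2) =
   (std_normal_density z*(z*\<nu> + k) - z * std_normal_density z/2*(z*\<nu> + k)^2)
   - (std_normal_density z*(k - z*\<nu>) + z * std_normal_density z/2*(k - z*\<nu>)^2)"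
  by (simp add: power2_eq_square field_simps)
 show ?thesis using 1 2 b unfolding e f by linarith
qed

text \<open>Here \<open>t = sqrt (1 + w)\<close>, so these are Taylor expansions of
  \<open>1/sqrt (1 + w)\<close> with exact remainders: written as rational functions of
  \<open>t\<close> they contain the factors \<open>(t - 1)^3\<close> and \<open>(t - 1)^2\<close>,
  and \<open>t - 1\<close> is at most of the size of \<open>w\<close>.\<close>

lemma inverse_sqrt_expansion:
 fixes t w \<nu> :: real assumes t: "0 < t" and w: "w = t^2 - 1" and n: "\<nu> = 1/t - 1"
 shows "\<nu> + w/2 - 3*w^2/8 = - ((t - 1)^3*(3*t^2 + 9*t + 8)/(8*t))"
  and "\<nu> + w/2 = (t - 1)^2*(t + 2)/(2*t)" and "\<bar>t - 1\<bar> \<le> \<bar>w\<bar>"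
proof -
 show "\<nu> + w/2 - 3*w^2/8 = - ((t - 1)^3*(3*t^2 + 9*t + 8)/(8*t))"
  unfolding w n using t by (simp add: field_simps) (simp add: power2_eq_square power3_eq_cube algebra_simps)
 show "\<nu> + w/2 = (t - 1)^2*(t + 2)/(2*t)"
  unfolding w n using t by (simp add: field_simps) (simp add: power2_eq_square power3_eq_cube algebra_simps)
 have "w = (t - 1)*(t + 1)" unfolding w by (simp add: power2_eq_square algebra_simps)
 then have "\<bar>w\<bar> = \<bar>t - 1\<bar>*(t + 1)" using t by (simp add: abs_mult)
 then show "\<bar>t - 1\<bar> \<le> \<bar>w\<bar>" using t by (simp add: mult_le_cancel_left1)
qed

lemma normal_interval_measure:
 assumes "0 < \<sigma>" "l \<le> u"
 shows "(\<integral>\<^sup>+t. ennreal (normal_density \<mu> \<sigma> t)*indicator {l..u} t \<partial>lborel) =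
  ennreal (\<Phi> ((u - \<mu>)/\<sigma>) - \<Phi> ((l - \<mu>)/\<sigma>))"
proof -
 have d: "((\<lambda>t. \<Phi> ((t - \<mu>)/\<sigma>)) has_real_derivative normal_density \<mu> \<sigma> t) (at t)" for t
 proof -
  have "((\<lambda>t. \<Phi> ((t - \<mu>)/\<sigma>)) has_real_derivative std_normal_density ((t - \<mu>)/\<sigma>)*(1/\<sigma>)) (at t)"
   by (rule DERIV_chain2[OF \<Phi>_deriv]) (use assms in \<open>auto intro!: derivative_eq_intros\<close>)
  moreover have "std_normal_density ((t - \<mu>)/\<sigma>)*(1/\<sigma>) = normal_density \<mu> \<sigma> t"
   using assms by (simp add: normal_density_def real_sqrt_mult power_divide)
  ultimately show ?thesis by simp
 qed
 show ?thesis
  by (rule nn_integral_FTC_Icc) (use assms d in auto)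
qed

text \<open>By symmetry of the density the lower tail also has mass \<open>\<alpha>/2\<close>. A
  negative \<open>z\<close> is impossible, because the two tails would then cover the line with
  total mass at most \<open>\<alpha> < 1\<close>.\<close>

lemma normal_quantile:
 assumes z: "measure (density lborel std_normal_density) {z<..} = \<alpha>/2" and al: "0 < \<alpha>" "\<alpha> < 1"
 shows "0 \<le> z" "\<Phi> z - \<Phi> (- z) = 1 - \<alpha>"
proof -
 let ?N = "density lborel (\<lambda>x. ennreal (std_normal_density x))"
 interpret N: prob_space ?N by (rule prob_space_normal_density) simp
 have sp: "space ?N = UNIV" "sets ?N = sets borel" by simp_all
 have refl: "measure ?N {..<- z} = \<alpha>/2"
 proof -
  have "emeasure ?N {..<- z} = (\<integral>\<^sup>+t. ennreal (std_normal_density t)*indicator {..<- z} t \<partial>lborel)"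
   by (rule emeasure_density) auto
  also have "\<dots> = ennreal \<bar>-1\<bar>*(\<integral>\<^sup>+t. ennreal (std_normal_density (0 + -1*t))*indicator {..<- z} (0 + -1*t) \<partial>lborel)"
   by (rule nn_integral_real_affine) auto
  also have "\<dots> = (\<integral>\<^sup>+t. ennreal (std_normal_density t)*indicator {z<..} t \<partial>lborel)"
   by (auto intro!: nn_integral_cong simp: std_normal_density_def indicator_def)
  also have "\<dots> = emeasure ?N {z<..}" by (rule emeasure_density[symmetric]) auto
  finally show ?thesis using z by (simp add: measure_def)
 qed
 show z0: "0 \<le> z"
 proof (rule ccontr)
  assume "\<not> 0 \<le> z"
  then have "space ?N \<subseteq> {..<- z} \<union> {z<..}" by auto
  then have "1 \<le> measure ?N ({..<- z} \<union> {z<..})"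
   using N.finite_measure_mono[of "space ?N" "{..<- z} \<union> {z<..}"] N.prob_space by simp
  also have "\<dots> \<le> measure ?N {..<- z} + measure ?N {z<..}" by (rule measure_Un_le) auto
  finally show False using refl z al by simp
 qed
 have "measure ?N UNIV = measure ?N {..<- z} + measure ?N {- z..z} + measure ?N {z<..}"
 proof -
  have "UNIV = ({..<- z} \<union> {- z..z}) \<union> {z<..}" by auto
  then have "measure ?N UNIV = measure ?N (({..<- z} \<union> {- z..z}) \<union> {z<..})" by simp
  also have "\<dots> = measure ?N ({..<- z} \<union> {- z..z}) + measure ?N {z<..}"
   by (rule N.finite_measure_Union) (use z0 in auto)
  also have "measure ?N ({..<- z} \<union> {- z..z}) = measure ?N {..<- z} + measure ?N {- z..z}"
   by (rule N.finite_measure_Union) (use z0 in auto)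
  finally show ?thesis .
 qed
 moreover have "measure ?N UNIV = 1" using N.prob_space by simp
 ultimately have m: "measure ?N {- z..z} = 1 - \<alpha>" using refl z by simp
 have mono: "\<Phi> (- z) \<le> \<Phi> z"
  by (rule DERIV_nonneg_imp_nondecreasing) (use z0 \<Phi>_deriv in \<open>auto intro!: exI\<close>)
 have "emeasure ?N {- z..z} = (\<integral>\<^sup>+t. ennreal (std_normal_density t)*indicator {- z..z} t \<partial>lborel)"
  by (rule emeasure_density) auto
 also have "\<dots> = ennreal (\<Phi> ((z - 0)/1) - \<Phi> ((- z - 0)/1))"
  by (rule normal_interval_measure) (use z0 in auto)
 finally have "measure ?N {- z..z} = \<Phi> z - \<Phi> (- z)"
  using mono by (simp add: measure_def)
 with m show "\<Phi> z - \<Phi> (- z) = 1 - \<alpha>" by simp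
qed

text \<open>With this filter a Landau bound is uniform over \<open>A\<close> in \<open>J\<close>, so
  the calculus of \<open>O\<close> applies to functions of \<open>n\<close> and \<open>A\<close> at
  once.\<close>

lemma eventually_prod_principal:
 "eventually P (sequentially \<times>\<^sub>F principal J) \<longleftrightarrow> (EV n. \<forall>A\<in>J. P (n, A))"
 unfolding eventually_prod_filter eventually_principal
proof safe
 fix Pf Pg assume "eventually Pf sequentially" "\<forall>x\<in>J. Pg x" "\<forall>x y. Pf x \<longrightarrow> Pg y \<longrightarrow> P (x, y)"
 then show "EV n. \<forall>A\<in>J. P (n, A)" by (auto elim!: eventually_mono)
next
 assume "EV n. \<forall>A\<in>J. P (n, A)"
 then show "\<exists>Pf Pg. eventually Pf sequentially \<and> (\<forall>x\<in>J. Pg x) \<and> (\<forall>x y. Pf x \<longrightarrow> Pg y \<longrightarrow> P (x, y))"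
  by (intro exI[of _ "\<lambda>n. \<forall>A\<in>J. P (n, A)"] exI[of _ "\<lambda>A. A \<in> J"]) auto
qed

text \<open>\<open>cov\<close> is the conditional probability of the interval given
  \<open>A\<close>; \<open>h\<close> plays the role of \<open>g2\<close>, and \<open>v\<close> that
  of the residual at the fixed area. With s = A - a, the variance ratio is 1 + w with w = \<gamma> s
  - \<gamma>/(a + D) s^2, and the standardised shift k of the centre satisfies k^2 = G s^2, up to
  the error function. Then \<open>coverage_taylor\<close> with \<nu> = - w/2 + 3 w^2/8 gives the
  coefficients. The error function collects what is negligible under the posterior: the cubic terms,
  the variation of \<open>h\<close> (|s|/m) and the slow variation of \<open>v\<close> (\<sigma>
  s^2).\<close>

lemma coverage_expansion:
 fixes a m \<sigma> Y :: "nat \<Rightarrow> real" and h v :: "nat \<Rightarrow> real \<Rightarrow> real" and lo hi D H V z :: real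
 defines "F \<equiv> sequentially \<times>\<^sub>F principal {lo..hi}"
 defines "\<delta>2 \<equiv> \<lambda>n A. A*D/(A + D) + h n A"
 defines "\<theta> \<equiv> \<lambda>n A. Y n - D/(A + D) * v n A"
 defines "cov \<equiv> \<lambda>n A. \<Phi> ((\<theta> n (a n) + z * sqrt (\<delta>2 n (a n)) - \<theta> n A)/sqrt (\<delta>2 n A))
   - \<Phi> ((\<theta> n (a n) - z * sqrt (\<delta>2 n (a n)) - \<theta> n A)/sqrt (\<delta>2 n A))"
 defines "\<gamma> \<equiv> \<lambda>n. D/(a n*(a n + D))"
 defines "G \<equiv> \<lambda>n. \<gamma> n*(v n (a n)/(a n + D))^2"
 assumes lo: "0 < lo" and D: "0 < D" and a: "EV n. a n \<in> {lo..hi}"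
  and m: "EV n. 1 \<le> m n"
  and h: "EV n. \<forall>A\<in>{lo..hi}. 0 \<le> h n A \<and> h n A \<le> H/m n \<and> \<bar>h n A - h n (a n)\<bar> \<le> H*\<bar>A - a n\<bar>/m n"
  and v: "EV n. \<forall>A\<in>{lo..hi}. \<bar>v n A - v n (a n)\<bar> \<le> \<sigma> n*\<bar>A - a n\<bar>"
  and V: "EV n. \<bar>v n (a n)\<bar> \<le> V" and \<sigma>: "EV n. 0 \<le> \<sigma> n \<and> \<sigma> n \<le> 1"
 shows "(\<lambda>(n, A). cov n A - (\<Phi> z - \<Phi> (- z))
   - std_normal_density z*z*(- \<gamma> n*(A - a n) + (\<gamma> n/(a n + D) + (3 - z^2)/4*(\<gamma> n)^2 - G n)*(A - a n)^2))
  \<in> O[F](\<lambda>(n, A). \<bar>A - a n\<bar>^3 + \<bar>A - a n\<bar>/m n + \<sigma> n*(A - a n)^2)"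
proof -
 have evF: "eventually P F \<longleftrightarrow> (EV n. \<forall>A\<in>{lo..hi}. P (n, A))" for P
  unfolding F_def by (rule eventually_prod_principal)
 define s where "s j = snd j - a (fst j)" for j :: "nat \<times> real"
 define T where "T j = \<bar>s j\<bar>^3 + \<bar>s j\<bar>/m (fst j) + \<sigma> (fst j)*(s j)^2" for j
 define aa AA aD AD mm ss va vv gg where "aa j = a (fst j)" and "AA j = snd j"
  and "aD j = 1/(a (fst j) + D)" and "AD j = 1/(snd j + D)"
  and "mm j = 1/m (fst j)" and "ss j = \<sigma> (fst j)" and "va j = v (fst j) (a (fst j))"
  and "vv j = v (fst j) (snd j) - v (fst j) (a (fst j))" and "gg j = \<gamma> (fst j)" for j :: "nat \<times> real"
 define dh h0 g0 d2 i2 where "dh j = h (fst j) (snd j) - h (fst j) (a (fst j))" and "h0 j = h (fst j) (a (fst j))"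
  and "g0 j = a (fst j)*D/(a (fst j) + D)" and "d2 j = \<delta>2 (fst j) (a (fst j))" and "i2 j = \<delta>2 (fst j) (snd j)" for j :: "nat \<times> real"
 have base: "eventually (\<lambda>j. lo \<le> aa j \<and> aa j \<le> hi \<and> lo \<le> AA j \<and> AA j \<le> hi \<and> 0 < mm j \<and> mm j \<le> 1 \<and>
   0 \<le> h0 j \<and> h0 j \<le> H*mm j \<and> \<bar>dh j\<bar> \<le> H*\<bar>s j\<bar>*mm j \<and> 0 \<le> h0 j + dh j \<and> h0 j + dh j \<le> H*mm j \<and> \<bar>vv j\<bar> \<le> ss j*\<bar>s j\<bar> \<and> \<bar>va j\<bar> \<le> V \<and> 0 \<le> ss j \<and> ss j \<le> 1) F"
  unfolding evF using a m h v V \<sigma>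
  by eventually_elim (auto simp: aa_def AA_def mm_def h0_def dh_def s_def vv_def va_def ss_def)
 have Tnn: "eventually (\<lambda>j. 0 \<le> T j \<and> \<bar>s j\<bar>^3 \<le> T j \<and> \<bar>s j\<bar>*mm j \<le> T j \<and> ss j*(s j)^2 \<le> T j) F"
  using base
 proof eventually_elim
  case (elim j)
  then have "0 \<le> \<bar>s j\<bar>^3" "0 \<le> \<bar>s j\<bar>/m (fst j)" "0 \<le> \<sigma> (fst j)*(s j)^2"
   by (auto simp: mm_def ss_def)
  then show ?case by (simp add: T_def mm_def ss_def)
 qed
 have bI: "f \<in> O[F](g)" if "eventually (\<lambda>j. \<bar>f j\<bar> \<le> c*\<bar>g j\<bar>) F" for f g :: "nat \<times> real \<Rightarrow> real" and c
  using that by (intro bigoI[of _ c]) simp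
 have s3: "(\<lambda>j. (s j)^3) \<in> O[F](T)" by (rule bI[of _ 1]) (use Tnn in \<open>eventually_elim, auto simp: power_abs\<close>)
 have sm: "(\<lambda>j. s j*mm j) \<in> O[F](T)"
  by (rule bI[of _ 1]) (use Tnn base in \<open>eventually_elim, auto simp: abs_mult\<close>)
 have s\<sigma>: "(\<lambda>j. ss j*(s j)^2) \<in> O[F](T)"
  by (rule bI[of _ 1]) (use Tnn base in \<open>eventually_elim, auto simp: abs_mult\<close>)
 have s1: "s \<in> O[F](\<lambda>_. 1)"
  by (rule bI[of _ "hi - lo"]) (use base in \<open>eventually_elim, auto simp: s_def aa_def AA_def\<close>)
 have aD1: "aD \<in> O[F](\<lambda>_. 1)"
  by (rule bI[of _ "1/D"]) (use base in \<open>eventually_elim, insert lo D, auto simp: aD_def aa_def intro!: divide_left_mono mult_pos_pos\<close>)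
 have AD1: "AD \<in> O[F](\<lambda>_. 1)"
  by (rule bI[of _ "1/D"]) (use base in \<open>eventually_elim, insert lo D, auto simp: AD_def AA_def intro!: divide_left_mono mult_pos_pos\<close>)
 have gg1: "gg \<in> O[F](\<lambda>_. 1)"
 proof (rule bI[of _ "1/lo"])
  show "eventually (\<lambda>j. \<bar>gg j\<bar> \<le> 1/lo*\<bar>1\<bar>) F"
   using base
  proof eventually_elim
   case (elim j)
   then have al: "lo \<le> a (fst j)" by (simp add: aa_def)
   have "gg j = (D/(a (fst j) + D))*(1/a (fst j))" by (simp add: gg_def \<gamma>_def)
   also have "\<bar>\<dots>\<bar> \<le> 1*(1/lo)" unfolding abs_mult using al lo D
    by (intro mult_mono) (auto intro!: divide_left_mono mult_pos_pos)
   finally show ?case by simp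
  qed
 qed
 \<comment> \<open>\<open>A*D/(A + D)\<close> increases in \<open>A\<close>, so its value at
   \<open>lo\<close> bounds all variances away from 0.\<close>
 define gl where "gl = lo*D/(lo + D)"
 have gl: "0 < gl" using lo D by (simp add: gl_def)
 have g1l: "gl \<le> A*D/(A + D)" if "lo \<le> A" for A
  using that lo D by (simp add: gl_def divide_simps algebra_simps)
 have g1u: "A*D/(A + D) \<le> D" if "lo \<le> A" for A
  using that lo D by (simp add: divide_simps)
 have pos: "eventually (\<lambda>j. gl \<le> g0 j \<and> g0 j \<le> D \<and> gl \<le> d2 j \<and> d2 j \<le> D + \<bar>H\<bar> \<and> gl \<le> i2 j \<and> i2 j \<le> D + \<bar>H\<bar> \<and> d2 j = g0 j + h0 j) F"
  using base
 proof eventually_elim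
  case (elim j)
  have "H*mm j \<le> \<bar>H\<bar>*1" by (rule order_trans[OF mult_right_mono mult_left_mono]) (use elim in auto)
  then show ?case
   using elim g1l[of "aa j"] g1u[of "aa j"] g1l[of "AA j"] g1u[of "AA j"]
   by (simp add: aa_def AA_def g0_def d2_def i2_def \<delta>2_def h0_def dh_def)
 qed
 have inv: "(\<lambda>j. 1/f j) \<in> O[F](\<lambda>_. 1)" if "eventually (\<lambda>j. gl \<le> f j) F" for f
  by (rule bI[of _ "1/gl"]) (use that in \<open>eventually_elim, insert gl, auto intro!: divide_left_mono mult_pos_pos\<close>)
 have ig0: "(\<lambda>j. 1/g0 j) \<in> O[F](\<lambda>_. 1)" by (rule inv) (use pos in eventually_elim, simp)
 have id2: "(\<lambda>j. 1/d2 j) \<in> O[F](\<lambda>_. 1)" by (rule inv) (use pos in eventually_elim, simp)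
 have ii2: "(\<lambda>j. 1/i2 j) \<in> O[F](\<lambda>_. 1)" by (rule inv) (use pos in eventually_elim, simp)
 have dhO: "dh \<in> O[F](\<lambda>j. s j*mm j)"
  by (rule bI[of _ H]) (use base in \<open>eventually_elim, auto simp: abs_mult\<close>)
 have h0O: "h0 \<in> O[F](mm)" by (rule bI[of _ H]) (use base in \<open>eventually_elim, auto\<close>)
 have mm1: "mm \<in> O[F](\<lambda>_. 1)" by (rule bI[of _ 1]) (use base in \<open>eventually_elim, auto\<close>)
 have vvO: "vv \<in> O[F](\<lambda>j. ss j * s j)" by (rule bI[of _ 1]) (use base in \<open>eventually_elim, auto simp: abs_mult\<close>)
 have vaO: "va \<in> O[F](\<lambda>_. 1)" by (rule bI[of _ V]) (use base in \<open>eventually_elim, auto\<close>)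
 have ss1: "ss \<in> O[F](\<lambda>_. 1)" by (rule bI[of _ 1]) (use base in \<open>eventually_elim, auto\<close>)
 note mulO = landau_o.big.mult
 have one: "f \<in> O[F](\<lambda>_. 1) \<Longrightarrow> g \<in> O[F](X) \<Longrightarrow> (\<lambda>j. f j*g j) \<in> O[F](X)" for f g X :: "nat \<times> real \<Rightarrow> real"
  using landau_o.big.mult[of f F "\<lambda>_. 1" g X] by simp
 have addO: "f \<in> O[F](X) \<Longrightarrow> g \<in> O[F](X) \<Longrightarrow> (\<lambda>j. f j + g j) \<in> O[F](X)" for f g X :: "nat \<times> real \<Rightarrow> real"
  by (rule sum_in_bigo)
 have subO: "f \<in> O[F](X) \<Longrightarrow> g \<in> O[F](X) \<Longrightarrow> (\<lambda>j. f j - g j) \<in> O[F](X)" for f g X :: "nat \<times> real \<Rightarrow> real"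
  by (rule sum_in_bigo)
 have cO: "(\<lambda>_. c) \<in> O[F](\<lambda>_. 1)" for c :: real by simp
 have tr: "f \<in> O[F](g) \<Longrightarrow> g \<in> O[F](k) \<Longrightarrow> f \<in> O[F](k)" for f g k :: "nat \<times> real \<Rightarrow> real"
  by (rule landau_o.big_trans)
 have cong: "f \<in> O[F](k)" if "g \<in> O[F](k)" "eventually (\<lambda>j. f j = g j) F" for f g k :: "nat \<times> real \<Rightarrow> real"
  using that by (simp cong: landau_o.big.in_cong)
 define t w \<nu> where "t j = sqrt (i2 j)/sqrt (d2 j)" and "w j = i2 j/d2 j - 1" and "\<nu> j = sqrt (d2 j)/sqrt (i2 j) - 1" for j
 \<comment> \<open>The difference of the variances consists of a part from
   \<open>A*D/(A + D)\<close> and the variation of \<open>h\<close>; replacing \<open>d2\<close> by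
   \<open>g0 = d2 - h0\<close> in the denominator costs only terms of size
   \<open>s/m\<close>.\<close>
 have w1: "(\<lambda>j. w j - (gg j * s j - gg j*aD j*(s j)^2)) \<in> O[F](T)"
 proof (rule cong)
  show "(\<lambda>j. (1/d2 j)*dh j - (D*(1/d2 j))*((1/g0 j)*(D*aD j*AD j)*(s j*h0 j)) + (gg j*aD j*AD j)*(s j)^3) \<in> O[F](T)"
  proof (intro addO subO)
   show "(\<lambda>j. (1/d2 j)*dh j) \<in> O[F](T)" by (rule one[OF id2 tr[OF dhO sm]])
   have sh: "(\<lambda>j. s j*h0 j) \<in> O[F](T)" by (rule tr[OF mulO[OF _ h0O] sm]) simp
   show "(\<lambda>j. (D*(1/d2 j))*((1/g0 j)*(D*aD j*AD j)*(s j*h0 j))) \<in> O[F](T)"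
    by (rule one[OF one[OF cO id2] one[OF one[OF ig0 one[OF one[OF cO aD1] AD1]] sh]])
   show "(\<lambda>j. (gg j*aD j*AD j)*(s j)^3) \<in> O[F](T)"
    by (rule one[OF one[OF one[OF gg1 aD1] AD1] s3])
  qed
  show "eventually (\<lambda>j. w j - (gg j * s j - gg j*aD j*(s j)^2) =
   (1/d2 j)*dh j - (D*(1/d2 j))*((1/g0 j)*(D*aD j*AD j)*(s j*h0 j)) + (gg j*aD j*AD j)*(s j)^3) F"
   using base pos
  proof eventually_elim
   case (elim j)
   obtain n A where o: "j = (n, A)" by (cases j)
   define x where "x = a n"
   have x: "0 < x" "0 < A" using elim lo by (auto simp: o x_def aa_def AA_def)
   have p: "0 < d2 j" "0 < g0 j" using elim gl by linarith+
   have q1: "i2 j - d2 j = D^2*(A - x)/((A + D)*(x + D)) + dh j"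
   proof -
    have "A*D/(A + D) - x*D/(x + D) = D^2*(A - x)/((A + D)*(x + D))"
     using x D by (simp add: field_simps power2_eq_square)
    then show ?thesis by (simp add: i2_def d2_def \<delta>2_def dh_def o x_def[symmetric])
   qed
   \<comment> \<open>\<open>X/Z\<close> is expanded about 1 to second order in
     \<open>(Z - X)/X\<close>, with exact remainder.\<close>
   have q2: "D^2*(A - x)/((A + D)*(x + D))/g0 j = gg j * s j - gg j*aD j*(s j)^2 + (gg j*aD j*AD j)*(s j)^3"
   proof -
    obtain X Z where X: "X = x + D" and Z: "Z = A + D" by simp
    have XZ: "0 < X" "0 < Z" using x D X Z by auto
    have S: "A - x = Z - X" using X Z by simp
    have g1: "(Z - X) - (Z - X)^2/X + (Z - X)^3/(X*Z) = X*(Z - X)/Z"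
     using XZ by (simp add: divide_simps) (simp add: algebra_simps power2_eq_square power3_eq_cube)
    have "D^2*(Z - X)/(Z*X)/(x*D/X) = D/(x*X)*(X*(Z - X)/Z)"
     using x D XZ by (simp add: power2_eq_square)
    also have "\<dots> = D/(x*X)*(Z - X) - D/(x*X)*(1/X)*(Z - X)^2 + D/(x*X)*(1/X)*(1/Z)*(Z - X)^3"
     unfolding g1[symmetric] by (simp add: right_diff_distrib distrib_left)
    finally show ?thesis
     by (simp add: gg_def \<gamma>_def aD_def AD_def s_def g0_def o x_def[symmetric] X[symmetric] Z[symmetric] S)
   qed
   have d2e: "d2 j = g0 j + h0 j" using elim by blast
   have "w j = (i2 j - d2 j)/d2 j" unfolding w_def using p by (simp add: diff_divide_distrib)
   also have "\<dots> = D^2*(A - x)/((A + D)*(x + D))/d2 j + dh j/d2 j" unfolding q1 by (simp add: add_divide_distrib)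
   also have "D^2*(A - x)/((A + D)*(x + D))/d2 j = D^2*(A - x)/((A + D)*(x + D))/g0 j - D^2*(A - x)/((A + D)*(x + D))*h0 j/(g0 j*d2 j)"
   proof -
    have "c/d = c/g - c*(d - g)/(g*d)" if "d \<noteq> 0" "g \<noteq> 0" for c d g :: real
     using that by (simp add: field_simps)
    moreover have "h0 j = d2 j - g0 j" using d2e by simp
    ultimately show ?thesis using p by (metis less_irrefl)
   qed
   finally show ?case unfolding q2
    by (simp add: aD_def AD_def s_def o x_def[symmetric] power2_eq_square mult_ac)
  qed
 qed
 have ss_T: "(\<lambda>j. s j*T j) \<in> O[F](T)" by (rule one[OF s1]) simp
 have s2O: "(\<lambda>j. (s j)^2) \<in> O[F](s)" using mulO[OF s1, of s s] by (simp add: power2_eq_square)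
 have T_s: "T \<in> O[F](s)"
 proof (rule bI[of _ "(hi - lo)^2 + 1 + (hi - lo)"])
  show "eventually (\<lambda>j. \<bar>T j\<bar> \<le> ((hi - lo)^2 + 1 + (hi - lo))*\<bar>s j\<bar>) F"
   using base Tnn
  proof eventually_elim
   case (elim j)
   have sl: "\<bar>s j\<bar> \<le> hi - lo" using elim by (auto simp: s_def aa_def AA_def)
   have "\<bar>s j\<bar>^3 = \<bar>s j\<bar>^2*\<bar>s j\<bar>" by (simp add: power2_eq_square power3_eq_cube)
   also have "\<dots> \<le> (hi - lo)^2*\<bar>s j\<bar>" by (intro mult_right_mono power_mono sl) auto
   finally have 1: "\<bar>s j\<bar>^3 \<le> (hi - lo)^2*\<bar>s j\<bar>" .
   have 2: "mm j*\<bar>s j\<bar> \<le> 1*\<bar>s j\<bar>" by (rule mult_right_mono) (use elim in auto)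
   have "ss j*(s j)^2 = (ss j*\<bar>s j\<bar>)*\<bar>s j\<bar>" by (simp add: power2_eq_square)
   also have "\<dots> \<le> (1*(hi - lo))*\<bar>s j\<bar>" by (intro mult_right_mono mult_mono sl) (use elim in auto)
   finally have 3: "ss j*(s j)^2 \<le> (hi - lo)*\<bar>s j\<bar>" by simp
   have "T j = \<bar>s j\<bar>^3 + mm j*\<bar>s j\<bar> + ss j*(s j)^2" by (simp add: T_def mm_def ss_def)
   then show ?case using 1 2 3 elim by (simp add: distrib_right)
  qed
 qed
 have ww: "(\<lambda>j. w j - gg j * s j) \<in> O[F](\<lambda>j. \<bar>(s j)^2\<bar> + \<bar>T j\<bar>)"
 proof (rule cong)
  have e: "f \<in> O[F](\<lambda>j. \<bar>(s j)^2\<bar> + \<bar>T j\<bar>)" if "f \<in> O[F](T)" for f :: "nat \<times> real \<Rightarrow> real"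
   by (rule tr[OF that], rule bI[of _ 1]) simp
  have e2: "(\<lambda>j. (s j)^2) \<in> O[F](\<lambda>j. \<bar>(s j)^2\<bar> + \<bar>T j\<bar>)" by (rule bI[of _ 1]) simp
  show "(\<lambda>j. (w j - (gg j * s j - gg j*aD j*(s j)^2)) - (gg j*aD j)*(s j)^2) \<in> O[F](\<lambda>j. \<bar>(s j)^2\<bar> + \<bar>T j\<bar>)"
   by (rule subO[OF e[OF w1] one[OF one[OF gg1 aD1] e2]])
 qed simp
 have wO: "w \<in> O[F](s)"
 proof (rule cong)
  show "(\<lambda>j. (w j - (gg j * s j - gg j*aD j*(s j)^2)) + (gg j * s j - (gg j*aD j)*(s j)^2)) \<in> O[F](s)"
   by (rule addO[OF tr[OF w1 T_s] subO[OF one[OF gg1] one[OF one[OF gg1 aD1] s2O]]]) simp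
 qed simp
 have cube: "(\<lambda>j. (f j)^3) \<in> O[F](T)" if "f \<in> O[F](s)" for f
  using tr[OF mulO[OF that mulO[OF that that]], of T] s3 by (simp add: power3_eq_cube mult.assoc)
 have sq3: "(\<lambda>j. s j*(\<bar>(s j)^2\<bar> + \<bar>T j\<bar>)) \<in> O[F](T)"
 proof (rule cong)
  have aT: "(\<lambda>j. \<bar>T j\<bar>) \<in> O[F](T)" by (rule bI[of _ 1]) simp
  show "(\<lambda>j. (s j)^3 + s j*\<bar>T j\<bar>) \<in> O[F](T)" by (rule addO[OF s3 one[OF s1 aT]])
 qed (simp add: distrib_left power2_eq_square power3_eq_cube)
 have w2: "(\<lambda>j. (w j)^2 - (gg j)^2*(s j)^2) \<in> O[F](T)"
 proof (rule cong)
  show "(\<lambda>j. (w j + gg j * s j)*(w j - gg j * s j)) \<in> O[F](T)"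
   by (rule tr[OF mulO[OF addO[OF wO one[OF gg1]] ww] sq3]) simp
 qed (simp add: power2_eq_square algebra_simps)
 obtain c0 where c0: "c0 = sqrt gl/sqrt (D + \<bar>H\<bar>)" by simp
 have tb: "eventually (\<lambda>j. c0 \<le> t j \<and> t j \<le> sqrt (D + \<bar>H\<bar>)/sqrt gl \<and> 0 < t j \<and> w j = (t j)^2 - 1 \<and> \<nu> j = 1/t j - 1) F"
  using pos
 proof eventually_elim
  case (elim j)
  have p: "0 < d2 j" "0 < i2 j" using elim gl by linarith+
  have "sqrt gl/sqrt (D + \<bar>H\<bar>) \<le> sqrt (i2 j)/sqrt (d2 j)" "sqrt (i2 j)/sqrt (d2 j) \<le> sqrt (D + \<bar>H\<bar>)/sqrt gl"
   using elim gl p D by (auto intro!: frac_le)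
  then show ?case using p by (simp add: t_def w_def \<nu>_def power_divide c0)
 qed
 have tl: "0 < c0" using gl D by (simp add: c0)
 have it1: "(\<lambda>j. 1/t j) \<in> O[F](\<lambda>_. 1)"
  by (rule bI[of _ "1/c0"]) (use tb in \<open>eventually_elim, insert tl, auto intro!: divide_left_mono mult_pos_pos\<close>)
 have t1: "t \<in> O[F](\<lambda>_. 1)"
  by (rule bI[of _ "sqrt (D + \<bar>H\<bar>)/sqrt gl"]) (use tb in \<open>eventually_elim, auto\<close>)
 have tw: "(\<lambda>j. t j - 1) \<in> O[F](s)"
 proof (rule tr[OF _ wO], rule bI[of _ 1])
  show "eventually (\<lambda>j. \<bar>t j - 1\<bar> \<le> 1*\<bar>w j\<bar>) F"
   using tb by eventually_elim (use inverse_sqrt_expansion(3) in auto)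
 qed
 have nu3: "(\<lambda>j. \<nu> j + w j/2 - 3*(w j)^2/8) \<in> O[F](T)"
 proof (rule cong)
  show "(\<lambda>j. (- (1/8)*((3*(t j*t j) + 9*t j + 8)*(1/t j)))*(t j - 1)^3) \<in> O[F](T)"
   by (rule one[OF one[OF cO one[OF addO[OF addO[OF one[OF cO one[OF t1 t1]] one[OF cO t1]] cO] it1]] cube[OF tw]])
  show "eventually (\<lambda>j. \<nu> j + w j/2 - 3*(w j)^2/8 = (- (1/8)*((3*(t j*t j) + 9*t j + 8)*(1/t j)))*(t j - 1)^3) F"
   using tb
  proof eventually_elim
   case (elim j)
   have "\<nu> j + w j/2 - 3*(w j)^2/8 = - ((t j - 1)^3*(3*(t j)^2 + 9*t j + 8)/(8*t j))"
    by (rule inverse_sqrt_expansion(1)) (use elim in auto)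
   then show ?case by (simp add: power2_eq_square mult_ac)
  qed
 qed
 have nuO: "\<nu> \<in> O[F](s)"
 proof (rule cong)
  show "(\<lambda>j. (- 1/t j)*(t j - 1)) \<in> O[F](s)" by (rule one[OF _ tw]) (use it1 in simp)
  show "eventually (\<lambda>j. \<nu> j = (- 1/t j)*(t j - 1)) F"
   using tb
  proof eventually_elim
   case (elim j)
   have "1/t j - 1 = (- 1/t j)*(t j - 1)" using elim by (simp add: field_simps)
   with elim show ?case by (simp only:)
  qed
 qed
 have nu2: "(\<lambda>j. (\<nu> j)^2 - (w j)^2/4) \<in> O[F](T)"
 proof (rule cong)
  have q: "(\<lambda>j. (\<nu> j - w j/2)*((t j - 1)*(t j - 1))) \<in> O[F](T)"
  proof (rule tr[OF mulO[OF _ mulO[OF tw tw]]])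
   show "(\<lambda>j. \<nu> j - w j/2) \<in> O[F](s)" using subO[OF nuO one[OF cO[of "1/2"] wO]] by simp
   show "(\<lambda>j. s j*(s j * s j)) \<in> O[F](T)" using s3 by (simp add: power3_eq_cube mult.assoc)
  qed
  show "(\<lambda>j. ((t j + 2)*(1/t j)*(1/2))*((\<nu> j - w j/2)*((t j - 1)*(t j - 1)))) \<in> O[F](T)"
   by (rule one[OF one[OF one[OF addO[OF t1 cO] it1] cO] q])
  show "eventually (\<lambda>j. (\<nu> j)^2 - (w j)^2/4 = ((t j + 2)*(1/t j)*(1/2))*((\<nu> j - w j/2)*((t j - 1)*(t j - 1)))) F"
   using tb
  proof eventually_elim
   case (elim j)
   have "\<nu> j + w j/2 = (t j - 1)^2*(t j + 2)/(2*t j)"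
    by (rule inverse_sqrt_expansion(2)) (use elim in auto)
   then have "\<nu> j + w j/2 = ((t j + 2)*(1/t j)*(1/2))*((t j - 1)*(t j - 1))" by (simp add: power2_eq_square mult_ac)
   moreover have "(\<nu> j)^2 - (w j)^2/4 = (\<nu> j + w j/2)*(\<nu> j - w j/2)" by (simp add: power2_eq_square algebra_simps)
   ultimately show ?case by (simp add: mult_ac)
  qed
 qed
 \<comment> \<open>\<open>\<kappa>\<close> is the shift of the centre and \<open>k\<close> its
   standardised version. To first order \<open>\<kappa>\<close> is \<open>- D * va/(a + D)^2\<close>
   times \<open>s\<close>; the rest \<open>\<rho>\<close> is of second order in \<open>s\<close> or
   carries the small Lipschitz constant of \<open>v\<close>, so \<open>s*\<rho>\<close> and
   \<open>\<rho>*\<rho>\<close> are negligible.\<close>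
 define \<kappa> k where "\<kappa> j = \<theta> (fst j) (a (fst j)) - \<theta> (fst j) (snd j)" and "k j = (\<theta> (fst j) (a (fst j)) - \<theta> (fst j) (snd j))/sqrt (i2 j)" for j :: "nat \<times> real"
 define \<rho> where "\<rho> j = (D * va j*(aD j*aD j)*AD j)*(s j * s j) + (D*AD j) * vv j" for j
 have kap: "eventually (\<lambda>j. \<kappa> j = (- D * va j*(aD j*aD j)) * s j + \<rho> j) F"
  using base
 proof eventually_elim
  case (elim j)
  obtain n A where o: "j = (n, A)" by (cases j)
  define x where "x = a n"
  define p q where "p = v n x" and "q = v n A - v n x"
  obtain X Z where X: "X = x + D" and Z: "Z = A + D" by simp
  have S: "A - x = Z - X" using X Z by simp
  have pp: "0 < X" "0 < Z" using elim lo D by (auto simp: o x_def X Z aa_def AA_def)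
  have vA: "v n A = p + q" by (simp add: p_def q_def)
  have gen: "D/Z*(p + q) - D/X*p = (- D*p*(1/X*(1/X)))*(Z - X) + ((D*p*(1/X*(1/X))*(1/Z))*((Z - X)*(Z - X)) + (D*(1/Z))*q)"
   using pp by (simp add: divide_simps) (simp add: algebra_simps)
  have "\<kappa> j = D/Z*(p + q) - D/X*p"
   by (simp add: \<kappa>_def \<theta>_def o x_def[symmetric] X Z p_def q_def)
  then show ?case
   unfolding gen by (simp add: \<rho>_def va_def vv_def aD_def AD_def s_def o x_def[symmetric] X[symmetric] Z[symmetric] S p_def q_def)
 qed
 have sOs: "s \<in> O[F](s)" by simp
 have svs: "(\<lambda>j. s j * vv j) \<in> O[F](T)"
 proof (rule tr[OF mulO[OF sOs vvO]])
  show "(\<lambda>j. s j*(ss j * s j)) \<in> O[F](T)" by (rule cong[OF s\<sigma>]) (simp add: power2_eq_square mult_ac)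
 qed
 have sss: "(\<lambda>j. s j*(s j * s j)) \<in> O[F](T)" using s3 by (simp add: power3_eq_cube mult.assoc)
 have vvs: "vv \<in> O[F](s)" by (rule tr[OF vvO one[OF ss1]]) simp
 have sso: "(\<lambda>j. s j * s j) \<in> O[F](s)" by (rule one[OF s1]) simp
 have cO1: "(\<lambda>j. D * va j*(aD j*aD j)*AD j) \<in> O[F](\<lambda>_. 1)" "(\<lambda>j. D*AD j) \<in> O[F](\<lambda>_. 1)" "(\<lambda>j. - D * va j*(aD j*aD j)) \<in> O[F](\<lambda>_. 1)"
  by (rule one[OF one[OF one[OF cO vaO] one[OF aD1 aD1]] AD1], rule one[OF cO AD1], rule one[OF one[OF cO vaO] one[OF aD1 aD1]])
 have rhoS: "\<rho> \<in> O[F](s)" unfolding \<rho>_def by (rule addO[OF one[OF cO1(1) sso] one[OF cO1(2) vvs]])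
 have srho: "(\<lambda>j. s j*\<rho> j) \<in> O[F](T)"
 proof (rule cong)
  show "(\<lambda>j. (D * va j*(aD j*aD j)*AD j)*(s j*(s j * s j)) + (D*AD j)*(s j * vv j)) \<in> O[F](T)"
   by (rule addO[OF one[OF cO1(1) sss] one[OF cO1(2) svs]])
 qed (simp add: \<rho>_def algebra_simps)
 have rr: "(\<lambda>j. \<rho> j*\<rho> j) \<in> O[F](T)"
 proof -
  have "(\<lambda>j. s j * s j * vv j) \<in> O[F](T)" by (rule cong[OF one[OF s1 svs]]) simp
  moreover have "(\<lambda>j. vv j * vv j) \<in> O[F](T)" by (rule tr[OF mulO[OF vvs] svs]) simp
  moreover have "(\<lambda>j. (s j * s j)*\<rho> j) \<in> O[F](T)" by (rule cong[OF one[OF s1 srho]]) simp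
  moreover have "(\<lambda>j. vv j*\<rho> j) \<in> O[F](T)" by (rule tr[OF mulO[OF vvs, of \<rho> \<rho>] srho]) simp
  ultimately have "(\<lambda>j. (D * va j*(aD j*aD j)*AD j)*((s j * s j)*\<rho> j) + (D*AD j)*(vv j*\<rho> j)) \<in> O[F](T)"
   by (intro addO one[OF cO1(1)] one[OF cO1(2)])
  then show ?thesis by (rule cong) (simp add: \<rho>_def algebra_simps)
 qed
 have kap2: "(\<lambda>j. (\<kappa> j)^2 - (D * va j*(aD j*aD j))^2*(s j)^2) \<in> O[F](T)"
 proof (rule cong)
  show "(\<lambda>j. (2*(- D * va j*(aD j*aD j)))*(s j*\<rho> j) + \<rho> j*\<rho> j) \<in> O[F](T)"
   by (rule addO[OF one[OF one[OF cO cO1(3)] srho] rr])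
  show "eventually (\<lambda>j. (\<kappa> j)^2 - (D * va j*(aD j*aD j))^2*(s j)^2 = (2*(- D * va j*(aD j*aD j)))*(s j*\<rho> j) + \<rho> j*\<rho> j) F"
   using kap
  proof eventually_elim
   case (elim j)
   have "(- u * s + r)^2 - u^2 * s^2 = (2*(- u))*(s*r) + r*r" for u s r :: real by (simp add: power2_eq_square algebra_simps)
   from this[of "D * va j*(aD j*aD j)" "s j" "\<rho> j"] elim show ?case by simp
  qed
 qed
 have kapS: "\<kappa> \<in> O[F](s)" by (rule cong[OF addO[OF one[OF cO1(3)] rhoS] kap]) simp
 \<comment> \<open>In \<open>k^2\<close> the variance at \<open>A\<close> may be replaced by the
   leading part \<open>g0\<close> of the variance at \<open>a\<close>: the relative error has size
   \<open>\<bar>s\<bar> + 1/m\<close>, and \<open>k^2\<close> is already of size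
   \<open>s^2\<close>.\<close>
 have i2g0: "(\<lambda>j. (s j * s j)*(1/i2 j - 1/g0 j)) \<in> O[F](T)"
 proof (rule cong)
  have smm: "(\<lambda>j. (s j * s j)*h0 j) \<in> O[F](T)"
   by (rule tr[OF mulO[OF sso h0O] sm])
  have "(\<lambda>j. (- (1/i2 j)*(1/g0 j))*(d2 j*((s j * s j)*w j) + (s j * s j)*h0 j)) \<in> O[F](T)"
  proof (rule one[OF one[OF _ ig0] addO[OF one smm]])
   show "(\<lambda>j. - (1/i2 j)) \<in> O[F](\<lambda>_. 1)" using ii2 by simp
   show "d2 \<in> O[F](\<lambda>_. 1)" by (rule bI[of _ "D + \<bar>H\<bar>"]) (use pos in \<open>eventually_elim, insert gl, auto\<close>)
   show "(\<lambda>j. (s j * s j)*w j) \<in> O[F](T)"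
   proof (rule tr[OF mulO[OF _ wO]])
    show "(\<lambda>j. s j * s j) \<in> O[F](\<lambda>j. s j * s j)" by simp
    show "(\<lambda>j. (s j * s j) * s j) \<in> O[F](T)" by (rule cong[OF sss]) simp
   qed
  qed
  then show "(\<lambda>j. (- (1/i2 j)*(1/g0 j))*(d2 j*((s j * s j)*w j) + (s j * s j)*h0 j)) \<in> O[F](T)" .
  show "eventually (\<lambda>j. (s j * s j)*(1/i2 j - 1/g0 j) = (- (1/i2 j)*(1/g0 j))*(d2 j*((s j * s j)*w j) + (s j * s j)*h0 j)) F"
   using pos
  proof eventually_elim
   case (elim j)
   have p: "0 < d2 j" "0 < i2 j" "0 < g0 j" using elim gl by linarith+
   have dw: "d2 j*w j = i2 j - d2 j" using p by (simp add: w_def field_simps)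
   have "d2 j*((s j * s j)*w j) + (s j * s j)*h0 j = (s j * s j)*(d2 j*w j + h0 j)" by (simp add: algebra_simps)
   also have "\<dots> = (s j * s j)*(i2 j - g0 j)" using elim dw by simp
   finally have e: "d2 j*((s j * s j)*w j) + (s j * s j)*h0 j = (s j * s j)*(i2 j - g0 j)" .
   have "S*(1/i - 1/g) = (- (1/i)*(1/g))*(S*(i - g))" if "i \<noteq> 0" "g \<noteq> 0" for S i g :: real
    using that by (simp add: field_simps)
   then show ?case unfolding e using p by (metis less_irrefl)
  qed
 qed
 have k2: "(\<lambda>j. (k j)^2 - G (fst j)*(s j)^2) \<in> O[F](T)"
 proof (rule cong)
  show "(\<lambda>j. (1/i2 j)*((\<kappa> j)^2 - (D * va j*(aD j*aD j))^2*(s j)^2)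
    + ((- D * va j*(aD j*aD j))*(- D * va j*(aD j*aD j)))*((s j * s j)*(1/i2 j - 1/g0 j))) \<in> O[F](T)"
   by (rule addO[OF one[OF ii2 kap2] one[OF one[OF cO1(3) cO1(3)] i2g0]])
  show "eventually (\<lambda>j. (k j)^2 - G (fst j)*(s j)^2 = (1/i2 j)*((\<kappa> j)^2 - (D * va j*(aD j*aD j))^2*(s j)^2)
    + ((- D * va j*(aD j*aD j))*(- D * va j*(aD j*aD j)))*((s j * s j)*(1/i2 j - 1/g0 j))) F"
   using pos base
  proof eventually_elim
   case (elim j)
   have p: "0 < i2 j" "0 < g0 j" using elim gl by linarith+
   have al: "0 < a (fst j)" using elim lo by (simp add: aa_def)
   have kk: "(k j)^2 = (\<kappa> j)^2/i2 j" using p by (simp add: k_def \<kappa>_def power_divide)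
   have GG: "G (fst j) = (D * va j*(aD j*aD j))^2/g0 j"
   proof -
    obtain X where X: "X = a (fst j) + D" by simp
    have "0 < X" using al D X by simp
    have gen: "D/(x*X)*(u/X)^2 = (D*u*(1/X*(1/X)))^2/(x*D/X)" if "0 < x" for x u
     using \<open>0 < X\<close> that D by (simp add: field_simps power2_eq_square)
    show ?thesis unfolding G_def \<gamma>_def va_def aD_def g0_def X[symmetric] by (rule gen[OF al])
   qed
   have gen: "K/i - u^2/g*S^2 = (1/i)*(K - u^2*S^2) + ((- u)*(- u))*((S*S)*(1/i - 1/g))" for K i g u S :: real
    by (simp add: power2_eq_square algebra_simps)
   show ?case unfolding kk GG using gen[of "(\<kappa> j)^2" "i2 j" "D * va j*(aD j*aD j)" "g0 j" "s j"] by simp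
  qed
 qed
 have isq: "(\<lambda>j. 1/sqrt (i2 j)) \<in> O[F](\<lambda>_. 1)"
  by (rule bI[of _ "1/sqrt gl"]) (use pos in \<open>eventually_elim, insert gl, auto intro!: divide_left_mono mult_pos_pos\<close>)
 have kS: "k \<in> O[F](s)" by (rule cong[OF one[OF isq kapS]]) (simp add: k_def \<kappa>_def)
 have R3: "(\<lambda>j. cov (fst j) (snd j) - (\<Phi> z - \<Phi> (- z))
   - std_normal_density z*z*(2*\<nu> j - z^2*(\<nu> j)^2 - (k j)^2)) \<in> O[F](T)"
 proof (rule tr)
  have absO: "(\<lambda>j. \<bar>f j\<bar>) \<in> O[F](X)" if "f \<in> O[F](X)" for f X :: "nat \<times> real \<Rightarrow> real" using that by simp
  show "(\<lambda>j. 2*(\<bar>z*\<nu> j\<bar> + \<bar>k j\<bar>)^3) \<in> O[F](T)"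
   by (rule one[OF cO cube[OF addO[OF absO[OF one[OF cO nuO]] absO[OF kS]]]])
  show "(\<lambda>j. cov (fst j) (snd j) - (\<Phi> z - \<Phi> (- z))
   - std_normal_density z*z*(2*\<nu> j - z^2*(\<nu> j)^2 - (k j)^2)) \<in> O[F](\<lambda>j. 2*(\<bar>z*\<nu> j\<bar> + \<bar>k j\<bar>)^3)"
  proof (rule bI[of _ 1])
   show "eventually (\<lambda>j. \<bar>cov (fst j) (snd j) - (\<Phi> z - \<Phi> (- z))
     - std_normal_density z*z*(2*\<nu> j - z^2*(\<nu> j)^2 - (k j)^2)\<bar> \<le> 1*\<bar>2*(\<bar>z*\<nu> j\<bar> + \<bar>k j\<bar>)^3\<bar>) F"
    using pos
   proof eventually_elim
    case (elim j)
    have p: "0 < d2 j" "0 < i2 j" using elim gl by linarith+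
    have "cov (fst j) (snd j) = \<Phi> (z*(1 + \<nu> j) + k j) - \<Phi> (- z*(1 + \<nu> j) + k j)"
     unfolding cov_def d2_def[symmetric] i2_def[symmetric] \<nu>_def k_def
     using p by (simp add: add_divide_distrib diff_divide_distrib algebra_simps)
    then show ?case using coverage_taylor[of z "\<nu> j" "k j"] by simp
   qed
  qed
 qed
 \<comment> \<open>The remainders are weighted so that \<open>\<nu>\<close>, \<open>w\<close> and
   \<open>k\<close> cancel: \<open>2*\<nu>\<close> is traded for \<open>- w + 3*w^2/4\<close>,
   \<open>z^2*\<nu>^2\<close> for \<open>z^2*w^2/4\<close>, \<open>w^2\<close> for
   \<open>gg^2 * s^2\<close>, and \<open>k^2\<close> for \<open>G * s^2\<close>.\<close>
 have "(\<lambda>j. (cov (fst j) (snd j) - (\<Phi> z - \<Phi> (- z))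
   - std_normal_density z*z*(2*\<nu> j - z^2*(\<nu> j)^2 - (k j)^2))
   + (std_normal_density z*z)*(2*(\<nu> j + w j/2 - 3*(w j)^2/8) - (w j - (gg j * s j - gg j*aD j*(s j)^2))
    + (3/4 - z^2/4)*((w j)^2 - (gg j)^2*(s j)^2) - z^2*((\<nu> j)^2 - (w j)^2/4)
    - ((k j)^2 - G (fst j)*(s j)^2))) \<in> O[F](T)"
  by (rule addO[OF R3 one[OF cO subO[OF subO[OF addO[OF subO[OF one[OF cO nu3] w1] one[OF cO w2]] one[OF cO nu2]] k2]]])
 then have "(\<lambda>j. cov (fst j) (snd j) - (\<Phi> z - \<Phi> (- z))
   - std_normal_density z*z*(- gg j * s j + (gg j*aD j + (3 - z^2)/4*(gg j)^2 - G (fst j))*(s j)^2)) \<in> O[F](T)"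
 proof (rule cong)
  have "c - P - q*N + q*(2*(\<nu> + w/2 - 3*w^2/8) - (w - (g * s - g*ad * s^2)) + (3/4 - z^2/4)*(w^2 - g^2 * s^2)
    - z^2*(\<nu>^2 - w^2/4) - (k^2 - G * s^2)) = c - P - q*(- g * s + (g*ad + (3 - z^2)/4*g^2 - G) * s^2)"
   if "N = 2*\<nu> - z^2*\<nu>^2 - k^2" for c P q N \<nu> w g s ad k G :: real
   unfolding that by (simp add: field_simps)
  from this[OF refl, symmetric] show "eventually (\<lambda>j. cov (fst j) (snd j) - (\<Phi> z - \<Phi> (- z))
   - std_normal_density z*z*(- gg j * s j + (gg j*aD j + (3 - z^2)/4*(gg j)^2 - G (fst j))*(s j)^2) =
   (cov (fst j) (snd j) - (\<Phi> z - \<Phi> (- z))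
   - std_normal_density z*z*(2*\<nu> j - z^2*(\<nu> j)^2 - (k j)^2))
   + (std_normal_density z*z)*(2*(\<nu> j + w j/2 - 3*(w j)^2/8) - (w j - (gg j * s j - gg j*aD j*(s j)^2))
    + (3/4 - z^2/4)*((w j)^2 - (gg j)^2*(s j)^2) - z^2*((\<nu> j)^2 - (w j)^2/4)
    - ((k j)^2 - G (fst j)*(s j)^2))) F" by (intro always_eventually allI)
 qed
 then show ?thesis
  unfolding T_def s_def gg_def aD_def split_beta' by simp
qed


text \<open>Averages the pointwise expansion over the weight. By
  \<open>abs_le_weighted_squares\<close> the errors |s|^3 and |s|/m have means of order m^(-3/2),
  and the error with \<open>\<sigma>\<close> has mean o(1/m) because \<open>\<sigma>\<close> tends
  to 0.\<close>

lemma coverage_mean: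
 fixes a m \<sigma> Y :: "nat \<Rightarrow> real" and h v w :: "nat \<Rightarrow> real \<Rightarrow> real" and lo hi D H V z C' :: real
 defines "\<delta>2 \<equiv> \<lambda>n A. A*D/(A + D) + h n A"
 defines "\<theta> \<equiv> \<lambda>n A. Y n - D/(A + D) * v n A"
 defines "cov \<equiv> \<lambda>n A. \<Phi> ((\<theta> n (a n) + z * sqrt (\<delta>2 n (a n)) - \<theta> n A)/sqrt (\<delta>2 n A))
   - \<Phi> ((\<theta> n (a n) - z * sqrt (\<delta>2 n (a n)) - \<theta> n A)/sqrt (\<delta>2 n A))"
 defines "\<gamma> \<equiv> \<lambda>n. D/(a n*(a n + D))"
 defines "G \<equiv> \<lambda>n. \<gamma> n*(v n (a n)/(a n + D))^2"
 defines "E \<equiv> \<lambda>n. wavg (w n) lo hi"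
 assumes lo: "0 < lo" "lo < hi" and D: "0 < D" and a: "EV n. a n \<in> {lo..hi}"
  and m: "filterlim m at_top sequentially"
  and h: "EV n. \<forall>A\<in>{lo..hi}. 0 \<le> h n A \<and> h n A \<le> H/m n \<and> \<bar>h n A - h n (a n)\<bar> \<le> H*\<bar>A - a n\<bar>/m n"
  and v: "EV n. \<forall>A\<in>{lo..hi}. \<bar>v n A - v n (a n)\<bar> \<le> \<sigma> n*\<bar>A - a n\<bar>"
  and V: "EV n. \<bar>v n (a n)\<bar> \<le> V" and \<sigma>: "EV n. 0 \<le> \<sigma> n" "\<sigma> \<longlonglongrightarrow> 0"
  and hc: "EV n. continuous_on {lo..hi} (h n) \<and> continuous_on {lo..hi} (v n)"
  and wc: "EV n. continuous_on {lo..hi} (w n) \<and> (\<forall>A\<in>{lo..hi}. 0 < w n A)"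
  and mom: "EV n. E n (\<lambda>A. (A - a n)^2) \<le> C'/m n \<and> E n (\<lambda>A. (A - a n)^4) \<le> C'/(m n)^2"
 shows "(\<lambda>n. m n*(E n (cov n) - (\<Phi> z - \<Phi> (- z)))
   - std_normal_density z*z*(- \<gamma> n*(m n*E n (\<lambda>A. A - a n))
     + (\<gamma> n/(a n + D) + (3 - z^2)/4*(\<gamma> n)^2 - G n)*(m n*E n (\<lambda>A. (A - a n)^2)))) \<longlonglongrightarrow> 0"
proof -
 let ?J = "{lo..hi}"
 let ?P = "\<Phi> z - \<Phi> (- z)"
 let ?q = "std_normal_density z*z"
 let ?c = "\<lambda>n. \<gamma> n/(a n + D) + (3 - z^2)/4*(\<gamma> n)^2 - G n"
 have m1: "EV n. 1 \<le> m n" using m by (simp add: filterlim_at_top)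
 have \<sigma>1: "EV n. 0 \<le> \<sigma> n \<and> \<sigma> n \<le> 1"
 proof -
  have "EV n. \<sigma> n < 1" using order_tendstoD(2)[OF \<sigma>(2), of 1] by simp
  with \<sigma>(1) show ?thesis by eventually_elim simp
 qed
 from coverage_expansion[OF lo(1) D a m1 h v V \<sigma>1, of Y z, folded \<delta>2_def \<theta>_def, folded cov_def, folded \<gamma>_def, folded G_def]
 obtain C where C0: "0 < C" and C: "eventually (\<lambda>\<omega>. norm ((\<lambda>(n, A). cov n A - ?P - ?q*(- \<gamma> n*(A - a n) + ?c n*(A - a n)^2)) \<omega>)
   \<le> C*norm ((\<lambda>(n, A). \<bar>A - a n\<bar>^3 + \<bar>A - a n\<bar>/m n + \<sigma> n*(A - a n)^2) \<omega>)) (sequentially \<times>\<^sub>F principal ?J)"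
  unfolding \<delta>2_def \<theta>_def cov_def \<gamma>_def G_def by (elim landau_o.bigE) blast
 have C': "EV n. \<forall>A\<in>?J. \<bar>cov n A - ?P - ?q*(- \<gamma> n*(A - a n) + ?c n*(A - a n)^2)\<bar>
   \<le> C*\<bar>\<bar>A - a n\<bar>^3 + \<bar>A - a n\<bar>/m n + \<sigma> n*(A - a n)^2\<bar>"
  using C unfolding eventually_prod_principal by simp
 have cont: "EV n. continuous_on ?J (cov n)"
  using hc h m1
 proof eventually_elim
  case (elim n)
  have p: "0 < \<delta>2 n A" if "A \<in> ?J" for A
   using bspec[OF elim(2) that] that lo D unfolding \<delta>2_def by (intro add_pos_nonneg) auto
  have c: "continuous_on ?J (\<delta>2 n)" unfolding \<delta>2_def
   using lo D by (intro continuous_intros) (use elim in auto)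
  have t: "continuous_on ?J (\<theta> n)" unfolding \<theta>_def
   using lo D by (intro continuous_intros) (use elim in auto)
  have P: "continuous_on S \<Phi>" for S
   using \<Phi>_deriv by (meson DERIV_isCont continuous_at_imp_continuous_on)
  have "continuous_on ?J (\<lambda>A. (\<theta> n (a n) + r - \<theta> n A)/sqrt (\<delta>2 n A))" for r
   by (intro continuous_intros c t) (use p in force)
  then have cf: "continuous_on ?J (\<lambda>A. \<Phi> ((\<theta> n (a n) + r - \<theta> n A)/sqrt (\<delta>2 n A)))" for r
   by (rule continuous_on_compose2[OF P[of UNIV]]) auto
  show ?case unfolding cov_def
   using cf[of "- (z * sqrt (\<delta>2 n (a n)))"] by (intro continuous_on_diff cf) simp
 qed
 define b where "b n = C*((\<bar>C'\<bar> + 1)*(2*(1/sqrt (m n)) + \<sigma> n))" for n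
 have b0: "b \<longlonglongrightarrow> 0"
 proof -
  have sq_inf: "filterlim (\<lambda>n. sqrt (m n)) at_top sequentially" by (rule filterlim_compose[OF sqrt_at_top m])
  have inv0: "(\<lambda>n. 1/sqrt (m n)) \<longlonglongrightarrow> 0"
   using filterlim_compose[OF tendsto_inverse_0_at_top[OF filterlim_ident] sq_inf] by (simp add: inverse_eq_divide)
  have "b \<longlonglongrightarrow> C*((\<bar>C'\<bar> + 1)*(2*0 + 0))" unfolding b_def by (intro tendsto_intros inv0 \<sigma>)
  then show ?thesis by simp
 qed
 show ?thesis
 proof (rule Lim_null_comparison[OF _ b0])
  show "EV n. norm (m n*(E n (cov n) - ?P) - ?q*(- \<gamma> n*(m n*E n (\<lambda>A. A - a n))
     + ?c n*(m n*E n (\<lambda>A. (A - a n)^2)))) \<le> b n"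
   using C' cont wc mom m1 \<sigma>1
  proof eventually_elim
   case (elim n)
   then have wcn: "continuous_on ?J (w n)" and wp: "\<And>A. A \<in> ?J \<Longrightarrow> 0 < w n A" and mp: "0 < m n" by auto
   note W = lo(2) wcn wp
   let ?e2 = "E n (\<lambda>A. (A - a n)^2)" and ?e4 = "E n (\<lambda>A. (A - a n)^4)"
   obtain q where q: "q = sqrt (m n)" by simp
   have q1: "1 \<le> q" "0 < q" using elim(5) by (auto simp: q)
   have qm: "m n = q^2" using mp by (simp add: q)
   have "\<bar>E n (cov n) - E n (\<lambda>A. ?P + ?q*(- \<gamma> n*(A - a n) + ?c n*(A - a n)^2))\<bar>
     \<le> E n (\<lambda>A. (C*q/2)*(A - a n)^4 + (C/(2*q) + C/(2*q) + C*\<sigma> n)*(A - a n)^2 + C/(2*q^3))"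
    unfolding E_def
   proof (rule wavg_abs_diff[OF W])
    fix A assume A: "A \<in> ?J"
    let ?s = "A - a n"
    have s3: "\<bar>?s\<bar>^3 \<le> (q*?s^4 + ?s^2/q)/2" and s1: "\<bar>?s\<bar> \<le> (q*?s^2 + 1/q)/2"
     unfolding q by (rule abs_le_weighted_squares[OF mp])+
    have s1': "\<bar>?s\<bar>/m n \<le> (?s^2/q + 1/q^3)/2"
    proof -
     have "\<bar>?s\<bar>/m n \<le> ((q*?s^2 + 1/q)/2)/q^2" unfolding qm by (rule divide_right_mono[OF s1]) simp
     also have "\<dots> = (?s^2/q + 1/q^3)/2" using q1(2)
      by (simp add: add_divide_distrib power2_eq_square power3_eq_cube)
     finally show ?thesis .
    qed
    have nn: "0 \<le> \<bar>?s\<bar>^3 + \<bar>?s\<bar>/m n + \<sigma> n*?s^2" using elim(6) mp by simp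
    have "\<bar>cov n A - (?P + ?q*(- \<gamma> n*?s + ?c n*?s^2))\<bar> \<le> C*(\<bar>?s\<bar>^3 + \<bar>?s\<bar>/m n + \<sigma> n*?s^2)"
     using bspec[OF elim(1) A] nn by (simp add: diff_diff_eq)
    also have "\<dots> \<le> C*((q*?s^4 + ?s^2/q)/2 + (?s^2/q + 1/q^3)/2 + \<sigma> n*?s^2)"
     by (intro mult_left_mono[OF _ less_imp_le[OF C0]] add_mono s3 s1' order_refl)
    also have "\<dots> = (C*q/2)*?s^4 + (C/(2*q) + C/(2*q) + C*\<sigma> n)*?s^2 + C/(2*q^3)"
     by (simp add: algebra_simps add_divide_distrib)
    finally show "\<bar>cov n A - (?P + ?q*(- \<gamma> n*?s + ?c n*?s^2))\<bar> \<le> (C*q/2)*?s^4 + (C/(2*q) + C/(2*q) + C*\<sigma> n)*?s^2 + C/(2*q^3)" .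
   qed (use elim(2) in \<open>auto intro!: continuous_intros\<close>)
   also have "\<dots> = (C*q/2)*?e4 + (C/(2*q) + C/(2*q) + C*\<sigma> n)*?e2 + C/(2*q^3)"
    unfolding E_def by (simp only: wavg_add[OF W] wavg_cmult[OF W] wavg_const[OF W] continuous_intros)
   also have "\<dots> \<le> (C*q/2)*(\<bar>C'\<bar>/q^4) + (C/(2*q) + C/(2*q) + C*\<sigma> n)*(\<bar>C'\<bar>/q^2) + C/(2*q^3)"
   proof (intro add_mono mult_left_mono order_refl)
    have "C'/(m n)^2 \<le> \<bar>C'\<bar>/(m n)^2" "C'/m n \<le> \<bar>C'\<bar>/m n" using mp by (auto intro!: divide_right_mono)
    then show "?e4 \<le> \<bar>C'\<bar>/q^4" "?e2 \<le> \<bar>C'\<bar>/q^2"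
     using elim(4) unfolding qm by (auto simp: power_mult[symmetric])
   qed (use C0 q1 elim(6) in auto)
   finally have B: "\<bar>E n (cov n) - E n (\<lambda>A. ?P + ?q*(- \<gamma> n*(A - a n) + ?c n*(A - a n)^2))\<bar>
    \<le> (C*q/2)*(\<bar>C'\<bar>/q^4) + (C/(2*q) + C/(2*q) + C*\<sigma> n)*(\<bar>C'\<bar>/q^2) + C/(2*q^3)" .
   have Ee: "E n (\<lambda>A. ?P + ?q*(- \<gamma> n*(A - a n) + ?c n*(A - a n)^2)) = ?P + ?q*(- \<gamma> n*E n (\<lambda>A. A - a n) + ?c n*?e2)"
    unfolding E_def by (simp only: wavg_add[OF W] wavg_cmult[OF W] wavg_const[OF W] continuous_intros)
   have "norm (m n*(E n (cov n) - ?P) - ?q*(- \<gamma> n*(m n*E n (\<lambda>A. A - a n)) + ?c n*(m n*?e2)))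
    = m n*\<bar>E n (cov n) - (?P + ?q*(- \<gamma> n*E n (\<lambda>A. A - a n) + ?c n*?e2))\<bar>"
   proof -
    have "m n*(X - P) - qq*(g*(m n*e1) + cc*(m n*e2)) = m n*(X - (P + qq*(g*e1 + cc*e2)))" for X P qq g e1 cc e2
     by (simp add: algebra_simps)
    then show ?thesis using mp by (simp only: real_norm_def abs_mult abs_of_pos)
   qed
   also have "\<dots> \<le> q^2*((C*q/2)*(\<bar>C'\<bar>/q^4) + (C/(2*q) + C/(2*q) + C*\<sigma> n)*(\<bar>C'\<bar>/q^2) + C/(2*q^3))"
    using B unfolding Ee qm by (intro mult_left_mono) auto
   also have "\<dots> = C*(\<bar>C'\<bar>*(3/2*(1/q) + \<sigma> n) + 1/2*(1/q))"
    using q1(2) by (simp add: power2_eq_square power3_eq_cube power4_eq_xxxx field_simps)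
   also have "\<dots> \<le> C*(\<bar>C'\<bar>*(2*(1/q) + \<sigma> n) + (2*(1/q) + \<sigma> n))"
   proof -
    obtain r where r: "r = 1/q" by simp
    have "0 \<le> r" "0 \<le> \<sigma> n" using q1 r elim(6) by auto
    then show ?thesis unfolding r[symmetric]
     by (intro mult_left_mono[OF _ less_imp_le[OF C0]] add_mono mult_left_mono) auto
   qed
   also have "\<dots> = b n" unfolding b_def q[symmetric] by (simp only: distrib_right mult_1_left)
   finally show ?case .
  qed
 qed
qed

section \<open>Local expansion of the score\<close>

text \<open>The data are \<open>x j \<bullet> \<beta> + e j\<close>. The bounds \<open>d\<close>,
  \<open>dm\<close>, \<open>X\<close>, \<open>c\<close> are kept apart from \<open>m\<close>, so
  every constant derived from them is uniform along a sequence of samples; \<open>gram\<close> says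
  that X'X grows linearly in \<open>m\<close> in all directions.\<close>

locale regression_sample =
 fixes x :: "nat \<Rightarrow> real^'p::finite" and D :: "nat \<Rightarrow> real" and m :: nat and e :: "nat \<Rightarrow> real"
  and d dm X c :: real
 assumes d: "0 < d" and Dlo: "\<And>j. d \<le> D j" and Dhi: "\<And>j. D j \<le> dm" and X: "\<And>j. norm (x j) \<le> X"
  and c: "0 < c" and m: "1 \<le> m" and rank: "dim (x ` {..<m}) = CARD('p)"
  and gram: "\<And>v. c*real m*(norm v)^2 \<le> (\<Sum>j<m. (x j \<bullet> v)^2)"
begin

abbreviation "Q \<equiv> XtVX x D m"

text \<open>X'V^{-k}e: the noise sums through which the estimation of beta affects the
  score.\<close>

definition u :: "nat \<Rightarrow> real \<Rightarrow> real^'p" where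
 "u k A = (\<Sum>j<m. (e j/(A + D j)^k) *\<^sub>R x j)"

text \<open>The estimation error \<open>beta_bar - \<beta>\<close>, being the generalised least
  squares estimate computed from the errors; see \<open>beta_bar_eq\<close>.\<close>

definition b :: "real \<Rightarrow> real^'p" where
 "b A = matrix_inv (Q A) *v u 1 A"

text \<open>Equal to y'PPy, which is minus the derivative of y'Py.\<close>

definition W :: "real \<Rightarrow> real" where
 "W A = (\<Sum>j<m. (e j - x j \<bullet> b A)^2/(A + D j)^2)"

lemma mp: "0 < real m" using m by simp

lemma X0: "0 \<le> X" using order_trans[OF norm_ge_zero X] .

lemma dm0: "0 < dm" using d Dlo[of 0] Dhi[of 0] by linarith

lemma t_pos: "0 \<le> A \<Longrightarrow> 0 < A + D j" using d Dlo[of j] by linarith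

lemma t_ge: "0 \<le> A \<Longrightarrow> d \<le> A + D j" using Dlo[of j] by linarith

lemma Q_quad: "v \<bullet> (Q A *v v) = (\<Sum>j<m. (x j \<bullet> v)^2/(A + D j))"
 unfolding XtVX_eq_wgram wgram_quad by (simp add: power2_eq_square)

lemma Q_pos: "0 \<le> A \<Longrightarrow> v \<noteq> 0 \<Longrightarrow> 0 < v \<bullet> (Q A *v v)"
 unfolding XtVX_eq_wgram by (rule wgram_pos_def[OF rank]) (use t_pos in auto)

lemmas Q_inv = pos_def_invertible[OF Q_pos]

lemma Q_lower:
 assumes A: "0 \<le> A" shows "c*real m/(A + dm)*(norm v)^2 \<le> v \<bullet> (Q A *v v)"
proof -
 have p: "0 < A + dm" using A dm0 by simp
 have "c*real m/(A + dm)*(norm v)^2 \<le> (\<Sum>j<m. (x j \<bullet> v)^2)/(A + dm)"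
  using divide_right_mono[OF gram[of v], of "A + dm"] p by simp
 also have "\<dots> = (\<Sum>j<m. (x j \<bullet> v)^2/(A + dm))" by (rule sum_divide_distrib)
 also have "\<dots> \<le> (\<Sum>j<m. (x j \<bullet> v)^2/(A + D j))"
  by (intro sum_mono divide_left_mono mult_pos_pos) (use p t_pos[OF A] Dhi in auto)
 finally show ?thesis unfolding Q_quad .
qed

text \<open>Coercivity of \<open>Q\<close>, tested with the solution itself.\<close>

lemma norm_solve:
 assumes A: "0 \<le> A" and e: "Q A *v v = w"
 shows "norm v \<le> (A + dm)/(c*real m)*norm w"
proof (cases "v = 0")
 case True
 have "0 \<le> (A + dm)/(c*real m)*norm w" using A dm0 c mp by simp
 then show ?thesis using True by simp
next
 case False
 have p: "0 < A + dm" "0 < c*real m" using A dm0 c mp by auto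
 have "c*real m/(A + dm)*(norm v)^2 \<le> v \<bullet> w" using Q_lower[OF A, of v] e by simp
 also have "\<dots> \<le> norm v * norm w" by (rule norm_cauchy_schwarz)
 finally have k: "c*real m/(A + dm)*(norm v)^2 \<le> norm v * norm w" .
 have "k*norm v \<le> r" if "k*(norm v)^2 \<le> norm v * r" for k r
 proof -
  have "norm v * (k*norm v) \<le> norm v * r" using that by (simp add: power2_eq_square mult_ac)
  then show ?thesis using False by simp
 qed
 from this[OF k] show ?thesis using p by (simp add: field_simps)
qed

lemma inverse_lipschitz:
 assumes "0 \<le> A" "0 \<le> B" shows "\<bar>1/(A + D j) - 1/(B + D j)\<bar> \<le> \<bar>A - B\<bar>/d^2"
proof -
 have p: "d \<le> A + D j" "d \<le> B + D j" using assms t_ge by auto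
 have "1/(A + D j) - 1/(B + D j) = (B - A)/((A + D j)*(B + D j))" using p d by (simp add: field_simps)
 then have "\<bar>1/(A + D j) - 1/(B + D j)\<bar> = \<bar>A - B\<bar>/((A + D j)*(B + D j))"
  using p d by (simp add: abs_divide abs_mult abs_minus_commute)
 also have "\<dots> \<le> \<bar>A - B\<bar>/d^2" unfolding power2_eq_square
  by (intro divide_left_mono mult_mono mult_pos_pos) (use p d in auto)
 finally show ?thesis .
qed

lemma Q_diff_norm:
 assumes "0 \<le> A" "0 \<le> B" shows "norm (Q A *v v - Q B *v v) \<le> real m*X^2/d^2*\<bar>A - B\<bar>*norm v"
proof -
 have "Q A *v v - Q B *v v = (\<Sum>j<m. ((1/(A + D j) - 1/(B + D j))*(x j \<bullet> v)) *\<^sub>R x j)"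
  unfolding XtVX_eq_wgram wgram_mult sum_subtractf[symmetric]
  by (simp add: scaleR_diff_left[symmetric] left_diff_distrib)
 also have "norm \<dots> \<le> (\<Sum>j<m. \<bar>A - B\<bar>/d^2*(X*norm v)*X)"
 proof (rule order_trans[OF norm_sum sum_mono])
  fix j
  have "\<bar>x j \<bullet> v\<bar> \<le> X*norm v"
   by (rule order_trans[OF Cauchy_Schwarz_ineq2 mult_right_mono[OF X]]) simp
  then show "norm (((1/(A + D j) - 1/(B + D j))*(x j \<bullet> v)) *\<^sub>R x j) \<le> \<bar>A - B\<bar>/d^2*(X*norm v)*X"
   unfolding norm_scaleR abs_mult
   by (intro mult_mono inverse_lipschitz assms X) (use X0 d in auto)
 qed
 finally show ?thesis by (simp add: power2_eq_square mult_ac)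
qed

text \<open>Resolvent identity: the difference of the solutions solves an equation with
  \<open>Q A\<close> whose right side contains the difference of the two matrices applied to
  \<open>v'\<close>.\<close>

lemma Q_solve_lipschitz:
 assumes A: "0 \<le> A" "0 \<le> B" and e: "Q A *v v = w" "Q B *v v' = w'"
 shows "norm (v - v') \<le> (A + dm)/(c*real m)*(norm (w - w') + real m*X^2/d^2*\<bar>A - B\<bar>*norm v')"
proof -
 have "Q A *v (v - v') = (w - w') - (Q A *v v' - Q B *v v')"
  using e by (simp add: matrix_vector_mult_diff_distrib)
 from norm_solve[OF A(1) this]
 have "norm (v - v') \<le> (A + dm)/(c*real m)*norm ((w - w') - (Q A *v v' - Q B *v v'))" .
 also have "\<dots> \<le> (A + dm)/(c*real m)*(norm (w - w') + real m*X^2/d^2*\<bar>A - B\<bar>*norm v')"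
  by (intro mult_left_mono order_trans[OF norm_triangle_ineq4 add_left_mono] Q_diff_norm A)
   (use A dm0 c mp in auto)
 finally show ?thesis .
qed

lemma Qb: "0 \<le> A \<Longrightarrow> Q A *v b A = u 1 A"
 unfolding b_def by (rule Q_inv)

lemma beta_bar_eq:
 assumes A: "0 \<le> A" shows "beta_bar x D m (\<lambda>j. x j \<bullet> \<beta> + e j) A = \<beta> + b A"
proof -
 have "(\<Sum>j<m. ((x j \<bullet> \<beta> + e j)/(A + D j)) *\<^sub>R x j) = Q A *v \<beta> + u 1 A"
  unfolding XtVX_eq_wgram wgram_mult u_def sum.distrib[symmetric]
  by (simp add: add_divide_distrib scaleR_left_distrib)
 then show ?thesis
  by (simp add: beta_bar_def b_def matrix_vector_right_distrib Q_inv[OF A])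
qed

text \<open>The three forms are \<open>gls_decomposition\<close> at the minimiser, at a general
  point and at 0 (in coordinates centred at \<open>\<beta>\<close>). The minimality in the second
  one is what drives the derivative formula.\<close>

lemma yPy_e:
 assumes A: "0 \<le> A"
 shows "yPy x D m (\<lambda>j. x j \<bullet> \<beta> + e j) A = (\<Sum>j<m. (e j - x j \<bullet> b A)^2/(A + D j))" (is ?t1)
  and "yPy x D m (\<lambda>j. x j \<bullet> \<beta> + e j) A \<le> (\<Sum>j<m. (e j - x j \<bullet> v)^2/(A + D j))" (is ?t2)
  and "yPy x D m (\<lambda>j. x j \<bullet> \<beta> + e j) A = (\<Sum>j<m. (e j)^2/(A + D j)) - b A \<bullet> u 1 A" (is ?t3)
proof -
 have g: "(\<Sum>j<m. (e j - x j \<bullet> v)^2/(A + D j)) = yPy x D m (\<lambda>j. x j \<bullet> \<beta> + e j) A + (v - b A) \<bullet> (Q A *v (v - b A))" for v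
  using gls_decomposition[OF rank t_pos[OF A], of "\<lambda>j. x j \<bullet> \<beta> + e j" "\<beta> + v"]
  by (simp add: beta_bar_eq[OF A] inner_add_right)
 show ?t1 using g[of "b A"] by simp
 have "0 \<le> (v - b A) \<bullet> (Q A *v (v - b A))"
  using Q_pos[OF A, of "v - b A"] by (cases "v - b A = 0") auto
 then show ?t2 using g[of v] by simp
 have "(- b A) \<bullet> (Q A *v (- b A)) = b A \<bullet> u 1 A"
  using Qb[OF A] matrix_vector_mult_diff_distrib[of "Q A" 0 "b A"] by simp
 then show ?t3 using g[of 0] by simp
qed

lemma bu_nonneg: "0 \<le> A \<Longrightarrow> 0 \<le> b A \<bullet> u 1 A"
 using Q_pos[of A "b A"] by (cases "b A = 0") (auto simp: Qb)

lemma isCont_u: "0 \<le> A \<Longrightarrow> isCont (u k) A"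
 unfolding u_def using t_pos[of A] by (intro continuous_intros) (auto simp: less_imp_neq[symmetric])

lemma tendsto_b:
 assumes B: "0 < B" shows "isCont b B"
proof -
 let ?K = "(B + 1 + dm)/(c*real m)"
 have "(\<lambda>A. ?K*(norm (u 1 A - u 1 B) + real m*X^2/d^2*\<bar>A - B\<bar>*norm (b B))) \<midarrow>B\<rightarrow>
   ?K*(norm (u 1 B - u 1 B) + real m*X^2/d^2*\<bar>B - B\<bar>*norm (b B))"
  using isCont_u[of B 1] B unfolding isCont_def by (intro tendsto_intros) auto
 then have lim: "(\<lambda>A. ?K*(norm (u 1 A - u 1 B) + real m*X^2/d^2*\<bar>A - B\<bar>*norm (b B))) \<midarrow>B\<rightarrow> 0" by simp
 have "(\<lambda>A. b A - b B) \<midarrow>B\<rightarrow> 0"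
 proof (rule Lim_null_comparison[OF _ lim])
  have "\<forall>\<^sub>F A in at B. 0 < A \<and> A < B + 1"
   using B by (intro eventually_conj order_tendstoD[OF tendsto_ident_at]) auto
  then show "\<forall>\<^sub>F A in at B. norm (b A - b B) \<le> ?K*(norm (u 1 A - u 1 B) + real m*X^2/d^2*\<bar>A - B\<bar>*norm (b B))"
  proof eventually_elim
   case (elim A)
   have "norm (b A - b B) \<le> (A + dm)/(c*real m)*(norm (u 1 A - u 1 B) + real m*X^2/d^2*\<bar>A - B\<bar>*norm (b B))"
    by (rule Q_solve_lipschitz) (use elim B Qb in auto)
   also have "\<dots> \<le> ?K*(norm (u 1 A - u 1 B) + real m*X^2/d^2*\<bar>A - B\<bar>*norm (b B))"
    by (intro mult_right_mono divide_right_mono) (use elim c mp in auto)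
   finally show ?case .
  qed
 qed
 then show ?thesis unfolding isCont_def by (simp add: LIM_zero_iff)
qed

lemma isCont_W: "0 < A \<Longrightarrow> isCont W A"
 unfolding W_def using t_pos[of A] by (intro continuous_intros tendsto_b) (auto simp: less_imp_neq[symmetric])

text \<open>Envelope theorem: the minimiser \<open>b\<close> of the weighted sum of squares does not contribute to the derivative.\<close>

lemma yPy_deriv:
 assumes A: "0 < A"
 shows "(yPy x D m (\<lambda>j. x j \<bullet> \<beta> + e j) has_real_derivative - W A) (at A)"
proof -
 let ?y = "yPy x D m (\<lambda>j. x j \<bullet> \<beta> + e j)"
 \<comment> \<open>\<open>V B B'\<close> is minus the difference quotient, between \<open>A\<close>
   and \<open>B'\<close>, of the weighted sum of squares with the coefficient frozen at
   \<open>b B\<close>.\<close>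
 define V where "V B B' = (\<Sum>j<m. (e j - x j \<bullet> b B)^2/((A + D j)*(B' + D j)))" for B B'
 have ne: "A + D j \<noteq> 0" for j using t_pos[of A j] A by simp
 have 1: "(\<lambda>B. V A B) \<midarrow>A\<rightarrow> W A"
 proof -
  have "isCont (\<lambda>B. V A B) A" unfolding V_def using ne by (intro continuous_intros) auto
  moreover have "V A A = W A" by (simp add: V_def W_def power2_eq_square)
  ultimately show ?thesis unfolding isCont_def by simp
 qed
 have 2: "(\<lambda>B. V B B) \<midarrow>A\<rightarrow> W A"
 proof -
  have "isCont (\<lambda>B. V B B) A" unfolding V_def using ne by (intro continuous_intros tendsto_b A) auto
  moreover have "V A A = W A" by (simp add: V_def W_def power2_eq_square)
  ultimately show ?thesis unfolding isCont_def by simp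
 qed
 have lim: "(\<lambda>B. \<bar>V A B - W A\<bar> + \<bar>V B B - W A\<bar>) \<midarrow>A\<rightarrow> 0"
  using tendsto_add[OF tendsto_rabs_zero[OF LIM_zero[OF 1]] tendsto_rabs_zero[OF LIM_zero[OF 2]]] by simp
 have "(\<lambda>B. (?y B - ?y A)/(B - A) - (- W A)) \<midarrow>A\<rightarrow> 0"
 proof (rule Lim_null_comparison[OF _ lim])
  have "\<forall>\<^sub>F B in at A. 0 < B" using A by (intro order_tendstoD[OF tendsto_ident_at]) auto
  moreover have "\<forall>\<^sub>F B in at A. B \<noteq> A" by (simp add: eventually_at_filter)
  ultimately show "\<forall>\<^sub>F B in at A. norm ((?y B - ?y A)/(B - A) - (- W A)) \<le> \<bar>V A B - W A\<bar> + \<bar>V B B - W A\<bar>"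
  proof eventually_elim
   case (elim B)
   have df: "(\<Sum>j<m. (e j - x j \<bullet> v)^2/(B + D j)) - (\<Sum>j<m. (e j - x j \<bullet> v)^2/(A + D j))
     = - (B - A)*(\<Sum>j<m. (e j - x j \<bullet> v)^2/((A + D j)*(B + D j)))" for v
   proof -
    have "r/(B + D j) - r/(A + D j) = - (B - A)*(r/((A + D j)*(B + D j)))" for r j
     using t_pos[of A j] t_pos[of B j] A elim by (simp add: field_simps)
    then show ?thesis unfolding sum_subtractf[symmetric] sum_distrib_left by (intro sum.cong) auto
   qed
   \<comment> \<open>Each minimiser is only a competitor at the other point, so the increment lies
     between those with frozen \<open>b A\<close> and frozen \<open>b B\<close>; both quotients tend
     to \<open>- W A\<close>.\<close>
   have up: "?y B - ?y A \<le> - (B - A)*V A B"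
    using yPy_e(2)[of B \<beta> "b A"] yPy_e(1)[of A \<beta>] df[of "b A"] A elim by (simp add: V_def)
   have lw: "- (B - A)*V B B \<le> ?y B - ?y A"
    using yPy_e(2)[of A \<beta> "b B"] yPy_e(1)[of B \<beta>] df[of "b B"] A elim by (simp add: V_def)
   let ?q = "(?y B - ?y A)/(B - A)"
   have "(B - A)*?q = ?y B - ?y A" using elim by simp
   then have "(B - A)*(?q + V A B) \<le> 0" "0 \<le> (B - A)*(?q + V B B)"
    using up lw unfolding distrib_left minus_mult_left[symmetric] by linarith+
   then have "(?q + V A B \<le> 0 \<and> 0 \<le> ?q + V B B) \<or> (0 \<le> ?q + V A B \<and> ?q + V B B \<le> 0)"
    using elim by (auto simp: mult_le_0_iff zero_le_mult_iff)
   then show ?case by (auto simp: abs_if)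
  qed
 qed
 then have "(\<lambda>B. (?y B - ?y A)/(B - A)) \<midarrow>A\<rightarrow> - W A" by (simp only: LIM_zero_iff)
 then show ?thesis by (simp add: has_field_derivative_iff)
qed

lemma W_eq: "0 \<le> A \<Longrightarrow> W A = (\<Sum>j<m. (e j)^2/(A + D j)^2) - 2*(b A \<bullet> u 2 A) + (\<Sum>j<m. (x j \<bullet> b A)^2/(A + D j)^2)"
 by (simp add: W_def u_def inner_sum_right power2_diff diff_divide_distrib add_divide_distrib sum.distrib sum_subtractf
   sum_distrib_left mult_ac inner_commute)

section \<open>The log-determinant term of the score\<close>

definition gcb :: "('p \<Rightarrow> nat) \<Rightarrow> real \<Rightarrow> real" where "gcb f A = (\<Prod>k\<in>UNIV. 1/(A + D (f k)))"
definition scb :: "('p \<Rightarrow> nat) \<Rightarrow> nat \<Rightarrow> real \<Rightarrow> real" where "scb f i A = (\<Sum>k\<in>UNIV. 1/(A + D (f k))^i)"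
text \<open>\<open>gcb f\<close> is the weight of one Cauchy-Binet term of the determinant and
  \<open>scb f 1\<close> is minus its logarithmic derivative. Hence \<open>ld1\<close>, minus the
  derivative of the log-determinant, is an average of the bounded quantities \<open>scb f 1\<close>;
  no inverse matrix has to be differentiated.\<close>

definition ld1 :: "real \<Rightarrow> real" where
 "ld1 A = (\<Sum>f | \<forall>k. f k \<in> {..<m}. cb_coeff x f*(gcb f A * scb f 1 A))/det (Q A)"

lemma det_Q: "det (Q A) = (\<Sum>f | \<forall>k. f k \<in> {..<m}. cb_coeff x f*gcb f A)"
 by (simp add: XtVX_eq_wgram det_wgram gcb_def)

lemma det_Q_pos: "0 \<le> A \<Longrightarrow> 0 < det (Q A)"
proof -
 assume A: "0 \<le> A"
 show ?thesis
  by (rule nn_integral_gaussian_vec(2)[where x = 0 and y = 0 and f = "\<lambda>_. 0"])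
   (use Q_pos[OF A] in \<open>auto simp: XtVX_eq_wgram transpose_wgram\<close>)
qed

lemma gcb_pos: "0 \<le> A \<Longrightarrow> 0 < gcb f A"
 unfolding gcb_def by (intro prod_pos) (use t_pos in auto)

lemma scb_bounds: "0 \<le> A \<Longrightarrow> 0 \<le> scb f i A \<and> scb f i A \<le> CARD('p)/d^i"
proof -
 assume A: "0 \<le> A"
 have "scb f i A \<le> (\<Sum>k\<in>(UNIV::'p set). 1/d^i)" unfolding scb_def
  by (intro sum_mono divide_left_mono power_mono t_ge A mult_pos_pos zero_less_power) (use d t_pos[OF A] in auto)
 moreover have "0 \<le> scb f i A" unfolding scb_def by (intro sum_nonneg) (use t_pos[OF A] in \<open>auto simp: less_imp_le\<close>)
 ultimately show ?thesis by simp
qed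

lemma gcb_deriv: "0 < A \<Longrightarrow> (gcb f has_real_derivative - (gcb f A * scb f 1 A)) (at A)"
proof -
 assume A: "0 < A"
 have e: "gcb f B = exp (- (\<Sum>k\<in>UNIV. ln (B + D (f k))))" if "0 < B" for B
 proof -
  have "exp (- (\<Sum>k\<in>UNIV. ln (B + D (f k)))) = (\<Prod>k\<in>UNIV. exp (- ln (B + D (f k))))"
   by (simp add: exp_sum sum_negf[symmetric])
  also have "\<dots> = gcb f B" unfolding gcb_def
   by (intro prod.cong) (use t_pos[of B] that in \<open>auto simp: exp_minus inverse_eq_divide\<close>)
  finally show ?thesis by simp
 qed
 have "((\<lambda>B. exp (- (\<Sum>k\<in>UNIV. ln (B + D (f k))))) has_real_derivative exp (- (\<Sum>k\<in>UNIV. ln (A + D (f k))))*(- (\<Sum>k\<in>UNIV. 1/(A + D (f k))))) (at A)"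
  using t_pos[of A] A by (auto intro!: derivative_eq_intros sum.cong)
 then have "((\<lambda>B. exp (- (\<Sum>k\<in>UNIV. ln (B + D (f k))))) has_real_derivative - (gcb f A * scb f 1 A)) (at A)"
  by (simp add: e[OF A] scb_def)
 then show ?thesis
  by (rule has_field_derivative_transform_within_open[of _ _ _ "{0<..}"]) (use A e in auto)
qed

lemma scb_deriv: "0 < A \<Longrightarrow> (scb f 1 has_real_derivative - scb f 2 A) (at A)"
 unfolding scb_def using t_pos[of A]
 by (auto intro!: derivative_eq_intros simp: sum_negf[symmetric] power2_eq_square less_imp_neq[symmetric] intro!: sum.cong)

lemma ln_det_deriv: "0 < A \<Longrightarrow> ((\<lambda>A. ln (det (Q A))) has_real_derivative - ld1 A) (at A)"
proof -
 assume A: "0 < A"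
 have "((\<lambda>A. det (Q A)) has_real_derivative (\<Sum>f | \<forall>k. f k \<in> {..<m}. cb_coeff x f*- (gcb f A * scb f 1 A))) (at A)"
  unfolding det_Q by (intro DERIV_sum DERIV_cmult gcb_deriv A)
 then have "((\<lambda>A. ln (det (Q A))) has_real_derivative (1/det (Q A))*(\<Sum>f | \<forall>k. f k \<in> {..<m}. cb_coeff x f*- (gcb f A * scb f 1 A))) (at A)"
  by (intro DERIV_chain2[OF DERIV_ln_divide]) (use det_Q_pos[of A] A in simp)
 then show ?thesis by (simp add: ld1_def sum_negf)
qed

lemma ld1_bounds:
 assumes "0 \<le> A" shows "0 \<le> ld1 A \<and> ld1 A \<le> CARD('p)/d"
proof -
 let ?F = "{f::'p \<Rightarrow> nat. \<forall>k. f k \<in> {..<m}}"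
 have "(\<Sum>f\<in>?F. cb_coeff x f*(gcb f A * scb f 1 A)) \<le> (\<Sum>f\<in>?F. (CARD('p)/d)*(cb_coeff x f*gcb f A))"
 proof (rule sum_mono)
  fix f
  have "cb_coeff x f*gcb f A * scb f 1 A \<le> cb_coeff x f*gcb f A*(CARD('p)/d)"
   using scb_bounds[OF assms, of f 1] gcb_pos[OF assms, of f] cb_coeff_nonneg[of x f] by (intro mult_left_mono) auto
  then show "cb_coeff x f*(gcb f A * scb f 1 A) \<le> (CARD('p)/d)*(cb_coeff x f*gcb f A)" by (simp add: mult_ac)
 qed
 also have "\<dots> = (CARD('p)/d)*det (Q A)" unfolding det_Q sum_distrib_left ..
 finally have "ld1 A \<le> CARD('p)/d" unfolding ld1_def using det_Q_pos[OF assms] by (simp add: pos_divide_le_eq)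
 moreover have "0 \<le> ld1 A" unfolding ld1_def
  by (intro divide_nonneg_pos det_Q_pos assms sum_nonneg mult_nonneg_nonneg cb_coeff_nonneg)
   (use scb_bounds[OF assms] gcb_pos[OF assms] in \<open>auto simp: less_imp_le\<close>)
 ultimately show ?thesis by simp
qed

definition Cd :: real where "Cd = (CARD('p)/d)^2 + CARD('p)/d^2"

lemma Cd0: "0 \<le> Cd" by (simp add: Cd_def)

text \<open>The derivative of \<open>ld1\<close> is \<open>ld1^2\<close> minus the weighted mean of
  \<open>(scb f 1)^2 + scb f 2\<close>; both parts are nonnegative and at most \<open>Cd\<close>, so
  the mean value theorem applies.\<close>

lemma ld1_lipschitz:
 assumes "0 < A" "0 < B" shows "\<bar>ld1 A - ld1 B\<bar> \<le> Cd*\<bar>A - B\<bar>"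
proof -
 let ?F = "{f::'p \<Rightarrow> nat. \<forall>k. f k \<in> {..<m}}"
 define f2 where "f2 A = (\<Sum>f\<in>?F. cb_coeff x f*(gcb f A*((scb f 1 A)^2 + scb f 2 A)))" for A
 have der: "\<exists>g. (ld1 has_real_derivative g) (at A) \<and> \<bar>g\<bar> \<le> Cd" if A: "0 < A" for A
 proof -
  let ?n = "\<Sum>f\<in>?F. cb_coeff x f*(gcb f A * scb f 1 A)"
  have dp: "0 < det (Q A)" using det_Q_pos[of A] A by simp
  have d0: "((\<lambda>A. det (Q A)) has_real_derivative - ?n) (at A)"
   unfolding det_Q by (rule derivative_eq_intros gcb_deriv A refl)+ (simp add: sum_negf mult_ac)
  have d1: "((\<lambda>A. \<Sum>f\<in>?F. cb_coeff x f*(gcb f A * scb f 1 A)) has_real_derivative - f2 A) (at A)"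
   by (rule derivative_eq_intros gcb_deriv scb_deriv A refl)+
    (simp add: f2_def sum_negf[symmetric] algebra_simps power2_eq_square)
  have "(ld1 has_real_derivative (- f2 A*det (Q A) - ?n*- ?n)/(det (Q A)*det (Q A))) (at A)"
   unfolding ld1_def[abs_def] by (rule DERIV_divide[OF d1 d0]) (use dp in simp)
  moreover have "(- f2 A*det (Q A) - ?n*- ?n)/(det (Q A)*det (Q A)) = (ld1 A)^2 - f2 A/det (Q A)"
   using dp by (simp add: ld1_def field_simps power2_eq_square)
  ultimately have D: "(ld1 has_real_derivative (ld1 A)^2 - f2 A/det (Q A)) (at A)" by simp
  have A0: "0 \<le> A" using A by simp
  have "f2 A \<le> (\<Sum>f\<in>?F. Cd*(cb_coeff x f*gcb f A))" unfolding f2_def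
  proof (rule sum_mono)
   fix f
   have "(scb f 1 A)^2 + scb f 2 A \<le> Cd" unfolding Cd_def
    by (intro add_mono power_mono) (use scb_bounds[OF A0, of f 1] scb_bounds[OF A0, of f 2] in auto)
   then have "cb_coeff x f*gcb f A*((scb f 1 A)^2 + scb f 2 A) \<le> cb_coeff x f*gcb f A*Cd"
    using gcb_pos[OF A0, of f] cb_coeff_nonneg[of x f] by (intro mult_left_mono) auto
   then show "cb_coeff x f*(gcb f A*((scb f 1 A)^2 + scb f 2 A)) \<le> Cd*(cb_coeff x f*gcb f A)" by (simp add: mult_ac)
  qed
  also have "\<dots> = Cd*det (Q A)" unfolding det_Q sum_distrib_left ..
  finally have 1: "f2 A/det (Q A) \<le> Cd" using dp by (simp add: pos_divide_le_eq)
  have 2: "0 \<le> f2 A/det (Q A)" unfolding f2_def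
   by (intro divide_nonneg_pos dp sum_nonneg mult_nonneg_nonneg cb_coeff_nonneg add_nonneg_nonneg)
    (use scb_bounds[OF A0] gcb_pos[OF A0] in \<open>auto simp: less_imp_le\<close>)
  have "(ld1 A)^2 \<le> (CARD('p)/d)^2" using ld1_bounds[OF A0] by (intro power_mono) auto
  also have "\<dots> \<le> Cd" using d by (simp add: Cd_def)
  finally have "\<bar>(ld1 A)^2 - f2 A/det (Q A)\<bar> \<le> Cd" using 1 2 by (simp add: abs_le_iff)
   (meson add_increasing order_trans zero_le_power2 le_add_same_cancel1 diff_le_eq add_mono)
  with D show ?thesis by blast
 qed
 have main: "\<bar>ld1 B - ld1 A\<bar> \<le> Cd*(B - A)" if A: "0 < A" and AB: "A < B" for A B
 proof -
  have "\<exists>g. \<forall>A. 0 < A \<longrightarrow> (ld1 has_real_derivative g A) (at A) \<and> \<bar>g A\<bar> \<le> Cd" using der by metis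
  then obtain g where g: "\<And>A. 0 < A \<Longrightarrow> (ld1 has_real_derivative g A) (at A) \<and> \<bar>g A\<bar> \<le> Cd" by blast
  obtain z where z: "A < z" "z < B" "ld1 B - ld1 A = (B - A)*g z"
   using MVT2[OF AB, of ld1 g] g A by (metis less_le_trans)
  have "\<bar>ld1 B - ld1 A\<bar> = (B - A)*\<bar>g z\<bar>" using z AB by (simp add: abs_mult)
  also have "\<dots> \<le> (B - A)*Cd" using g[of z] z A AB by (intro mult_left_mono) auto
  finally show ?thesis by (simp add: mult.commute)
 qed
 show ?thesis
 proof (cases A B rule: linorder_cases)
  case less then show ?thesis using main[of A B] assms by (simp add: abs_minus_commute)
 next
  case greater then show ?thesis using main[of B A] assms by simp
 qed simp
qed

text \<open>The score of \<open>L_RE\<close>, in the usual form (y'PPy - tr P)/2.\<close>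

definition lp :: "real \<Rightarrow> real" where
 "lp A = 1/2*W A - 1/2*(\<Sum>j<m. 1/(A + D j)) + 1/2*ld1 A"

lemma L_RE_pos:
 assumes "0 \<le> A" shows "0 < L_RE x D m y A"
proof -
 have "0 < (\<Prod>j<m. A + D j)" by (intro prod_pos) (use t_pos[OF assms] in auto)
 then have 1: "0 < (\<Prod>j<m. A + D j) powr (-1/2)" by (simp only: powr_gt_zero)
 have 2: "0 < det (Q A) powr (-1/2)" using det_Q_pos[OF assms] by (simp only: powr_gt_zero)
 show ?thesis unfolding L_RE_eq by (rule mult_pos_pos[OF mult_pos_pos[OF 1 2] exp_gt_zero])
qed

lemma ln_L_RE:
 assumes "0 \<le> A"
 shows "ln (L_RE x D m y A) = - 1/2*(\<Sum>j<m. ln (A + D j)) - 1/2*ln (det (Q A)) - 1/2*yPy x D m y A"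
proof -
 have p: "0 < (\<Prod>j<m. A + D j)" by (intro prod_pos) (use t_pos[OF assms] in auto)
 have "ln (\<Prod>j<m. A + D j) = (\<Sum>j<m. ln (A + D j))" by (rule ln_prod) (auto simp: less_imp_neq[OF t_pos[OF assms], symmetric] t_pos[OF assms])
 moreover have "ln (P powr (-1/2)*q powr (-1/2)*exp E) = - 1/2*ln P - 1/2*ln q + E" if "0 < P" "0 < q" for P q E :: real
  using that by (simp add: ln_mult ln_powr)
 note this[OF p det_Q_pos[OF assms]]
 ultimately show ?thesis unfolding L_RE_eq by simp
qed

lemma ln_L_RE_deriv:
 assumes A: "0 < A"
 shows "((\<lambda>A. ln (L_RE x D m (\<lambda>j. x j \<bullet> \<beta> + e j) A)) has_real_derivative lp A) (at A)"
proof -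
 have s: "((\<lambda>A. \<Sum>j<m. ln (A + D j)) has_real_derivative (\<Sum>j<m. 1/(A + D j))) (at A)"
  using t_pos[of A] A by (auto intro!: derivative_eq_intros sum.cong)
 have "((\<lambda>A. - 1/2*(\<Sum>j<m. ln (A + D j)) - 1/2*ln (det (Q A)) - 1/2*yPy x D m (\<lambda>j. x j \<bullet> \<beta> + e j) A) has_real_derivative lp A) (at A)"
  by (rule derivative_eq_intros s ln_det_deriv yPy_deriv A refl)+ (simp add: lp_def)
 then show ?thesis
  by (rule has_field_derivative_transform_within_open[of _ _ _ "{0<..}"]) (use A ln_L_RE in auto)
qed

lemma continuous_lp:
 assumes "0 < lo" shows "continuous_on {lo..hi} lp"
proof -
 have W: "continuous_on {lo..hi} W"
  by (intro continuous_at_imp_continuous_on ballI isCont_W) (use assms in auto)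
 have l: "continuous_on {lo..hi} ld1"
 proof (rule continuous_on_subset[OF lipschitz_on_continuous_on])
  show "Cd-lipschitz_on {0<..} ld1"
   by (rule lipschitz_onI) (use ld1_lipschitz Cd0 in \<open>auto simp: dist_real_def\<close>)
 qed (use assms in auto)
 show ?thesis unfolding lp_def
  by (intro continuous_intros W l) (use assms t_pos in \<open>auto simp: less_imp_neq[symmetric]\<close>)
qed

end

section \<open>Increments of the score\<close>

lemma abs_mult_diff_le: "\<bar>a*b - a'*b'\<bar> \<le> \<bar>a - a'\<bar>*\<bar>b\<bar> + \<bar>a'\<bar>*\<bar>b - b'\<bar>" for a b a' b' :: real
proof -
 have "a*b - a'*b' = (a - a')*b + a'*(b - b')" by (simp add: algebra_simps)
 then show ?thesis using abs_triangle_ineq[of "(a - a')*b" "a'*(b - b')"] by (simp add: abs_mult)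
qed

context regression_sample
begin

lemma inverse_bounds: "0 \<le> A \<Longrightarrow> 0 < 1/(A + D j) \<and> 1/(A + D j) \<le> 1/d"
 using t_pos[of A j] t_ge[of A j] d by (auto intro!: divide_left_mono mult_pos_pos)

text \<open>Only the change of the weights is paid for with the sum of absolute errors; at the
  reference weights \<open>g0\<close> the cancellation in the noise sum is kept.\<close>

lemma weighted_sum_perturb:
 assumes S: "(\<Sum>j<m. \<bar>e j\<bar>) \<le> s" and g: "\<And>j. \<bar>g j - g0 j\<bar> \<le> \<eta>" and n: "norm (\<Sum>j<m. (e j*g0 j) *\<^sub>R x j) \<le> \<tau>"
 shows "norm (\<Sum>j<m. (e j*g j) *\<^sub>R x j) \<le> \<tau> + s*X*\<eta>"
proof -
 have e0: "0 \<le> \<eta>" using order_trans[OF abs_ge_zero g] .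
 have "(\<Sum>j<m. (e j*g j) *\<^sub>R x j) = (\<Sum>j<m. (e j*g0 j) *\<^sub>R x j) + (\<Sum>j<m. (e j*(g j - g0 j)) *\<^sub>R x j)"
  unfolding sum.distrib[symmetric] scaleR_left_distrib[symmetric] by (simp add: right_diff_distrib)
 also have "norm \<dots> \<le> \<tau> + (\<Sum>j<m. \<bar>e j\<bar>*(X*\<eta>))"
 proof (intro order_trans[OF norm_triangle_ineq] add_mono n order_trans[OF norm_sum] sum_mono)
  fix j
  show "norm ((e j*(g j - g0 j)) *\<^sub>R x j) \<le> \<bar>e j\<bar>*(X*\<eta>)"
   using mult_mono[OF g X, of j j] e0
   by (simp add: abs_mult mult.assoc mult_left_mono mult.commute[of X])
 qed
 also have "(\<Sum>j<m. \<bar>e j\<bar>*(X*\<eta>)) \<le> s*(X*\<eta>)"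
  unfolding sum_distrib_right[symmetric] by (rule mult_right_mono[OF S]) (use X0 e0 in simp)
 finally show ?thesis by simp
qed

definition kU :: real where "kU = 6*(1/d^2 + 1/d^3 + 1/d^4)*X"

text \<open>At \<open>A0\<close> the noise sums have size \<open>\<tau>\<close>, in the application
  far below the trivial order \<open>m\<close>; moving by \<open>r\<close> costs at most a multiple
  of \<open>s*r\<close>. Increments obey the same bound times \<open>\<bar>A - B\<bar>\<close>,
  because \<open>p - q = (B - A)*(p*q)\<close> turns them into noise sums with one more inverse
  weight; this is where \<open>k = 3\<close> at \<open>A0\<close> comes in.\<close>

lemma u_bounds:
 assumes A: "0 \<le> A" "0 \<le> B" "0 \<le> A0" and r: "\<bar>A - A0\<bar> \<le> r" "\<bar>B - A0\<bar> \<le> r"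
  and t: "\<And>k. k \<in> {1,2,3} \<Longrightarrow> norm (u k A0) \<le> \<tau>" and S: "(\<Sum>j<m. \<bar>e j\<bar>) \<le> s"
 defines "U \<equiv> 2*\<tau> + kU * s*r"
 shows "norm (u 1 A) \<le> U" "norm (u 2 A) \<le> U" "norm (u 1 A - u 1 B) \<le> U*\<bar>A - B\<bar>" "norm (u 2 A - u 2 B) \<le> U*\<bar>A - B\<bar>"
proof -
 define p q v where "p j = 1/(A + D j)" and "q j = 1/(B + D j)" and "v j = 1/(A0 + D j)" for j
 have r0: "0 \<le> r" using r by linarith
 have s0: "0 \<le> s" using order_trans[OF sum_nonneg S] by simp
 have t0: "0 \<le> \<tau>" using t[of 1] by (auto intro: order_trans[OF norm_ge_zero])
 have pb: "0 < p j \<and> p j \<le> 1/d" and qb: "0 < q j \<and> q j \<le> 1/d" and vb: "0 < v j \<and> v j \<le> 1/d" for j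
  using inverse_bounds A by (auto simp: p_def q_def v_def)
 have pv: "\<bar>p j - v j\<bar> \<le> r/d^2" and qv: "\<bar>q j - v j\<bar> \<le> r/d^2" for j
  using order_trans[OF inverse_lipschitz divide_right_mono[OF r(1)]] order_trans[OF inverse_lipschitz divide_right_mono[OF r(2)]] A
  by (auto simp: p_def q_def v_def)
 \<comment> \<open>Products of two and of three inverse weights stay close to their values at
   \<open>A0\<close>; each further factor contributes another \<open>1/d\<close>.\<close>
 have pr2: "\<bar>a*b - a'*b'\<bar> \<le> 2*(r/d^3)" if "\<bar>a - a'\<bar> \<le> r/d^2" "\<bar>b - b'\<bar> \<le> r/d^2" "0 < b" "b \<le> 1/d" "0 < a'" "a' \<le> 1/d" for a b a' b'
 proof -
  have "\<bar>a*b - a'*b'\<bar> \<le> \<bar>a - a'\<bar>*\<bar>b\<bar> + \<bar>a'\<bar>*\<bar>b - b'\<bar>" by (rule abs_mult_diff_le)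
  also have "\<dots> \<le> (r/d^2)*(1/d) + (1/d)*(r/d^2)" using that r0 d by (intro add_mono mult_mono) auto
  also have "\<dots> = 2*(r/d^3)" by (simp add: power2_eq_square power3_eq_cube)
  finally show ?thesis .
 qed
 have pr3: "\<bar>a*b - v j*(v j * v j)\<bar> \<le> 3*(r/d^4)" if "\<bar>a - v j\<bar> \<le> r/d^2" "\<bar>b - v j * v j\<bar> \<le> 2*(r/d^3)" "0 < b" "b \<le> 1/d^2" for a b j
 proof -
  have "\<bar>a*b - v j*(v j * v j)\<bar> \<le> \<bar>a - v j\<bar>*\<bar>b\<bar> + \<bar>v j\<bar>*\<bar>b - v j * v j\<bar>" by (rule abs_mult_diff_le)
  also have "\<dots> \<le> (r/d^2)*(1/d^2) + (1/d)*(2*(r/d^3))" using that r0 d vb[of j] by (intro add_mono mult_mono) auto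
  also have "\<dots> = 3*(r/d^4)" by (simp add: power2_eq_square power3_eq_cube power4_eq_xxxx)
  finally show ?thesis .
 qed
 have u1: "u k A = (\<Sum>j<m. (e j*p j^k) *\<^sub>R x j)" "u k B = (\<Sum>j<m. (e j*q j^k) *\<^sub>R x j)" "u k A0 = (\<Sum>j<m. (e j * v j^k) *\<^sub>R x j)" for k
  by (simp_all add: u_def p_def q_def v_def power_one_over)
 have kk: "n*(r/d^j)*(s*X) \<le> kU * s*r" if "0 \<le> n" "n \<le> 6" "j \<in> {2,3,4}" for n :: real and j
 proof -
  have "n*(1/d^j)*(s*X*r) \<le> (6*(1/d^2 + 1/d^3 + 1/d^4))*(s*X*r)"
   using that d s0 r0 X0 by (intro mult_right_mono mult_mono) auto
  then show ?thesis by (simp add: kU_def mult_ac)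
 qed
 have pp2: "0 < p j*p j \<and> p j*p j \<le> 1/d^2" "0 < p j*q j \<and> p j*q j \<le> 1/d^2" for j
  using mult_mono[of "p j" "1/d" "p j" "1/d"] mult_mono[of "p j" "1/d" "q j" "1/d"] pb[of j] qb[of j] d by (auto simp: power2_eq_square)
 have z1: "norm (\<Sum>j<m. (e j * v j) *\<^sub>R x j) \<le> \<tau>" "norm (\<Sum>j<m. (e j*(v j * v j)) *\<^sub>R x j) \<le> \<tau>" "norm (\<Sum>j<m. (e j*(v j*(v j * v j))) *\<^sub>R x j) \<le> \<tau>"
  using t[of 1] t[of 2] t[of 3] unfolding u1(3) by (simp_all add: power2_eq_square power3_eq_cube mult.assoc)
 have b2: "\<bar>p j*q j - v j * v j\<bar> \<le> 2*(r/d^3)" for j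
  by (rule pr2[OF pv qv]) (use qb vb in auto)
 have b3: "\<bar>p j*(p j*q j) - v j*(v j * v j)\<bar> \<le> 3*(r/d^4)" "\<bar>q j*(p j*q j) - v j*(v j * v j)\<bar> \<le> 3*(r/d^4)" for j
  using pr3[OF pv b2] pr3[OF qv b2] pp2 by blast+
 have "norm (u 1 A) \<le> \<tau> + s*X*(r/d^2)"
  unfolding u1 power_one_right by (rule weighted_sum_perturb[OF S pv z1(1)])
 then show "norm (u 1 A) \<le> U" using kk[of 1 2] t0 unfolding U_def by (simp add: mult_ac)
 have "norm (u 2 A) \<le> \<tau> + s*X*(2*(r/d^3))"
  unfolding u1 power2_eq_square by (rule weighted_sum_perturb[OF S _ z1(2)]) (rule pr2; use pv pb vb in auto)
 then show "norm (u 2 A) \<le> U" using kk[of 2 3] t0 unfolding U_def by (simp add: mult_ac)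
 have pq: "p j - q j = (B - A)*(p j*q j)" for j
  using t_pos[OF A(1), of j] t_pos[OF A(2), of j] by (simp add: p_def q_def field_simps)
 have "u 1 A - u 1 B = (B - A) *\<^sub>R (\<Sum>j<m. (e j*(p j*q j)) *\<^sub>R x j)"
 proof -
  have "u 1 A - u 1 B = (\<Sum>j<m. (e j*(p j - q j)) *\<^sub>R x j)"
   unfolding u1 power_one_right by (simp add: sum_subtractf[symmetric] scaleR_left_diff_distrib[symmetric] right_diff_distrib)
  then show ?thesis unfolding pq scaleR_sum_right by (simp add: mult_ac)
 qed
 moreover have "norm (\<Sum>j<m. (e j*(p j*q j)) *\<^sub>R x j) \<le> \<tau> + s*X*(2*(r/d^3))"
  by (rule weighted_sum_perturb[OF S _ z1(2)]) (rule pr2; use pv qv qb vb in auto)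
 moreover have "\<tau> + s*X*(2*(r/d^3)) \<le> U" using kk[of 2 3] t0 unfolding U_def by (simp add: mult_ac)
 moreover have "norm (r *\<^sub>R w) \<le> V*\<bar>r\<bar>" if "norm w \<le> V'" "V' \<le> V" for r V V' :: real and w :: "real^'p"
  using mult_left_mono[of "norm w" V "\<bar>r\<bar>"] that by (simp add: mult.commute[of V])
 ultimately show "norm (u 1 A - u 1 B) \<le> U*\<bar>A - B\<bar>"
  unfolding abs_minus_commute[of A B] by presburger
 have "u 2 A - u 2 B = (B - A) *\<^sub>R ((\<Sum>j<m. (e j*(p j*(p j*q j))) *\<^sub>R x j) + (\<Sum>j<m. (e j*(q j*(p j*q j))) *\<^sub>R x j))"
 proof -
  have "p j^2 - q j^2 = (B - A)*(p j*(p j*q j) + q j*(p j*q j))" for j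
  proof -
   have "p j^2 - q j^2 = (p j - q j)*(p j + q j)" by (simp add: power2_eq_square algebra_simps)
   then show ?thesis unfolding pq by (simp add: algebra_simps)
  qed
  note h = this
  have "u 2 A - u 2 B = (\<Sum>j<m. (e j*(p j^2 - q j^2)) *\<^sub>R x j)"
   unfolding u1 by (simp add: sum_subtractf[symmetric] scaleR_left_diff_distrib[symmetric] right_diff_distrib)
  then show ?thesis unfolding h sum.distrib[symmetric] scaleR_sum_right
   by (simp add: scaleR_left_distrib[symmetric] distrib_left mult_ac)
 qed
 moreover have "norm (\<Sum>j<m. (e j*(p j*(p j*q j))) *\<^sub>R x j) \<le> \<tau> + s*X*(3*(r/d^4))"
  by (rule weighted_sum_perturb[OF S b3(1) z1(3)])
 moreover have "norm (\<Sum>j<m. (e j*(q j*(p j*q j))) *\<^sub>R x j) \<le> \<tau> + s*X*(3*(r/d^4))"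
  by (rule weighted_sum_perturb[OF S b3(2) z1(3)])
 moreover have "(\<tau> + s*X*(3*(r/d^4))) + (\<tau> + s*X*(3*(r/d^4))) \<le> U"
  using kk[of 6 4] unfolding U_def by (simp add: mult_ac)
 moreover have "norm (r *\<^sub>R (w + w')) \<le> V*\<bar>r\<bar>" if "norm w \<le> V'" "norm w' \<le> V'" "V' + V' \<le> V" for r V V' :: real and w w' :: "real^'p"
 proof -
  have "norm (w + w') \<le> V" using that norm_triangle_ineq[of w w'] by linarith
  then show ?thesis using mult_left_mono[of "norm (w + w')" V "\<bar>r\<bar>"] by (simp add: mult.commute[of V])
 qed
 ultimately show "norm (u 2 A - u 2 B) \<le> U*\<bar>A - B\<bar>"
  unfolding abs_minus_commute[of A B] by presburger
qed

text \<open>\<open>k0 hi/m\<close> bounds the inverse of \<open>Q\<close> on \<open>{0..hi}\<close>,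
  \<open>k1\<close> enters the Lipschitz constant of solutions of linear equations with
  \<open>Q\<close>, and \<open>k2\<close> is the resulting constant in \<open>W_diff\<close>; all
  three are free of \<open>m\<close>.\<close>

definition k0 :: "real \<Rightarrow> real" where "k0 hi = (hi + dm)/c"
definition k1 :: "real \<Rightarrow> real" where "k1 hi = k0 hi*(1 + X^2/d^2*k0 hi)"
definition k2 :: "real \<Rightarrow> real" where "k2 hi = 2*(k1 hi + k0 hi) + 2*X^2/d^2*k0 hi*k1 hi + 2*X^2/d^3*(k0 hi)^2"

lemma k_nonneg: "0 \<le> hi \<Longrightarrow> 0 \<le> k0 hi" "0 \<le> hi \<Longrightarrow> 0 \<le> k1 hi" "0 \<le> hi \<Longrightarrow> 0 \<le> k2 hi"
proof -
 assume h: "0 \<le> hi"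
 show 0: "0 \<le> k0 hi" using h dm0 c by (simp add: k0_def)
 show 1: "0 \<le> k1 hi" using 0 by (simp add: k1_def)
 show "0 \<le> k2 hi" using 0 1 d by (simp add: k2_def)
qed

lemma solve_bounds:
 assumes A: "0 \<le> A" "A \<le> hi" "0 \<le> B" "B \<le> hi" and e: "Q A *v v = w" "Q B *v v' = w'"
  and U: "norm w' \<le> U" "norm (w - w') \<le> U*\<bar>A - B\<bar>"
 shows "norm v' \<le> k0 hi*U/m" "norm (v - v') \<le> k1 hi*U*\<bar>A - B\<bar>/m"
proof -
 have U0: "0 \<le> U" using U(1) norm_ge_zero order_trans by blast
 have kA: "(A + dm)/(c*real m) \<le> k0 hi/m" "(B + dm)/(c*real m) \<le> k0 hi/m"
  using A c mp by (auto simp: k0_def divide_right_mono)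
 have k0: "0 \<le> k0 hi" using A k_nonneg by auto
 have "norm v' \<le> (B + dm)/(c*real m)*norm w'" by (rule norm_solve[OF A(3) e(2)])
 also have "\<dots> \<le> k0 hi/m*U" by (rule mult_mono[OF kA(2) U(1)]) (use k0 mp in auto)
 finally show 1: "norm v' \<le> k0 hi*U/m" by simp
 have "norm (v - v') \<le> (A + dm)/(c*real m)*(norm (w - w') + real m*X^2/d^2*\<bar>A - B\<bar>*norm v')"
  by (rule Q_solve_lipschitz[OF A(1,3) e])
 also have "\<dots> \<le> k0 hi/m*(U*\<bar>A - B\<bar> + real m*X^2/d^2*\<bar>A - B\<bar>*(k0 hi*U/m))"
  by (intro mult_mono kA add_mono U mult_left_mono 1) (use k0 mp in auto)
 also have "\<dots> = k1 hi*U*\<bar>A - B\<bar>/m" using mp by (simp add: k1_def distrib_left distrib_right add_divide_distrib mult_ac)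
 finally show "norm (v - v') \<le> k1 hi*U*\<bar>A - B\<bar>/m" .
qed

text \<open>\<open>b\<close> has size \<open>U/m\<close>, so the estimation of beta changes the
  increments of \<open>W\<close> only by a multiple of
  \<open>U^2/m*\<bar>A - B\<bar>\<close>.\<close>

lemma W_diff:
 assumes A: "0 \<le> A" "A \<le> hi" "0 \<le> B" "B \<le> hi"
  and U: "norm (u 1 A) \<le> U" "norm (u 1 B) \<le> U" "norm (u 2 A) \<le> U" "norm (u 1 A - u 1 B) \<le> U*\<bar>A - B\<bar>" "norm (u 2 A - u 2 B) \<le> U*\<bar>A - B\<bar>"
 shows "\<bar>W A - W B - (\<Sum>j<m. (e j)^2*(1/(A + D j)^2 - 1/(B + D j)^2))\<bar> \<le> k2 hi*U^2/m*\<bar>A - B\<bar>"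
proof -
 let ?s = "\<bar>A - B\<bar>"
 have U0: "0 \<le> U" using U(1) norm_ge_zero order_trans by blast
 note sb = solve_bounds[OF A Qb[OF A(1)] Qb[OF A(3)] U(2) U(4)]
 have bA: "norm (b A) \<le> k0 hi*U/m"
  by (rule solve_bounds(1)[OF A(3,4,1,2) Qb[OF A(3)] Qb[OF A(1)] U(1)]) (use U(4) in \<open>simp add: norm_minus_commute abs_minus_commute\<close>)
 have k: "0 \<le> k0 hi" "0 \<le> k1 hi" using A k_nonneg by auto
 have i1: "\<bar>b A \<bullet> u 2 A - b B \<bullet> u 2 B\<bar> \<le> (k1 hi + k0 hi)*U^2/m*?s"
 proof -
  have eq: "b A \<bullet> u 2 A - b B \<bullet> u 2 B = (b A - b B) \<bullet> u 2 A + b B \<bullet> (u 2 A - u 2 B)" by (simp add: inner_diff_left inner_diff_right)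
  have "\<bar>b A \<bullet> u 2 A - b B \<bullet> u 2 B\<bar> \<le> norm (b A - b B)*norm (u 2 A) + norm (b B)*norm (u 2 A - u 2 B)"
   unfolding eq by (rule order_trans[OF abs_triangle_ineq add_mono[OF Cauchy_Schwarz_ineq2 Cauchy_Schwarz_ineq2]])
  also have "\<dots> \<le> (k1 hi*U*?s/m)*U + (k0 hi*U/m)*(U*?s)"
   by (intro add_mono mult_mono sb U) (use k U0 mp in auto)
  also have "\<dots> = (k1 hi + k0 hi)*U^2/m*?s"
   by (simp add: power2_eq_square distrib_left distrib_right add_divide_distrib mult_ac)
  finally show ?thesis .
 qed
 have i2: "\<bar>(\<Sum>j<m. (x j \<bullet> b A)^2/(A + D j)^2) - (\<Sum>j<m. (x j \<bullet> b B)^2/(B + D j)^2)\<bar> \<le>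
   (2*X^2/d^2*k0 hi*k1 hi + 2*X^2/d^3*(k0 hi)^2)*U^2/m*?s"
 proof -
  let ?T = "(2*X^2/d^2*k0 hi*k1 hi + 2*X^2/d^3*(k0 hi)^2)*U^2/(real m)^2*?s"
  have "\<bar>(x j \<bullet> b A)^2/(A + D j)^2 - (x j \<bullet> b B)^2/(B + D j)^2\<bar> \<le> ?T" for j
  proof -
   let ?p = "1/(A + D j)" and ?q = "1/(B + D j)"
   let ?a = "x j \<bullet> b A" and ?b = "x j \<bullet> b B"
   have p: "0 < ?p" "?p \<le> 1/d" "0 < ?q" "?q \<le> 1/d" using inverse_bounds A by auto
   have xb: "\<bar>x j \<bullet> w\<bar> \<le> X*r" if "norm w \<le> r" for w r
    by (rule order_trans[OF Cauchy_Schwarz_ineq2 mult_mono[OF X that X0]]) simp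
   have ab: "\<bar>?a\<bar> \<le> X*(k0 hi*U/m)" "\<bar>?b\<bar> \<le> X*(k0 hi*U/m)" "\<bar>?a - ?b\<bar> \<le> X*(k1 hi*U*?s/m)"
    unfolding inner_diff_right[symmetric] using xb[OF bA] xb[OF sb(1)] xb[OF sb(2)] by blast+
   have "\<bar>?a^2 - ?b^2\<bar> = \<bar>?a - ?b\<bar>*\<bar>?a + ?b\<bar>" by (simp add: abs_mult[symmetric] power2_eq_square algebra_simps)
   also have "\<dots> \<le> (X*(k1 hi*U*?s/m))*(X*(k0 hi*U/m) + X*(k0 hi*U/m))"
    by (intro mult_mono ab order_trans[OF abs_triangle_ineq add_mono]) (use X0 k U0 mp in auto)
   finally have d1: "\<bar>?a^2 - ?b^2\<bar> \<le> (X*(k1 hi*U*?s/m))*(X*(k0 hi*U/m) + X*(k0 hi*U/m))" .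
   have "\<bar>?p^2 - ?q^2\<bar> = \<bar>?p - ?q\<bar>*\<bar>?p + ?q\<bar>" by (simp only: abs_mult[symmetric] power2_eq_square) (simp only: algebra_simps)
   also have "\<dots> \<le> (?s/d^2)*(1/d + 1/d)"
    by (intro mult_mono inverse_lipschitz A) (use p in auto)
   finally have d2: "\<bar>?p^2 - ?q^2\<bar> \<le> (?s/d^2)*(1/d + 1/d)" .
   have b2: "?b^2 \<le> (X*(k0 hi*U/m))^2" using power_mono[OF ab(2), of 2] by simp
   have p2: "?p^2 \<le> (1/d)^2" using p by (intro power_mono) auto
   have "\<bar>?a^2*?p^2 - ?b^2*?q^2\<bar> \<le> \<bar>?a^2 - ?b^2\<bar>*\<bar>?p^2\<bar> + \<bar>?b^2\<bar>*\<bar>?p^2 - ?q^2\<bar>" by (rule abs_mult_diff_le)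
   also have "\<dots> \<le> (X*(k1 hi*U*?s/m))*(X*(k0 hi*U/m) + X*(k0 hi*U/m))*(1/d)^2 + (X*(k0 hi*U/m))^2*((?s/d^2)*(1/d + 1/d))"
    by (intro add_mono mult_mono d1 d2) (use b2 p2 X0 k U0 mp in auto)
   also have "\<dots> = ?T" using d mp by (simp add: power2_eq_square power3_eq_cube field_simps)
   finally show ?thesis by (simp add: power_one_over divide_inverse power_inverse)
  qed
  then have "\<bar>(\<Sum>j<m. (x j \<bullet> b A)^2/(A + D j)^2) - (\<Sum>j<m. (x j \<bullet> b B)^2/(B + D j)^2)\<bar> \<le> (\<Sum>j<m. ?T)"
   unfolding sum_subtractf[symmetric] by (intro order_trans[OF sum_abs sum_mono]) auto
  also have "\<dots> = (2*X^2/d^2*k0 hi*k1 hi + 2*X^2/d^3*(k0 hi)^2)*U^2/m*?s"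
   using mp by (simp add: power2_eq_square)
  finally show ?thesis .
 qed
 have eq: "W A - W B - (\<Sum>j<m. (e j)^2*(1/(A + D j)^2 - 1/(B + D j)^2)) =
  - 2*(b A \<bullet> u 2 A - b B \<bullet> u 2 B) + ((\<Sum>j<m. (x j \<bullet> b A)^2/(A + D j)^2) - (\<Sum>j<m. (x j \<bullet> b B)^2/(B + D j)^2))"
  unfolding W_eq[OF A(1)] W_eq[OF A(3)] by (simp add: right_diff_distrib sum_subtractf)
 have "\<bar>W A - W B - (\<Sum>j<m. (e j)^2*(1/(A + D j)^2 - 1/(B + D j)^2))\<bar> \<le> 2*((k1 hi + k0 hi)*U^2/m*?s) + (2*X^2/d^2*k0 hi*k1 hi + 2*X^2/d^3*(k0 hi)^2)*U^2/m*?s"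
  unfolding eq by (intro order_trans[OF abs_triangle_ineq] add_mono i2) (use i1 in \<open>simp add: abs_mult\<close>)
 also have "\<dots> = k2 hi*U^2/m*?s"
 proof -
  have "2*(P*W/M*S) + (a + b)*W/M*S = (2*P + a + b)*W/M*S" for P W M S a b :: real
   by (simp add: distrib_right add_divide_distrib)
  then show ?thesis unfolding k2_def by this
 qed
 finally show ?thesis .
qed

text \<open>Minus the derivative in \<open>B\<close> of half the sum of
  \<open>(e j)^2/(B + D j)^2 - 1/(B + D j)\<close>, which is the score for known beta.\<close>

definition info :: "real \<Rightarrow> real" where
 "info B = 1/2*(\<Sum>j<m. 2*(e j)^2/(B + D j)^3 - 1/(B + D j)^2)"

text \<open>The second derivative of the same score, hence a third derivative of a
  log-likelihood.\<close>

definition third :: "real \<Rightarrow> real" where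
 "third B = (\<Sum>j<m. 3*(e j)^2/(B + D j)^4 - 1/(B + D j)^3)"

text \<open>The score for known beta is expanded to second order with exact cubic remainders. The
  estimation of beta is covered by \<open>W_diff\<close> and the log-determinant by
  \<open>ld1_lipschitz\<close>; for these, bounds of first order in \<open>\<bar>A - B\<bar>\<close>
  are enough.\<close>

lemma lp_expansion:
 assumes A: "0 < A" "A \<le> hi" "0 < B" "B \<le> hi"
  and U: "norm (u 1 A) \<le> U" "norm (u 1 B) \<le> U" "norm (u 2 A) \<le> U" "norm (u 1 A - u 1 B) \<le> U*\<bar>A - B\<bar>" "norm (u 2 A - u 2 B) \<le> U*\<bar>A - B\<bar>"
 shows "\<bar>lp A - lp B + info B*(A - B) - third B/2*(A - B)^2\<bar> \<le>
  (2/d^5*(\<Sum>j<m. (e j)^2) + 1/(2*d^4)*real m)*\<bar>A - B\<bar>^3 + (k2 hi*U^2/m + Cd)*\<bar>A - B\<bar>"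
proof -
 define s where "s = A - B"
 have A0: "0 \<le> A" "0 \<le> B" using A by auto
 have wd: "\<bar>W A - W B - (\<Sum>j<m. (e j)^2*(1/(A + D j)^2 - 1/(B + D j)^2))\<bar> \<le> k2 hi*U^2/m*\<bar>s\<bar>"
  unfolding s_def by (rule W_diff[OF A0(1) A(2) A0(2) A(4) U])
 have ld: "\<bar>ld1 A - ld1 B\<bar> \<le> Cd*\<bar>s\<bar>" unfolding s_def by (rule ld1_lipschitz[OF A(1,3)])
 have t1: "\<bar>1/(A + D j)^2 - 1/(B + D j)^2 + 2 * s/(B + D j)^3 - 3 * s^2/(B + D j)^4\<bar> \<le> 4/d^5*\<bar>s\<bar>^3" for j
 proof -
  obtain p q where p: "p = 1/(A + D j)" and q: "q = 1/(B + D j)" by simp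
  have pb: "0 < p" "p \<le> 1/d" "0 < q" "q \<le> 1/d" using inverse_bounds[OF A0(1), of j] inverse_bounds[OF A0(2), of j] p q by auto
  have rel: "p*q * s = q - p" using t_pos[OF A0(1), of j] t_pos[OF A0(2), of j] unfolding p q s_def by (simp add: field_simps)
  have e1: "p - q = - (p*q * s)" using rel by simp
  \<comment> \<open>The remainder is found by substituting \<open>p = q - p*q * s\<close>
    repeatedly, each time trading one factor \<open>p\<close> for \<open>q\<close>; the numbered
    identities are the instances.\<close>
  have "p^2 - q^2 + 2 * s*q^3 - 3 * s^2*q^4 = - (s^3*(q^3*p^2 + 3*(q^4*p)))"
  proof -
   have pe: "p = q - p*q * s" using rel by simp
   have 1: "p^2 = q*p - p^2*q * s" using arg_cong[OF pe, of "\<lambda>t. t*p"] by (simp add: power2_eq_square algebra_simps)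
   have 2: "p*q = q^2 - p*q^2 * s" using arg_cong[OF pe, of "\<lambda>t. t*q"] by (simp add: power2_eq_square algebra_simps)
   have 3: "p*q^2 = q^3 - p*q^3 * s" using arg_cong[OF pe, of "\<lambda>t. t*q^2"] by (simp add: power2_eq_square power3_eq_cube algebra_simps)
   have 4: "p*q^3 = q^4 - p*q^4 * s" using arg_cong[OF pe, of "\<lambda>t. t*q^3"] by (simp add: power4_eq_xxxx power3_eq_cube algebra_simps)
   have 5: "p^2*q = p*q^2 - p^2*q^2 * s" using arg_cong[OF 1, of "\<lambda>t. t*q"] by (simp add: power2_eq_square algebra_simps)
   have 6: "p^2*q^2 = p*q^3 - p^2*q^3 * s" using arg_cong[OF 5, of "\<lambda>t. t*q"] by (simp add: power2_eq_square power3_eq_cube algebra_simps)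
   have "p^2 = q^2 - p*q^2 * s - p^2*q * s" using 1 2 by (simp add: mult_ac)
   also have "\<dots> = q^2 - 2*(p*q^2) * s + p^2*q^2 * s^2" unfolding 5 by (simp add: power2_eq_square algebra_simps)
   also have "\<dots> = q^2 - 2*q^3 * s + 2*(p*q^3) * s^2 + p^2*q^2 * s^2" unfolding 3 by (simp add: power2_eq_square algebra_simps)
   also have "\<dots> = q^2 - 2*q^3 * s + 3*(p*q^3) * s^2 - p^2*q^3 * s^3" unfolding 6 by (simp add: power2_eq_square power3_eq_cube algebra_simps)
   also have "\<dots> = q^2 - 2*q^3 * s + 3*q^4 * s^2 - 3*(p*q^4) * s^3 - p^2*q^3 * s^3" unfolding 4 by (simp add: power2_eq_square power3_eq_cube algebra_simps)
   finally show ?thesis by (simp add: algebra_simps)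
  qed
  then have "\<bar>p^2 - q^2 + 2 * s*q^3 - 3 * s^2*q^4\<bar> = \<bar>s\<bar>^3*(q^3*p^2 + 3*(q^4*p))"
   using pb by (simp add: abs_mult power_abs)
  also have "\<dots> \<le> \<bar>s\<bar>^3*((1/d)^3*(1/d)^2 + 3*((1/d)^4*(1/d)))"
   using pb d by (intro mult_left_mono add_mono mult_mono power_mono) auto
  also have "\<dots> = 4/d^5*\<bar>s\<bar>^3"
  proof -
   have "i^3*i^2 + 3*(i^4*i) = 4*i^5" for i :: real by (simp add: eval_nat_numeral)
   from this[of "1/d"] show ?thesis by (simp add: power_one_over)
  qed
  finally show ?thesis unfolding p q by (simp add: power_one_over divide_inverse power_inverse)
 qed
 have t2: "\<bar>1/(A + D j) - 1/(B + D j) + s/(B + D j)^2 - s^2/(B + D j)^3\<bar> \<le> 1/d^4*\<bar>s\<bar>^3" for j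
 proof -
  obtain p q where p: "p = 1/(A + D j)" and q: "q = 1/(B + D j)" by simp
  have pb: "0 < p" "p \<le> 1/d" "0 < q" "q \<le> 1/d" using inverse_bounds[OF A0(1), of j] inverse_bounds[OF A0(2), of j] p q by auto
  have rel: "p*q * s = q - p" using t_pos[OF A0(1), of j] t_pos[OF A0(2), of j] unfolding p q s_def by (simp add: field_simps)
  have "p - q + s*q^2 - s^2*q^3 = - (s^3*(q^3*p))"
  proof -
   have pe: "p = q - p*q * s" using rel by simp
   have 2: "p*q = q^2 - p*q^2 * s" using arg_cong[OF pe, of "\<lambda>t. t*q"] by (simp add: power2_eq_square algebra_simps)
   have 3: "p*q^2 = q^3 - p*q^3 * s" using arg_cong[OF pe, of "\<lambda>t. t*q^2"] by (simp add: power2_eq_square power3_eq_cube algebra_simps)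
   have "p = q - p*q * s" by (rule pe)
   also have "\<dots> = q - q^2 * s + p*q^2 * s^2" unfolding 2 by (simp add: power2_eq_square algebra_simps)
   also have "\<dots> = q - q^2 * s + q^3 * s^2 - p*q^3 * s^3" unfolding 3 by (simp add: power2_eq_square power3_eq_cube algebra_simps)
   finally show ?thesis by (simp add: algebra_simps)
  qed
  then have "\<bar>p - q + s*q^2 - s^2*q^3\<bar> = \<bar>s\<bar>^3*(q^3*p)"
   using pb by (simp add: abs_mult power_abs)
  also have "\<dots> \<le> \<bar>s\<bar>^3*((1/d)^3*(1/d))"
   using pb d by (intro mult_left_mono mult_mono power_mono) auto
  also have "\<dots> = 1/d^4*\<bar>s\<bar>^3" using d by (simp add: power3_eq_cube power4_eq_xxxx)
  finally show ?thesis unfolding p q by (simp add: power_one_over divide_inverse power_inverse)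
 qed
 define R1 where "R1 = (\<Sum>j<m. (e j)^2*(1/(A + D j)^2 - 1/(B + D j)^2 + 2 * s/(B + D j)^3 - 3 * s^2/(B + D j)^4))"
 define R2 where "R2 = (\<Sum>j<m. 1/(A + D j) - 1/(B + D j) + s/(B + D j)^2 - s^2/(B + D j)^3)"
 have R1: "\<bar>R1\<bar> \<le> 4/d^5*\<bar>s\<bar>^3*(\<Sum>j<m. (e j)^2)"
  unfolding R1_def sum_distrib_left
 proof (intro order_trans[OF sum_abs sum_mono])
  fix j
  show "\<bar>(e j)^2*(1/(A + D j)^2 - 1/(B + D j)^2 + 2 * s/(B + D j)^3 - 3 * s^2/(B + D j)^4)\<bar> \<le> 4/d^5*\<bar>s\<bar>^3*(e j)^2"
   using mult_right_mono[OF t1[of j], of "(e j)^2"] by (simp only: abs_mult mult.commute[of "(e j)^2"]) simp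
 qed
 have R2: "\<bar>R2\<bar> \<le> 1/d^4*\<bar>s\<bar>^3*real m"
 proof -
  have "\<bar>R2\<bar> \<le> (\<Sum>j<m. 1/d^4*\<bar>s\<bar>^3)" unfolding R2_def by (intro order_trans[OF sum_abs sum_mono] t2)
  then show ?thesis by (simp add: mult.commute)
 qed
 have eq: "lp A - lp B + info B * s - third B/2 * s^2 =
   1/2*(W A - W B - (\<Sum>j<m. (e j)^2*(1/(A + D j)^2 - 1/(B + D j)^2))) + 1/2*(ld1 A - ld1 B) + 1/2*R1 - 1/2*R2"
 proof -
  obtain S12 S3 S4 S5 S6 where S: "S12 = (\<Sum>j<m. (e j)^2*(1/(A + D j)^2 - 1/(B + D j)^2))"
   "S3 = (\<Sum>j<m. (e j)^2*(2 * s/(B + D j)^3))" "S4 = (\<Sum>j<m. (e j)^2*(3 * s^2/(B + D j)^4))"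
   "S5 = (\<Sum>j<m. s/(B + D j)^2)" "S6 = (\<Sum>j<m. s^2/(B + D j)^3)" by blast
  have i: "info B * s = 1/2*(S3 - S5)"
   unfolding info_def S sum_subtractf[symmetric] mult.assoc sum_distrib_right
   by (intro arg_cong[of _ _ "\<lambda>t. 1/2*t"] sum.cong) (auto simp: left_diff_distrib)
  have t: "third B/2 * s^2 = 1/2*(S4 - S6)"
  proof -
   have "third B * s^2 = S4 - S6"
    unfolding third_def S sum_subtractf[symmetric] sum_distrib_right
    by (intro sum.cong) (auto simp: left_diff_distrib)
   then show ?thesis by simp
  qed
  have R1e: "R1 = S12 + S3 - S4" unfolding R1_def S sum.distrib[symmetric] sum_subtractf[symmetric]
   by (intro sum.cong) (auto simp: distrib_left right_diff_distrib)
  have R2e: "R2 = (\<Sum>j<m. 1/(A + D j)) - (\<Sum>j<m. 1/(B + D j)) + S5 - S6"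
   unfolding R2_def S by (simp only: sum.distrib sum_subtractf)
  have "1/2*w - 1/2*a + 1/2*l - (1/2*w' - 1/2*b + 1/2*l') + 1/2*(s3 - s5) - 1/2*(s4 - s6) =
   1/2*(w - w' - s12) + 1/2*(l - l') + 1/2*(s12 + s3 - s4) - 1/2*(a - b + s5 - s6)" for w a l w' b l' s3 s4 s5 s6 s12 :: real
   by (simp add: field_simps)
  then show ?thesis unfolding lp_def R1e R2e i t S(1)[symmetric] by blast
 qed
 have "\<bar>lp A - lp B + info B * s - third B/2 * s^2\<bar> \<le> 1/2*(k2 hi*U^2/m*\<bar>s\<bar>) + 1/2*(Cd*\<bar>s\<bar>) + 1/2*(4/d^5*\<bar>s\<bar>^3*(\<Sum>j<m. (e j)^2)) + 1/2*(1/d^4*\<bar>s\<bar>^3*real m)"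
 proof -
  have "\<bar>1/2*w + 1/2*l + 1/2*p - 1/2*q\<bar> \<le> 1/2*a + 1/2*b + 1/2*c + 1/2*f"
   if "\<bar>w\<bar> \<le> a" "\<bar>l\<bar> \<le> b" "\<bar>p\<bar> \<le> c" "\<bar>q\<bar> \<le> f" for w l p q a b c f :: real using that by linarith
  from this[OF wd ld R1 R2] show ?thesis unfolding eq .
 qed
 also have "\<dots> \<le> (2/d^5*(\<Sum>j<m. (e j)^2) + 1/(2*d^4)*real m)*\<bar>s\<bar>^3 + (k2 hi*U^2/m + Cd)*\<bar>s\<bar>"
 proof -
  have "0 \<le> k2 hi*U^2/m*\<bar>s\<bar>" using k_nonneg(3)[of hi] A mp by simp
  moreover have "0 \<le> Cd*\<bar>s\<bar>" using Cd0 by simp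
  moreover have "1/2*(a*r) + 1/2*(b*r) + 1/2*(4/d^5*S*E) + 1/2*(1/d^4*S*M) \<le> (2/d^5*E + 1/(2*d^4)*M)*S + (a + b)*r"
   if "0 \<le> a*r" "0 \<le> b*r" for E M S a b r :: real
  proof -
   have "(2/d^5*E + 1/(2*d^4)*M)*S + (a + b)*r = 1/2*(4/d^5*S*E) + 1/2*(1/d^4*S*M) + (a*r + b*r)"
    by (simp add: algebra_simps)
   then show ?thesis using that by simp
  qed
  ultimately show ?thesis by blast
 qed
 finally show ?thesis unfolding s_def .
qed

lemma r_fun_bounds:
 assumes A: "0 \<le> A" "A \<le> hi" "0 \<le> B" "B \<le> hi"
 shows "0 \<le> r_fun x D m i A" "r_fun x D m i A \<le> k0 hi*X^2/m" "\<bar>r_fun x D m i A - r_fun x D m i B\<bar> \<le> k1 hi*X^2*\<bar>A - B\<bar>/m"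
proof -
 show "0 \<le> r_fun x D m i A" by (rule r_fun_nonneg[OF rank t_pos[OF A(1)]])
 have w: "norm (x i) \<le> X" "norm (x i - x i) \<le> X*\<bar>A' - B'\<bar>" for A' B' using X X0 by auto
 have k: "0 \<le> k0 hi" "0 \<le> k1 hi" using A k_nonneg by auto
 have sA: "norm (matrix_inv (Q A) *v x i) \<le> k0 hi*X/m"
  by (rule solve_bounds(1)[OF A(3,4,1,2) Q_inv(1)[OF A(3)] Q_inv(1)[OF A(1)] w])
 have sAB: "norm (matrix_inv (Q A) *v x i - matrix_inv (Q B) *v x i) \<le> k1 hi*X*\<bar>A - B\<bar>/m"
  by (rule solve_bounds(2)[OF A Q_inv(1)[OF A(1)] Q_inv(1)[OF A(3)] w])
 have "r_fun x D m i A \<le> norm (x i)*norm (matrix_inv (Q A) *v x i)"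
  unfolding r_fun_def by (rule norm_cauchy_schwarz)
 also have "\<dots> \<le> X*(k0 hi*X/m)" by (intro mult_mono sA X) (use X0 k mp in auto)
 finally show "r_fun x D m i A \<le> k0 hi*X^2/m" by (simp add: power2_eq_square mult_ac)
 have "\<bar>r_fun x D m i A - r_fun x D m i B\<bar> \<le> norm (x i)*norm (matrix_inv (Q A) *v x i - matrix_inv (Q B) *v x i)"
  unfolding r_fun_def inner_diff_right[symmetric] by (rule Cauchy_Schwarz_ineq2)
 also have "\<dots> \<le> X*(k1 hi*X*\<bar>A - B\<bar>/m)" by (intro mult_mono sAB X) (use X0 k mp in auto)
 finally show "\<bar>r_fun x D m i A - r_fun x D m i B\<bar> \<le> k1 hi*X^2*\<bar>A - B\<bar>/m" by (simp add: power2_eq_square mult_ac)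
qed

definition kg :: "real \<Rightarrow> real" where "kg hi = k0 hi*X^2 + k1 hi*X^2 + 2*dm/d^2*k0 hi*X^2"

text \<open>The leverage \<open>r_fun\<close> and its Lipschitz constant are of order
  \<open>1/m\<close>, while \<open>B_fun\<close> is bounded and Lipschitz. This provides what
  \<open>coverage_expansion\<close> demands of \<open>h\<close>.\<close>

lemma g2_bounds:
 assumes A: "0 \<le> A" "A \<le> hi" "0 \<le> B" "B \<le> hi"
 shows "0 \<le> g2 x D m i A" "g2 x D m i A \<le> kg hi/m" "\<bar>g2 x D m i A - g2 x D m i B\<bar> \<le> kg hi*\<bar>A - B\<bar>/m"
proof -
 note r = r_fun_bounds[OF A, of i]
 note rB = r_fun_bounds[OF A(3,4,1,2), of i]
 have k: "0 \<le> k0 hi" "0 \<le> k1 hi" using A k_nonneg by auto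
 have B1: "0 \<le> B_fun D i A'" "B_fun D i A' \<le> 1" if "0 \<le> A'" for A'
  using t_pos[OF that, of i] d Dlo[of i] that by (auto simp: B_fun_def)
 have B2: "0 \<le> (B_fun D i A')^2" "(B_fun D i A')^2 \<le> 1" if "0 \<le> A'" for A'
  using B1[OF that] by (auto simp: power_le_one)
 show "0 \<le> g2 x D m i A" using r(1) by (simp add: g2_def)
 have "g2 x D m i A \<le> 1*(k0 hi*X^2/m)" unfolding g2_def
  by (intro mult_mono r B2 A) (use r(1) in auto)
 also have "\<dots> \<le> kg hi/m" unfolding kg_def using k X0 d dm0 by (simp add: divide_right_mono)
 finally show "g2 x D m i A \<le> kg hi/m" .
 have dB: "\<bar>(B_fun D i A)^2 - (B_fun D i B)^2\<bar> \<le> 2*dm/d^2*\<bar>A - B\<bar>"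
 proof -
  have "(B_fun D i A)^2 - (B_fun D i B)^2 = (B_fun D i A - B_fun D i B)*(B_fun D i A + B_fun D i B)" by (simp add: power2_eq_square algebra_simps)
  then have "\<bar>(B_fun D i A)^2 - (B_fun D i B)^2\<bar> = \<bar>B_fun D i A - B_fun D i B\<bar>*\<bar>B_fun D i A + B_fun D i B\<bar>" by (simp add: abs_mult)
  also have "\<dots> \<le> (dm*(\<bar>A - B\<bar>/d^2))*2"
  proof (rule mult_mono)
   have "B_fun D i A - B_fun D i B = D i*(1/(A + D i) - 1/(B + D i))" by (simp add: B_fun_def right_diff_distrib)
   then show "\<bar>B_fun D i A - B_fun D i B\<bar> \<le> dm*(\<bar>A - B\<bar>/d^2)"
    using mult_mono[OF Dhi[of i] inverse_lipschitz[OF A(1,3), of i]] Dlo[of i] dm0 d by (simp add: abs_mult)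
  qed (use B1[OF A(1)] B1[OF A(3)] dm0 in auto)
  finally show ?thesis by (simp add: mult_ac)
 qed
 have "\<bar>g2 x D m i A - g2 x D m i B\<bar> \<le> \<bar>(B_fun D i A)^2 - (B_fun D i B)^2\<bar>*\<bar>r_fun x D m i A\<bar> + \<bar>(B_fun D i B)^2\<bar>*\<bar>r_fun x D m i A - r_fun x D m i B\<bar>"
  unfolding g2_def by (rule abs_mult_diff_le)
 also have "\<dots> \<le> (2*dm/d^2*\<bar>A - B\<bar>)*(k0 hi*X^2/m) + 1*(k1 hi*X^2*\<bar>A - B\<bar>/m)"
  by (intro add_mono mult_mono dB r) (use r B2[OF A(3)] dm0 in auto)
 also have "\<dots> = (2*dm/d^2*k0 hi*X^2 + k1 hi*X^2)*(\<bar>A - B\<bar>/m)" by (simp add: algebra_simps)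
 also have "\<dots> \<le> kg hi*(\<bar>A - B\<bar>/m)" unfolding kg_def using k X0 mp by (intro mult_right_mono) auto
 finally show "\<bar>g2 x D m i A - g2 x D m i B\<bar> \<le> kg hi*\<bar>A - B\<bar>/m" by simp
qed

text \<open>The derivative of \<open>u 1\<close> is \<open>- u 2\<close>. Testing the increment
  against itself reduces the vector-valued mean value inequality to the real one.\<close>

lemma u1_lipschitz:
 assumes A: "0 < A" "0 < B" and U: "\<And>z. z \<in> {min A B..max A B} \<Longrightarrow> norm (u 2 z) \<le> U"
 shows "norm (u 1 A - u 1 B) \<le> U*\<bar>A - B\<bar>"
proof -
 have main: "norm (u 1 B - u 1 A) \<le> U*(B - A)" if A: "0 < A" and AB: "A < B" and U: "\<And>z. z \<in> {A..B} \<Longrightarrow> norm (u 2 z) \<le> U" for A B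
 proof -
  let ?w = "u 1 B - u 1 A"
  have d: "((\<lambda>z. u 1 z \<bullet> ?w) has_real_derivative - (u 2 z \<bullet> ?w)) (at z)" if "A \<le> z" "z \<le> B" for z
  proof -
   have "0 \<le> z" using that A by simp
   then have "((\<lambda>z. \<Sum>j<m. (e j/(z + D j)^1)*(x j \<bullet> ?w)) has_real_derivative (\<Sum>j<m. - (e j/(z + D j)^2)*(x j \<bullet> ?w))) (at z)"
    using t_pos[of z] by (auto intro!: derivative_eq_intros sum.cong simp: power2_eq_square less_imp_neq[symmetric])
   then show ?thesis by (simp add: u_def inner_sum_left sum_negf)
  qed
  obtain z where z: "A < z" "z < B" "u 1 B \<bullet> ?w - u 1 A \<bullet> ?w = (B - A)*- (u 2 z \<bullet> ?w)"
   using MVT2[OF AB, of "\<lambda>z. u 1 z \<bullet> ?w" "\<lambda>z. - (u 2 z \<bullet> ?w)"] d by auto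
  have "norm ?w*norm ?w = ?w \<bullet> ?w" by (simp add: norm_eq_square[symmetric] power2_norm_eq_inner[symmetric] power2_eq_square)
  also have "\<dots> = (B - A)*- (u 2 z \<bullet> ?w)" using z(3) by (simp add: inner_diff_left)
  also have "\<dots> \<le> (B - A)*(U*norm ?w)"
  proof (rule mult_left_mono)
   have "\<bar>u 2 z \<bullet> ?w\<bar> \<le> U*norm ?w"
    by (rule order_trans[OF Cauchy_Schwarz_ineq2 mult_right_mono]) (use U[of z] z in auto)
   then show "- (u 2 z \<bullet> ?w) \<le> U*norm ?w" by linarith
  qed (use AB in simp)
  finally have "norm ?w*norm ?w \<le> (U*(B - A))*norm ?w" by (simp add: mult_ac)
  moreover have "0 \<le> U" using U[of A] AB order_trans[OF norm_ge_zero] by auto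
  ultimately show ?thesis using AB by (cases "norm ?w = 0") (auto simp: mult_le_cancel_right)
 qed
 show ?thesis
 proof (cases A B rule: linorder_cases)
  case less then show ?thesis using main[of A B] A U by (simp add: norm_minus_commute abs_minus_commute)
 next
  case greater then show ?thesis using main[of B A] A U by simp
 qed simp
qed

section \<open>Global comparison of the residual likelihood with its value at
  \<open>A0\<close>\<close>

lemma det_Q_lower:
 assumes "0 \<le> A" "0 \<le> A0" shows "((A0 + d)/(A + dm))^CARD('p)*det (Q A0) \<le> det (Q A)"
proof -
 \<comment> \<open>Chosen so that \<open>?k*(1/(A0 + D j)) \<le> 1/(A + D j)\<close> for all
   \<open>j\<close>; monotonicity and homogeneity of the determinant then compare \<open>Q A\<close>
   with \<open>Q A0\<close>.\<close>
 let ?k = "(A0 + d)/(A + dm)"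
 have p: "0 < A + dm" "0 < A0 + d" using assms dm0 d by auto
 have "det (wgram x m (\<lambda>j. ?k*(1/(A0 + D j)))) \<le> det (wgram x m (\<lambda>j. 1/(A + D j)))"
 proof (rule det_wgram_mono)
  fix j
  have t: "0 < A + D j" "0 < A0 + D j" using t_pos assms by auto
  have "?k*(1/(A0 + D j)) \<le> 1*(1/(A + dm))"
  proof -
   have "?k*(1/(A0 + D j)) = ((A0 + d)/(A0 + D j))*(1/(A + dm))" by simp
   also have "\<dots> \<le> 1*(1/(A + dm))" by (rule mult_right_mono) (use t p Dlo[of j] in auto)
   finally show ?thesis .
  qed
  also have "1*(1/(A + dm)) \<le> 1/(A + D j)" using t p Dhi[of j] by (simp add: divide_left_mono)
  finally show "0 \<le> ?k*(1/(A0 + D j)) \<and> ?k*(1/(A0 + D j)) \<le> 1/(A + D j)" using p t by simp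
  show "0 \<le> 1/(A + D j)" using t by simp
 qed simp
 then show ?thesis unfolding XtVX_eq_wgram det_wgram_scale .
qed

lemma ln_det_diff:
 assumes "0 \<le> A" "0 \<le> A0"
 shows "ln (det (Q A0)) - ln (det (Q A)) \<le> CARD('p)*ln ((A + dm)/(A0 + d))"
proof -
 have p: "0 < A + dm" "0 < A0 + d" using assms dm0 d by auto
 have "ln (((A0 + d)/(A + dm))^CARD('p)*det (Q A0)) \<le> ln (det (Q A))"
  using det_Q_lower[OF assms] det_Q_pos[OF assms(1)] det_Q_pos[OF assms(2)] p by (subst ln_le_cancel_iff) auto
 also have "ln (((A0 + d)/(A + dm))^CARD('p)*det (Q A0)) = CARD('p)*ln ((A0 + d)/(A + dm)) + ln (det (Q A0))"
  using p det_Q_pos[OF assms(2)] by (simp add: ln_mult ln_realpow)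
 also have "ln ((A0 + d)/(A + dm)) = - ln ((A + dm)/(A0 + d))" using p by (simp add: ln_div)
 finally show ?thesis by simp
qed

text \<open>Two bounds for two ranges. For bounded \<open>A\<close> the first sum is twice a
  Kullback-Leibler divergence between normal laws with variances \<open>A0 + D j\<close> and
  \<open>A + D j\<close>, and the centred sums and the noise sum are perturbations of it. For large
  \<open>A\<close> the quadratic form at \<open>A\<close> is dropped and the decay of order
  \<open>(A + d) powr (- m/2)\<close> dominates.\<close>

lemma ln_L_RE_diff:
 fixes \<beta> :: "real^'p"
 assumes A: "0 \<le> A" "0 \<le> A0"
 defines "l \<equiv> \<lambda>A. ln (L_RE x D m (\<lambda>j. x j \<bullet> \<beta> + e j) A)"
 shows "l A - l A0 \<le> - 1/2*(\<Sum>j<m. ln ((A + D j)/(A0 + D j)) + (A0 + D j)/(A + D j) - 1)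
   + 1/2*\<bar>\<Sum>j<m. ((e j)^2 - (A0 + D j))/(A + D j)\<bar> + 1/2*\<bar>\<Sum>j<m. ((e j)^2 - (A0 + D j))/(A0 + D j)\<bar>
   + 1/2*((A + dm)/(c*real m)*(norm (u 1 A))^2) + CARD('p)/2*ln ((A + dm)/(A0 + d))" (is ?t1)
  and "l A - l A0 \<le> - 1/2*real m*ln ((A + d)/(A0 + dm)) + 1/2*(\<Sum>j<m. (e j)^2)/d + CARD('p)/2*ln ((A + dm)/(A0 + d))" (is ?t2)
proof -
 have lnd: "ln (A + D j) - ln (A0 + D j) = ln ((A + D j)/(A0 + D j))" for j
  using t_pos[OF A(1), of j] t_pos[OF A(2), of j] by (simp add: ln_div)
 have base: "l A - l A0 = - 1/2*(\<Sum>j<m. ln ((A + D j)/(A0 + D j))) + 1/2*(ln (det (Q A0)) - ln (det (Q A)))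
   - 1/2*(yPy x D m (\<lambda>j. x j \<bullet> \<beta> + e j) A - yPy x D m (\<lambda>j. x j \<bullet> \<beta> + e j) A0)"
  unfolding l_def ln_L_RE[OF A(1)] ln_L_RE[OF A(2)] lnd[symmetric] sum_subtractf by (simp add: algebra_simps)
 note ld = ln_det_diff[OF A]
 have bu: "b A \<bullet> u 1 A \<le> (A + dm)/(c*real m)*(norm (u 1 A))^2"
 proof -
  have "b A \<bullet> u 1 A \<le> norm (b A)*norm (u 1 A)" by (rule norm_cauchy_schwarz)
  also have "\<dots> \<le> (A + dm)/(c*real m)*norm (u 1 A)*norm (u 1 A)"
   by (rule mult_right_mono[OF norm_solve[OF A(1) Qb[OF A(1)]]]) simp
  finally show ?thesis by (simp add: power2_eq_square mult_ac)
 qed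
 have e1: "(\<Sum>j<m. (e j)^2/(A + D j)) - (\<Sum>j<m. (e j)^2/(A0 + D j)) =
  (\<Sum>j<m. (A0 + D j)/(A + D j) - 1) + (\<Sum>j<m. ((e j)^2 - (A0 + D j))/(A + D j)) - (\<Sum>j<m. ((e j)^2 - (A0 + D j))/(A0 + D j))"
 proof -
  have "(e j)^2/(A + D j) - (e j)^2/(A0 + D j) = ((A0 + D j)/(A + D j) - 1) + ((e j)^2 - (A0 + D j))/(A + D j) - ((e j)^2 - (A0 + D j))/(A0 + D j)" for j
   using t_pos[OF A(2), of j] by (simp add: diff_divide_distrib)
  then show ?thesis unfolding sum_subtractf[symmetric] sum.distrib[symmetric] by (intro sum.cong) auto
 qed
 have "- (yPy x D m (\<lambda>j. x j \<bullet> \<beta> + e j) A - yPy x D m (\<lambda>j. x j \<bullet> \<beta> + e j) A0) \<le>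
  - (\<Sum>j<m. (A0 + D j)/(A + D j) - 1) + \<bar>\<Sum>j<m. ((e j)^2 - (A0 + D j))/(A + D j)\<bar> + \<bar>\<Sum>j<m. ((e j)^2 - (A0 + D j))/(A0 + D j)\<bar>
  + (A + dm)/(c*real m)*(norm (u 1 A))^2"
  unfolding yPy_e(3)[OF A(1)] yPy_e(3)[OF A(2)] using e1 bu bu_nonneg[OF A(2)] by linarith
 moreover have "(\<Sum>j<m. ln ((A + D j)/(A0 + D j)) + (A0 + D j)/(A + D j) - 1) = (\<Sum>j<m. ln ((A + D j)/(A0 + D j))) + (\<Sum>j<m. (A0 + D j)/(A + D j) - 1)"
  by (simp add: sum.distrib sum_subtractf)
 moreover have "- 1/2*a + 1/2*dd - 1/2*yy \<le> - 1/2*ab + 1/2*u + 1/2 * v + 1/2*w + P/2*L"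
  if "- yy \<le> - b' + u + v + w" "ab = a + b'" "dd \<le> P*L" for a b' ab dd yy u v w P L :: real
 proof -
  have "P/2*L = (P*L)/2" by simp
  then show ?thesis using that by linarith
 qed
 ultimately show ?t1 unfolding base using ld by blast
 have s1: "real m*ln ((A + d)/(A0 + dm)) \<le> (\<Sum>j<m. ln ((A + D j)/(A0 + D j)))"
 proof -
  have "ln ((A + d)/(A0 + dm)) \<le> ln ((A + D j)/(A0 + D j))" for j
  proof (subst ln_le_cancel_iff)
   show "(A + d)/(A0 + dm) \<le> (A + D j)/(A0 + D j)"
    by (rule frac_le) (use t_pos[OF A(1), of j] t_pos[OF A(2), of j] Dlo[of j] Dhi[of j] in auto)
  qed (use t_pos[OF A(1), of j] t_pos[OF A(2), of j] A d dm0 in auto)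
  then have "(\<Sum>j<m. ln ((A + d)/(A0 + dm))) \<le> (\<Sum>j<m. ln ((A + D j)/(A0 + D j)))" by (rule sum_mono)
  then show ?thesis by simp
 qed
 have y0: "0 \<le> yPy x D m (\<lambda>j. x j \<bullet> \<beta> + e j) A" unfolding yPy_e(1)[OF A(1)]
  by (intro sum_nonneg divide_nonneg_pos t_pos A) auto
 have "yPy x D m (\<lambda>j. x j \<bullet> \<beta> + e j) A0 \<le> (\<Sum>j<m. (e j)^2/(A0 + D j))"
  unfolding yPy_e(3)[OF A(2)] using bu_nonneg[OF A(2)] by simp
 also have "\<dots> \<le> (\<Sum>j<m. (e j)^2/d)"
  by (intro sum_mono divide_left_mono t_ge A mult_pos_pos t_pos d) auto
 also have "\<dots> = (\<Sum>j<m. (e j)^2)/d" by (simp add: sum_divide_distrib)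
 finally have y1: "yPy x D m (\<lambda>j. x j \<bullet> \<beta> + e j) A0 \<le> (\<Sum>j<m. (e j)^2)/d" .
 have "- 1/2*a + 1/2*dd - 1/2*(y - y') \<le> - 1/2*M*N + 1/2*E/d + P/2*L"
  if "M*N \<le> a" "dd \<le> P*L" "0 \<le> y" "y' \<le> E/d" for a dd y y' M N E P L :: real
 proof -
  have e: "P/2*L = (P*L)/2" "- 1/2*M*N = - (M*N)/2" "1/2*E/d = (E/d)/2" by simp_all
  show ?thesis unfolding e using that by argo
 qed
 from this[OF s1 ld y0 y1] show ?t2 unfolding base .
qed

end

text \<open>From \<open>ln (sqrt \<rho>) \<le> sqrt \<rho> - 1\<close> the right side is at least
  \<open>(sqrt \<rho> - 1)^2\<close>. The explicit bound depends on the area only through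
  \<open>R\<close> and \<open>\<eta>\<close>, so it is uniform in \<open>j\<close>.\<close>

lemma log_ratio_lower_bound:
 assumes \<rho>: "0 < \<rho>" "\<rho> \<le> R" and e: "\<eta> \<le> \<bar>\<rho> - 1\<bar>" "0 \<le> \<eta>"
 shows "(\<eta>/(sqrt R + 1))^2 \<le> - ln \<rho> + \<rho> - 1"
proof -
 have "ln \<rho> = 2*ln (sqrt \<rho>)" using \<rho> by (simp add: ln_sqrt)
 also have "\<dots> \<le> 2*(sqrt \<rho> - 1)" using ln_le_minus_one[of "sqrt \<rho>"] \<rho> by simp
 finally have "ln \<rho> \<le> 2*(sqrt \<rho> - 1)" .
 then have "(sqrt \<rho> - 1)^2 \<le> - ln \<rho> + \<rho> - 1" using \<rho> by (simp add: power2_diff)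
 moreover have "(\<eta>/(sqrt R + 1))^2 \<le> (sqrt \<rho> - 1)^2"
 proof -
  have "\<rho> - 1 = (sqrt \<rho> - 1)*(sqrt \<rho> + 1)" using \<rho> by (simp add: algebra_simps)
  then have "\<bar>\<rho> - 1\<bar> = \<bar>sqrt \<rho> - 1\<bar>*(sqrt \<rho> + 1)" using \<rho> by (simp add: abs_mult)
  also have "\<dots> \<le> \<bar>sqrt \<rho> - 1\<bar>*(sqrt R + 1)" using \<rho> by (intro mult_left_mono) auto
  finally have "\<eta> \<le> \<bar>sqrt \<rho> - 1\<bar>*(sqrt R + 1)" using e by simp
  moreover have "0 < sqrt R + 1" using \<rho> by (intro add_nonneg_pos) auto
  ultimately have "\<eta>/(sqrt R + 1) \<le> \<bar>sqrt \<rho> - 1\<bar>" by (simp add: pos_divide_le_eq)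
  then show ?thesis using power_mono[of "\<eta>/(sqrt R + 1)" "\<bar>sqrt \<rho> - 1\<bar>" 2] e \<open>0 < sqrt R + 1\<close> by simp
 qed
 ultimately show ?thesis by simp
qed

section \<open>Sequences of data\<close>

text \<open>A finite grid of mesh \<open>1/k\<close> comes within \<open>1/k\<close> of every point;
  convergence at the grid points and the common Lipschitz constant suffice.\<close>

lemma uniform_limit_from_rationals:
 fixes f :: "nat \<Rightarrow> real \<Rightarrow> 'b::real_normed_vector"
 assumes lip: "EV n. \<forall>A B. 0 \<le> A \<longrightarrow> 0 \<le> B \<longrightarrow> norm (f n A - f n B) \<le> L*\<bar>A - B\<bar>"
  and pw: "\<And>r::rat. 0 \<le> r \<Longrightarrow> (\<lambda>n. f n (of_rat r)) \<longlonglongrightarrow> 0" and \<eta>: "0 < \<eta>"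
 shows "EV n. \<forall>A\<in>{0..M}. norm (f n A) \<le> \<eta>"
proof -
 obtain k :: nat where k: "2*\<bar>L\<bar>/\<eta> < real k" using reals_Archimedean2 by blast
 have k0: "0 < real k" using k \<eta> by (smt (verit) divide_nonneg_pos)
 have kL: "\<bar>L\<bar>*(1/real k) \<le> \<eta>/2" using k k0 \<eta> by (simp add: field_simps)
 obtain N :: nat where N: "M*real k \<le> real N" using real_arch_simple by blast
 have "EV n. norm (f n (real i/real k)) < \<eta>/2" for i
 proof -
  have "(\<lambda>n. f n (of_rat (of_nat i/of_nat k))) \<longlonglongrightarrow> 0" by (rule pw) simp
  then have "(\<lambda>n. f n (real i/real k)) \<longlonglongrightarrow> 0" by (simp add: of_rat_divide)
  from tendstoD[OF this, of "\<eta>/2"] show ?thesis using \<eta> by simp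
 qed
 then have "EV n. \<forall>i\<in>{..N}. norm (f n (real i/real k)) < \<eta>/2"
  by (intro eventually_ball_finite) auto
 with lip show ?thesis
 proof eventually_elim
  case (elim n)
  show ?case
  proof
   fix A assume A: "A \<in> {0..M}"
   define i where "i = nat \<lfloor>A*real k\<rfloor>"
   have i: "real i \<le> A*real k" "A*real k \<le> real i + 1"
    using A k0 by (auto simp: i_def)
   have "A*real k \<le> M*real k" using A k0 by simp
   with i N have "i \<le> N" by linarith
   then have 1: "norm (f n (real i/real k)) < \<eta>/2" using elim(2) by simp
   have "\<bar>A - real i/real k\<bar> \<le> 1/real k"
   proof -
    have "real i/real k \<le> A" using i(1) k0 by (simp add: pos_divide_le_eq)
    moreover have "A \<le> (real i + 1)/real k" using i(2) k0 by (simp add: pos_le_divide_eq)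
    ultimately show ?thesis by (simp add: abs_le_iff add_divide_distrib)
   qed
   then have "\<bar>L\<bar>*\<bar>A - real i/real k\<bar> \<le> \<eta>/2" using kL by (meson abs_ge_zero mult_left_mono order_trans)
   moreover have "L*\<bar>A - real i/real k\<bar> \<le> \<bar>L\<bar>*\<bar>A - real i/real k\<bar>" by (intro mult_right_mono) auto
   moreover have "norm (f n A - f n (real i/real k)) \<le> L*\<bar>A - real i/real k\<bar>" using elim(1) A by simp
   moreover have "norm (f n A) \<le> norm (f n A - f n (real i/real k)) + norm (f n (real i/real k))"
    using norm_triangle_ineq[of "f n A - f n (real i/real k)" "f n (real i/real k)"] by simp
   ultimately show "norm (f n A) \<le> \<eta>" using 1 by linarith
  qed
 qed
qed

text \<open>
 The averages are only controlled at \<open>A0\<close> and at rational points, which are countably many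
 conditions; Lipschitz bounds extend them uniformly to compact sets of \<open>A\<close>.
\<close>

locale regression_sequence =
 fixes x :: "nat \<Rightarrow> real^'p::finite" and D :: "nat \<Rightarrow> real" and d dm X c A0 :: real
  and mm :: "nat \<Rightarrow> nat" and e :: "nat \<Rightarrow> nat \<Rightarrow> real"
 assumes d: "0 < d" and Dlo: "\<And>j. d \<le> D j" and Dhi: "\<And>j. D j \<le> dm" and X: "\<And>j. norm (x j) \<le> X"
  and c: "0 < c" and A0: "0 < A0"
  and reg: "EV m. dim (x ` {..<m}) = CARD('p) \<and> (\<forall>v. c*real m*(norm v)^2 \<le> (\<Sum>j<m. (x j \<bullet> v)^2))"
  and mm: "filterlim mm at_top sequentially"
  and L2: "\<And>q k. q = A0 \<or> q \<in> of_rat ` {0..} \<Longrightarrow> k \<le> 4 \<Longrightarrow>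
   (\<lambda>n. (\<Sum>j<mm n. ((e n j)^2 - (A0 + D j))/(q + D j)^k)/real (mm n) powr (3/4)) \<longlonglongrightarrow> 0"
  and L1: "\<And>q k l. q = A0 \<or> q \<in> of_rat ` {0..} \<Longrightarrow> k \<le> 4 \<Longrightarrow>
   (\<lambda>n. (\<Sum>j<mm n. e n j*x j $ l/(q + D j)^k)/real (mm n) powr (3/4)) \<longlonglongrightarrow> 0"
begin

abbreviation M :: "nat \<Rightarrow> real" where "M n \<equiv> real (mm n)"
abbreviation "U n \<equiv> regression_sample.u x D (mm n) (e n)"

lemma Minf: "filterlim M at_top sequentially"
 using filterlim_compose[OF filterlim_real_sequentially mm] .

lemma M_ge: "EV n. r \<le> M n"
 using Minf by (simp add: filterlim_at_top)

lemma sample: "EV n. regression_sample x D (mm n) d dm X c"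
proof -
 have "EV n. dim (x ` {..<mm n}) = CARD('p) \<and> (\<forall>v. c*real (mm n)*(norm v)^2 \<le> (\<Sum>j<mm n. (x j \<bullet> v)^2))"
  using reg mm by (rule eventually_compose_filterlim)
 with M_ge[of 1] show ?thesis
 proof eventually_elim
  case (elim n)
  then show ?case by unfold_locales (use d Dlo Dhi X c in auto)
 qed
qed

lemma X0: "0 \<le> X" using order_trans[OF norm_ge_zero X] .
lemma dm0: "0 < dm" using d Dlo[of 0] Dhi[of 0] by linarith
lemma t_pos: "0 \<le> A \<Longrightarrow> 0 < A + D j" using d Dlo[of j] by linarith
lemma t_ge: "0 \<le> A \<Longrightarrow> d \<le> A + D j" using Dlo[of j] by linarith

lemma rate_le: "f \<longlonglongrightarrow> 0" if "(\<lambda>n. (f n*M n)/M n powr (3/4)) \<longlonglongrightarrow> 0" for f :: "nat \<Rightarrow> real"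
proof (rule Lim_null_comparison[OF _ tendsto_norm_zero[OF that]])
 show "EV n. norm (f n) \<le> norm ((f n*M n)/M n powr (3/4))"
  using M_ge[of 1]
 proof eventually_elim
  case (elim n)
  have "M n powr (3/4) \<le> M n powr 1" using elim by (intro powr_mono) auto
  then have q: "M n powr (3/4) \<le> M n" "0 < M n powr (3/4)" using elim by auto
  have "\<bar>f n\<bar>*M n powr (3/4) \<le> \<bar>f n\<bar>*M n" by (rule mult_left_mono[OF q(1)]) simp
  then show ?case using q(2) elim by (simp add: abs_mult pos_le_divide_eq)
 qed
qed

lemma avg2: "q = A0 \<or> q \<in> of_rat ` {0..} \<Longrightarrow> k \<le> 4 \<Longrightarrow>
  (\<lambda>n. (\<Sum>j<mm n. ((e n j)^2 - (A0 + D j))/(q + D j)^k)/M n) \<longlonglongrightarrow> 0"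
proof (rule rate_le)
 assume "q = A0 \<or> q \<in> of_rat ` {0..}" "k \<le> 4"
 from L2[OF this] show "(\<lambda>n. ((\<Sum>j<mm n. ((e n j)^2 - (A0 + D j))/(q + D j)^k)/M n*M n)/M n powr (3/4)) \<longlonglongrightarrow> 0"
 proof (rule Lim_transform_eventually)
  show "EV n. (\<Sum>j<mm n. ((e n j)^2 - (A0 + D j))/(q + D j)^k)/M n powr (3/4) =
   ((\<Sum>j<mm n. ((e n j)^2 - (A0 + D j))/(q + D j)^k)/M n*M n)/M n powr (3/4)"
   using M_ge[of 1] by eventually_elim simp
 qed
qed

lemma U_rate:
 assumes "q = A0 \<or> q \<in> of_rat ` {0..}" "k \<le> 4"
 shows "(\<lambda>n. norm (U n k q)/M n powr (3/4)) \<longlonglongrightarrow> 0"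
proof (rule Lim_null_comparison)
 let ?s = "\<lambda>n l. (\<Sum>j<mm n. e n j*x j $ l/(q + D j)^k)/M n powr (3/4)"
 show "EV n. norm (norm (U n k q)/M n powr (3/4)) \<le> (\<Sum>l\<in>UNIV. \<bar>?s n l\<bar>)"
  using sample
 proof eventually_elim
  case (elim n)
  then interpret S: regression_sample x D "mm n" "e n" d dm X c .
  have "norm (U n k q) \<le> (\<Sum>l\<in>UNIV. \<bar>U n k q $ l\<bar>)" by (rule norm_le_l1_cart)
  also have "\<dots> = (\<Sum>l\<in>UNIV. \<bar>\<Sum>j<mm n. e n j*x j $ l/(q + D j)^k\<bar>)"
   by (simp add: S.u_def)
  finally have "norm (U n k q)/M n powr (3/4) \<le> (\<Sum>l\<in>UNIV. \<bar>\<Sum>j<mm n. e n j*x j $ l/(q + D j)^k\<bar>)/M n powr (3/4)"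
   by (rule divide_right_mono) simp
  moreover have "(\<Sum>l\<in>(UNIV::'p set). \<bar>f l\<bar>)/p = (\<Sum>l\<in>UNIV. \<bar>f l/p\<bar>)" if "0 \<le> p" for f :: "'p \<Rightarrow> real" and p :: real
   using that by (simp add: sum_divide_distrib abs_divide)
  ultimately show ?case by simp
 qed
 have "(\<lambda>n. \<Sum>l\<in>UNIV. \<bar>?s n l\<bar>) \<longlonglongrightarrow> (\<Sum>l\<in>(UNIV::'p set). 0)"
  by (intro tendsto_sum tendsto_rabs_zero L1 assms)
 then show "(\<lambda>n. \<Sum>l\<in>UNIV. \<bar>?s n l\<bar>) \<longlonglongrightarrow> 0" by simp
qed

lemma U_avg:
 assumes "q = A0 \<or> q \<in> of_rat ` {0..}" "k \<le> 4"
 shows "(\<lambda>n. U n k q /\<^sub>R M n) \<longlonglongrightarrow> 0"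
proof (rule tendsto_norm_zero_cancel, rule rate_le)
 from U_rate[OF assms] show "(\<lambda>n. norm (U n k q /\<^sub>R M n)*M n/M n powr (3/4)) \<longlonglongrightarrow> 0"
 proof (rule Lim_transform_eventually)
  show "EV n. norm (U n k q)/M n powr (3/4) = norm (U n k q /\<^sub>R M n)*M n/M n powr (3/4)"
   using M_ge[of 1] by eventually_elim simp
 qed
qed

text \<open>The mean of \<open>(e n j)^2\<close> is asymptotically at most \<open>A0 + dm\<close>;
  the additional 1 absorbs the deviation and makes \<open>1 \<le> CS\<close>, so that the same
  constant serves for the mean of \<open>\<bar>e n j\<bar>\<close>.\<close>

definition CS :: real where "CS = A0 + dm + 1"

lemma CS0: "1 \<le> CS" using A0 dm0 by (simp add: CS_def)

lemma sum_sq: "EV n. (\<Sum>j<mm n. (e n j)^2) \<le> CS*M n \<and> (\<Sum>j<mm n. \<bar>e n j\<bar>) \<le> CS*M n"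
proof -
 have "EV n. \<bar>(\<Sum>j<mm n. ((e n j)^2 - (A0 + D j))/(A0 + D j)^0)/M n\<bar> < 1"
  using tendstoD[OF avg2[of A0 0], of 1] by simp
 with M_ge[of 1] show ?thesis
 proof eventually_elim
  case (elim n)
  have "\<bar>\<Sum>j<mm n. ((e n j)^2 - (A0 + D j))\<bar> < M n"
   using elim by (simp add: abs_divide divide_less_eq)
  then have "(\<Sum>j<mm n. (e n j)^2) \<le> (\<Sum>j<mm n. A0 + D j) + M n" by (simp add: sum_subtractf)
  moreover have "(\<Sum>j<mm n. A0 + D j) \<le> (\<Sum>j<mm n. A0 + dm)" by (intro sum_mono add_left_mono Dhi)
  ultimately have 1: "(\<Sum>j<mm n. (e n j)^2) \<le> CS*M n" by (simp add: CS_def algebra_simps)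
  have "(\<Sum>j<mm n. \<bar>e n j\<bar>) \<le> (\<Sum>j<mm n. (1 + (e n j)^2)/2)"
  proof (rule sum_mono)
   fix j
   have "0 \<le> (\<bar>e n j\<bar> - 1)^2" by simp
   then show "\<bar>e n j\<bar> \<le> (1 + (e n j)^2)/2" by (simp add: power2_diff)
  qed
  also have "\<dots> = (M n + (\<Sum>j<mm n. (e n j)^2))/2" by (simp add: sum_divide_distrib[symmetric] sum.distrib)
  also have "\<dots> \<le> CS*M n"
  proof -
   have "1*M n \<le> CS*M n" by (rule mult_right_mono[OF CS0]) simp
   moreover have "(a + b)/2 \<le> c" if "1*a \<le> c" "b \<le> c" for a b c :: real using that by simp
   ultimately show ?thesis using 1 by blast
  qed
  finally show ?case using 1 by simp
 qed
qed

section \<open>Uniform laws of large numbers on bounded ranges of \<open>A\<close>\<close>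

lemma pow_inverse_lipschitz:
 assumes "0 \<le> A" "0 \<le> B"
 shows "\<bar>1/(A + D j)^k - 1/(B + D j)^k\<bar> \<le> real k/d^(k+1)*\<bar>A - B\<bar>"
proof -
 obtain p q where p: "p = 1/(A + D j)" and q: "q = 1/(B + D j)" by simp
 have b: "0 < p" "p \<le> 1/d" "0 < q" "q \<le> 1/d"
  using t_pos[OF assms(1), of j] t_pos[OF assms(2), of j] t_ge[OF assms(1), of j] t_ge[OF assms(2), of j] d p q
  by (auto intro!: divide_left_mono mult_pos_pos)
 have pq: "\<bar>p - q\<bar> \<le> \<bar>A - B\<bar>/d^2"
 proof -
  have "p - q = (B - A)*(p*q)" using t_pos[OF assms(1), of j] t_pos[OF assms(2), of j] by (simp add: p q field_simps)
  then have "\<bar>p - q\<bar> = \<bar>A - B\<bar>*(p*q)" using b by (simp add: abs_mult abs_minus_commute)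
  also have "\<dots> \<le> \<bar>A - B\<bar>*((1/d)*(1/d))" by (intro mult_left_mono mult_mono) (use b d in auto)
  finally show ?thesis by (simp add: power2_eq_square)
 qed
 have "\<bar>p^k - q^k\<bar> \<le> real k*((1/d)^(k+1)*\<bar>A - B\<bar>)"
 proof (induction k)
  case (Suc k)
  have "\<bar>p*p^k - q*q^k\<bar> \<le> \<bar>p - q\<bar>*\<bar>p^k\<bar> + \<bar>q\<bar>*\<bar>p^k - q^k\<bar>" by (rule abs_mult_diff_le)
  also have "\<dots> \<le> (\<bar>A - B\<bar>/d^2)*(1/d)^k + (1/d)*(real k*((1/d)^(k+1)*\<bar>A - B\<bar>))"
  proof (intro add_mono mult_mono pq Suc.IH)
   show "\<bar>p^k\<bar> \<le> (1/d)^k" using power_mono[OF b(2), of k] b by simp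
  qed (use b d in auto)
  also have "\<dots> = real (Suc k)*((1/d)^(Suc k + 1)*\<bar>A - B\<bar>)"
   by (simp add: power2_eq_square power_one_over algebra_simps add_divide_distrib)
  finally show ?case by simp
 qed simp
 then show ?thesis unfolding p q by (simp add: power_one_over)
qed

lemma U_uniform:
 assumes k: "k \<le> 4" and \<eta>: "0 < \<eta>"
 shows "EV n. \<forall>A\<in>{0..B}. norm (U n k A) \<le> \<eta>*M n"
proof -
 have "EV n. \<forall>A\<in>{0..B}. norm (U n k A /\<^sub>R M n) \<le> \<eta>"
 proof (rule uniform_limit_from_rationals[where f = "\<lambda>n A. U n k A /\<^sub>R M n" and L = "CS*X*(real k/d^(k+1))"])
  show "EV n. \<forall>A B. 0 \<le> A \<longrightarrow> 0 \<le> B \<longrightarrow> norm (U n k A /\<^sub>R M n - U n k B /\<^sub>R M n) \<le> CS*X*(real k/d^(k+1))*\<bar>A - B\<bar>"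
   using sample sum_sq M_ge[of 1]
  proof eventually_elim
   case (elim n)
   then interpret S: regression_sample x D "mm n" "e n" d dm X c by blast
   show ?case
   proof (intro allI impI)
    fix A B :: real assume AB: "0 \<le> A" "0 \<le> B"
    let ?\<eta> = "real k/d^(k+1)*\<bar>A - B\<bar>"
    have "S.u k A - S.u k B = (\<Sum>j<mm n. (e n j*(1/(A + D j)^k - 1/(B + D j)^k)) *\<^sub>R x j)"
     unfolding S.u_def sum_subtractf[symmetric] scaleR_left_diff_distrib[symmetric] by (simp add: right_diff_distrib)
    also have "norm \<dots> \<le> 0 + (CS*M n)*X*?\<eta>"
    proof (rule S.weighted_sum_perturb[where g = "\<lambda>j. 1/(A + D j)^k - 1/(B + D j)^k" and g0 = "\<lambda>_. 0" and s = "CS*M n" and \<tau> = 0 and \<eta> = ?\<eta>])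
     show "(\<Sum>j<mm n. \<bar>e n j\<bar>) \<le> CS*M n" using elim by blast
     show "\<bar>(1/(A + D j)^k - 1/(B + D j)^k) - 0\<bar> \<le> ?\<eta>" for j using pow_inverse_lipschitz[OF AB] by simp
    qed simp
    finally have "norm (S.u k A - S.u k B) \<le> (CS*X*?\<eta>)*M n" by (simp add: mult_ac)
    then have "norm (S.u k A - S.u k B)/M n \<le> CS*X*?\<eta>" using elim(3) by (subst pos_divide_le_eq) auto
    then show "norm (S.u k A /\<^sub>R M n - S.u k B /\<^sub>R M n) \<le> CS*X*(real k/d^(k+1))*\<bar>A - B\<bar>"
     by (simp add: scaleR_diff_right[symmetric] divide_inverse_commute mult.assoc)
   qed
  qed
  show "(\<lambda>n. U n k (of_rat r) /\<^sub>R M n) \<longlonglongrightarrow> 0" if "0 \<le> r" for r :: rat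
   using that k by (intro U_avg) auto
 qed fact
 with M_ge[of 1] show ?thesis
 proof eventually_elim
  case (elim n)
  show ?case
  proof
   fix A assume "A \<in> {0..B}"
   from bspec[OF elim(2) this] have "norm (U n k A)/M n \<le> \<eta>" by (simp add: divide_inverse_commute)
   then show "norm (U n k A) \<le> \<eta>*M n" using elim(1) by (simp add: pos_divide_le_eq)
  qed
 qed
qed

lemma sq_uniform:
 assumes \<eta>: "0 < \<eta>"
 shows "EV n. \<forall>A\<in>{0..B}. \<bar>\<Sum>j<mm n. ((e n j)^2 - (A0 + D j))/(A + D j)\<bar> \<le> \<eta>*M n"
proof -
 let ?f = "\<lambda>n A. (\<Sum>j<mm n. ((e n j)^2 - (A0 + D j))/(A + D j))/M n"
 have "EV n. \<forall>A\<in>{0..B}. norm (?f n A) \<le> \<eta>"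
 proof (rule uniform_limit_from_rationals[where f = ?f and L = "2*CS/d^2"])
  show "EV n. \<forall>A B. 0 \<le> A \<longrightarrow> 0 \<le> B \<longrightarrow> norm (?f n A - ?f n B) \<le> 2*CS/d^2*\<bar>A - B\<bar>"
   using sum_sq M_ge[of 1]
  proof eventually_elim
   case (elim n)
   show ?case
   proof (intro allI impI)
    fix A B :: real assume AB: "0 \<le> A" "0 \<le> B"
    let ?\<eta> = "\<bar>A - B\<bar>/d^2"
    have "(\<Sum>j<mm n. ((e n j)^2 - (A0 + D j))/(A + D j)) - (\<Sum>j<mm n. ((e n j)^2 - (A0 + D j))/(B + D j)) =
     (\<Sum>j<mm n. ((e n j)^2 - (A0 + D j))*(1/(A + D j)^1 - 1/(B + D j)^1))"
     unfolding sum_subtractf[symmetric] by (simp add: right_diff_distrib)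
    moreover have "\<bar>\<dots>\<bar> \<le> (\<Sum>j<mm n. ((e n j)^2 + (A0 + dm))*?\<eta>)"
    proof (intro order_trans[OF sum_abs sum_mono])
     fix j
     have "\<bar>(e n j)^2 - (A0 + D j)\<bar> \<le> (e n j)^2 + (A0 + dm)"
      using Dhi[of j] Dlo[of j] d A0 by (simp add: abs_le_iff)
       (smt (verit) zero_le_power2)
     then show "\<bar>((e n j)^2 - (A0 + D j))*(1/(A + D j)^1 - 1/(B + D j)^1)\<bar> \<le> ((e n j)^2 + (A0 + dm))*?\<eta>"
      unfolding abs_mult using pow_inverse_lipschitz[OF AB, of j 1]
      by (intro mult_mono) (auto simp: power2_eq_square)
    qed
    moreover have "(\<Sum>j<mm n. ((e n j)^2 + (A0 + dm))*?\<eta>) \<le> (2*CS*M n)*?\<eta>"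
    proof -
     have "(\<Sum>j<mm n. (e n j)^2 + (A0 + dm)) \<le> 2*CS*M n"

     proof -
      have "(A0 + dm)*M n \<le> CS*M n" by (rule mult_right_mono) (auto simp: CS_def)
      moreover have "(\<Sum>j<mm n. (e n j)^2 + (A0 + dm)) = (\<Sum>j<mm n. (e n j)^2) + (A0 + dm)*M n" by (simp add: sum.distrib mult.commute)
      moreover have "(\<Sum>j<mm n. (e n j)^2) \<le> CS*M n" using elim by blast
      ultimately show ?thesis by linarith
     qed
     then show ?thesis unfolding sum_distrib_right[symmetric] by (rule mult_right_mono) simp
    qed
    ultimately have "\<bar>(\<Sum>j<mm n. ((e n j)^2 - (A0 + D j))/(A + D j)) - (\<Sum>j<mm n. ((e n j)^2 - (A0 + D j))/(B + D j))\<bar>/M n \<le> (2*CS*M n)*?\<eta>/M n"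
     by (intro divide_right_mono) auto
    then show "norm (?f n A - ?f n B) \<le> 2*CS/d^2*\<bar>A - B\<bar>"
     using elim(2) by (simp add: diff_divide_distrib[symmetric] abs_divide)
   qed
  qed
  show "(\<lambda>n. ?f n (of_rat r)) \<longlonglongrightarrow> 0" if "0 \<le> r" for r :: rat
   using avg2[of "of_rat r" 1] that by auto
 qed fact
 with M_ge[of 1] show ?thesis
 proof eventually_elim
  case (elim n)
  show ?case
  proof
   fix A assume "A \<in> {0..B}"
   from bspec[OF elim(2) this] show "\<bar>\<Sum>j<mm n. ((e n j)^2 - (A0 + D j))/(A + D j)\<bar> \<le> \<eta>*M n"
    using elim(1) by (simp add: abs_divide pos_divide_le_eq)
  qed
 qed
qed

abbreviation y :: "real^'p \<Rightarrow> nat \<Rightarrow> nat \<Rightarrow> real" where "y \<beta> n \<equiv> \<lambda>j. x j \<bullet> \<beta> + e n j"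
abbreviation l :: "real^'p \<Rightarrow> nat \<Rightarrow> real \<Rightarrow> real" where "l \<beta> n A \<equiv> ln (L_RE x D (mm n) (y \<beta> n) A)"

text \<open>Two regimes. Up to \<open>B\<close> the divergence term of every area is at least
  \<open>c\<psi>\<close>, which beats the uniformly small noise; beyond \<open>B\<close> the
  likelihood decays like a power of \<open>1 + A\<close> with exponent proportional to
  \<open>M n\<close>. The extra term \<open>q*ln (1 + A)\<close> leaves room for a factor of
  polynomial growth, such as the adjustment factor, and for a prior that is integrable only against
  a negative power of \<open>1 + A\<close>.\<close>

lemma tail:
 assumes \<epsilon>: "0 < \<epsilon>" and q: "0 \<le> q"
 shows "\<exists>c1>0. EV n. \<forall>A\<ge>0. \<epsilon> \<le> \<bar>A - A0\<bar> \<longrightarrow> l \<beta> n A - l \<beta> n A0 \<le> - c1*M n - q*ln (1 + A)"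
proof -
 let ?P = "real CARD('p)"
 \<comment> \<open>For \<open>A \<ge> B\<close> two things are needed:
   \<open>ln (1 + A)/2 \<le> ln ((A + d)/(A0 + dm))\<close>, from
   \<open>B \<ge> 2*(A0 + dm)^2\<close>, and \<open>ln (1 + A) \<ge> \<Lambda>0\<close>, so that an
   eighth of \<open>M n*ln (1 + A)\<close> pays for \<open>2*(1 + CS/d)*M n\<close>.\<close>
 define \<Lambda>0 where "\<Lambda>0 = 16*(1 + CS/d)"
 define B where "B = max (max 1 (2*(A0 + dm)^2)) (exp \<Lambda>0)"
 define R where "R = (A0 + dm)/d"
 define c\<psi> where "c\<psi> = ((\<epsilon>/(B + dm))/(sqrt R + 1))^2"
 have B: "1 \<le> B" "2*(A0 + dm)^2 \<le> B" "exp \<Lambda>0 \<le> B" by (auto simp: B_def)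
 have Bd: "0 < B + dm" using B dm0 by simp
 have R0: "0 < R" using A0 dm0 d by (simp add: R_def)
 have cp: "0 < c\<psi>"
 proof -
  have "0 < sqrt R + 1" using R0 by (simp add: add_nonneg_pos)
  then have "0 < (\<epsilon>/(B + dm))/(sqrt R + 1)" using \<epsilon> Bd by simp
  then show ?thesis by (simp only: c\<psi>_def zero_less_power)
 qed
 define s where "s = 1/2 + (B + dm)/(2*c)"
 have s0: "0 < s" using Bd c by (simp add: s_def add_pos_pos)
 define \<eta> where "\<eta> = min 1 (c\<psi>/16/s)"
 have \<eta>: "0 < \<eta>" "\<eta> \<le> 1" "\<eta> * s \<le> c\<psi>/16" using cp s0 by (auto simp: \<eta>_def min_def field_simps)
 define kc where "kc = \<bar>ln (max 1 dm/(A0 + d))\<bar>"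
 define const where "const = ?P/2*(kc + ln (1 + B)) + q*ln (1 + B)"
 have lnd: "ln ((A + dm)/(A0 + d)) \<le> kc + ln (1 + A)" if A: "0 \<le> A" for A
 proof -
  have "A + dm \<le> max 1 dm*(1 + A)" using A dm0 by (simp add: distrib_left max_def) (smt (verit) mult_left_le_one_le mult_le_cancel_right1)
  then have "(A + dm)/(A0 + d) \<le> max 1 dm/(A0 + d)*(1 + A)" using A0 d by (simp add: divide_right_mono)
  then have "ln ((A + dm)/(A0 + d)) \<le> ln (max 1 dm/(A0 + d)*(1 + A))"
   using A A0 d dm0 by (subst ln_le_cancel_iff) (auto intro!: mult_pos_pos divide_pos_pos)
  also have "\<dots> = ln (max 1 dm/(A0 + d)) + ln (1 + A)" using A A0 d by (subst ln_mult) auto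
  finally show ?thesis by (simp add: kc_def)
 qed
 have ev1: "EV n. \<forall>A\<in>{0..B}. norm (U n 1 A) \<le> \<eta>*M n" by (rule U_uniform[OF _ \<eta>(1)]) simp
 note ev2 = sq_uniform[OF \<eta>(1), of "max B A0"]
 have "EV n. \<forall>A\<ge>0. \<epsilon> \<le> \<bar>A - A0\<bar> \<longrightarrow> l \<beta> n A - l \<beta> n A0 \<le> - (min 1 (c\<psi>/4)*M n) - q*ln (1 + A)"
  using sample sum_sq M_ge[of 1] ev1 ev2 M_ge[of "8*const/c\<psi>"] M_ge[of "?P/2*kc"] M_ge[of "8*(?P/2 + q)"]
 proof eventually_elim
  case (elim n)
  then interpret S: regression_sample x D "mm n" "e n" d dm X c by blast
  have Mp: "1 \<le> M n" using elim by simp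
  show ?case
  proof (intro allI impI)
   fix A :: real assume A: "0 \<le> A" and eA: "\<epsilon> \<le> \<bar>A - A0\<bar>"
   have A00: "0 \<le> A0" using A0 by simp
   show "l \<beta> n A - l \<beta> n A0 \<le> - (min 1 (c\<psi>/4)*M n) - q*ln (1 + A)"
   proof (cases "A \<le> B")
    case True
    have psi: "c\<psi> \<le> ln ((A + D j)/(A0 + D j)) + (A0 + D j)/(A + D j) - 1" for j
    proof -
     have t: "0 < A + D j" "0 < A0 + D j" using t_pos A A00 by auto
     let ?r = "(A0 + D j)/(A + D j)"
     have "c\<psi> \<le> - ln ?r + ?r - 1" unfolding c\<psi>_def
     proof (rule log_ratio_lower_bound)
      show "0 < ?r" using t by simp
      show "?r \<le> R" unfolding R_def by (rule frac_le) (use t_ge[OF A, of j] Dhi[of j] A0 dm0 d in auto)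
      have "?r - 1 = (A0 - A)/(A + D j)" using t by (simp add: field_simps)
      then have "\<bar>?r - 1\<bar> = \<bar>A - A0\<bar>/(A + D j)" using t by (simp add: abs_minus_commute)
      moreover have "\<epsilon>/(B + dm) \<le> \<bar>A - A0\<bar>/(A + D j)"
       by (rule frac_le) (use eA t Dhi[of j] True \<epsilon> in auto)
      ultimately show "\<epsilon>/(B + dm) \<le> \<bar>?r - 1\<bar>" by simp
      show "0 \<le> \<epsilon>/(B + dm)" using \<epsilon> Bd by simp
     qed
     moreover have "ln ((A + D j)/(A0 + D j)) = - ln ?r" using t by (simp add: ln_div)
     ultimately show ?thesis by simp
    qed
    have 1: "c\<psi>*M n \<le> (\<Sum>j<mm n. ln ((A + D j)/(A0 + D j)) + (A0 + D j)/(A + D j) - 1)"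
     using sum_mono[of "{..<mm n}" "\<lambda>_. c\<psi>", OF psi] by (simp add: mult.commute)
    have 2: "\<bar>\<Sum>j<mm n. ((e n j)^2 - (A0 + D j))/(A + D j)\<bar> \<le> \<eta>*M n" "\<bar>\<Sum>j<mm n. ((e n j)^2 - (A0 + D j))/(A0 + D j)\<bar> \<le> \<eta>*M n"
     using elim A True A0 by auto
    have 3: "(A + dm)/(c*M n)*(norm (S.u 1 A))^2 \<le> (B + dm)/c*\<eta>*M n"
    proof -
     have "norm (S.u 1 A) \<le> \<eta>*M n" using elim A True by auto
     then have "(norm (S.u 1 A))^2 \<le> (\<eta>*M n)^2" by (intro power_mono) auto
     also have "\<dots> \<le> \<eta>*(M n)^2"
     proof -
      have "\<eta>*\<eta> \<le> 1*\<eta>" using \<eta> by (intro mult_right_mono) auto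
      then show ?thesis unfolding power_mult_distrib by (intro mult_right_mono) (auto simp: power2_eq_square)
     qed
     finally have "(A + dm)/(c*M n)*(norm (S.u 1 A))^2 \<le> (B + dm)/(c*M n)*(\<eta>*(M n)^2)"
      using True A dm0 c Mp by (intro mult_mono divide_right_mono) auto
     also have "\<dots> = (B + dm)/c*\<eta>*M n" using Mp by (simp add: power2_eq_square)
     finally show ?thesis .
    qed
    have 4: "?P/2*ln ((A + dm)/(A0 + d)) + q*ln (1 + A) \<le> const"
     unfolding const_def
    proof (intro add_mono mult_left_mono)
     have l1: "ln (1 + A) \<le> ln (1 + B)" using A True by simp
     then show "ln ((A + dm)/(A0 + d)) \<le> kc + ln (1 + B)" using lnd[OF A] by simp
     show "ln (1 + A) \<le> ln (1 + B)" by (rule l1)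
    qed (use q in auto)
    have 5: "const \<le> c\<psi>/8*M n" using elim cp by (simp add: field_simps)
    have 6: "\<eta>*M n + 1/2*((B + dm)/c*\<eta>*M n) \<le> c\<psi>/8*M n"
    proof -
     have "\<eta>*M n + 1/2*((B + dm)/c*\<eta>*M n) \<le> 2*(\<eta> * s)*M n"
     proof -
      have "0 \<le> (B + dm)/c*\<eta>*M n" using Bd c \<eta> Mp by simp
      moreover have "2*(\<eta> * s)*M n = \<eta>*M n + (B + dm)/c*\<eta>*M n"
      proof -
       have "2*(h*(1/2 + b/(2*k)))*r = h*r + b/k*h*r" for h b k r :: real by (simp add: distrib_left distrib_right mult_ac)
       then show ?thesis unfolding s_def .
      qed
      moreover have "a + 1/2*b \<le> r" if "0 \<le> b" "r = a + b" for a b r :: real using that by simp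
      ultimately show ?thesis by blast
     qed
     also have "\<dots> \<le> 2*(c\<psi>/16)*M n" by (intro mult_right_mono mult_left_mono \<eta>) (use Mp in auto)
     finally show ?thesis by simp
    qed
    have 7: "min 1 (c\<psi>/4)*M n \<le> c\<psi>/4*M n" using Mp by (intro mult_right_mono) auto
    have gen: "df \<le> - mn - qq" if "df \<le> - 1/2*ps + 1/2*a1 + 1/2*a2 + 1/2*b1 + p1" "cm \<le> ps" "a1 \<le> em" "a2 \<le> em" "b1 \<le> bm"
     "p1 + qq \<le> co" "co \<le> cm/8" "em + 1/2*bm \<le> cm/8" "mn \<le> cm/4" for df mn qq ps a1 a2 b1 p1 cm em bm co :: real
     using that by argo
    show ?thesis
     by (rule gen[OF S.ln_L_RE_diff(1)[OF A A00] 1 2 3 4]) (use 5 6 7 in auto)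
   next
    case False
    define \<Lambda> where "\<Lambda> = ln (1 + A)"
    have AB: "B \<le> A" "1 \<le> A" using False B by auto
    have L0: "\<Lambda>0 \<le> \<Lambda>"
    proof -
     have "exp \<Lambda>0 \<le> 1 + A" using B(3) AB by linarith
     then have "ln (exp \<Lambda>0) \<le> ln (1 + A)" using A by (subst ln_le_cancel_iff) auto
     then show ?thesis by (simp add: \<Lambda>_def)
    qed
    have "1/2*\<Lambda> \<le> ln ((A + d)/(A0 + dm))"
    proof -
     have pp: "0 < A0 + dm" using A0 dm0 by simp
     have "(1 + A)*(A0 + dm)^2 \<le> A^2"
     proof -
      have "(1 + A)*(A0 + dm)^2 \<le> (2*A)*(A0 + dm)^2" using AB by (intro mult_right_mono) auto
      also have "\<dots> = A*(2*(A0 + dm)^2)" by simp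
      also have "\<dots> \<le> A*A" using AB B(2) A by (intro mult_left_mono) auto
      finally show ?thesis by (simp add: power2_eq_square)
     qed
     then have "(1 + A) \<le> (A/(A0 + dm))^2" using pp by (simp add: power_divide pos_le_divide_eq)
     also have "\<dots> \<le> ((A + d)/(A0 + dm))^2" using pp A d by (intro power_mono divide_right_mono) auto
     finally have "ln (1 + A) \<le> ln (((A + d)/(A0 + dm))^2)" using A pp d by (subst ln_le_cancel_iff) auto
     also have "\<dots> = 2*ln ((A + d)/(A0 + dm))" using A pp d by (simp add: ln_realpow)
     finally show ?thesis by (simp add: \<Lambda>_def)
    qed
    then have 1: "M n*(1/2*\<Lambda>) \<le> M n*ln ((A + d)/(A0 + dm))" using Mp by (intro mult_left_mono) auto
    have 2: "(\<Sum>j<mm n. (e n j)^2)/d \<le> CS/d*M n" using elim d by (simp add: divide_right_mono)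
    have 3: "?P/2*ln ((A + dm)/(A0 + d)) \<le> ?P/2*(kc + \<Lambda>)" using lnd[OF A] by (intro mult_left_mono) (auto simp: \<Lambda>_def)
    have 4: "2*(1 + CS/d)*M n \<le> 1/8*(M n*\<Lambda>)"
    proof -
     have "2*(1 + CS/d)*M n = 1/8*(M n*\<Lambda>0)" by (simp add: \<Lambda>0_def)
     also have "\<dots> \<le> 1/8*(M n*\<Lambda>)" using L0 Mp by (intro mult_left_mono) auto
     finally show ?thesis .
    qed
    have L00: "0 \<le> \<Lambda>" using A by (simp add: \<Lambda>_def)
    have 5: "(?P/2 + q)*\<Lambda> \<le> 1/8*(M n*\<Lambda>)"
    proof -
     have "?P/2 + q \<le> 1/8*M n" using elim by simp
     from mult_right_mono[OF this L00] show ?thesis by (simp only: mult.assoc)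
    qed
    have 6: "?P/2*kc \<le> M n" using elim by blast
    have 7: "min 1 (c\<psi>/4)*M n \<le> 1*M n" using Mp by (intro mult_right_mono) auto
    have 8: "?P/2*(kc + \<Lambda>) = ?P/2*kc + ?P/2*\<Lambda>" "(?P/2 + q)*\<Lambda> = ?P/2*\<Lambda> + q*\<Lambda>" "2*(1 + CS/d)*M n = 2*M n + 2*(CS/d*M n)"
     by (simp_all add: algebra_simps)
    have 9: "0 \<le> CS/d*M n" using CS0 d Mp by simp
    have gen: "df \<le> - mn - qq" if "df \<le> - 1/2*ml + 1/2 * sd + p1" "1/2*mL \<le> ml" "sd \<le> cd" "p1 \<le> pk + pl" "2*m + 2*cd \<le> 1/8*mL"
     "pl + qq \<le> 1/8*mL" "pk \<le> m" "mn \<le> m" "0 \<le> cd" for df mn qq ml sd p1 mL cd pk pl m :: real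
     using that by argo
    have 10: "l \<beta> n A - l \<beta> n A0 \<le> - 1/2*(M n*ln ((A + d)/(A0 + dm))) + 1/2*((\<Sum>j<mm n. (e n j)^2)/d) + ?P/2*ln ((A + dm)/(A0 + d))"
     using S.ln_L_RE_diff(2)[OF A A00, of \<beta>] by (simp add: mult.assoc)
    have 11: "1/2*(M n*\<Lambda>) \<le> M n*ln ((A + d)/(A0 + dm))" using 1 by (simp add: mult_ac)
    show ?thesis unfolding \<Lambda>_def[symmetric]
     by (rule gen[OF 10 11 2 3[unfolded 8(1)] 4[unfolded 8(3)] 5[unfolded 8(2)] 6]) (use 7 9 in auto)
   qed
  qed
 qed
 then show ?thesis using cp by (intro exI[of _ "min 1 (c\<psi>/4)"]) auto
qed

end

text \<open>With the radius \<open>\<bar>A - B\<bar> + \<bar>B - A0\<bar>\<close> in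
  \<open>u_bounds\<close>, \<open>U^2/m\<close> splits into multiples of \<open>\<tau>^2/m\<close>,
  \<open>m*(B - A0)^2\<close> and \<open>m*\<bar>A - B\<bar>^2\<close>; the last is absorbed into
  the cubic term.\<close>

lemma (in regression_sample) score_expansion:
 fixes A B A0 s :: real
 assumes A: "0 < A" "A \<le> hi" "0 < B" "B \<le> hi" "0 \<le> A0"
  and t: "\<And>k. k \<in> {1,2,3} \<Longrightarrow> norm (u k A0) \<le> \<tau>" and S: "(\<Sum>j<m. \<bar>e j\<bar>) \<le> s*m" "(\<Sum>j<m. (e j)^2) \<le> s*m"
 shows "\<bar>lp A - lp B + info B*(A - B) - third B/2*(A - B)^2\<bar> \<le>
  (2/d^5 * s + 1/(2*d^4) + 3*k2 hi*(kU * s)^2)*m*\<bar>A - B\<bar>^3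
  + (12*k2 hi*(\<tau>^2/m) + 3*k2 hi*(kU * s)^2*(m*(B - A0)^2) + Cd)*\<bar>A - B\<bar>"
proof -
 have r: "\<bar>A - A0\<bar> \<le> \<bar>A - B\<bar> + \<bar>B - A0\<bar>" "\<bar>B - A0\<bar> \<le> \<bar>A - B\<bar> + \<bar>B - A0\<bar>" by linarith+
 let ?U = "2*\<tau> + kU*(s*m)*(\<bar>A - B\<bar> + \<bar>B - A0\<bar>)"
 have A': "0 \<le> A" "0 \<le> B" using A by auto
 have u: "norm (u 1 A) \<le> ?U" "norm (u 2 A) \<le> ?U" "norm (u 1 A - u 1 B) \<le> ?U*\<bar>A - B\<bar>" "norm (u 2 A - u 2 B) \<le> ?U*\<bar>A - B\<bar>"
  by (rule u_bounds[OF A' A(5) r t S(1)]; assumption)+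
 have u': "norm (u 1 B) \<le> ?U" by (rule u_bounds(1)[OF A'(2,1) A(5) r(2,1) t S(1)])
 note L = lp_expansion[OF A(1-4) u(1) u' u(2-4)]
 have k: "0 \<le> k2 hi" using A by (intro k_nonneg) auto
 have sq: "(x + y*(p + q))^2 \<le> 3*(x^2 + y^2*p^2 + y^2*q^2)" for x y p q :: real
 proof -
  have "0 \<le> (x - y*p)^2 + (x - y*q)^2 + (y*p - y*q)^2" by simp
  then show ?thesis by (simp add: power2_eq_square algebra_simps)
 qed
 have "k2 hi*?U^2/m \<le> k2 hi*(3*((2*\<tau>)^2 + (kU*(s*m))^2*\<bar>A - B\<bar>^2 + (kU*(s*m))^2*\<bar>B - A0\<bar>^2))/m"
  by (intro divide_right_mono mult_left_mono sq k) auto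
 also have "\<dots> = 12*k2 hi*(\<tau>^2/m) + 3*k2 hi*(kU * s)^2*(m*(B - A0)^2) + 3*k2 hi*(kU * s)^2*m*\<bar>A - B\<bar>^2"
 proof -
  have "K*(3*((2*t)^2 + (y*(s*r))^2*P + (y*(s*r))^2*Q))/r = 12*K*(t^2/r) + 3*K*(y * s)^2*(r*Q) + 3*K*(y * s)^2*r*P"
   if "0 < r" for K t y s r P Q :: real using that by (simp add: power2_eq_square field_simps)
  from this[OF mp] show ?thesis by simp
 qed
 finally have u2: "k2 hi*?U^2/m \<le> \<dots>" .
 have "(k2 hi*?U^2/m + Cd)*\<bar>A - B\<bar> \<le> (12*k2 hi*(\<tau>^2/m) + 3*k2 hi*(kU * s)^2*(m*(B - A0)^2) + 3*k2 hi*(kU * s)^2*m*\<bar>A - B\<bar>^2 + Cd)*\<bar>A - B\<bar>"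
  by (intro mult_right_mono add_right_mono u2) auto
 moreover have "(2/d^5*(\<Sum>j<m. (e j)^2) + 1/(2*d^4)*m)*\<bar>A - B\<bar>^3 \<le> (2/d^5*(s*m) + 1/(2*d^4)*m)*\<bar>A - B\<bar>^3"
  using d by (intro mult_right_mono add_right_mono mult_left_mono S) auto
 moreover have "E \<le> (i5 * s + i4 + 3*K*Y)*r*t^3 + (T + 3*K*Y*Q + C)*t"
  if "E \<le> P + R" "P \<le> (i5*(s*r) + i4*r)*t^3" "R \<le> (T + 3*K*Y*Q + 3*K*Y*r*t^2 + C)*t" for E P R i5 i4 K Y r t T Q C :: real
  using that by (simp add: power2_eq_square power3_eq_cube algebra_simps)
 ultimately show ?thesis using L by blast
qed

section \<open>Rates for the score and limits of its derivatives\<close>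

context regression_sequence
begin

abbreviation "lp n \<equiv> regression_sample.lp x D (mm n) (e n)"
abbreviation "info n \<equiv> regression_sample.info D (mm n) (e n)"
abbreviation "third n \<equiv> regression_sample.third D (mm n) (e n)"
abbreviation "T k n \<equiv> trVinv D (mm n) k"
definition \<tau> :: "nat \<Rightarrow> real" where "\<tau> n = (\<Sum>k\<in>{1,2,3}. norm (U n k A0))"
text \<open>The fourth root of the sample size: the assumed rate \<open>M n powr (3/4)\<close> is
  \<open>g n^3\<close> and \<open>sqrt (M n)\<close> is \<open>g n^2\<close>, so rate computations
  become polynomial in \<open>g\<close>.\<close>

definition g :: "nat \<Rightarrow> real" where "g n = M n powr (1/4)"

lemma g: "EV n. 1 \<le> g n \<and> 0 < g n \<and> M n = g n^4 \<and> M n powr (3/4) = g n^3 \<and> sqrt (M n) = g n^2"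
 using M_ge[of 1]
proof eventually_elim
 case (elim n)
 have "1 \<le> g n" using elim unfolding g_def by (intro ge_one_powr_ge_zero) auto
 moreover have "g n^4 = M n" "M n powr (3/4) = g n^3" using elim unfolding g_def by (simp_all add: powr_power powr_realpow[symmetric] powr_powr)
 moreover have "sqrt (M n) = g n^2"
 proof (rule real_sqrt_unique)
  show "(g n^2)^2 = M n" using \<open>g n^4 = M n\<close> by simp
 qed simp
 ultimately show ?case by simp
qed

lemma ginf: "filterlim g at_top sequentially"
proof -
 have "filterlim (\<lambda>r::real. r powr (1/4)) at_top at_top" by real_asymp
 from filterlim_compose[OF this Minf] show ?thesis unfolding g_def .
qed

lemma g_inv: "(\<lambda>n. 1/g n) \<longlonglongrightarrow> 0"
 by (rule tendsto_divide_0[OF tendsto_const filterlim_at_top_imp_at_infinity[OF ginf]])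

lemma \<tau>_rate: "(\<lambda>n. \<tau> n/g n^3) \<longlonglongrightarrow> 0"
proof -
 have "(\<lambda>n. \<Sum>k\<in>{1,2,3::nat}. norm (U n k A0)/M n powr (3/4)) \<longlonglongrightarrow> (\<Sum>k\<in>{1,2,3::nat}. 0)"
  by (intro tendsto_sum U_rate) auto
 then have "(\<lambda>n. \<tau> n/M n powr (3/4)) \<longlonglongrightarrow> 0" unfolding \<tau>_def sum_divide_distrib by simp
 moreover have "EV n. \<tau> n/M n powr (3/4) = \<tau> n/g n^3" using g
 proof eventually_elim
  case (elim n)
  then have "M n powr (3/4) = g n^3" by blast
  then show ?case by (simp only:)
 qed
 ultimately show ?thesis by (rule Lim_transform_eventually)
qed

lemma \<tau>_ge: "k \<in> {1,2,3} \<Longrightarrow> norm (U n k A0) \<le> \<tau> n" unfolding \<tau>_def by (intro member_le_sum) auto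
lemma \<tau>0: "0 \<le> \<tau> n" unfolding \<tau>_def by (intro sum_nonneg) auto

lemma expansion:
 assumes hi: "0 \<le> hi"
 obtains C1 where "0 < C1" "EV n. \<forall>A B. 0 < A \<longrightarrow> A \<le> hi \<longrightarrow> 0 < B \<longrightarrow> B \<le> hi \<longrightarrow>
  \<bar>lp n A - lp n B + info n B*(A - B) - third n B/2*(A - B)^2\<bar> \<le>
   C1*M n*\<bar>A - B\<bar>^3 + C1*(\<tau> n^2/M n + M n*(B - A0)^2 + 1)*\<bar>A - B\<bar>"
proof -
 let ?k = "regression_sample.k2 d dm X c hi" and ?y = "3*regression_sample.k2 d dm X c hi*(regression_sample.kU d X*CS)^2" and ?Cd = "regression_sample.Cd TYPE('p) d"
 define C1 where "C1 = max 1 (max (2/d^5*CS + 1/(2*d^4) + ?y) (max (12*?k) (max ?y ?Cd)))"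
 have C: "1 \<le> C1" "2/d^5*CS + 1/(2*d^4) + ?y \<le> C1" "12*?k \<le> C1" "?y \<le> C1" "?Cd \<le> C1" by (auto simp: C1_def)
 have "EV n. \<forall>A B. 0 < A \<longrightarrow> A \<le> hi \<longrightarrow> 0 < B \<longrightarrow> B \<le> hi \<longrightarrow>
  \<bar>lp n A - lp n B + info n B*(A - B) - third n B/2*(A - B)^2\<bar> \<le>
   C1*M n*\<bar>A - B\<bar>^3 + C1*(\<tau> n^2/M n + M n*(B - A0)^2 + 1)*\<bar>A - B\<bar>"
  using sample sum_sq
 proof eventually_elim
  case (elim n)
  then interpret S: regression_sample x D "mm n" "e n" d dm X c by blast
  show ?case
  proof (intro allI impI)
   fix A B assume AB: "0 < A" "A \<le> hi" "0 < B" "B \<le> hi"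
   have "\<bar>S.lp A - S.lp B + S.info B*(A - B) - S.third B/2*(A - B)^2\<bar> \<le>
     (2/d^5*CS + 1/(2*d^4) + ?y)*M n*\<bar>A - B\<bar>^3 + (12*?k*(\<tau> n^2/M n) + ?y*(M n*(B - A0)^2) + ?Cd)*\<bar>A - B\<bar>"
    by (rule S.score_expansion[OF AB _ \<tau>_ge]) (use A0 elim in auto)
   also have "\<dots> \<le> C1*M n*\<bar>A - B\<bar>^3 + (C1*(\<tau> n^2/M n) + C1*(M n*(B - A0)^2) + C1)*\<bar>A - B\<bar>"
    by (intro add_mono mult_right_mono C) auto
   finally show "\<bar>S.lp A - S.lp B + S.info B*(A - B) - S.third B/2*(A - B)^2\<bar> \<le>
    C1*M n*\<bar>A - B\<bar>^3 + C1*(\<tau> n^2/M n + M n*(B - A0)^2 + 1)*\<bar>A - B\<bar>" by (simp only: distrib_left mult_1_right)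
  qed
 qed
 with C(1) show ?thesis by (intro that[of C1]) auto
qed

lemma trVinv_bounds:
 assumes "0 \<le> A" shows "M n/(A + dm)^k \<le> T k n A \<and> T k n A \<le> M n/d^k"
proof -
 have "1/(A + dm)^k \<le> 1/(A + D j)^k \<and> 1/(A + D j)^k \<le> 1/d^k" for j
  using t_pos[OF assms, of j] t_ge[OF assms, of j] Dhi[of j] d assms
  by (auto intro!: divide_left_mono power_mono mult_pos_pos zero_less_power)
 then have "(\<Sum>j<mm n. 1/(A + dm)^k) \<le> T k n A" "T k n A \<le> (\<Sum>j<mm n. 1/d^k)"
  unfolding trVinv_def by (intro sum_mono; blast)+
 then show ?thesis by simp
qed

lemma weighted_power_lipschitz:
 assumes "0 \<le> A" "0 \<le> B" and w: "\<And>j. 0 \<le> w j" "(\<Sum>j<mm n. w j) \<le> s"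
 shows "\<bar>(\<Sum>j<mm n. w j/(A + D j)^k) - (\<Sum>j<mm n. w j/(B + D j)^k)\<bar> \<le> s*(real k/d^(k+1)*\<bar>A - B\<bar>)"
proof -
 have "\<bar>\<Sum>j<mm n. w j*(1/(A + D j)^k - 1/(B + D j)^k)\<bar> \<le> (\<Sum>j<mm n. w j*(real k/d^(k+1)*\<bar>A - B\<bar>))"
 proof (intro order_trans[OF sum_abs sum_mono])
  fix j
  show "\<bar>w j*(1/(A + D j)^k - 1/(B + D j)^k)\<bar> \<le> w j*(real k/d^(k+1)*\<bar>A - B\<bar>)"
   unfolding abs_mult using mult_left_mono[OF pow_inverse_lipschitz[OF assms(1,2)] w(1)] w(1) by simp
 qed
 also have "\<dots> \<le> s*(real k/d^(k+1)*\<bar>A - B\<bar>)"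
  unfolding sum_distrib_right[symmetric] by (rule mult_right_mono[OF w(2)]) (use d in simp)
 finally show ?thesis by (simp add: right_diff_distrib sum_subtractf)
qed

text \<open>For sums over the sample the Lipschitz constant is of order \<open>M n\<close>; after
  division by \<open>M n\<close>, consistency of \<open>a\<close> moves the argument from
  \<open>A0\<close> to \<open>a n\<close>.\<close>

lemma average_limit:
 assumes a: "a \<longlonglongrightarrow> A0" and f: "EV n. \<forall>A. 0 \<le> A \<longrightarrow> \<bar>f n A - f n A0\<bar> \<le> L*M n*\<bar>A - A0\<bar>"
  and lim: "(\<lambda>n. (f n A0 - q n)/M n) \<longlonglongrightarrow> 0"
 shows "(\<lambda>n. (f n (a n) - q n)/M n) \<longlonglongrightarrow> 0"
proof -
 have a0: "EV n. 0 \<le> a n" using order_tendstoD(1)[OF a A0] by eventually_elim simp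
 have "(\<lambda>n. L*\<bar>a n - A0\<bar>) \<longlonglongrightarrow> L*\<bar>A0 - A0\<bar>" by (intro tendsto_intros a)
 then have z: "(\<lambda>n. L*\<bar>a n - A0\<bar>) \<longlonglongrightarrow> 0" by simp
 have "(\<lambda>n. (f n (a n) - f n A0)/M n) \<longlonglongrightarrow> 0"
 proof (rule Lim_null_comparison[OF _ z])
  show "EV n. norm ((f n (a n) - f n A0)/M n) \<le> L*\<bar>a n - A0\<bar>"
   using f a0 M_ge[of 1]
  proof eventually_elim
   case (elim n)
   then have "\<bar>f n (a n) - f n A0\<bar> \<le> (L*\<bar>a n - A0\<bar>)*M n" by (simp add: mult_ac)
   then show ?case using elim(3) by (simp add: abs_divide pos_divide_le_eq)
  qed
 qed
 from tendsto_add[OF this lim] show ?thesis by (simp add: add_divide_distrib[symmetric])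
qed

text \<open>At \<open>A0\<close> the mean of \<open>info\<close> is half of tr[V^{-2}], and the
  deviation is a centred sum of squares with exponent 3 in the weights.\<close>

lemma info_limit: "a \<longlonglongrightarrow> A0 \<Longrightarrow> (\<lambda>n. (info n (a n) - T 2 n A0/2)/M n) \<longlonglongrightarrow> 0"
proof (erule average_limit)
 show "EV n. \<forall>A\<ge>0. \<bar>info n A - info n A0\<bar> \<le> (CS*(3/d^4) + 1/d^3)*M n*\<bar>A - A0\<bar>"
  using sample sum_sq
 proof eventually_elim
  case (elim n)
  then interpret S: regression_sample x D "mm n" "e n" d dm X c by blast
  show ?case
  proof (intro allI impI)
   fix A :: real assume A: "0 \<le> A"
   have i: "S.info B = (\<Sum>j<mm n. (e n j)^2/(B + D j)^3) - 1/2*(\<Sum>j<mm n. 1/(B + D j)^2)" for B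
    unfolding S.info_def by (simp add: sum_subtractf sum_distrib_left right_diff_distrib)
   have 1: "\<bar>(\<Sum>j<mm n. (e n j)^2/(A + D j)^3) - (\<Sum>j<mm n. (e n j)^2/(A0 + D j)^3)\<bar> \<le> CS*M n*(real 3/d^(3+1)*\<bar>A - A0\<bar>)"
    using elim A A0 by (intro weighted_power_lipschitz) auto
   have 2: "\<bar>(\<Sum>j<mm n. 1/(A + D j)^2) - (\<Sum>j<mm n. 1/(A0 + D j)^2)\<bar> \<le> M n*(real 2/d^(2+1)*\<bar>A - A0\<bar>)"
    using elim A A0 by (intro weighted_power_lipschitz) auto
   have "\<bar>(p - 1/2*q) - (p' - 1/2*q')\<bar> \<le> (C*(3/d^4) + 1/d^3)*r * s"
    if "\<bar>p - p'\<bar> \<le> C*r*(real 3/d^(3+1) * s)" "\<bar>q - q'\<bar> \<le> r*(real 2/d^(2+1) * s)" for p q p' q' C r s :: real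
   proof -
    have e: "(C*(3/d^4) + 1/d^3)*r * s = C*r*(real 3/d^(3+1) * s) + 1/2*(r*(real 2/d^(2+1) * s))" by (simp add: algebra_simps power3_eq_cube)
    have "\<bar>(p - 1/2*q) - (p' - 1/2*q')\<bar> \<le> a + 1/2*b" if "\<bar>p - p'\<bar> \<le> a" "\<bar>q - q'\<bar> \<le> b" for a b using that by linarith
    from this[OF that] show ?thesis unfolding e .
   qed
   from this[OF 1 2] show "\<bar>S.info A - S.info A0\<bar> \<le> (CS*(3/d^4) + 1/d^3)*M n*\<bar>A - A0\<bar>" unfolding i .
  qed
 qed
 have "EV n. (\<Sum>j<mm n. ((e n j)^2 - (A0 + D j))/(A0 + D j)^3)/M n = (info n A0 - T 2 n A0/2)/M n"
  using sample
 proof eventually_elim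
  case (elim n)
  have "1/2*(2*w/t^3 - 1/t^2) - (1/t^2)/2 = (w - t)/t^3" if "0 < t" for w t :: real
   using that by (simp add: power2_eq_square power3_eq_cube field_simps)
  note this[OF t_pos[of A0]]
  then have "(\<Sum>j<mm n. ((e n j)^2 - (A0 + D j))/(A0 + D j)^3) = info n A0 - T 2 n A0/2"
   unfolding regression_sample.info_def[OF elim] trVinv_def sum_distrib_left sum_divide_distrib sum_subtractf[symmetric]
   using A0 by (intro sum.cong) auto
  then show ?case by simp
 qed
 from Lim_transform_eventually[OF avg2[of A0 3] this] show "(\<lambda>n. (info n A0 - T 2 n A0/2)/M n) \<longlonglongrightarrow> 0" by simp
qed

text \<open>As for \<open>info\<close>: the mean at \<open>A0\<close> is 2 tr[V^{-3}], and the
  deviation is three times a centred sum with exponent 4.\<close>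

lemma third_limit: "a \<longlonglongrightarrow> A0 \<Longrightarrow> (\<lambda>n. (third n (a n) - 2*T 3 n A0)/M n) \<longlonglongrightarrow> 0"
proof (erule average_limit)
 show "EV n. \<forall>A\<ge>0. \<bar>third n A - third n A0\<bar> \<le> (CS*(12/d^5) + 3/d^4)*M n*\<bar>A - A0\<bar>"
  using sample sum_sq
 proof eventually_elim
  case (elim n)
  then interpret S: regression_sample x D "mm n" "e n" d dm X c by blast
  show ?case
  proof (intro allI impI)
   fix A :: real assume A: "0 \<le> A"
   have i: "S.third B = 3*(\<Sum>j<mm n. (e n j)^2/(B + D j)^4) - (\<Sum>j<mm n. 1/(B + D j)^3)" for B
    unfolding S.third_def by (simp add: sum_subtractf sum_distrib_left right_diff_distrib)
   have 1: "\<bar>(\<Sum>j<mm n. (e n j)^2/(A + D j)^4) - (\<Sum>j<mm n. (e n j)^2/(A0 + D j)^4)\<bar> \<le> CS*M n*(real 4/d^(4+1)*\<bar>A - A0\<bar>)"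
    using elim A A0 by (intro weighted_power_lipschitz) auto
   have 2: "\<bar>(\<Sum>j<mm n. 1/(A + D j)^3) - (\<Sum>j<mm n. 1/(A0 + D j)^3)\<bar> \<le> M n*(real 3/d^(3+1)*\<bar>A - A0\<bar>)"
    using elim A A0 by (intro weighted_power_lipschitz) auto
   have "\<bar>(3*p - q) - (3*p' - q')\<bar> \<le> (C*(12/d^5) + 3/d^4)*r * s"
    if "\<bar>p - p'\<bar> \<le> C*r*(real 4/d^(4+1) * s)" "\<bar>q - q'\<bar> \<le> r*(real 3/d^(3+1) * s)" for p q p' q' C r s :: real
   proof -
    have e: "(C*(12/d^5) + 3/d^4)*r * s = 3*(C*r*(real 4/d^(4+1) * s)) + r*(real 3/d^(3+1) * s)" by (simp add: algebra_simps)
    have "\<bar>(3*p - q) - (3*p' - q')\<bar> \<le> 3*a + b" if "\<bar>p - p'\<bar> \<le> a" "\<bar>q - q'\<bar> \<le> b" for a b using that by linarith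
    from this[OF that] show ?thesis unfolding e .
   qed
   from this[OF 1 2] show "\<bar>S.third A - S.third A0\<bar> \<le> (CS*(12/d^5) + 3/d^4)*M n*\<bar>A - A0\<bar>" unfolding i .
  qed
 qed
 have "EV n. 3*((\<Sum>j<mm n. ((e n j)^2 - (A0 + D j))/(A0 + D j)^4)/M n) = (third n A0 - 2*T 3 n A0)/M n"
  using sample
 proof eventually_elim
  case (elim n)
  have "(3*w/t^4 - 1/t^3) - 2*(1/t^3) = 3*((w - t)/t^4)" if "0 < t" for w t :: real
   using that by (simp add: power3_eq_cube power4_eq_xxxx field_simps)
  note this[OF t_pos[of A0]]
  then have "3*(\<Sum>j<mm n. ((e n j)^2 - (A0 + D j))/(A0 + D j)^4) = third n A0 - 2*T 3 n A0"
   unfolding regression_sample.third_def[OF elim] trVinv_def sum_distrib_left sum_subtractf[symmetric]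
   using A0 by (intro sum.cong) auto
  then show ?case by simp
 qed
 from Lim_transform_eventually[OF tendsto_mult_left[OF avg2[of A0 4], of 3] this] show "(\<lambda>n. (third n A0 - 2*T 3 n A0)/M n) \<longlonglongrightarrow> 0" by simp
qed

lemma trVinv_limit: "a \<longlonglongrightarrow> A0 \<Longrightarrow> (\<lambda>n. (T k n (a n) - T k n A0)/M n) \<longlonglongrightarrow> 0"
proof (erule average_limit)
 show "EV n. \<forall>A\<ge>0. \<bar>T k n A - T k n A0\<bar> \<le> (real k/d^(k+1))*M n*\<bar>A - A0\<bar>"
 proof (intro always_eventually allI impI)
  fix n and A :: real assume A: "0 \<le> A"
  have "\<bar>(\<Sum>j<mm n. 1/(A + D j)^k) - (\<Sum>j<mm n. 1/(A0 + D j)^k)\<bar> \<le> M n*(real k/d^(k+1)*\<bar>A - A0\<bar>)"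
   using A A0 by (intro weighted_power_lipschitz) auto
  then show "\<bar>T k n A - T k n A0\<bar> \<le> (real k/d^(k+1))*M n*\<bar>A - A0\<bar>" unfolding trVinv_def by (simp add: mult_ac)
 qed
qed simp

text \<open>The score at \<open>A0\<close> is half a centred sum of squares, which is o(g^3), plus
  corrections for beta of order \<tau>^2/M = o(g^2) and a bounded log-determinant term.\<close>

lemma score_at_truth: "(\<lambda>n. lp n A0/g n^3) \<longlonglongrightarrow> 0"
proof -
 let ?k = "regression_sample.k0 dm c A0"
 let ?P = "real CARD('p)"
 let ?b = "\<lambda>n. 1/2*\<bar>(\<Sum>j<mm n. ((e n j)^2 - (A0 + D j))/(A0 + D j)^2)/M n powr (3/4)\<bar> + (?k + X^2/d^2*?k^2)*(\<tau> n/g n^3)^2*(1/g n) + ?P/d*(1/g n)"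
 show ?thesis
 proof (rule Lim_null_comparison)
  have "?b \<longlonglongrightarrow> 1/2*\<bar>0\<bar> + (?k + X^2/d^2*?k^2)*0^2*0 + ?P/d*0"
   by (intro tendsto_intros L2 \<tau>_rate g_inv) auto
  then show "?b \<longlonglongrightarrow> 0" by simp
  show "EV n. norm (lp n A0/g n^3) \<le> ?b n"
   using sample g
  proof eventually_elim
   case (elim n)
   then interpret S: regression_sample x D "mm n" "e n" d dm X c by blast
   let ?Z = "\<Sum>j<mm n. ((e n j)^2 - (A0 + D j))/(A0 + D j)^2"
   have g: "1 \<le> g n" "0 < g n" "M n = g n^4" "M n powr (3/4) = g n^3" using elim by auto
   have A00: "0 \<le> A0" using A0 by simp
   have kp: "0 \<le> S.k0 A0" by (rule S.k_nonneg[OF A00])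
   have b: "norm (S.b A0) \<le> S.k0 A0*\<tau> n/M n"
    by (rule S.solve_bounds(1)[OF A00 order_refl A00 order_refl S.Qb[OF A00] S.Qb[OF A00]]) (use \<tau>_ge[of 1 n] in auto)
   have "\<bar>S.b A0 \<bullet> S.u 2 A0\<bar> \<le> (S.k0 A0*\<tau> n/M n)*\<tau> n"
    by (rule order_trans[OF Cauchy_Schwarz_ineq2 mult_mono]) (use b \<tau>_ge[of 2 n] kp \<tau>0 in auto)
   also have "\<dots> = S.k0 A0*(\<tau> n)^2/M n" by (simp add: power2_eq_square)
   finally have 1: "\<bar>S.b A0 \<bullet> S.u 2 A0\<bar> \<le> S.k0 A0*(\<tau> n)^2/M n" .
   have "(\<Sum>j<mm n. (x j \<bullet> S.b A0)^2/(A0 + D j)^2) \<le> (\<Sum>j<mm n. (X*(S.k0 A0*\<tau> n/M n))^2/d^2)"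
   proof (rule sum_mono)
    fix j
    have "\<bar>x j \<bullet> S.b A0\<bar> \<le> X*(S.k0 A0*\<tau> n/M n)"
     by (rule order_trans[OF Cauchy_Schwarz_ineq2 mult_mono]) (use b X X0 in auto)
    then have "(x j \<bullet> S.b A0)^2 \<le> (X*(S.k0 A0*\<tau> n/M n))^2" using abs_le_square_iff[of "x j \<bullet> S.b A0" "X*(S.k0 A0*\<tau> n/M n)"] by linarith
    then show "(x j \<bullet> S.b A0)^2/(A0 + D j)^2 \<le> (X*(S.k0 A0*\<tau> n/M n))^2/d^2"
     by (rule frac_le[rotated]) (use t_ge[OF A00, of j] d in \<open>auto intro: power_mono\<close>)
   qed
   also have "\<dots> = X^2/d^2*(S.k0 A0)^2*(\<tau> n)^2/M n" using S.mp by (simp add: power_mult_distrib power_divide power2_eq_square mult_ac)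
   finally have 2: "(\<Sum>j<mm n. (x j \<bullet> S.b A0)^2/(A0 + D j)^2) \<le> X^2/d^2*(S.k0 A0)^2*(\<tau> n)^2/M n" .
   have 20: "0 \<le> (\<Sum>j<mm n. (x j \<bullet> S.b A0)^2/(A0 + D j)^2)" by (intro sum_nonneg) auto
   have 3: "0 \<le> S.ld1 A0 \<and> S.ld1 A0 \<le> ?P/d" by (rule S.ld1_bounds[OF A00])
   have Z: "?Z = (\<Sum>j<mm n. (e n j)^2/(A0 + D j)^2) - (\<Sum>j<mm n. 1/(A0 + D j))"
    unfolding sum_subtractf[symmetric] using t_pos[OF A00] by (intro sum.cong) (auto simp: diff_divide_distrib power2_eq_square less_imp_neq[symmetric])
   have "\<bar>S.lp A0\<bar> \<le> 1/2*\<bar>?Z\<bar> + (S.k0 A0*(\<tau> n)^2/M n + X^2/d^2*(S.k0 A0)^2*(\<tau> n)^2/M n) + ?P/d"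
   proof -
    have "\<bar>1/2*(s - 2*bu + q) - 1/2*t + 1/2*l\<bar> \<le> 1/2*\<bar>Z\<bar> + (B + Q) + L" if "Z = s - t" "\<bar>bu\<bar> \<le> B" "q \<le> Q" "0 \<le> q" "0 \<le> l" "l \<le> L" for s bu q t l Z B Q L :: real
     using that abs_ge_self[of Z] abs_ge_minus_self[of Z] unfolding abs_le_iff by argo
    from this[OF Z 1 2 20 conjunct1[OF 3] conjunct2[OF 3]] show ?thesis unfolding S.lp_def S.W_eq[OF A00] .
   qed
   then have "\<bar>S.lp A0\<bar>/g n^3 \<le> (1/2*\<bar>?Z\<bar> + (S.k0 A0*(\<tau> n)^2/M n + X^2/d^2*(S.k0 A0)^2*(\<tau> n)^2/M n) + ?P/d)/g n^3"
    using g by (intro divide_right_mono) auto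
   also have "\<dots> = 1/2*\<bar>?Z\<bar>/g n^3 + (S.k0 A0 + X^2/d^2*(S.k0 A0)^2)*(\<tau> n/g n^3)^2*(1/g n) + ?P/d*(1/g n^3)"
   proof -
    have "(h*Z + (k*t^2/r^4 + y*t^2/r^4) + p)/r^3 = h*Z/r^3 + (k + y)*(t/r^3)^2*(1/r) + p*(1/r^3)" if "0 < r" for h Z k t r y p :: real
     using that by (simp add: eval_nat_numeral field_simps)
    from this[OF g(2)] show ?thesis unfolding g(3) .
   qed
   also have "\<dots> \<le> 1/2*\<bar>?Z\<bar>/g n^3 + (S.k0 A0 + X^2/d^2*(S.k0 A0)^2)*(\<tau> n/g n^3)^2*(1/g n) + ?P/d*(1/g n)"
   proof (intro add_left_mono mult_left_mono)
    show "1/g n^3 \<le> 1/g n" using power_increasing[OF _ g(1), of 1 3] g by (intro divide_left_mono) auto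
   qed (use d in simp)
   finally show ?case using g by (simp add: abs_divide)
  qed
 qed
qed

end

section \<open>Consistency of the estimators\<close>

text \<open>Supplies the exponent \<open>q\<close> with which \<open>tail\<close> shows that the
  adjusted likelihood, too, is negligible away from \<open>A0\<close>.\<close>

lemma h_adj_growth:
 assumes "0 < d" "d \<le> D i"
 shows "\<exists>C. \<forall>A>0. ln (h_adj D z i A) \<le> C + ((1 + z^2)/4 + \<bar>(7 - z^2)/4\<bar>)*ln (1 + A)"
proof -
 let ?p = "(1 + z^2)/4" and ?q = "(7 - z^2)/4"
 let ?k = "\<bar>ln d\<bar> + ln (1 + D i)"
 have "ln (h_adj D z i A) \<le> \<bar>?q\<bar>*?k + (?p + \<bar>?q\<bar>)*ln (1 + A)" if A: "0 < A" for A
 proof -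
  have t: "0 < A + D i" "d \<le> A + D i" using A assms by auto
  have "ln (A + D i) \<le> ln ((1 + D i)*(1 + A))"
   using t A assms by (subst ln_le_cancel_iff) (auto simp: algebra_simps intro!: add_pos_nonneg mult_nonneg_nonneg)
  then have "ln (A + D i) \<le> ?k + ln (1 + A)" using A assms by (simp add: ln_mult)
  moreover have "ln d \<le> ln (A + D i)" using t assms by (subst ln_le_cancel_iff) auto
  moreover have "0 \<le> ln (1 + A)" "0 \<le> ln (1 + D i)" using A assms by auto
  ultimately have "\<bar>ln (A + D i)\<bar> \<le> ?k + ln (1 + A)" by linarith
  then have "\<bar>?q\<bar>*\<bar>ln (A + D i)\<bar> \<le> \<bar>?q\<bar>*(?k + ln (1 + A))" by (rule mult_left_mono) simp
  then have "?q*ln (A + D i) \<le> \<bar>?q\<bar>*?k + \<bar>?q\<bar>*ln (1 + A)"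
   using abs_ge_self[of "?q*ln (A + D i)"] by (simp only: abs_mult distrib_left)
  moreover have "?p*ln A \<le> ?p*ln (1 + A)" using A by (intro mult_left_mono) auto
  moreover have "ln (h_adj D z i A) = ?p*ln A + ?q*ln (A + D i)"
   unfolding h_adj_def using A t by (simp add: ln_mult ln_powr)
  ultimately show ?thesis by (simp only: distrib_right)
 qed
 then show ?thesis by blast
qed

text \<open>Partial fractions: \<open>(1 + z^2)/(4*A) + (7 - z^2)/(4*(A + D i))\<close> is
  \<open>l1\<close>.\<close>

lemma h_adj_log_deriv:
 assumes "0 < A" "0 < D i"
 shows "((\<lambda>A. ln (h_adj D z i A)) has_real_derivative l1 D z i A) (at A)"
proof -
 let ?p = "(1 + z^2)/4" and ?q = "(7 - z^2)/4"
 have e: "?p*(1/A) + ?q*(1/(A + D i)) = l1 D z i A"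
 proof -
  have "(1 + z^2)*D i/(4*A*(A + D i)) = (1 + z^2)/4*(1/A - 1/(A + D i))"
   using assms by (simp add: divide_simps)
  moreover have "w/4*r + (8 - w)/4*t = 2*t + w/4*(r - t)" for w r t :: real by (simp add: field_simps)
  from this[of "1 + z^2" "1/A" "1/(A + D i)"] have "?p*(1/A) + ?q*(1/(A + D i)) = 2/(A + D i) + (1 + z^2)/4*(1/A - 1/(A + D i))" by simp
  ultimately show ?thesis unfolding l1_def by presburger
 qed
 have "((\<lambda>A. ?p*ln A + ?q*ln (A + D i)) has_real_derivative l1 D z i A) (at A)"
  unfolding e[symmetric] by (intro DERIV_add DERIV_cmult) (use assms in \<open>auto intro!: derivative_eq_intros\<close>)
 then show ?thesis
  by (rule has_field_derivative_transform_within_open[of _ _ _ "{0<..}"])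
   (use assms in \<open>auto simp: h_adj_def ln_mult ln_powr\<close>)
qed

locale estimator_sequence = regression_sequence +
 fixes \<beta> :: "real^'a" and i :: nat and z K :: real and a ah :: "nat \<Rightarrow> real"
 assumes eK: "EV n. \<bar>e n i\<bar> \<le> K"
  and reml: "EV n. is_REML x D (mm n) (\<lambda>j. x j \<bullet> \<beta> + e n j) (ah n)"
  and aml: "EV n. is_AML x D z (mm n) i (\<lambda>j. x j \<bullet> \<beta> + e n j) (a n)"
begin

abbreviation "L n \<equiv> L_RE x D (mm n) (y \<beta> n)"

lemma L_pos: "EV n. \<forall>A\<ge>0. 0 < L n A"
 using sample by eventually_elim (use regression_sample.L_RE_pos in blast)

lemma Di: "0 < D i" using d Dlo[of i] by linarith

text \<open>By \<open>tail\<close> with \<open>q = 0\<close>, no point at distance at least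
  \<open>\<epsilon>\<close> from \<open>A0\<close> has a likelihood as large as the one at
  \<open>A0\<close>.\<close>

lemma reml_consistent: "ah \<longlonglongrightarrow> A0"
proof (rule tendstoI)
 fix \<epsilon> :: real assume "0 < \<epsilon>"
 from tail[OF this order_refl] obtain c1 where c1: "0 < c1" and
  t: "EV n. \<forall>A\<ge>0. \<epsilon> \<le> \<bar>A - A0\<bar> \<longrightarrow> l \<beta> n A - l \<beta> n A0 \<le> - c1*M n - 0*ln (1 + A)" by blast
 show "EV n. dist (ah n) A0 < \<epsilon>" using t reml L_pos M_ge[of 1]
 proof eventually_elim
  case (elim n)
  have 0: "0 \<le> ah n" "L n A0 \<le> L n (ah n)" using elim(2) A0 unfolding is_REML_def is_arg_max_def by (auto simp: not_less)
  have "l \<beta> n A0 \<le> l \<beta> n (ah n)" using 0 elim(3) A0 by (subst ln_le_cancel_iff) auto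
  then show ?case using elim(1) 0 mult_pos_pos[OF c1, of "M n"] elim(4)
   by (simp add: dist_real_def) (smt (verit))
 qed
qed

text \<open>The adjusted likelihood vanishes at 0, since \<open>0 powr r = 0\<close>, and is
  positive at \<open>A0\<close>; so its maximiser is positive and logarithms may be taken.\<close>

lemma aml_properties: "EV n. 0 < a n \<and> h_adj D z i A0*L n A0 \<le> h_adj D z i (a n)*L n (a n)
  \<and> (\<forall>A>0. ln (h_adj D z i A) + l \<beta> n A \<le> ln (h_adj D z i (a n)) + l \<beta> n (a n))"
 using aml L_pos
proof eventually_elim
 case (elim n)
 have h0: "0 < h_adj D z i A" if "0 < A" for A using that Di by (auto simp: h_adj_def)
 have mx: "0 \<le> a n" "\<And>A. 0 \<le> A \<Longrightarrow> h_adj D z i A*L n A \<le> h_adj D z i (a n)*L n (a n)"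
  using elim(1) unfolding is_AML_def is_arg_max_def by (auto simp: not_less)
 have "0 < h_adj D z i A0*L n A0" using h0[OF A0] elim(2) A0 by simp
 then have "0 < h_adj D z i (a n)*L n (a n)" using mx(2)[of A0] A0 by simp
 then have "a n \<noteq> 0" by (auto simp: h_adj_def)
 then have a0: "0 < a n" using mx(1) by simp
 moreover have "ln (h_adj D z i A) + l \<beta> n A \<le> ln (h_adj D z i (a n)) + l \<beta> n (a n)" if A: "0 < A" for A
 proof -
  have "ln (h_adj D z i A*L n A) \<le> ln (h_adj D z i (a n)*L n (a n))"
   using mx(2)[of A] A h0[OF A] h0[OF a0] elim(2) a0 by (subst ln_le_cancel_iff) auto
  then show ?thesis using A h0[OF A] h0[OF a0] elim(2) a0 by (simp add: ln_mult_pos)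
 qed
 ultimately show ?case using mx(2)[of A0] A0 by auto
qed

text \<open>The adjustment factor grows at most like a power of \<open>1 + A\<close>, which
  \<open>tail\<close> compensates; far from \<open>A0\<close> the adjusted likelihood therefore
  stays below its value at \<open>A0\<close>.\<close>

lemma aml_consistent: "a \<longlonglongrightarrow> A0"
proof (rule tendstoI)
 fix \<epsilon> :: real assume e: "0 < \<epsilon>"
 let ?q = "(1 + z^2)/4 + \<bar>(7 - z^2)/4\<bar>"
 obtain Ch where Ch: "\<And>A. 0 < A \<Longrightarrow> ln (h_adj D z i A) \<le> Ch + ?q*ln (1 + A)"
  using h_adj_growth[OF d, of D i z] Dlo by blast
 have "0 \<le> ?q" by simp
 from tail[OF e this] obtain c1 where c1: "0 < c1" and
  t: "EV n. \<forall>A\<ge>0. \<epsilon> \<le> \<bar>A - A0\<bar> \<longrightarrow> l \<beta> n A - l \<beta> n A0 \<le> - c1*M n - ?q*ln (1 + A)" by blast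
 show "EV n. dist (a n) A0 < \<epsilon>"
  using t aml_properties M_ge[of "(Ch - ln (h_adj D z i A0) + 1)/c1"]
 proof eventually_elim
  case (elim n)
  have a0: "0 < a n" and m: "ln (h_adj D z i A0) + l \<beta> n A0 \<le> ln (h_adj D z i (a n)) + l \<beta> n (a n)" using elim(2) A0 by auto
  have 3: "Ch - ln (h_adj D z i A0) + 1 \<le> c1*M n" using elim(3) c1 by (simp add: pos_divide_le_eq mult.commute)
  show ?case
  proof (rule ccontr)
   assume "\<not> dist (a n) A0 < \<epsilon>"
   then have "l \<beta> n (a n) - l \<beta> n A0 \<le> - c1*M n - ?q*ln (1 + a n)" using elim(1) a0 by (simp add: dist_real_def)
   moreover have "False" if "la - l0 \<le> - c1*r - w" "h0 + l0 \<le> ha + la" "ha \<le> Ch + w" "Ch - h0 + 1 \<le> c1*r" for la l0 r w h0 ha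
    using that by simp
   ultimately show False using m Ch[OF a0] 3 by blast
  qed
 qed
qed

text \<open>First-order condition at the interior maximiser of the adjusted likelihood. It is how
  the adjustment factor enters the posterior mean of \<open>A - a n\<close>.\<close>

lemma score_at_aml: "EV n. lp n (a n) = - l1 D z i (a n)"
 using sample aml_properties
proof eventually_elim
 case (elim n)
 then interpret S: regression_sample x D "mm n" "e n" d dm X c by blast
 have a0: "0 < a n" using elim by blast
 have "((\<lambda>A. ln (h_adj D z i A) + l \<beta> n A) has_real_derivative l1 D z i (a n) + S.lp (a n)) (at (a n))"
  by (intro DERIV_add h_adj_log_deriv S.ln_L_RE_deriv a0 Di)
 then have "l1 D z i (a n) + S.lp (a n) = 0"
  by (rule DERIV_local_max[OF _ a0]) (use elim(2) a0 in \<open>auto simp: abs_less_iff\<close>)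
 then show ?case by simp
qed

lemma l1_limit: "b \<longlonglongrightarrow> A0 \<Longrightarrow> (\<lambda>n. l1 D z i (b n)) \<longlonglongrightarrow> l1 D z i A0"
 unfolding l1_def using A0 Di by (auto intro!: tendsto_eq_intros)

lemma score_bounded: "EV n. \<bar>lp n (a n)\<bar> \<le> \<bar>l1 D z i A0\<bar> + 1"
proof -
 have "EV n. \<bar>l1 D z i (a n)\<bar> < \<bar>l1 D z i A0\<bar> + 1"
  by (rule order_tendstoD(2)[OF tendsto_rabs[OF l1_limit[OF aml_consistent]]]) simp
 with score_at_aml show ?thesis by eventually_elim simp
qed

text \<open>By consistency the adjustment factors at \<open>a n\<close> and \<open>A0\<close> have
  ratio close to 1, for which 2 is a convenient bound. This lets the tail bound, stated relative to
  \<open>A0\<close>, be used with the likelihood normalised at \<open>a n\<close>.\<close>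

lemma L_truth_le: "EV n. L n A0 \<le> 2*L n (a n)"
proof -
 have h0: "0 < h_adj D z i A0" using A0 Di by (auto simp: h_adj_def)
 have "(\<lambda>n. h_adj D z i (a n)) \<longlonglongrightarrow> h_adj D z i A0"
  unfolding h_adj_def using A0 Di by (auto intro!: tendsto_eq_intros aml_consistent)
 then have "EV n. h_adj D z i (a n) < 2*h_adj D z i A0" by (rule order_tendstoD) (use h0 in simp)
 with aml_properties L_pos show ?thesis
 proof eventually_elim
  case (elim n)
  have "h_adj D z i A0*L n A0 \<le> h_adj D z i (a n)*L n (a n)" using elim(1) by blast
  also have "\<dots> \<le> 2*h_adj D z i A0*L n (a n)" using elim by (intro mult_right_mono) (auto simp: less_imp_le)
  finally have "h_adj D z i A0*L n A0 \<le> h_adj D z i A0*(2*L n (a n))" by (simp only: mult_ac)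
  then show ?case using h0 by simp
 qed
qed

text \<open>Half of the lower bound \<open>1/(2*(A0 + dm)^2)\<close> for tr[V^{-2}]/(2 M), leaving
  the other half for the deviation of \<open>info\<close>; \<open>CI\<close> is an upper bound for
  \<open>info\<close> and \<open>third\<close> per area.\<close>

definition cI :: real where "cI = 1/(4*(A0 + dm)^2)"
definition CI :: real where "CI = 1/d^2 + 2/d^3 + cI + 1"

lemma cI0: "0 < cI" "0 < CI" using A0 dm0 d unfolding cI_def CI_def by (auto intro!: add_nonneg_pos)

lemma info_third_bounds:
 assumes b: "b \<longlonglongrightarrow> A0"
 shows "EV n. cI*M n \<le> info n (b n) \<and> info n (b n) \<le> CI*M n \<and> \<bar>third n (b n)\<bar> \<le> CI*M n"
proof -
 have 1: "EV n. \<bar>(info n (b n) - T 2 n A0/2)/M n\<bar> < cI" using tendstoD[OF info_limit[OF b], of cI] cI0 by simp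
 have 2: "EV n. \<bar>(third n (b n) - 2*T 3 n A0)/M n\<bar> < 1" using tendstoD[OF third_limit[OF b], of 1] by simp
 show ?thesis using 1 2 M_ge[of 1]
 proof eventually_elim
  case (elim n)
  have t: "M n/(A0 + dm)^2 \<le> T 2 n A0" "T 2 n A0 \<le> M n/d^2" "M n/(A0 + dm)^3 \<le> T 3 n A0" "T 3 n A0 \<le> M n/d^3"
   using trVinv_bounds[of A0 n] A0 by auto
  have p: "0 \<le> M n/(A0 + dm)^3" "0 \<le> M n/d^3" "0 \<le> M n/d^2" "0 \<le> cI*M n" using A0 dm0 d cI0 by auto
  have a: "\<bar>info n (b n) - T 2 n A0/2\<bar> \<le> cI*M n" "\<bar>third n (b n) - 2*T 3 n A0\<bar> \<le> M n"
   using elim by (auto simp: abs_divide pos_divide_less_eq)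
  have m: "cI*M n = (M n/(A0 + dm)^2)/4" by (simp add: cI_def)
  have C: "CI*M n = M n/d^2 + 2*(M n/d^3) + cI*M n + M n" by (simp add: CI_def distrib_right)
  have "cm \<le> f" "f \<le> C" "\<bar>h\<bar> \<le> C"
   if "P2 \<le> t2" "t2 \<le> Q2" "P3 \<le> t3" "t3 \<le> Q3" "0 \<le> P3" "0 \<le> Q3" "0 \<le> Q2" "0 \<le> cm" "\<bar>f - t2/2\<bar> \<le> cm" "\<bar>h - 2*t3\<bar> \<le> r" "cm = P2/4" "C = Q2 + 2*Q3 + cm + r"
   for cm f C h P2 t2 Q2 P3 t3 Q3 r :: real using that by linarith+
  from this[OF t p a m C] show ?case by blast
 qed
qed

text \<open>Expanding the score between \<open>A0\<close> and \<open>a n\<close>, where it is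
  bounded, estimates \<open>info n A0*\<bar>a n - A0\<bar>\<close> by the score at the truth, of
  order o(g^3), plus terms with further factors that tend to 0; these are absorbed into the left
  side.\<close>

lemma rate: "(\<lambda>n. g n*\<bar>a n - A0\<bar>) \<longlonglongrightarrow> 0"
proof -
 obtain C1 where C1: "0 < C1" and ex: "EV n. \<forall>A B. 0 < A \<longrightarrow> A \<le> A0 + 1 \<longrightarrow> 0 < B \<longrightarrow> B \<le> A0 + 1 \<longrightarrow>
  \<bar>lp n A - lp n B + info n B*(A - B) - third n B/2*(A - B)^2\<bar> \<le>
   C1*M n*\<bar>A - B\<bar>^3 + C1*(\<tau> n^2/M n + M n*(B - A0)^2 + 1)*\<bar>A - B\<bar>"
  by (rule expansion[of "A0 + 1"]) (use A0 in auto)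
 let ?Cl = "\<bar>l1 D z i A0\<bar> + 1"
 \<comment> \<open>The coefficient of \<open>g n*\<bar>a n - A0\<bar>\<close> in the remainder after
   division by \<open>g n^3\<close>; once it is below \<open>cI/2\<close> it can be
   absorbed.\<close>
 let ?r = "\<lambda>n. CI/2*\<bar>a n - A0\<bar> + C1*\<bar>a n - A0\<bar>^2 + C1*(\<tau> n/g n^3)^2*(1/g n)^2 + C1*(1/g n)^4"
 let ?b = "\<lambda>n. 2/cI*(?Cl*(1/g n)^3 + \<bar>lp n A0/g n^3\<bar>)"
 have "(\<lambda>n. \<bar>a n - A0\<bar>) \<longlonglongrightarrow> \<bar>A0 - A0\<bar>" by (intro tendsto_intros aml_consistent)
 then have s0: "(\<lambda>n. \<bar>a n - A0\<bar>) \<longlonglongrightarrow> 0" by simp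
 have "?r \<longlonglongrightarrow> CI/2*0 + C1*0^2 + C1*0^2*0^2 + C1*0^4" by (intro tendsto_intros s0 \<tau>_rate g_inv)
 then have r: "EV n. ?r n < cI/2" by (intro order_tendstoD) (use cI0 in auto)
 have "?b \<longlonglongrightarrow> 2/cI*(?Cl*0^3 + \<bar>0\<bar>)" by (intro tendsto_intros score_at_truth g_inv)
 then have b: "?b \<longlonglongrightarrow> 0" by simp
 have s1: "EV n. \<bar>a n - A0\<bar> < min 1 A0" using order_tendstoD(2)[OF s0, of "min 1 A0"] A0 by simp
 show ?thesis
 proof (rule Lim_null_comparison[OF _ b])
  show "EV n. norm (g n*\<bar>a n - A0\<bar>) \<le> ?b n"
   using ex r s1 g info_third_bounds[OF tendsto_const] score_bounded
  proof eventually_elim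
   case (elim n)
   define s where "s = \<bar>a n - A0\<bar>"
   have gn: "0 < g n" "M n = g n^4" using elim by auto
   have s: "0 \<le> s" by (simp add: s_def)
   have E: "\<bar>lp n (a n) - lp n A0 + info n A0*(a n - A0) - third n A0/2*(a n - A0)^2\<bar> \<le>
     C1*M n * s^3 + C1*(\<tau> n^2/M n + M n*(A0 - A0)^2 + 1) * s" unfolding s_def
    using elim(1)[rule_format, of "a n" A0] elim(3) A0 by (auto simp: abs_less_iff)
   have "info n A0 * s \<le> ?Cl + \<bar>lp n A0\<bar> + CI/2*M n * s^2 + (C1*M n * s^3 + C1*(\<tau> n^2/M n + 1) * s)"
   proof -
    have I: "\<bar>info n A0*(a n - A0)\<bar> = info n A0 * s"
    proof -
     have "0 \<le> cI*M n" using cI0 by simp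
     then have "0 \<le> info n A0" using conjunct1[OF elim(5)] by (rule order_trans)
     then show ?thesis by (simp only: abs_mult abs_of_nonneg s_def)
    qed
    have "\<bar>third n A0/2*(a n - A0)^2\<bar> \<le> CI*M n/2 * s^2"
     unfolding abs_mult s_def by (intro mult_mono) (use elim(5) in auto)
    moreover have "\<bar>q\<bar> \<le> Cl + \<bar>l0\<bar> + B + E" if "\<bar>la - l0 + q - t\<bar> \<le> E" "\<bar>t\<bar> \<le> B" "\<bar>la\<bar> \<le> Cl" for la l0 q t E B Cl :: real using that by linarith
    note this[OF E _ elim(6)]
    ultimately show ?thesis unfolding I[symmetric] by simp
   qed
   moreover have "cI*M n * s \<le> info n A0 * s" using elim(5) s by (intro mult_right_mono) auto
   ultimately have "cI*g n^4 * s \<le> ?Cl + \<bar>lp n A0\<bar> + CI/2*g n^4 * s^2 + (C1*g n^4 * s^3 + C1*(\<tau> n^2/g n^4 + 1) * s)"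
    unfolding gn(2) by linarith
   then have DV: "(cI*g n^4 * s)/g n^3 \<le> (?Cl + \<bar>lp n A0\<bar> + CI/2*g n^4 * s^2 + (C1*g n^4 * s^3 + C1*(\<tau> n^2/g n^4 + 1) * s))/g n^3"
    using gn by (intro divide_right_mono) auto
   have "(k*r^4 * s)/r^3 = k*(r * s)" "(p + q + y/2*r^4 * s^2 + (w*r^4 * s^3 + w*(t^2/r^4 + 1) * s))/r^3
     = p*(1/r)^3 + q/r^3 + (y/2 * s + w * s^2 + w*(t/r^3)^2*(1/r)^2 + w*(1/r)^4)*(r * s)" if "0 < r" for k r s p q y w t :: real
    using that by (simp_all add: eval_nat_numeral field_simps)
   note q = this[OF gn(1)]
   have "cI*(g n * s) \<le> ?Cl*(1/g n)^3 + \<bar>lp n A0\<bar>/g n^3 + ?r n*(g n * s)"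
    using DV unfolding q unfolding s_def .
   also have "?r n*(g n * s) \<le> cI/2*(g n * s)" using elim(2) gn s by (intro mult_right_mono) auto
   finally have "cI*(g n * s) \<le> ?Cl*(1/g n)^3 + \<bar>lp n A0\<bar>/g n^3 + cI/2*(g n * s)" by simp
   moreover have "k/2*u \<le> v" if "k*u \<le> v + k/2*u" for k u v :: real using that by simp
   ultimately have "cI/2*(g n * s) \<le> ?Cl*(1/g n)^3 + \<bar>lp n A0\<bar>/g n^3" by blast
   moreover have "u \<le> 2/k * v" if "k/2*u \<le> v" "0 < k" for k u v :: real using that by (simp add: field_simps)
   ultimately have "g n * s \<le> 2/cI*(?Cl*(1/g n)^3 + \<bar>lp n A0\<bar>/g n^3)" using cI0 by blast
   then show ?case using gn s by (simp add: s_def abs_divide)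
  qed
 qed
qed

text \<open>The expansion at \<open>B = a n\<close> in the form required by
  \<open>posterior_moments\<close>. Since \<open>M n*(a n - A0)^2\<close> equals
  \<open>(g n*\<bar>a n - A0\<bar>)^2 * sqrt (M n)\<close>, the rate of \<open>a n\<close> is what
  makes the coefficient \<open>\<tau>'\<close> tend to 0.\<close>

lemma local_score:
 obtains \<epsilon> c1 C \<tau>' where "0 < \<epsilon>" "\<epsilon> \<le> 1" "\<epsilon> < A0" "0 < c1" "\<tau>' \<longlonglongrightarrow> 0"
  "EV n. \<bar>lp n (a n)\<bar> \<le> C"
  "EV n. \<forall>A\<in>{A0-\<epsilon>..A0+\<epsilon>}. (A - a n)*(lp n A - lp n (a n)) \<le> - (c1*M n)*(A - a n)^2"
  "EV n. \<forall>A\<in>{A0-\<epsilon>..A0+\<epsilon>}. \<bar>lp n A - lp n (a n) + info n (a n)*(A - a n) - third n (a n)/2*(A - a n)^2\<bar>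
    \<le> C*M n*\<bar>A - a n\<bar>^3 + \<tau>' n * sqrt (M n)*\<bar>A - a n\<bar>"
  "EV n. c1*M n \<le> info n (a n) \<and> info n (a n) \<le> C*M n \<and> \<bar>third n (a n)\<bar> \<le> C*M n"
proof -
 obtain C1 where C1: "0 < C1" and ex: "EV n. \<forall>A B. 0 < A \<longrightarrow> A \<le> A0 + 1 \<longrightarrow> 0 < B \<longrightarrow> B \<le> A0 + 1 \<longrightarrow>
  \<bar>lp n A - lp n B + info n B*(A - B) - third n B/2*(A - B)^2\<bar> \<le>
   C1*M n*\<bar>A - B\<bar>^3 + C1*(\<tau> n^2/M n + M n*(B - A0)^2 + 1)*\<bar>A - B\<bar>"
  by (rule expansion[of "A0 + 1"]) (use A0 in auto)
 \<comment> \<open>On the window \<open>\<bar>A - a n\<bar> \<le> 2*\<epsilon>\<close> the quadratic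
   and the cubic term each use up at most \<open>cI/8\<close> of the curvature \<open>cI\<close>,
   and the \<open>\<tau>'\<close> term at most \<open>cI/4\<close>; \<open>cI/2\<close> remains. The
   bound \<open>A0/2\<close> keeps the window away from 0.\<close>
 define \<epsilon> where "\<epsilon> = min (min 1 (A0/2)) (min (cI/(8*CI)) (cI/(32*C1)))"
 have \<epsilon>: "0 < \<epsilon>" "\<epsilon> \<le> 1" "\<epsilon> \<le> A0/2" "\<epsilon> \<le> cI/(8*CI)" "\<epsilon> \<le> cI/(32*C1)" using A0 cI0 C1 by (auto simp: \<epsilon>_def)
 define \<tau>' where "\<tau>' n = C1*((\<tau> n/g n^3)^2 + (g n*\<bar>a n - A0\<bar>)^2 + (1/g n)^2)" for n
 have "\<tau>' \<longlonglongrightarrow> C1*(0^2 + 0^2 + 0^2)" unfolding \<tau>'_def by (intro tendsto_intros \<tau>_rate g_inv rate)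
 then have t0: "\<tau>' \<longlonglongrightarrow> 0" by simp
 have t1: "EV n. \<tau>' n < cI/4" using order_tendstoD(2)[OF t0, of "cI/4"] cI0 by simp
 define C where "C = max C1 (max CI (\<bar>l1 D z i A0\<bar> + 1))"
 have aeps: "EV n. \<bar>a n - A0\<bar> < \<epsilon>" using tendstoD[OF aml_consistent \<epsilon>(1)] by (simp add: dist_real_def)
 have H4': "EV n. \<forall>A\<in>{A0-\<epsilon>..A0+\<epsilon>}. \<bar>lp n A - lp n (a n) + info n (a n)*(A - a n) - third n (a n)/2*(A - a n)^2\<bar>
    \<le> C1*M n*\<bar>A - a n\<bar>^3 + \<tau>' n * sqrt (M n)*\<bar>A - a n\<bar>"
  using ex aeps g
 proof eventually_elim
  case (elim n)
  have gn: "0 < g n" "M n = g n^4" "sqrt (M n) = g n^2" using elim by auto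
  have ab: "0 < a n" "a n \<le> A0 + 1" using elim(2) \<epsilon> A0 by (auto simp: abs_less_iff)
  have "C1*(t^2/r^4 + r^4 * s^2 + 1) = C1*((t/r^3)^2 + (r*\<bar>s\<bar>)^2 + (1/r)^2)*r^2" if "0 < r" for t r s
   using that by (simp add: power_mult_distrib power_divide) (simp add: eval_nat_numeral field_simps)
  from this[OF gn(1)] have e: "C1*(\<tau> n^2/M n + M n*(a n - A0)^2 + 1) = \<tau>' n * sqrt (M n)"
   unfolding gn(3) unfolding gn(2) \<tau>'_def by blast
  show ?case using elim(1)[rule_format, of _ "a n", unfolded e] ab \<epsilon> A0 by auto
 qed
 have NK: "EV n. cI*M n \<le> info n (a n) \<and> info n (a n) \<le> CI*M n \<and> \<bar>third n (a n)\<bar> \<le> CI*M n"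
  by (rule info_third_bounds[OF aml_consistent])
 have H3: "EV n. \<forall>A\<in>{A0-\<epsilon>..A0+\<epsilon>}. (A - a n)*(lp n A - lp n (a n)) \<le> - (cI/2*M n)*(A - a n)^2"
  using H4' NK aeps t1 g
 proof eventually_elim
  case (elim n)
  show ?case
  proof
   fix A assume A: "A \<in> {A0-\<epsilon>..A0+\<epsilon>}"
   obtain s where s: "s = A - a n" by simp
   have s2: "\<bar>s\<bar> \<le> 2*\<epsilon>" using A elim(3) unfolding s by (auto simp: abs_le_iff abs_less_iff)
   have gn: "1 \<le> g n" "0 < g n" "M n = g n^4" "sqrt (M n) = g n^2" using elim by auto
   have E: "\<bar>(lp n A - lp n (a n)) + info n (a n) * s - third n (a n)/2 * s^2\<bar> \<le> C1*M n*\<bar>s\<bar>^3 + \<tau>' n * sqrt (M n)*\<bar>s\<bar>"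
    using elim(1) A unfolding s by blast
   have 1: "s*(lp n A - lp n (a n)) \<le> - info n (a n) * s^2 + \<bar>third n (a n)\<bar>/2*\<bar>s\<bar> * s^2 + C1*M n*(\<bar>s\<bar>^2 * s^2) + \<tau>' n * sqrt (M n) * s^2"
   proof -
    have "s*d \<le> - I * s^2 + \<bar>k\<bar>/2*\<bar>s\<bar> * s^2 + P*(\<bar>s\<bar>^2 * s^2) + t * s^2"
     if E: "\<bar>d + I * s - k/2 * s^2\<bar> \<le> P*\<bar>s\<bar>^3 + t*\<bar>s\<bar>" for d I k P t
    proof -
     have "s*(d + I * s - k/2 * s^2) \<le> \<bar>s\<bar>*(P*\<bar>s\<bar>^3 + t*\<bar>s\<bar>)"
      by (rule order_trans[OF abs_ge_self]) (unfold abs_mult, rule mult_left_mono[OF E], simp)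
     also have "\<dots> = P*(\<bar>s\<bar>^2 * s^2) + t * s^2"
     proof -
      have "r*(P*r^3 + t*r) = P*(r^2*r^2) + t*r^2" for r by (simp add: power2_eq_square power3_eq_cube distrib_left mult_ac)
      from this[of "\<bar>s\<bar>"] show ?thesis by (simp only: power2_abs)
     qed
     finally have "s*d \<le> - I * s^2 + k/2 * s * s^2 + P*(\<bar>s\<bar>^2 * s^2) + t * s^2" by (simp add: power2_eq_square algebra_simps)
     moreover have "k/2 * s * s^2 \<le> \<bar>k\<bar>/2*\<bar>s\<bar> * s^2"
      by (rule mult_right_mono) (use abs_ge_self[of "k/2 * s"] in \<open>auto simp: abs_mult\<close>)
     ultimately show ?thesis by linarith
    qed
    from this[OF E] show ?thesis .
   qed
   have 2: "cI*M n * s^2 \<le> info n (a n) * s^2" using elim(2) by (intro mult_right_mono) auto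
   have 3: "\<bar>third n (a n)\<bar>/2*\<bar>s\<bar> * s^2 \<le> cI/8*M n * s^2"
   proof (rule mult_right_mono)
    have "\<bar>third n (a n)\<bar>/2*\<bar>s\<bar> \<le> (CI*M n)/2*(2*\<epsilon>)" using elim(2) s2 by (intro mult_mono) auto
    also have "\<dots> = (\<epsilon>*CI)*M n" by simp
    also have "\<dots> \<le> cI/8*M n" using \<epsilon>(4) cI0 by (intro mult_right_mono) (auto simp: field_simps)
    finally show "\<bar>third n (a n)\<bar>/2*\<bar>s\<bar> \<le> cI/8*M n" .
   qed simp
   have 4: "C1*M n*(\<bar>s\<bar>^2 * s^2) \<le> cI/8*M n * s^2"
   proof -
    have "\<bar>s\<bar>^2 \<le> (2*\<epsilon>)^2" using s2 by (intro power_mono) auto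
    also have "\<dots> \<le> 4*\<epsilon>" using \<epsilon> by (simp add: power2_eq_square mult_left_le)
    finally have "C1*\<bar>s\<bar>^2 \<le> C1*(4*\<epsilon>)" using C1 by (intro mult_left_mono) auto
    also have "\<dots> \<le> cI/8" using \<epsilon>(5) C1 by (simp add: field_simps)
    finally have "C1*\<bar>s\<bar>^2*(M n * s^2) \<le> cI/8*(M n * s^2)" by (rule mult_right_mono) simp
    then show ?thesis by (simp only: mult_ac)
   qed
   have 5: "\<tau>' n * sqrt (M n) * s^2 \<le> cI/4*M n * s^2"
   proof (intro mult_right_mono mult_mono)
    show "sqrt (M n) \<le> M n" unfolding gn(4) unfolding gn(3) by (rule power_increasing) (use gn in auto)
   qed (use elim(4) cI0 in auto)
   have "s*(lp n A - lp n (a n)) \<le> - (cI/2*M n) * s^2"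
   proof -
    have e: "- (cI/2*M n) * s^2 = - (cI*M n * s^2)/2" "cI/8*M n * s^2 = (cI*M n * s^2)/8" "cI/4*M n * s^2 = (cI*M n * s^2)/4" "- info n (a n) * s^2 = - (info n (a n) * s^2)" by simp_all
    have "d \<le> - P/2" if "d \<le> - I + k + q + t" "P \<le> I" "k \<le> P/8" "q \<le> P/8" "t \<le> P/4" for d P I k q t :: real using that by linarith
    from this[OF 1[unfolded e] 2 3[unfolded e] 4[unfolded e] 5[unfolded e]] show ?thesis unfolding e .
   qed
   then show "(A - a n)*(lp n A - lp n (a n)) \<le> - (cI/2*M n)*(A - a n)^2" unfolding s .
  qed
 qed
 show ?thesis
 proof (rule that[of \<epsilon> "cI/2" \<tau>' C])
  show "\<epsilon> < A0" using \<epsilon> A0 by simp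
  show "EV n. \<bar>lp n (a n)\<bar> \<le> C" using score_bounded by eventually_elim (simp add: C_def)
  show "EV n. cI/2*M n \<le> info n (a n) \<and> info n (a n) \<le> C*M n \<and> \<bar>third n (a n)\<bar> \<le> C*M n"
   using NK
  proof eventually_elim
   case (elim n)
   have "CI*M n \<le> C*M n" by (rule mult_right_mono) (auto simp: C_def)
   moreover have "cI/2*M n \<le> cI*M n" using cI0 by (intro mult_right_mono) auto
   ultimately show ?case using elim by linarith
  qed
  show "EV n. \<forall>A\<in>{A0-\<epsilon>..A0+\<epsilon>}. \<bar>lp n A - lp n (a n) + info n (a n)*(A - a n) - third n (a n)/2*(A - a n)^2\<bar>
    \<le> C*M n*\<bar>A - a n\<bar>^3 + \<tau>' n * sqrt (M n)*\<bar>A - a n\<bar>"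
   using H4'
  proof eventually_elim
   case (elim n)
   have "C1*M n*\<bar>A - a n\<bar>^3 \<le> C*M n*\<bar>A - a n\<bar>^3" for A by (intro mult_right_mono) (auto simp: C_def)
   with elim show ?case by (meson add_right_mono order_trans)
  qed
 qed (use \<epsilon> cI0 t0 H3 in auto)
qed

end

section \<open>Posterior coverage along a sequence of data\<close>

text \<open>A substitute for convergence, since the normalised traces of V^{-k} need not have
  limits. Boundedness of the comparison sequence makes the relation compatible with
  products.\<close>

definition asymp_equiv_bdd :: "(nat \<Rightarrow> real) \<Rightarrow> (nat \<Rightarrow> real) \<Rightarrow> bool" (infix "\<bumpeq>" 50) where
 "f \<bumpeq> h \<longleftrightarrow> (\<lambda>n. f n - h n) \<longlonglongrightarrow> 0 \<and> Bseq h"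

lemma aeb_tendsto: "f \<longlonglongrightarrow> c \<Longrightarrow> f \<bumpeq> (\<lambda>_. c)"
 by (simp add: asymp_equiv_bdd_def LIM_zero)

lemma aeb_add: "f \<bumpeq> h \<Longrightarrow> f' \<bumpeq> h' \<Longrightarrow> (\<lambda>n. f n + f' n) \<bumpeq> (\<lambda>n. h n + h' n)"
proof -
 assume "f \<bumpeq> h" "f' \<bumpeq> h'"
 then have d: "(\<lambda>n. f n - h n) \<longlonglongrightarrow> 0" "(\<lambda>n. f' n - h' n) \<longlonglongrightarrow> 0" and B: "Bseq h" "Bseq h'"
  by (auto simp: asymp_equiv_bdd_def)
 obtain K where "\<forall>n. norm (h n) \<le> K" using B(1) by (rule BseqE)
 moreover obtain K' where "\<forall>n. norm (h' n) \<le> K'" using B(2) by (rule BseqE)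
 ultimately have "norm (h n) \<le> K" "norm (h' n) \<le> K'" for n by auto
 then have "Bseq (\<lambda>n. h n + h' n)" by (intro BseqI'[of _ "K + K'"] norm_triangle_mono)
 with tendsto_add[OF d] show ?thesis by (simp add: asymp_equiv_bdd_def algebra_simps)
qed

lemma aeb_mult:
 assumes "f \<bumpeq> h" "f' \<bumpeq> h'" shows "(\<lambda>n. f n*f' n) \<bumpeq> (\<lambda>n. h n*h' n)"
proof -
 have d: "(\<lambda>n. f n - h n) \<longlonglongrightarrow> 0" "(\<lambda>n. f' n - h' n) \<longlonglongrightarrow> 0" and B: "Bseq h" "Bseq h'"
  using assms by (auto simp: asymp_equiv_bdd_def)
 have z: "(\<lambda>n. p n*q n) \<longlonglongrightarrow> 0" if "p \<longlonglongrightarrow> 0" "Bseq q" for p q :: "nat \<Rightarrow> real"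
  using bounded_bilinear.Zfun_prod_Bfun[OF bounded_bilinear_mult, of p sequentially q] that by (simp add: tendsto_Zfun_iff)
 have "(\<lambda>n. (f n - h n)*(f' n - h' n) + (f n - h n)*h' n + (f' n - h' n)*h n) \<longlonglongrightarrow> 0*0 + 0 + 0"
  by (intro tendsto_add tendsto_mult d z B)
 moreover have "Bseq (\<lambda>n. h n*h' n)" by (rule Bseq_mult[OF B])
 ultimately show ?thesis by (simp add: asymp_equiv_bdd_def algebra_simps)
qed

lemma aeb_minus: "f \<bumpeq> h \<Longrightarrow> (\<lambda>n. - f n) \<bumpeq> (\<lambda>n. - h n)"
 using aeb_mult[OF aeb_tendsto[OF tendsto_const, of "-1"]] by simp

lemma aeb_diff: "f \<bumpeq> h \<Longrightarrow> f' \<bumpeq> h' \<Longrightarrow> (\<lambda>n. f n - f' n) \<bumpeq> (\<lambda>n. h n - h' n)"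
 using aeb_add[OF _ aeb_minus] by fastforce

lemma aeb_power: "f \<bumpeq> h \<Longrightarrow> (\<lambda>n. (f n)^k) \<bumpeq> (\<lambda>n. (h n)^k)"
 by (induction k) (auto intro: aeb_mult aeb_tendsto)

lemma aeb_inverse:
 assumes "f \<bumpeq> h" "0 < c" "EV n. c \<le> h n"
 shows "(\<lambda>n. 1/f n) \<bumpeq> (\<lambda>n. 1/h n)"
proof -
 have d: "(\<lambda>n. f n - h n) \<longlonglongrightarrow> 0" using assms by (simp add: asymp_equiv_bdd_def)
 have d2: "EV n. \<bar>f n - h n\<bar> < c/2" using tendstoD[OF d, of "c/2"] assms(2) by simp
 have "(\<lambda>n. 2/c^2*\<bar>f n - h n\<bar>) \<longlonglongrightarrow> 2/c^2*\<bar>0\<bar>" by (intro tendsto_intros d)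
 then have z: "(\<lambda>n. 2/c^2*\<bar>f n - h n\<bar>) \<longlonglongrightarrow> 0" by simp
 have "(\<lambda>n. 1/f n - 1/h n) \<longlonglongrightarrow> 0"
 proof (rule Lim_null_comparison[OF _ z])
  show "EV n. norm (1/f n - 1/h n) \<le> 2/c^2*\<bar>f n - h n\<bar>"
   using d2 assms(3)
  proof eventually_elim
   case (elim n)
   have p: "c/2 < f n" "0 < h n" using elim assms(2) by linarith+
   have fp: "0 < f n" using p assms(2) by linarith
   have "c^2/2 \<le> f n*h n" using mult_mono[of "c/2" "f n" c "h n"] p elim assms(2) by (simp add: power2_eq_square)
   moreover have "1/f n - 1/h n = (h n - f n)/(f n*h n)" using fp p by (simp add: field_simps)
   ultimately have "\<bar>1/f n - 1/h n\<bar> \<le> \<bar>f n - h n\<bar>/(c^2/2)"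
    using fp p assms(2) by (simp only: abs_divide abs_mult abs_minus_commute[of "h n"] abs_of_pos) (intro divide_left_mono, auto)
   then show ?case by (simp add: mult.commute)
  qed
 qed
 moreover have "Bseq (\<lambda>n. 1/h n)"
 proof (rule Bseq_eventually_mono)
  show "EV n. norm (1/h n) \<le> norm (1/c)" using assms(3) by eventually_elim (use assms(2) in \<open>auto intro!: divide_left_mono mult_pos_pos\<close>)
 qed simp
 ultimately show ?thesis by (simp add: asymp_equiv_bdd_def)
qed

lemma aebD: "f \<bumpeq> h \<Longrightarrow> f' \<bumpeq> h \<Longrightarrow> (\<lambda>n. f n - f' n) \<longlonglongrightarrow> 0"
 using tendsto_diff[of "\<lambda>n. f n - h n" 0 sequentially "\<lambda>n. f' n - h n" 0] by (simp add: asymp_equiv_bdd_def)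

text \<open>The supremum over \<open>A\<close> turns an epsilon-type uniform statement into one null
  sequence.\<close>

lemma uniform_rate:
 fixes f :: "nat \<Rightarrow> real \<Rightarrow> real"
 assumes f: "\<And>\<eta>. 0 < \<eta> \<Longrightarrow> EV n. \<forall>A\<in>I. f n A \<le> \<eta>" and f0: "\<And>n A. 0 \<le> f n A" and I: "I \<noteq> {}"
 obtains S where "S \<longlonglongrightarrow> 0" "EV n. 0 \<le> S n \<and> (\<forall>A\<in>I. f n A \<le> S n)"
proof (rule that[of "\<lambda>n. SUP A\<in>I. f n A"])
 have b: "EV n. bdd_above (f n ` I)"
  using f[OF zero_less_one] by eventually_elim (auto intro: bdd_aboveI2)
 show s: "EV n. 0 \<le> (SUP A\<in>I. f n A) \<and> (\<forall>A\<in>I. f n A \<le> (SUP A\<in>I. f n A))"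
  using b
 proof eventually_elim
  case (elim n)
  have u: "f n A \<le> (SUP A\<in>I. f n A)" if "A \<in> I" for A by (rule cSUP_upper[OF that elim])
  moreover obtain A where "A \<in> I" using I by blast
  ultimately show ?case using order_trans[OF f0 u] by blast
 qed
 show "(\<lambda>n. SUP A\<in>I. f n A) \<longlonglongrightarrow> 0"
 proof (rule tendstoI)
  fix \<eta> :: real assume "0 < \<eta>"
  then have "EV n. \<forall>A\<in>I. f n A \<le> \<eta>/2" by (intro f) simp
  with s show "EV n. dist (SUP A\<in>I. f n A) 0 < \<eta>"
  proof eventually_elim
   case (elim n)
   have "(SUP A\<in>I. f n A) \<le> \<eta>/2" by (rule cSUP_least[OF I]) (use elim in blast)
   then show ?case using elim \<open>0 < \<eta>\<close> by simp
  qed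
 qed
qed

lemma nn_integral_continuous_Icc:
 fixes f :: "real \<Rightarrow> real"
 assumes "continuous_on {lo..hi} f" "\<And>A. A \<in> {lo..hi} \<Longrightarrow> 0 \<le> f A"
 shows "(\<integral>\<^sup>+A. indicator {lo..hi} A*ennreal (f A) \<partial>lborel) = ennreal (integral {lo..hi} f)"
proof -
 have i: "set_integrable lborel {lo..hi} f" by (rule borel_integrable_atLeastAtMost'[OF assms(1)])
 have "(\<integral>\<^sup>+A. indicator {lo..hi} A*ennreal (f A) \<partial>lborel) = (\<integral>\<^sup>+A. ennreal (indicator {lo..hi} A *\<^sub>R f A) \<partial>lborel)"
  by (intro nn_integral_cong) (auto split: split_indicator)
 also have "\<dots> = ennreal (LINT A|lborel. indicator {lo..hi} A *\<^sub>R f A)"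
  by (rule nn_integral_eq_integral) (use i assms(2) in \<open>auto simp: set_integrable_def split: split_indicator\<close>)
 also have "(LINT A|lborel. indicator {lo..hi} A *\<^sub>R f A) = integral {lo..hi} f"
  using set_borel_integral_eq_integral(2)[OF i] by (simp add: set_lebesgue_integral_def)
 finally show ?thesis .
qed

text \<open>A function with values between 0 and 1 adds at most as much tail mass to the numerator
  as the weight adds to the denominator, so the quotient moves by at most the tail mass relative to
  the mass of the interval.\<close>

lemma posterior_mean_localise:
 fixes F q :: "real \<Rightarrow> real"
 assumes lo: "0 < lo" "lo < hi" and F0: "\<And>A. 0 < A \<Longrightarrow> 0 \<le> F A" and Fp: "\<And>A. A \<in> {lo..hi} \<Longrightarrow> 0 < F A"
  and Fc: "continuous_on {lo..hi} F" and qc: "continuous_on {lo..hi} q" and q: "\<And>A. 0 < A \<Longrightarrow> 0 \<le> q A \<and> q A \<le> 1"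
  and m1: "(\<lambda>A. indicator {0<..} A*ennreal (F A)) \<in> borel_measurable borel"
  and m2: "(\<lambda>A. indicator {0<..} A*ennreal (F A)*ennreal (q A)) \<in> borel_measurable borel"
  and tail: "(\<integral>\<^sup>+A. indicator ({0<..} - {lo..hi}) A*ennreal (F A) \<partial>lborel) \<le> ennreal t" and t: "0 \<le> t"
 shows "\<bar>enn2real (\<integral>\<^sup>+A. indicator {0<..} A*ennreal (F A)*ennreal (q A) \<partial>lborel)/enn2real (\<integral>\<^sup>+A. indicator {0<..} A*ennreal (F A) \<partial>lborel)
  - wavg F lo hi q\<bar> \<le> t/integral {lo..hi} F"
proof -
 let ?J = "{lo..hi}" and ?T = "{0<..} - {lo..hi}"
 have split: "(\<integral>\<^sup>+A. indicator {0<..} A*ennreal (F A)*ennreal (p A) \<partial>lborel) =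
   ennreal (integral ?J (\<lambda>A. p A*F A)) + (\<integral>\<^sup>+A. indicator ?T A*ennreal (F A)*ennreal (p A) \<partial>lborel)"
  if m: "(\<lambda>A. indicator {0<..} A*ennreal (F A)*ennreal (p A)) \<in> borel_measurable borel" and pc: "continuous_on ?J p" and p0: "\<And>A. 0 < A \<Longrightarrow> 0 \<le> p A" for p
 proof -
  have "(\<integral>\<^sup>+A. indicator {0<..} A*ennreal (F A)*ennreal (p A) \<partial>lborel) =
    (\<integral>\<^sup>+A. indicator ?J A*(indicator {0<..} A*ennreal (F A)*ennreal (p A)) + indicator ?T A*(indicator {0<..} A*ennreal (F A)*ennreal (p A)) \<partial>lborel)"
   using lo by (intro nn_integral_cong) (auto split: split_indicator)
  also have "\<dots> = (\<integral>\<^sup>+A. indicator ?J A*(indicator {0<..} A*ennreal (F A)*ennreal (p A)) \<partial>lborel) + (\<integral>\<^sup>+A. indicator ?T A*(indicator {0<..} A*ennreal (F A)*ennreal (p A)) \<partial>lborel)"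
   using m by (intro nn_integral_add) simp_all
  also have "(\<integral>\<^sup>+A. indicator ?J A*(indicator {0<..} A*ennreal (F A)*ennreal (p A)) \<partial>lborel) = (\<integral>\<^sup>+A. indicator ?J A*ennreal (p A*F A) \<partial>lborel)"
   using lo p0 F0 by (intro nn_integral_cong) (auto simp: ennreal_mult mult.commute split: split_indicator)
  also have "\<dots> = ennreal (integral ?J (\<lambda>A. p A*F A))"
   using lo p0 F0 by (intro nn_integral_continuous_Icc continuous_intros pc Fc) auto
  also have "(\<integral>\<^sup>+A. indicator ?T A*(indicator {0<..} A*ennreal (F A)*ennreal (p A)) \<partial>lborel) = (\<integral>\<^sup>+A. indicator ?T A*ennreal (F A)*ennreal (p A) \<partial>lborel)"
   by (intro nn_integral_cong) (auto split: split_indicator)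
  finally show ?thesis .
 qed
 let ?NJ = "integral ?J (\<lambda>A. q A*F A)" and ?DJ = "integral ?J F"
 let ?NT = "\<integral>\<^sup>+A. indicator ?T A*ennreal (F A)*ennreal (q A) \<partial>lborel" and ?DT = "\<integral>\<^sup>+A. indicator ?T A*ennreal (F A) \<partial>lborel"
 have D: "(\<integral>\<^sup>+A. indicator {0<..} A*ennreal (F A) \<partial>lborel) = ennreal ?DJ + ?DT" using split[of "\<lambda>_. 1"] m1 by simp
 have N: "(\<integral>\<^sup>+A. indicator {0<..} A*ennreal (F A)*ennreal (q A) \<partial>lborel) = ennreal ?NJ + ?NT" using split[OF m2 qc] q by blast
 have NT: "?NT \<le> ?DT"
 proof (rule nn_integral_mono)
  fix A
  have "indicator ?T A*ennreal (F A)*ennreal (q A) \<le> indicator ?T A*ennreal (F A)*1" if "0 < A"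
   using q[OF that] by (intro mult_left_mono) (auto simp: ennreal_le_1)
  then show "indicator ?T A*ennreal (F A)*ennreal (q A) \<le> indicator ?T A*ennreal (F A)" by (cases "0 < A") auto
 qed
 define nt dt where "nt = enn2real ?NT" and "dt = enn2real ?DT"
 have fin: "?DT < \<infinity>" "?NT < \<infinity>" using tail NT order_le_less_trans[of ?DT "ennreal t" \<infinity>] order_le_less_trans[of ?NT ?DT \<infinity>] by (auto simp: ennreal_less_top)
 have e: "?NT = ennreal nt" "?DT = ennreal dt" using fin by (simp_all add: nt_def dt_def)
 have nd: "0 \<le> nt" "nt \<le> dt" "dt \<le> t" using NT tail t unfolding e by (auto simp: nt_def dt_def ennreal_le_iff)
 have DJ: "0 < ?DJ" by (rule integral_weight_pos[OF lo(2) Fc Fp])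
 have NJ: "0 \<le> ?NJ" "?NJ \<le> ?DJ"
 proof -
  have i: "(\<lambda>A. q A*F A) integrable_on ?J" "F integrable_on ?J" by (intro integrable_continuous_real continuous_intros qc Fc)+
  show "0 \<le> ?NJ" using lo q F0 by (intro integral_nonneg i) auto
  show "?NJ \<le> ?DJ" using lo q F0 by (intro integral_le i) (auto intro!: mult_left_le_one_le)
 qed
 have r: "\<bar>(N + n)/(D + d) - N/D\<bar> \<le> t/D" if "0 \<le> n" "n \<le> d" "d \<le> t" "0 < D" "0 \<le> N" "N \<le> D" for N n D d t :: real
 proof -
  have "\<bar>(N + n)/(D + d) - N/D\<bar> = \<bar>n*D - N*d\<bar>/(D*(D + d))"
  proof -
   have "(N + n)/(D + d) - N/D = (n*D - N*d)/(D*(D + d))"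
   proof -
    have "(N + n)/(D + d) - N/D = ((N + n)*D - N*(D + d))/((D + d)*D)" using that by (intro diff_frac_eq) auto
    moreover have "(N + n)*D - N*(D + d) = n*D - N*d" by (simp add: algebra_simps)
    ultimately show ?thesis by (simp only: mult.commute[of "D + d"])
   qed
   then show ?thesis using that by (simp add: abs_divide)
  qed
  also have "\<dots> \<le> (t*(D + d))/(D*(D + d))"
  proof (rule divide_right_mono)
   have "0 \<le> n*D" "n*D \<le> t*D" "0 \<le> N*d" "N*d \<le> D*t" "0 \<le> t*d" using that by (auto intro!: mult_mono)
   then show "\<bar>n*D - N*d\<bar> \<le> t*(D + d)" by (simp add: algebra_simps)
  qed (use that in auto)
  also have "\<dots> = t/D" using that by simp
  finally show ?thesis .
 qed
 have "enn2real (ennreal ?NJ + ennreal nt) = ?NJ + nt" "enn2real (ennreal ?DJ + ennreal dt) = ?DJ + dt"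
  using NJ nd DJ by (simp_all add: ennreal_plus[symmetric] del: ennreal_plus)
 then show ?thesis unfolding N D e wavg_def using r[OF nd DJ NJ] by simp
qed

section \<open>The posterior probability as a quotient of integrals over \<open>A\<close>\<close>

lemma \<Phi>_mono: "u \<le> v \<Longrightarrow> \<Phi> u \<le> \<Phi> v"
 by (rule DERIV_nonneg_imp_nondecreasing) (use \<Phi>_deriv in \<open>auto intro!: exI\<close>)

lemma delta_pos:
 fixes x :: "nat \<Rightarrow> real^'p::finite"
 assumes R: "dim (x ` {..<m}) = CARD('p)" and D: "\<And>j. 0 < D j" and A: "0 < A"
 shows "0 < delta x D m i A"
proof -
 have "0 \<le> g2 x D m i A" unfolding g2_def by (intro mult_nonneg_nonneg r_fun_nonneg[where D = D and A = A, OF R] add_pos_pos A D) simp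
 moreover have "0 < g1 D i A" unfolding g1_def using D[of i] A by simp
 ultimately show ?thesis by (simp add: delta_def)
qed

text \<open>The case \<open>S = UNIV\<close> of \<open>emeasure_joint_M2\<close>, where the inner
  normal density integrates to 1.\<close>

lemma posterior_mass:
 fixes x :: "nat \<Rightarrow> real^'p::finite"
 assumes R: "dim (x ` {..<m}) = CARD('p)" and D: "\<And>j. 0 < D j" and i: "i < m"
  and pm: "(\<lambda>A. prior A*indicator {0<..} A) \<in> borel_measurable borel" and pp: "\<And>A. 0 < A \<Longrightarrow> 0 < prior A"
 shows "emeasure (joint_M2 x D prior m y) (space (joint_M2 x D prior m y)) =
   ennreal (sqrt (2*pi)^CARD('p)/sqrt (2*pi)^m)*(\<integral>\<^sup>+A. indicator {0<..} A*ennreal (prior A*L_RE x D m y A) \<partial>lborel)" (is ?t1)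
  and "(\<lambda>A. indicator {0<..} A*ennreal (prior A*L_RE x D m y A)) \<in> borel_measurable borel" (is ?t2)
proof -
 have pp': "0 \<le> prior A" if "0 < A" for A using pp[OF that] by simp
 have eq: "indicator {0<..} A*ennreal (prior A*L_RE x D m y A)*(\<integral>\<^sup>+t. ennreal (normal_density (theta_tilde x D m i y A) (delta x D m i A) t)*indicator UNIV t \<partial>lborel)
   = indicator {0<..} A*ennreal (prior A*L_RE x D m y A)" for A
  using nn_integral_normal_density[OF delta_pos[where D = D and i = i and A = A, OF R D]] by (cases "0 < A") auto
 have S: "(UNIV :: real set) \<in> sets borel" by simp
 show ?t1 using emeasure_joint_M2(1)[where x = x and prior = prior and m = m and D = D and i = i and y = y, OF R D i S pm pp'] unfolding eq by simp
 show ?t2 using emeasure_joint_M2(2)[where x = x and prior = prior and m = m and D = D and i = i and y = y, OF R D i S pm pp'] unfolding eq .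
qed

text \<open>The powers of \<open>2*pi\<close> cancel in the quotient. The bounds on
  \<open>cov\<close> hold because it is the conditional probability of the interval given
  \<open>A\<close>.\<close>

lemma posterior_prob_interval:
 fixes x :: "nat \<Rightarrow> real^'p::finite" and y :: "nat \<Rightarrow> real" and a z :: real
 assumes R: "dim (x ` {..<m}) = CARD('p)" and D: "\<And>j. 0 < D j" and i: "i < m"
  and pm: "(\<lambda>A. prior A*indicator {0<..} A) \<in> borel_measurable borel" and pp: "\<And>A. 0 < A \<Longrightarrow> 0 < prior A"
  and a: "0 < a" "0 \<le> z"
 defines "cov \<equiv> \<lambda>A. \<Phi> ((theta_tilde x D m i y a + z*delta x D m i a - theta_tilde x D m i y A)/delta x D m i A)
   - \<Phi> ((theta_tilde x D m i y a - z*delta x D m i a - theta_tilde x D m i y A)/delta x D m i A)"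
 shows "posterior_prob x D prior m y i (interval_N x D z m i y a) =
   enn2real (\<integral>\<^sup>+A. indicator {0<..} A*ennreal (prior A*L_RE x D m y A)*ennreal (cov A) \<partial>lborel) /
   enn2real (\<integral>\<^sup>+A. indicator {0<..} A*ennreal (prior A*L_RE x D m y A) \<partial>lborel)" (is ?t1)
  and "(\<lambda>A. indicator {0<..} A*ennreal (prior A*L_RE x D m y A)*ennreal (cov A)) \<in> borel_measurable borel" (is ?t2)
  and "0 < A \<Longrightarrow> 0 \<le> cov A \<and> cov A \<le> 1"
proof -
 let ?I = "interval_N x D z m i y a"
 have pp': "0 \<le> prior A" if "0 < A" for A using pp[OF that] by simp
 have le: "theta_tilde x D m i y a - z*delta x D m i a \<le> theta_tilde x D m i y a + z*delta x D m i a"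
  using a delta_pos[where D = D and i = i, OF R D a(1)] mult_nonneg_nonneg[of z "delta x D m i a"] by linarith
 have inner: "(\<integral>\<^sup>+t. ennreal (normal_density (theta_tilde x D m i y A) (delta x D m i A) t)*indicator ?I t \<partial>lborel) = ennreal (cov A)" if "0 < A" for A
  unfolding interval_N_def cov_def by (rule normal_interval_measure[OF delta_pos[where D = D and i = i, OF R D that] le])
 have eq: "indicator {0<..} A*ennreal (prior A*L_RE x D m y A)*(\<integral>\<^sup>+t. ennreal (normal_density (theta_tilde x D m i y A) (delta x D m i A) t)*indicator ?I t \<partial>lborel)
   = indicator {0<..} A*ennreal (prior A*L_RE x D m y A)*ennreal (cov A)" for A
  using inner[of A] by (cases "0 < A") auto
 have S: "?I \<in> sets borel" by (simp add: interval_N_def)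
 have C: "0 < sqrt (2*pi)^CARD('p)/sqrt (2*pi)^m" by simp
 note J = emeasure_joint_M2[where x = x and prior = prior and m = m and D = D and i = i and y = y, OF R D i S pm]
 have J1: "emeasure (joint_M2 x D prior m y) {(\<theta>, \<beta>, A) \<in> space (joint_M2 x D prior m y). \<theta> i \<in> ?I} =
  ennreal (sqrt (2*pi)^CARD('p)/sqrt (2*pi)^m) *
  (\<integral>\<^sup>+A. indicator {0<..} A*ennreal (prior A*L_RE x D m y A)*ennreal (cov A) \<partial>lborel)"
  unfolding eq[symmetric] by (rule J(1)) (rule pp')
 have J2: "emeasure (joint_M2 x D prior m y) (space (joint_M2 x D prior m y)) =
  ennreal (sqrt (2*pi)^CARD('p)/sqrt (2*pi)^m)*(\<integral>\<^sup>+A. indicator {0<..} A*ennreal (prior A*L_RE x D m y A) \<partial>lborel)"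
  by (rule posterior_mass(1)[OF R D i pm]) (rule pp)
 show ?t1 unfolding posterior_prob_def measure_def J1 J2 using C by (simp add: enn2real_mult)
 show ?t2 unfolding eq[symmetric] by (rule J(2)) (rule pp')
 show "0 \<le> cov A \<and> cov A \<le> 1" if A: "0 < A"
 proof
  show "0 \<le> cov A" unfolding cov_def diff_ge_0_iff_ge
   by (intro \<Phi>_mono divide_right_mono) (use le delta_pos[where D = D and i = i, OF R D A] in auto)
  have "ennreal (cov A) \<le> (\<integral>\<^sup>+t. ennreal (normal_density (theta_tilde x D m i y A) (delta x D m i A) t) \<partial>lborel)"
   unfolding inner[OF A, symmetric] by (intro nn_integral_mono) (auto split: split_indicator)
  then show "cov A \<le> 1" unfolding nn_integral_normal_density[OF delta_pos[where D = D and i = i, OF R D A]] by (simp add: ennreal_le_1)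
 qed
qed

text \<open>For \<open>y = 0\<close> the quadratic form vanishes and \<open>L_RE\<close> is at least
  a multiple of \<open>(1 + A) powr (- m/2)\<close>, so properness for these data controls the tail
  of the prior. One sample size is enough: for large samples \<open>tail\<close> provides any fixed
  power of \<open>1 + A\<close>.\<close>

lemma prior_tail_integrable:
 fixes x :: "nat \<Rightarrow> real^'p::finite"
 assumes R: "dim (x ` {..<m}) = CARD('p)" and D: "\<And>j. 0 < D j" and Dhi: "\<And>j. D j \<le> dm"
  and pm: "(\<lambda>A. prior A*indicator {0<..} A) \<in> borel_measurable borel" and pp: "\<And>A. 0 < A \<Longrightarrow> 0 < prior A"
  and proper: "posterior_proper x D prior m (\<lambda>_. 0)"
 shows "(\<integral>\<^sup>+A. indicator {0<..} A*ennreal (prior A*exp (- (real m/2)*ln (1 + A))) \<partial>lborel) < \<infinity>"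
proof -
 have m0: "0 < m"
 proof (rule ccontr)
  assume "\<not> 0 < m" then show False using R by simp
 qed
 let ?L = "L_RE x D m (\<lambda>_. 0)"
 let ?\<Delta> = "det (XtVX x D m 0)"
 let ?c = "exp (- 1/2*(real m*ln (1 + dm)) - 1/2*ln ?\<Delta>)"
 have pd: "0 < det (XtVX x D m A)" if "0 \<le> A" for A
 proof -
  have "0 < v \<bullet> (XtVX x D m A *v v)" if "v \<noteq> 0" for v
   unfolding XtVX_eq_wgram by (rule wgram_pos_def[OF R _ that]) (use \<open>0 \<le> A\<close> D in \<open>auto intro: add_nonneg_pos\<close>)
  then show ?thesis
   by (intro nn_integral_gaussian_vec(2)[where x = 0 and y = 0 and f = "\<lambda>_. 0"]) (auto simp: XtVX_eq_wgram transpose_wgram)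
 qed
 have lower: "?c*exp (- (real m/2)*ln (1 + A)) \<le> ?L A" if A: "0 < A" for A
 proof -
  let ?P = "\<Prod>j<m. A + D j"
  have P0: "0 < ?P" using D A by (intro prod_pos) (auto intro: add_pos_pos)
  have d1: "det (XtVX x D m A) \<le> ?\<Delta>" unfolding XtVX_eq_wgram using D A
   by (intro det_wgram_mono) (auto intro!: divide_left_mono mult_pos_pos add_pos_pos simp: less_imp_le add_pos_pos)
  have "?P \<le> (\<Prod>j<m. (1 + dm)*(1 + A))"
  proof (rule prod_mono)
   fix j
   have "A + D j \<le> A + dm" using Dhi[of j] by simp
   also have "\<dots> \<le> (1 + dm)*(1 + A)" using A D[of j] Dhi[of j] by (simp add: algebra_simps)
   finally show "0 \<le> A + D j \<and> A + D j \<le> (1 + dm)*(1 + A)" using A D[of j] by simp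
  qed
  then have "ln ?P \<le> ln (((1 + dm)*(1 + A))^m)" using P0 A D[of 0] Dhi[of 0] by (subst ln_le_cancel_iff) auto
  also have "\<dots> = real m*ln (1 + dm) + real m*ln (1 + A)"
  proof -
   have p: "0 < 1 + dm" "0 < 1 + A" using A D[of 0] Dhi[of 0] by auto
   have "ln (((1 + dm)*(1 + A))^m) = real m*ln ((1 + dm)*(1 + A))" using mult_pos_pos[OF p] by (simp only: ln_realpow)
   then show ?thesis unfolding ln_mult_pos[OF p] distrib_left[of "real m"] .
  qed
  finally have lP: "ln ?P \<le> real m*ln (1 + dm) + real m*ln (1 + A)" .
  have ld: "ln (det (XtVX x D m A)) \<le> ln ?\<Delta>" using d1 pd[of A] pd[of 0] A by simp
  have "?L A = exp (- 1/2*ln ?P - 1/2*ln (det (XtVX x D m A)))"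

  proof -
   have "p powr (-1/2)*q powr (-1/2)*exp (- (1/2)*0) = exp (- 1/2*ln p - 1/2*ln q)" if "0 < p" "0 < q" for p q :: real
    using that by (simp add: powr_def exp_add[symmetric])
   from this[OF P0 pd[of A]] A show ?thesis unfolding L_RE_def by simp
  qed
  moreover have "- 1/2*(real m*ln (1 + dm)) - 1/2*ln ?\<Delta> + - (real m/2)*ln (1 + A) \<le> - 1/2*ln ?P - 1/2*ln (det (XtVX x D m A))"
   using lP ld by argo
  ultimately show ?thesis unfolding exp_add[symmetric] by simp
 qed
 have "ennreal ?c*(\<integral>\<^sup>+A. indicator {0<..} A*ennreal (prior A*exp (- (real m/2)*ln (1 + A))) \<partial>lborel)
   \<le> (\<integral>\<^sup>+A. indicator {0<..} A*ennreal (prior A*?L A) \<partial>lborel)"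
 proof -
  have "(\<lambda>A. ennreal (prior A*indicator {0<..} A*exp (- (real m/2)*ln (1 + A)))) \<in> borel_measurable borel"
   using pm by measurable
  moreover have "(\<lambda>A. ennreal (prior A*indicator {0<..} A*exp (- (real m/2)*ln (1 + A)))) = (\<lambda>A. indicator {0<..} A*ennreal (prior A*exp (- (real m/2)*ln (1 + A))))"
   by (auto simp: fun_eq_iff split: split_indicator)
  ultimately have meas: "(\<lambda>A. indicator {0<..} A*ennreal (prior A*exp (- (real m/2)*ln (1 + A)))) \<in> borel_measurable lborel" by simp
  have "ennreal ?c*(indicator {0<..} A*ennreal (prior A*exp (- (real m/2)*ln (1 + A)))) \<le> indicator {0<..} A*ennreal (prior A*?L A)" for A
  proof (cases "0 < A")
   case True
   have "?c*(prior A*exp (- (real m/2)*ln (1 + A))) \<le> prior A*?L A"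
    using mult_left_mono[OF lower[OF True], of "prior A"] pp[OF True] by (simp add: mult_ac)
   then show ?thesis using True pp[OF True] by (simp add: ennreal_mult[symmetric] ennreal_leI)
  qed simp
  then show ?thesis unfolding nn_integral_cmult[OF meas, symmetric] by (rule nn_integral_mono)
 qed
 also have "\<dots> < \<infinity>"
 proof -
  let ?C = "ennreal (sqrt (2*pi)^CARD('p)/sqrt (2*pi)^m)"
  have "?C*(\<integral>\<^sup>+A. indicator {0<..} A*ennreal (prior A*?L A) \<partial>lborel) < \<infinity>"
   using proper unfolding posterior_proper_def by (subst (asm) posterior_mass(1)[OF R D m0 pm]) (use pp in auto)
  moreover have "?C \<noteq> 0" by (simp add: ennreal_eq_0_iff not_le)
  ultimately show ?thesis by (auto simp: ennreal_mult_less_top top_unique)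
 qed
 finally show ?thesis by (auto simp: ennreal_mult_less_top)
qed

locale posterior_sequence = estimator_sequence +
 fixes prior prior' :: "real \<Rightarrow> real" and \<alpha> :: real
 assumes prior_pos: "\<And>A. 0 < A \<Longrightarrow> 0 < prior A"
  and prior_deriv: "\<And>A. 0 < A \<Longrightarrow> (prior has_real_derivative prior' A) (at A)"
  and prior'_cont: "continuous_on {0<..} prior'"
  and z: "0 \<le> z" "\<Phi> z - \<Phi> (- z) = 1 - \<alpha>"
  and proper: "\<exists>m. dim (x ` {..<m}) = CARD('a) \<and> posterior_proper x D prior m (\<lambda>_. 0)"
begin

abbreviation "v n A \<equiv> e n i - x i \<bullet> regression_sample.b x D (mm n) (e n) A"
abbreviation "w n A \<equiv> prior A*exp (l \<beta> n A - l \<beta> n (a n))"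
abbreviation "cov n A \<equiv> \<Phi> ((theta_tilde x D (mm n) i (y \<beta> n) (a n) + z*delta x D (mm n) i (a n) - theta_tilde x D (mm n) i (y \<beta> n) A)/delta x D (mm n) i A)
   - \<Phi> ((theta_tilde x D (mm n) i (y \<beta> n) (a n) - z*delta x D (mm n) i (a n) - theta_tilde x D (mm n) i (y \<beta> n) A)/delta x D (mm n) i A)"
abbreviation "post n \<equiv> posterior_prob x D prior (mm n) (y \<beta> n) i (interval_N x D z (mm n) i (y \<beta> n) (a n))"

lemma Dj: "0 < D j" using d Dlo[of j] by linarith

lemma prior_cont: "continuous_on {0<..} prior"
 by (rule continuous_at_imp_continuous_on) (use prior_deriv DERIV_isCont in auto)

lemma prior_meas: "(\<lambda>A. prior A*indicator {0<..} A) \<in> borel_measurable borel"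
proof -
 have "(\<lambda>A. indicator {0<..} A *\<^sub>R prior A) \<in> borel_measurable borel"
  by (rule borel_measurable_continuous_on_indicator[OF _ prior_cont]) simp
 then show ?thesis by (simp add: mult.commute)
qed

lemma theta_v: "EV n. \<forall>A\<ge>0. y \<beta> n i - x i \<bullet> beta_bar x D (mm n) (y \<beta> n) A = v n A \<and>
  theta_tilde x D (mm n) i (y \<beta> n) A = y \<beta> n i - D i/(A + D i) * v n A"
 using sample
proof eventually_elim
 case (elim n)
 then interpret S: regression_sample x D "mm n" "e n" d dm X c by blast
 show ?case
 proof (intro allI impI conjI)
  fix A :: real assume A: "0 \<le> A"
  show 1: "y \<beta> n i - x i \<bullet> beta_bar x D (mm n) (y \<beta> n) A = v n A"
   by (simp add: S.beta_bar_eq[OF A] inner_add_right)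
  have "(1 - B)*p + B*q = p - B*(p - q)" for B p q :: real by (simp add: algebra_simps)
  then show "theta_tilde x D (mm n) i (y \<beta> n) A = y \<beta> n i - D i/(A + D i) * v n A"
   unfolding theta_tilde_def 1[symmetric] B_fun_def by blast
 qed
qed

text \<open>\<open>b\<close> solves an equation with \<open>Q\<close>, of order \<open>m\<close>,
  and right side \<open>u 1\<close>, which is o(m) uniformly on bounded ranges, as is its derivative
  \<open>- u 2\<close>. So \<open>b\<close> and its Lipschitz constant tend to 0, and
  \<open>v\<close> is \<open>e n i\<close> plus a small, slowly varying term.\<close>

lemma residual_lipschitz:
 obtains \<sigma> where "\<sigma> \<longlonglongrightarrow> 0"
  "EV n. 0 \<le> \<sigma> n \<and> (\<forall>A\<in>{0<..A0+1}. \<forall>B\<in>{0<..A0+1}. \<bar>v n A - v n B\<bar> \<le> \<sigma> n*\<bar>A - B\<bar>) \<and> (\<forall>A\<in>{0<..A0+1}. \<bar>v n A\<bar> \<le> \<bar>e n i\<bar> + \<sigma> n)"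
proof -
 let ?f = "\<lambda>n A. (norm (U n 1 A) + norm (U n 2 A))/M n"
 obtain S where S0: "S \<longlonglongrightarrow> 0" and S: "EV n. 0 \<le> S n \<and> (\<forall>A\<in>{0..A0+1}. ?f n A \<le> S n)"
 proof (rule uniform_rate[of "{0..A0+1}" ?f])
  fix \<eta> :: real assume \<eta>: "0 < \<eta>"
  then have "0 < \<eta>/2" by simp
  from U_uniform[OF _ this, of 1 "A0 + 1"] U_uniform[OF _ this, of 2 "A0 + 1"]
  have "EV n. \<forall>A\<in>{0..A0+1}. norm (U n 1 A) \<le> \<eta>/2*M n" "EV n. \<forall>A\<in>{0..A0+1}. norm (U n 2 A) \<le> \<eta>/2*M n" by simp_all
  with M_ge[of 1] show "EV n. \<forall>A\<in>{0..A0+1}. ?f n A \<le> \<eta>"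
  proof eventually_elim
   case (elim n)
   show ?case
   proof
    fix A assume "A \<in> {0..A0+1}"
    with elim have "norm (U n 1 A) \<le> \<eta>/2*M n" "norm (U n 2 A) \<le> \<eta>/2*M n" by blast+
    then have "norm (U n 1 A) + norm (U n 2 A) \<le> \<eta>*M n" by simp
    then show "?f n A \<le> \<eta>" using elim(1) by (simp add: pos_divide_le_eq)
   qed
  qed
 qed (use A0 in auto)
 let ?k = "regression_sample.k0 dm c (A0 + 1)" and ?k1 = "regression_sample.k1 d dm X c (A0 + 1)"
 define \<sigma> where "\<sigma> n = X*(?k + ?k1)*S n" for n
 have "\<sigma> \<longlonglongrightarrow> X*(?k + ?k1)*0" unfolding \<sigma>_def by (intro tendsto_intros S0)
 moreover have "EV n. 0 \<le> \<sigma> n \<and> (\<forall>A\<in>{0<..A0+1}. \<forall>B\<in>{0<..A0+1}. \<bar>v n A - v n B\<bar> \<le> \<sigma> n*\<bar>A - B\<bar>) \<and> (\<forall>A\<in>{0<..A0+1}. \<bar>v n A\<bar> \<le> \<bar>e n i\<bar> + \<sigma> n)"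
  using S sample
 proof eventually_elim
  case (elim n)
  then interpret R: regression_sample x D "mm n" "e n" d dm X c by blast
  have k: "0 \<le> R.k0 (A0 + 1)" "0 \<le> R.k1 (A0 + 1)" using R.k_nonneg[of "A0 + 1"] A0 by auto
  have u: "norm (U n 1 A) \<le> S n*M n" "norm (U n 2 A) \<le> S n*M n" if "A \<in> {0..A0+1}" for A
  proof -
   have "?f n A \<le> S n" using elim(1) that by blast
   then have "norm (U n 1 A) + norm (U n 2 A) \<le> S n*M n" using R.mp by (simp add: pos_divide_le_eq)
   then show "norm (U n 1 A) \<le> S n*M n" "norm (U n 2 A) \<le> S n*M n"
    using norm_ge_zero[of "U n 1 A"] norm_ge_zero[of "U n 2 A"] by linarith+
  qed
  have b: "norm (R.b A) \<le> R.k0 (A0 + 1)*S n" "norm (R.b A - R.b B) \<le> R.k1 (A0 + 1)*S n*\<bar>A - B\<bar>"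
   if AB: "A \<in> {0<..A0+1}" "B \<in> {0<..A0+1}" for A B
  proof -
   have A: "0 \<le> A" "A \<le> A0 + 1" "0 \<le> B" "B \<le> A0 + 1" "0 < A" "0 < B" using AB by auto
   have ul: "norm (R.u 1 A' - R.u 1 B') \<le> (S n*M n)*\<bar>A' - B'\<bar>" if "A' \<in> {0<..A0+1}" "B' \<in> {0<..A0+1}" for A' B'
    by (rule R.u1_lipschitz) (use that in \<open>auto intro!: u\<close>)
   have "norm (R.b A) \<le> R.k0 (A0 + 1)*(S n*M n)/M n"
    by (rule R.solve_bounds(1)[OF A(3,4,1,2) R.Qb[OF A(3)] R.Qb[OF A(1)]]) (use u[of A] ul[OF AB(2,1)] A in auto)
   then show "norm (R.b A) \<le> R.k0 (A0 + 1)*S n" using R.mp by simp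
   have "norm (R.b A - R.b B) \<le> R.k1 (A0 + 1)*(S n*M n)*\<bar>A - B\<bar>/M n"
    by (rule R.solve_bounds(2)[OF A(1-4) R.Qb[OF A(1)] R.Qb[OF A(3)]]) (use u[of B] ul[OF AB] A in auto)
   then show "norm (R.b A - R.b B) \<le> R.k1 (A0 + 1)*S n*\<bar>A - B\<bar>" using R.mp by (simp add: mult_ac)
  qed
  have xb: "\<bar>x i \<bullet> q\<bar> \<le> X*r" if "norm q \<le> r" for q r
   by (rule order_trans[OF Cauchy_Schwarz_ineq2 mult_mono[OF X that X0]]) simp
  have s: "0 \<le> X*R.k0 (A0 + 1)*S n" "0 \<le> X*R.k1 (A0 + 1)*S n" using elim(1) k X0 by simp_all
  have e: "\<sigma> n = X*R.k0 (A0 + 1)*S n + X*R.k1 (A0 + 1)*S n" by (simp add: \<sigma>_def algebra_simps)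
  show ?case
  proof (intro conjI ballI)
   show "0 \<le> \<sigma> n" using s e by simp
   fix A assume A: "A \<in> {0<..A0+1}"
   show "\<bar>v n A\<bar> \<le> \<bar>e n i\<bar> + \<sigma> n" using xb[OF b(1)[OF A A]] s e abs_triangle_ineq4[of "e n i" "x i \<bullet> R.b A"] by simp
   fix B assume B: "B \<in> {0<..A0+1}"
   have "\<bar>v n A - v n B\<bar> = \<bar>x i \<bullet> (R.b A - R.b B)\<bar>" by (simp add: inner_diff_right abs_minus_commute)
   also have "\<dots> \<le> X*(R.k1 (A0 + 1)*S n*\<bar>A - B\<bar>)" by (rule xb[OF b(2)[OF A B]])
   also have "\<dots> = (X*R.k1 (A0 + 1)*S n)*\<bar>A - B\<bar>" by simp
   also have "\<dots> \<le> \<sigma> n*\<bar>A - B\<bar>" using s e by (intro mult_right_mono) auto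
   finally show "\<bar>v n A - v n B\<bar> \<le> \<sigma> n*\<bar>A - B\<bar>" .
  qed
 qed
 ultimately show ?thesis using that by simp
qed

lemma prior_tail:
 obtains q i0 where "0 \<le> q" "0 \<le> i0" "(\<integral>\<^sup>+A. indicator {0<..} A*ennreal (prior A*exp (- q*ln (1 + A))) \<partial>lborel) = ennreal i0"
proof -
 obtain m where m: "dim (x ` {..<m}) = CARD('a)" "posterior_proper x D prior m (\<lambda>_. 0)" using proper by blast
 have "(\<integral>\<^sup>+A. indicator {0<..} A*ennreal (prior A*exp (- (real m/2)*ln (1 + A))) \<partial>lborel) < \<infinity>"
  by (rule prior_tail_integrable[OF m(1) _ _ prior_meas _ m(2)]) (use Dj Dhi prior_pos in auto)
 then show ?thesis using that[of "real m/2" "enn2real (\<integral>\<^sup>+A. indicator {0<..} A*ennreal (prior A*exp (- (real m/2)*ln (1 + A))) \<partial>lborel)"] by simp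
qed

text \<open>The posterior mass of \<open>A\<close> outside a fixed neighbourhood of the true value is exponentially small.\<close>

lemma posterior_localised:
 assumes \<epsilon>: "0 < \<epsilon>" "\<epsilon> < A0" and c': "0 < c'" and w: "EV n. c'/M n \<le> integral {A0-\<epsilon>..A0+\<epsilon>} (w n)"
  and cc: "EV n. continuous_on {A0-\<epsilon>..A0+\<epsilon>} (cov n)"
  and wc: "EV n. continuous_on {A0-\<epsilon>..A0+\<epsilon>} (w n)"
 shows "(\<lambda>n. M n*(post n - wavg (w n) (A0-\<epsilon>) (A0+\<epsilon>) (cov n))) \<longlonglongrightarrow> 0"
proof -
 let ?J = "{A0-\<epsilon>..A0+\<epsilon>}"
 obtain q i0 where q: "0 \<le> q" and i0: "0 \<le> i0" "(\<integral>\<^sup>+A. indicator {0<..} A*ennreal (prior A*exp (- q*ln (1 + A))) \<partial>lborel) = ennreal i0"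
  by (rule prior_tail)
 obtain c1 where c1: "0 < c1" and tl: "EV n. \<forall>A\<ge>0. \<epsilon> \<le> \<bar>A - A0\<bar> \<longrightarrow> l \<beta> n A - l \<beta> n A0 \<le> - c1*M n - q*ln (1 + A)"
  using tail[OF \<epsilon>(1) q] by blast
 have i: "EV n. i < mm n" using mm[unfolded filterlim_at_top, rule_format, of "Suc i"] by (simp add: Suc_le_eq)
 have "(\<lambda>n. 2*i0/c'*(M n^2*exp (- c1*M n))) \<longlonglongrightarrow> 2*i0/c'*0" by (intro tendsto_intros tendsto_power_mult_exp_neg Minf c1)
 then have z0: "(\<lambda>n. 2*i0/c'*(M n^2*exp (- c1*M n))) \<longlonglongrightarrow> 0" by simp
 show ?thesis
 proof (rule Lim_null_comparison[OF _ z0])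
  show "EV n. norm (M n*(post n - wavg (w n) (A0-\<epsilon>) (A0+\<epsilon>) (cov n))) \<le> 2*i0/c'*(M n^2*exp (- c1*M n))"
   using w cc wc tl i sample L_pos L_truth_le aml_properties M_ge[of 1]
  proof eventually_elim
   case (elim n)
   then interpret S: regression_sample x D "mm n" "e n" d dm X c by blast
   have Lp: "0 < L n A" if "0 \<le> A" for A using elim(7) that by blast
   have a0: "0 < a n" using elim(9) by blast
   let ?F = "\<lambda>A. prior A*L n A"
   \<comment> \<open>The weight \<open>w n\<close> is the unnormalised posterior density divided by
     \<open>L n (a n)\<close>; the factor cancels in \<open>wavg\<close>.\<close>
   have Fw: "?F A = L n (a n)*w n A" if "0 \<le> A" for A
    using Lp[OF that] Lp[of "a n"] a0 by (simp add: exp_diff)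
   have J0: "0 \<le> A" if "A \<in> ?J" for A using that \<epsilon> by auto
   have iF: "integral ?J ?F = L n (a n)*integral ?J (w n)"
    unfolding integral_mult_right[symmetric] by (rule Henstock_Kurzweil_Integration.integral_cong) (rule Fw[OF J0])
   have wv: "wavg ?F (A0-\<epsilon>) (A0+\<epsilon>) (cov n) = wavg (w n) (A0-\<epsilon>) (A0+\<epsilon>) (cov n)"
   proof -
    have "integral ?J (\<lambda>A. cov n A*?F A) = L n (a n)*integral ?J (\<lambda>A. cov n A*w n A)"
     unfolding integral_mult_right[symmetric] by (rule Henstock_Kurzweil_Integration.integral_cong) (use Fw[OF J0] in simp)
    then show ?thesis unfolding wavg_def iF using Lp[of "a n"] a0 by simp
   qed
   \<comment> \<open>Bound for the tail mass: \<open>tail\<close> with exponent \<open>q\<close>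
     leaves the prior integrated against \<open>(1 + A) powr (- q)\<close>, which is the finite
     constant \<open>i0\<close>.\<close>
   define t where "t = exp (- c1*M n)*L n A0*i0"
   have t0: "0 \<le> t" unfolding t_def using Lp[of A0] A0 i0 by simp
   have m1: "(\<lambda>A. indicator {0<..} A*ennreal (?F A)) \<in> borel_measurable borel"
    by (rule posterior_mass(2)[OF S.rank Dj elim(5) prior_meas prior_pos])
   note P = posterior_prob_interval[where prior = prior and m = "mm n" and i = i and y = "y \<beta> n" and D = D and x = x, OF S.rank Dj elim(5) prior_meas _ a0 z(1)]
   have "\<bar>post n - wavg ?F (A0-\<epsilon>) (A0+\<epsilon>) (cov n)\<bar> \<le> t/integral ?J ?F"
   proof (subst P(1), rule prior_pos, assumption, rule posterior_mean_localise[OF _ _ _ _ _ elim(2) _ m1])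
    show "0 \<le> ?F A" if "0 < A" for A using prior_pos[OF that] Lp[of A] that by simp
    show "0 < ?F A" if "A \<in> ?J" for A using prior_pos[of A] Lp[of A] that \<epsilon> by auto
    show "continuous_on ?J ?F"
     by (rule continuous_on_eq[OF continuous_on_mult_left[OF elim(3), of "L n (a n)"]]) (rule Fw[OF J0, symmetric])
    show "0 \<le> cov n A \<and> cov n A \<le> 1" if "0 < A" for A by (rule P(3)[OF prior_pos that])
    show "(\<lambda>A. indicator {0<..} A*ennreal (?F A)*ennreal (cov n A)) \<in> borel_measurable borel" by (rule P(2)[OF prior_pos])
    show "(\<integral>\<^sup>+A. indicator ({0<..} - ?J) A*ennreal (?F A) \<partial>lborel) \<le> ennreal t"
    proof -
     have "indicator ({0<..} - ?J) A*ennreal (?F A) \<le> ennreal (exp (- c1*M n)*L n A0)*(indicator {0<..} A*ennreal (prior A*exp (- q*ln (1 + A))))" for A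
     proof (cases "0 < A \<and> A \<notin> ?J")
      case True
      then have A: "0 < A" "\<epsilon> \<le> \<bar>A - A0\<bar>" by auto
      have "l \<beta> n A \<le> l \<beta> n A0 + (- c1*M n - q*ln (1 + A))" using elim(4) A by (simp add: algebra_simps)
      then have "exp (l \<beta> n A) \<le> exp (l \<beta> n A0 + (- c1*M n + - q*ln (1 + A)))" by simp
      also have "\<dots> = L n A0*(exp (- c1*M n)*exp (- q*ln (1 + A)))" unfolding exp_add using Lp[of A0] A0 by simp
      finally have "L n A \<le> L n A0*(exp (- c1*M n)*exp (- q*ln (1 + A)))" using Lp[of A] A by simp
      then have "prior A*L n A \<le> prior A*(L n A0*(exp (- c1*M n)*exp (- q*ln (1 + A))))"
       using prior_pos[OF A(1)] by (intro mult_left_mono) auto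
      also have "\<dots> = (exp (- c1*M n)*L n A0)*(prior A*exp (- q*ln (1 + A)))" by (simp only: mult_ac)
      finally have "ennreal (?F A) \<le> ennreal ((exp (- c1*M n)*L n A0)*(prior A*exp (- q*ln (1 + A))))" by (rule ennreal_leI)
      then show ?thesis using True prior_pos[OF A(1)] Lp[of A0] A0 by (simp add: ennreal_mult)
     qed auto
     then have "(\<integral>\<^sup>+A. indicator ({0<..} - ?J) A*ennreal (?F A) \<partial>lborel) \<le> (\<integral>\<^sup>+A. ennreal (exp (- c1*M n)*L n A0)*(indicator {0<..} A*ennreal (prior A*exp (- q*ln (1 + A)))) \<partial>lborel)"
      by (intro nn_integral_mono)
     also have "\<dots> = ennreal (exp (- c1*M n)*L n A0)*ennreal i0"
     proof -
      have "(\<lambda>A. ennreal (prior A*indicator {0<..} A*exp (- q*ln (1 + A)))) \<in> borel_measurable borel"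
       using prior_meas by measurable
      moreover have "(\<lambda>A. ennreal (prior A*indicator {0<..} A*exp (- q*ln (1 + A)))) = (\<lambda>A. indicator {0<..} A*ennreal (prior A*exp (- q*ln (1 + A))))"
       by (auto simp: fun_eq_iff split: split_indicator)
      ultimately have "(\<lambda>A. indicator {0<..} A*ennreal (prior A*exp (- q*ln (1 + A)))) \<in> borel_measurable lborel" by simp
      then show ?thesis by (simp only: nn_integral_cmult i0)
     qed
     also have "\<dots> = ennreal t" unfolding t_def using Lp[of A0] A0 i0 by (simp add: ennreal_mult)
     finally show ?thesis .
    qed
   qed (use \<epsilon> t0 in auto)
   also have "\<dots> \<le> (exp (- c1*M n)*(2*L n (a n))*i0)/(L n (a n)*(c'/M n))"
    unfolding iF t_def using Lp[of "a n"] a0 i0 elim(1,8,10) c'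
    by (intro frac_le mult_right_mono mult_left_mono mult_nonneg_nonneg mult_pos_pos) auto
   also have "\<dots> = 2*i0/c'*(M n*exp (- c1*M n))" using Lp[of "a n"] a0 c' elim(10) by simp
   finally have "M n*\<bar>post n - wavg (w n) (A0-\<epsilon>) (A0+\<epsilon>) (cov n)\<bar> \<le> M n*(2*i0/c'*(M n*exp (- c1*M n)))"
    unfolding wv by (rule mult_left_mono) simp
   then show ?case by (simp add: abs_mult power2_eq_square mult_ac)
  qed
 qed
qed

text \<open>Up to o(1) both sides are the same function of the bounded sequences tr[V^{-k}]/m and of
  the residual at \<open>A0\<close>: \<open>a n\<close> and \<open>ah n\<close> both tend to
  \<open>A0\<close>, \<open>info\<close> is close to tr[V^{-2}]/2, \<open>third\<close> to 2
  tr[V^{-3}], and the score at \<open>a n\<close> to \<open>- l1\<close>. What remains is the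
  algebraic identity \<open>XY\<close>.\<close>

lemma c_hat_expansion:
 assumes mEs: "(\<lambda>n. mE1 n - M n/info n (a n)*(lp n (a n) + prior' A0/prior A0 + third n (a n)/(2*info n (a n)))) \<longlonglongrightarrow> 0"
  and mEs2: "(\<lambda>n. mE2 n - M n/info n (a n)) \<longlonglongrightarrow> 0"
 defines "\<gamma> \<equiv> \<lambda>n. D i/(a n*(a n + D i))"
 shows "(\<lambda>n. z*(- \<gamma> n*mE1 n + (\<gamma> n/(a n + D i) + (3 - z^2)/4*(\<gamma> n)^2 - \<gamma> n*(v n (a n)/(a n + D i))^2)*mE2 n)
   - M n*c_hat x D prior z (mm n) i (y \<beta> n) (ah n)) \<longlonglongrightarrow> 0"
proof -
 let ?t = "\<lambda>n. T 2 n A0/M n" and ?k = "\<lambda>n. T 3 n A0/M n"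
 let ?\<rho> = "prior' A0/prior A0" and ?\<gamma> = "D i/(A0*(A0 + D i))" and ?l = "l1 D z i A0"
 have AD: "0 < A0 + D i" using A0 Di by simp
 have M1: "EV n. 1 \<le> M n" by (rule M_ge)
 have Tb: "EV n. 1/(A0 + dm)^k \<le> T k n A0/M n \<and> T k n A0/M n \<le> 1/d^k" for k
  using M1
 proof eventually_elim
  case (elim n)
  have p: "0 < M n" using elim by linarith
  have "M n/(A0 + dm)^k/M n \<le> T k n A0/M n" "T k n A0/M n \<le> M n/d^k/M n"
   by (rule divide_right_mono; use trVinv_bounds[of A0 n k] A0 p in auto)+
  then show ?case using p by simp
 qed
 have TB: "Bseq (\<lambda>n. T k n A0/M n)" for k
 proof (rule Bseq_eventually_mono)
  show "EV n. norm (T k n A0/M n) \<le> norm (1/d^k)" using Tb[of k]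
  proof eventually_elim
   case (elim n)
   have "0 \<le> 1/(A0 + dm)^k" using A0 dm0 by simp
   then have "0 \<le> T k n A0/M n" using elim by linarith
   then show ?case using elim by (simp only: real_norm_def abs_of_nonneg) (use d in simp)
  qed
 qed simp
 have aebI: "f \<bumpeq> h" if "(\<lambda>n. f n - h n) \<longlonglongrightarrow> 0" "Bseq h" for f h using that by (simp add: asymp_equiv_bdd_def)
 have ev: "f' \<bumpeq> h" if "f \<bumpeq> h" "EV n. f n = f' n" for f f' h
  using that Lim_transform_eventually[of "\<lambda>n. f n - h n" 0 sequentially "\<lambda>n. f' n - h n"]
  by (auto simp: asymp_equiv_bdd_def elim: eventually_mono)
 have T: "(\<lambda>n. T k n (b n)/M n) \<bumpeq> (\<lambda>n. T k n A0/M n)" if "b \<longlonglongrightarrow> A0" for b k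
  by (rule aebI[OF _ TB]) (use trVinv_limit[OF that, of k] in \<open>simp add: diff_divide_distrib\<close>)
 have cst: "(\<lambda>n. r) \<bumpeq> (\<lambda>n. r)" for r by (intro aeb_tendsto tendsto_const)
 note a = aml_consistent and ah = reml_consistent
 have I: "(\<lambda>n. info n (a n)/M n) \<bumpeq> (\<lambda>n. 1/2*?t n)"
 proof (rule aebI)
  show "(\<lambda>n. info n (a n)/M n - 1/2*?t n) \<longlonglongrightarrow> 0" using info_limit[OF a] by (simp add: diff_divide_distrib mult.commute)
  show "Bseq (\<lambda>n. 1/2*?t n)" using Bseq_mult[OF Bfun_const[of "1/2"] TB] .
 qed
 have Th: "(\<lambda>n. third n (a n)/M n) \<bumpeq> (\<lambda>n. 2*?k n)"
 proof (rule aebI)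
  show "(\<lambda>n. third n (a n)/M n - 2*?k n) \<longlonglongrightarrow> 0" using third_limit[OF a] by (simp add: diff_divide_distrib mult.commute)
  show "Bseq (\<lambda>n. 2*?k n)" using Bseq_mult[OF Bfun_const[of "2"] TB] .
 qed
 have cpos: "0 < 1/(A0 + dm)^2" using A0 dm0 by simp
 have I': "(\<lambda>n. 1/(info n (a n)/M n)) \<bumpeq> (\<lambda>n. 1/(1/2*?t n))"
  by (rule aeb_inverse[OF I, of "1/2*(1/(A0 + dm)^2)"]) (use cpos Tb[of 2] in \<open>auto elim: eventually_mono\<close>)
 have T': "(\<lambda>n. 1/(T 2 n (ah n)/M n)) \<bumpeq> (\<lambda>n. 1/?t n)"
  by (rule aeb_inverse[OF T[OF ah] cpos]) (use Tb[of 2] in \<open>auto elim: eventually_mono\<close>)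
 have lpl: "(\<lambda>n. lp n (a n)) \<bumpeq> (\<lambda>n. - ?l)"
  by (rule ev[OF aeb_tendsto[OF tendsto_minus[OF l1_limit[OF a]]]]) (use score_at_aml in \<open>auto elim: eventually_mono\<close>)
 have E2: "mE2 \<bumpeq> (\<lambda>n. 1/(1/2*?t n))"
 proof -
  have "(\<lambda>n. (mE2 n - M n/info n (a n)) + 1/(info n (a n)/M n)) \<bumpeq> (\<lambda>n. 0 + 1/(1/2*?t n))"
   by (intro aeb_add I' aeb_tendsto mEs2)
  then show ?thesis by simp
 qed
 have E1: "mE1 \<bumpeq> (\<lambda>n. 0 + (1/(1/2*?t n))*(- ?l + ?\<rho> + 1/2*((2*?k n)*(1/(1/2*?t n)))))"
 proof (rule ev)
  show "(\<lambda>n. (mE1 n - M n/info n (a n)*(lp n (a n) + ?\<rho> + third n (a n)/(2*info n (a n)))) +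
    (1/(info n (a n)/M n))*(lp n (a n) + ?\<rho> + 1/2*((third n (a n)/M n)*(1/(info n (a n)/M n))))) \<bumpeq>
    (\<lambda>n. 0 + (1/(1/2*?t n))*(- ?l + ?\<rho> + 1/2*((2*?k n)*(1/(1/2*?t n)))))"
   by (intro aeb_add aeb_mult I' Th lpl cst aeb_tendsto[OF mEs])
  show "EV n. (mE1 n - M n/info n (a n)*(lp n (a n) + ?\<rho> + third n (a n)/(2*info n (a n)))) +
    (1/(info n (a n)/M n))*(lp n (a n) + ?\<rho> + 1/2*((third n (a n)/M n)*(1/(info n (a n)/M n)))) = mE1 n"
   using M1 by eventually_elim simp
 qed
 obtain \<sigma> where s0: "\<sigma> \<longlonglongrightarrow> 0" and s: "EV n. 0 \<le> \<sigma> n \<and> (\<forall>A\<in>{0<..A0+1}. \<forall>B\<in>{0<..A0+1}. \<bar>v n A - v n B\<bar> \<le> \<sigma> n*\<bar>A - B\<bar>) \<and> (\<forall>A\<in>{0<..A0+1}. \<bar>v n A\<bar> \<le> \<bar>e n i\<bar> + \<sigma> n)"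
  by (rule residual_lipschitz)
 have s1: "EV n. \<sigma> n < 1" using order_tendstoD(2)[OF s0, of 1] by simp
 have near: "EV n. b n \<in> {0<..A0+1} \<and> \<bar>b n - A0\<bar> \<le> 1" if "b \<longlonglongrightarrow> A0" for b
 proof -
  have "EV n. \<bar>b n - A0\<bar> < min 1 A0" using tendstoD[OF that, of "min 1 A0"] A0 by (simp add: dist_real_def)
  then show ?thesis by eventually_elim (auto simp: abs_less_iff)
 qed
 have vB: "Bseq (\<lambda>n. v n A0)"
 proof (rule Bseq_eventually_mono)
  show "EV n. norm (v n A0) \<le> norm (K + 1)" using s s1 eK
  proof eventually_elim
   case (elim n)
   then have "\<bar>v n A0\<bar> \<le> \<bar>e n i\<bar> + \<sigma> n" using A0 by auto
   then show ?case using elim by simp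
  qed
 qed simp
 have V: "(\<lambda>n. v n (b n)) \<bumpeq> (\<lambda>n. v n A0)" if b: "b \<longlonglongrightarrow> A0" for b
 proof (rule aebI[OF Lim_null_comparison[OF _ s0] vB])
  show "EV n. norm (v n (b n) - v n A0) \<le> \<sigma> n" using s near[OF b]
  proof eventually_elim
   case (elim n)
   then have "\<bar>v n (b n) - v n A0\<bar> \<le> \<sigma> n*\<bar>b n - A0\<bar>" using A0 by auto
   also have "\<dots> \<le> \<sigma> n*1" using elim by (intro mult_left_mono) auto
   finally show ?case by simp
  qed
 qed
 have lim: "(\<lambda>n. f (b n)) \<bumpeq> (\<lambda>_. f A0)" if "b \<longlonglongrightarrow> A0" "isCont f A0" for f b
  by (rule aeb_tendsto[OF isCont_tendsto_compose[OF that(2,1)]])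
 have c1: "isCont (\<lambda>A. D i/(A*(A + D i))) A0" "isCont (\<lambda>A. 1/(A + D i)) A0" "isCont (\<lambda>A. B_fun D i A/A) A0" "isCont (\<lambda>A. l1 D z i A) A0"
  "isCont (\<lambda>A. 1/A) A0" "isCont (\<lambda>A. B_fun D i A) A0"
  unfolding B_fun_def l1_def using A0 AD by (auto intro!: continuous_intros)
 have p'c: "isCont prior' A0" using prior'_cont A0 by (simp add: continuous_on_eq_continuous_at)
 have c2: "isCont (\<lambda>A. prior' A/prior A) A0"
  by (intro isCont_divide p'c DERIV_isCont[OF prior_deriv[OF A0]]) (use prior_pos[OF A0] in simp)
 have \<rho>: "rho1 prior A = prior' A/prior A" if "0 < A" for A
 proof -
  have "((\<lambda>A. ln (prior A)) has_real_derivative prior' A/prior A) (at A)"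
   using DERIV_ln_divide[OF prior_pos[OF that]] prior_deriv[OF that] prior_pos[OF that] by (auto intro!: derivative_eq_intros)
  then show ?thesis unfolding rho1_def by (rule DERIV_imp_deriv)
 qed
 let ?X = "\<lambda>n. - \<gamma> n*mE1 n + (\<gamma> n*(1/(a n + D i)) + (3 - z^2)/4*(\<gamma> n)^2 - \<gamma> n*(v n (a n)*(1/(a n + D i)))^2)*mE2 n"
 let ?XX = "\<lambda>n. - ?\<gamma>*(0 + (1/(1/2*?t n))*(- ?l + ?\<rho> + 1/2*((2*?k n)*(1/(1/2*?t n))))) +
   (?\<gamma>*(1/(A0 + D i)) + (3 - z^2)/4*?\<gamma>^2 - ?\<gamma>*(v n A0*(1/(A0 + D i)))^2)*(1/(1/2*?t n))"
 have X: "?X \<bumpeq> ?XX" unfolding \<gamma>_def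
  by (intro aeb_add aeb_diff aeb_mult aeb_minus aeb_power cst E1 E2 V a lim c1)
 let ?Y = "\<lambda>n. 2*(B_fun D i (ah n)/ah n)*(1/(T 2 n (ah n)/M n)) *
   (l1 D z i (ah n) - 1/2*((B_fun D i (ah n)*(1/2) - 2)*(1/ah n) + 4*((T 3 n (ah n)/M n)*(1/(T 2 n (ah n)/M n))))
   - prior' (ah n)/prior (ah n) - (v n (ah n)*(1/(ah n + D i)))^2 - z^2*(1/4)*(B_fun D i (ah n)/ah n))"
 let ?YY = "\<lambda>n. 2*(B_fun D i A0/A0)*(1/?t n) *
   (l1 D z i A0 - 1/2*((B_fun D i A0*(1/2) - 2)*(1/A0) + 4*(?k n*(1/?t n)))
   - prior' A0/prior A0 - (v n A0*(1/(A0 + D i)))^2 - z^2*(1/4)*(B_fun D i A0/A0))"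
 have Y: "?Y \<bumpeq> ?YY"
  by (intro aeb_add aeb_diff aeb_mult aeb_power cst T' T V ah lim[where f = "\<lambda>A. B_fun D i A/A"] lim[where f = "\<lambda>A. prior' A/prior A"]
   lim[where f = "\<lambda>A. l1 D z i A"] lim[where f = "\<lambda>A. 1/A"] lim[where f = "\<lambda>A. 1/(A + D i)"] lim[where f = "\<lambda>A. B_fun D i A"] c1 c2)
 \<comment> \<open>With \<open>B\<close> the shrinkage factor at \<open>A0\<close> and
   \<open>r = 1/A0\<close> one has \<open>\<gamma> = B*r\<close> and
   \<open>1/(A0 + D i) = (1 - B)*r\<close>. So
   \<open>\<gamma>/(A0 + D i) + (3 - z^2)/4*\<gamma>^2\<close> becomes
   \<open>B*r^2*(1 - B/4 - z^2*B/4)\<close>, which produces both the term with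
   \<open>B/2 - 2\<close> and the last term of \<open>c_hat\<close>.\<close>
 have XY: "?XX n = ?YY n" for n
 proof -
  have g: "?\<gamma> = B_fun D i A0*(1/A0)" by (simp add: B_fun_def)
  have q: "1/(A0 + D i) = (1 - B_fun D i A0)*(1/A0)" using A0 AD by (simp add: B_fun_def field_simps)
  have "- (B*r)*(0 + (1/(1/2*t))*(- L + R + 1/2*((2*k)*(1/(1/2*t))))) +
   ((B*r)*((1 - B)*r) + (3 - z^2)/4*(B*r)^2 - (B*r)*V)*(1/(1/2*t)) =
   2*(B*r)*(1/t)*(L - 1/2*((B*(1/2) - 2)*r + 4*(k*(1/t))) - R - V - z^2*(1/4)*(B*r))" for B r t k L R V :: real
  proof -
   have "1/(1/2*t) = 2*(1/t)" by simp
   then obtain u where u: "1/(1/2*t) = 2*u" "1/t = u" by simp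
   show ?thesis unfolding u by (simp add: power2_eq_square field_simps)
  qed
  from this[of "B_fun D i A0" "1/A0" "?t n" ?l ?\<rho> "?k n" "(v n A0*(1/(A0 + D i)))^2"]
  show ?thesis unfolding g q[symmetric] by simp
 qed
 have "(\<lambda>n. z*(?X n - ?Y n)) \<longlonglongrightarrow> z*0" by (intro tendsto_mult tendsto_const aebD[OF X Y[folded XY]])
 moreover have "EV n. z*(?X n - ?Y n) = z*(- \<gamma> n*mE1 n + (\<gamma> n/(a n + D i) + (3 - z^2)/4*(\<gamma> n)^2 - \<gamma> n*(v n (a n)/(a n + D i))^2)*mE2 n)
   - M n*c_hat x D prior z (mm n) i (y \<beta> n) (ah n)"
  using M1 near[OF ah] theta_v
 proof eventually_elim
  case (elim n)
  have h: "0 < ah n" using elim by auto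
  have v: "y \<beta> n i - x i \<bullet> beta_bar x D (mm n) (y \<beta> n) (ah n) = v n (ah n)" using elim(3) h by (auto simp: less_imp_le)
  have "M n*c_hat x D prior z (mm n) i (y \<beta> n) (ah n) = z*?Y n"
  proof -
   have "m*(2*z*B/(A*t2)*(L - 1/2*((B/2 - 2)*(1/A) + 4*(t3/t2)) - R - (w/q)^2 - z^2*B/(4*A))) =
    z*(2*(B/A)*(1/(t2/m))*(L - 1/2*((B*(1/2) - 2)*(1/A) + 4*((t3/m)*(1/(t2/m)))) - R - (w*(1/q))^2 - z^2*(1/4)*(B/A)))"
    if "0 < m" for m B A t2 t3 L R w q :: real using that by simp
   from this[of "M n"] show ?thesis unfolding c_hat_def v \<rho>[OF h] using elim(1) by simp
  qed
  then show ?case by (simp add: right_diff_distrib)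
 qed
 ultimately show ?thesis by (simp add: Lim_transform_eventually)
qed

text \<open>Three errors add up: the posterior mass of \<open>A\<close> outside the window, the
  expansion of the coverage on the window, and the identification of its coefficients with
  \<open>c_hat\<close>.\<close>

theorem coverage_sequence:
 "(\<lambda>n. M n*(post n - (1 - \<alpha> + std_normal_density z*c_hat x D prior z (mm n) i (y \<beta> n) (ah n)))) \<longlonglongrightarrow> 0"
proof -
 obtain \<epsilon> c1 C \<tau>' where \<epsilon>: "0 < \<epsilon>" "\<epsilon> \<le> 1" "\<epsilon> < A0" "0 < c1" and t0: "\<tau>' \<longlonglongrightarrow> 0"
  and la: "EV n. \<bar>lp n (a n)\<bar> \<le> C"
  and H3: "EV n. \<forall>A\<in>{A0-\<epsilon>..A0+\<epsilon>}. (A - a n)*(lp n A - lp n (a n)) \<le> - (c1*M n)*(A - a n)^2"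
  and H4: "EV n. \<forall>A\<in>{A0-\<epsilon>..A0+\<epsilon>}. \<bar>lp n A - lp n (a n) + info n (a n)*(A - a n) - third n (a n)/2*(A - a n)^2\<bar>
    \<le> C*M n*\<bar>A - a n\<bar>^3 + \<tau>' n * sqrt (M n)*\<bar>A - a n\<bar>"
  and NK: "EV n. c1*M n \<le> info n (a n) \<and> info n (a n) \<le> C*M n \<and> \<bar>third n (a n)\<bar> \<le> C*M n"
  by (rule local_score)
 let ?lo = "A0 - \<epsilon>" and ?hi = "A0 + \<epsilon>"
 have lo: "0 < ?lo" "?lo < ?hi" using \<epsilon> by auto
 have ld: "EV n. \<forall>A\<in>{?lo..?hi}. (l \<beta> n has_real_derivative lp n A) (at A)"
  using sample
 proof eventually_elim
  case (elim n)
  then interpret S: regression_sample x D "mm n" "e n" d dm X c by blast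
  show ?case using lo by (auto intro!: S.ln_L_RE_deriv)
 qed
 have lc: "EV n. continuous_on {?lo..?hi} (lp n)"
  using sample by eventually_elim (rule regression_sample.continuous_lp[OF _ lo(1)])
 have pc: "continuous_on {?lo..?hi} prior'" by (rule continuous_on_subset[OF prior'_cont]) (use lo in auto)
 have J0: "0 < A" if "A \<in> {?lo..?hi}" for A using that lo by auto
 note mom = posterior_moments[where l = "l \<beta>" and l' = lp and p = prior and p' = prior' and lo = ?lo and hi = ?hi and ?A0.0 = A0 and m = M and a = a and N = "\<lambda>n. info n (a n)" and K = "\<lambda>n. third n (a n)",
   OF _ _ prior_deriv[OF J0] pc prior_pos[OF J0] ld lc Minf \<epsilon>(4) aml_consistent la H3 H4 t0 NK]
 have lh: "?lo < A0" "A0 < ?hi" using \<epsilon> by auto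
 obtain c' where c': "0 < c'" "EV n. c'/M n \<le> integral {?lo..?hi} (w n)" using mom(1)[OF lh] by auto
 obtain C' where C': "EV n. wavg (w n) ?lo ?hi (\<lambda>A. (A - a n)^2) \<le> C'/M n \<and> wavg (w n) ?lo ?hi (\<lambda>A. (A - a n)^4) \<le> C'/(M n)^2" using mom(2)[OF lh] by auto
 have m2: "(\<lambda>n. M n*wavg (w n) ?lo ?hi (\<lambda>A. (A - a n)^2) - M n/info n (a n)) \<longlonglongrightarrow> 0" using mom(3)[OF lh] by simp
 have m1: "(\<lambda>n. M n*wavg (w n) ?lo ?hi (\<lambda>A. A - a n) - M n/info n (a n)*(lp n (a n) + prior' A0/prior A0 + third n (a n)/(2*info n (a n)))) \<longlonglongrightarrow> 0" using mom(4)[OF lh] by simp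
 obtain \<sigma> where s0: "\<sigma> \<longlonglongrightarrow> 0" and s: "EV n. 0 \<le> \<sigma> n \<and> (\<forall>A\<in>{0<..A0+1}. \<forall>B\<in>{0<..A0+1}. \<bar>v n A - v n B\<bar> \<le> \<sigma> n*\<bar>A - B\<bar>) \<and> (\<forall>A\<in>{0<..A0+1}. \<bar>v n A\<bar> \<le> \<bar>e n i\<bar> + \<sigma> n)"
  by (rule residual_lipschitz)
 have s1: "EV n. \<sigma> n < 1" using order_tendstoD(2)[OF s0, of 1] by simp
 have aJ: "EV n. a n \<in> {?lo..?hi}"
  using tendstoD[OF aml_consistent \<epsilon>(1)] by eventually_elim (auto simp: dist_real_def abs_less_iff)
 have sub: "A \<in> {0<..A0+1}" if "A \<in> {?lo..?hi}" for A using that \<epsilon> by auto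
 let ?H = "regression_sample.kg d dm X c (A0 + 1)"
 have h: "EV n. \<forall>A\<in>{?lo..?hi}. 0 \<le> g2 x D (mm n) i A \<and> g2 x D (mm n) i A \<le> ?H/M n \<and> \<bar>g2 x D (mm n) i A - g2 x D (mm n) i (a n)\<bar> \<le> ?H*\<bar>A - a n\<bar>/M n"
  using sample aJ
 proof eventually_elim
  case (elim n)
  then interpret S: regression_sample x D "mm n" "e n" d dm X c by blast
  show ?case
  proof
   fix A assume A: "A \<in> {?lo..?hi}"
   have b: "0 \<le> A" "A \<le> A0 + 1" "0 \<le> a n" "a n \<le> A0 + 1" using sub[OF A] sub[OF elim(2)] by auto
   show "0 \<le> g2 x D (mm n) i A \<and> g2 x D (mm n) i A \<le> ?H/M n \<and> \<bar>g2 x D (mm n) i A - g2 x D (mm n) i (a n)\<bar> \<le> ?H*\<bar>A - a n\<bar>/M n"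
    using S.g2_bounds[OF b, of i] by blast
  qed
 qed
 have vl: "EV n. \<forall>A\<in>{?lo..?hi}. \<bar>v n A - v n (a n)\<bar> \<le> \<sigma> n*\<bar>A - a n\<bar>"
  using s aJ by eventually_elim (use sub in blast)
 have V: "EV n. \<bar>v n (a n)\<bar> \<le> K + 1" using s s1 aJ eK
 proof eventually_elim
  case (elim n)
  then have "\<bar>v n (a n)\<bar> \<le> \<bar>e n i\<bar> + \<sigma> n" using sub by blast
  then show ?case using elim by linarith
 qed
 have hc: "EV n. continuous_on {?lo..?hi} (g2 x D (mm n) i) \<and> continuous_on {?lo..?hi} (v n)"
  using sample s
 proof eventually_elim
  case (elim n)
  then interpret S: regression_sample x D "mm n" "e n" d dm X c by blast
  have "(?H/M n)-lipschitz_on {?lo..?hi} (g2 x D (mm n) i)"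
  proof (rule lipschitz_onI)
   show "0 \<le> ?H/M n" using S.g2_bounds(1,2)[of A0 "A0 + 1" A0 i] A0 by linarith
   fix A B assume "A \<in> {?lo..?hi}" "B \<in> {?lo..?hi}"
   from sub[OF this(1)] sub[OF this(2)] show "dist (g2 x D (mm n) i A) (g2 x D (mm n) i B) \<le> ?H/M n*dist A B"
    using S.g2_bounds(3)[of A "A0 + 1" B i] by (simp add: dist_real_def)
  qed
  moreover have "(\<sigma> n)-lipschitz_on {?lo..?hi} (v n)"
   by (rule lipschitz_onI) (use elim(2) sub in \<open>auto simp: dist_real_def\<close>)
  ultimately show ?case by (auto intro: lipschitz_on_continuous_on)
 qed
 have wc: "EV n. continuous_on {?lo..?hi} (w n) \<and> (\<forall>A\<in>{?lo..?hi}. 0 < w n A)"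
  using ld
 proof eventually_elim
  case (elim n)
  have "continuous_on {?lo..?hi} (l \<beta> n)" using elim by (meson DERIV_isCont continuous_at_imp_continuous_on)
  moreover have "continuous_on {?lo..?hi} prior" by (rule continuous_on_subset[OF prior_cont]) (use lo in auto)
  ultimately have "continuous_on {?lo..?hi} (w n)" by (intro continuous_on_mult continuous_on_exp continuous_on_diff continuous_on_const)
  then show ?case using prior_pos[OF J0] by auto
 qed
 have s': "EV n. 0 \<le> \<sigma> n" using s by eventually_elim blast
 note cm = coverage_mean[where Y = "\<lambda>n. y \<beta> n i" and v = v and h = "\<lambda>n. g2 x D (mm n) i" and w = w and a = a and m = M and D = "D i" and z = z,
  OF lo Di aJ Minf h vl V s' s0 hc wc C']
 \<comment> \<open>\<open>cov\<close> written with the residual \<open>v n\<close> and with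
   \<open>delta\<close> unfolded, the form in which \<open>coverage_mean\<close> is stated; the two
   agree on the window.\<close>
 define cv where "cv n A = \<Phi> ((y \<beta> n i - D i/(a n + D i) * v n (a n) + z * sqrt (a n*D i/(a n + D i) + g2 x D (mm n) i (a n)) - (y \<beta> n i - D i/(A + D i) * v n A))/sqrt (A*D i/(A + D i) + g2 x D (mm n) i A))
  - \<Phi> ((y \<beta> n i - D i/(a n + D i) * v n (a n) - z * sqrt (a n*D i/(a n + D i) + g2 x D (mm n) i (a n)) - (y \<beta> n i - D i/(A + D i) * v n A))/sqrt (A*D i/(A + D i) + g2 x D (mm n) i A))" for n A
 have cv: "EV n. \<forall>A\<in>{?lo..?hi}. cov n A = cv n A"
  using theta_v aJ
 proof eventually_elim
  case (elim n)
  have t: "theta_tilde x D (mm n) i (y \<beta> n) B = y \<beta> n i - D i/(B + D i) * v n B" "delta x D (mm n) i B = sqrt (B*D i/(B + D i) + g2 x D (mm n) i B)" if "B \<in> {?lo..?hi}" for B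
   using elim(1) J0[OF that] by (auto simp: less_imp_le delta_def g1_def)
  show ?case unfolding cv_def by (intro ballI) (simp only: t t[OF elim(2)])
 qed
 have wcv: "EV n. wavg (w n) ?lo ?hi (cv n) = wavg (w n) ?lo ?hi (cov n)"
  using cv
 proof eventually_elim
  case (elim n)
  have "integral {?lo..?hi} (\<lambda>A. cv n A*w n A) = integral {?lo..?hi} (\<lambda>A. cov n A*w n A)"
   by (rule Henstock_Kurzweil_Integration.integral_cong) (simp only: bspec[OF elim])
  then show ?case unfolding wavg_def by (rule arg_cong)
 qed
 let ?\<gamma> = "\<lambda>n. D i/(a n*(a n + D i))"
 let ?mE1 = "\<lambda>n. M n*wavg (w n) ?lo ?hi (\<lambda>A. A - a n)" and ?mE2 = "\<lambda>n. M n*wavg (w n) ?lo ?hi (\<lambda>A. (A - a n)^2)"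
 let ?Z = "\<lambda>n. - ?\<gamma> n*?mE1 n + (?\<gamma> n/(a n + D i) + (3 - z^2)/4*(?\<gamma> n)^2 - ?\<gamma> n*(v n (a n)/(a n + D i))^2)*?mE2 n"
 have 1: "(\<lambda>n. M n*(wavg (w n) ?lo ?hi (cv n) - (1 - \<alpha>)) - std_normal_density z*z*?Z n) \<longlonglongrightarrow> 0"
  using cm unfolding z(2) cv_def .
 have 2: "(\<lambda>n. z*?Z n - M n*c_hat x D prior z (mm n) i (y \<beta> n) (ah n)) \<longlonglongrightarrow> 0"
  by (rule c_hat_expansion[OF m1 m2])
 have cc: "EV n. continuous_on {?lo..?hi} (cov n)"
  using cv hc h M_ge[of 1]
 proof eventually_elim
  case (elim n)
  have q: "0 < A*D i/(A + D i) + g2 x D (mm n) i A" if "A \<in> {?lo..?hi}" for A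
   using elim(3) J0[OF that] Di that by (intro add_pos_nonneg divide_pos_pos mult_pos_pos) (auto intro: add_pos_pos)
  have nz: "A + D i \<noteq> 0" if "A \<in> {?lo..?hi}" for A using J0[OF that] Di by simp
  have sc: "continuous_on UNIV \<Phi>" using \<Phi>_deriv DERIV_isCont continuous_at_imp_continuous_on by blast
  have c1: "continuous_on {?lo..?hi} (\<lambda>A. sqrt (A*D i/(A + D i) + g2 x D (mm n) i A))"
   by (intro continuous_on_real_sqrt continuous_on_add continuous_on_divide continuous_on_mult continuous_on_id continuous_on_const conjunct1[OF elim(2)]) (use nz in blast)
  have c2: "continuous_on {?lo..?hi} (\<lambda>A. y \<beta> n i - D i/(A + D i) * v n A)"
   by (intro continuous_on_diff continuous_on_add continuous_on_divide continuous_on_mult continuous_on_id continuous_on_const conjunct2[OF elim(2)]) (use nz in blast)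
  have sq: "\<forall>A\<in>{?lo..?hi}. sqrt (A*D i/(A + D i) + g2 x D (mm n) i A) \<noteq> 0" using q by force
  have "continuous_on {?lo..?hi} (cv n)" unfolding cv_def
   by (intro continuous_on_diff continuous_on_compose2[OF sc] subset_UNIV continuous_on_divide[OF continuous_on_diff[OF continuous_on_const c2] c1 sq])
  then show ?case by (rule continuous_on_eq) (simp only: bspec[OF elim(1)])
 qed
 have 3: "(\<lambda>n. M n*(post n - wavg (w n) ?lo ?hi (cov n))) \<longlonglongrightarrow> 0"
  by (rule posterior_localised[OF \<epsilon>(1,3) c' cc]) (use wc in \<open>auto elim: eventually_mono\<close>)
 have "(\<lambda>n. (M n*(post n - wavg (w n) ?lo ?hi (cov n))) + (M n*(wavg (w n) ?lo ?hi (cv n) - (1 - \<alpha>)) - std_normal_density z*z*?Z n) +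
   std_normal_density z*(z*?Z n - M n*c_hat x D prior z (mm n) i (y \<beta> n) (ah n))) \<longlonglongrightarrow> 0 + 0 + std_normal_density z*0"
  by (intro tendsto_add tendsto_mult tendsto_const 1 2 3)
 moreover have "EV n. (M n*(post n - wavg (w n) ?lo ?hi (cov n))) + (M n*(wavg (w n) ?lo ?hi (cv n) - (1 - \<alpha>)) - std_normal_density z*z*?Z n) +
   std_normal_density z*(z*?Z n - M n*c_hat x D prior z (mm n) i (y \<beta> n) (ah n)) =
   M n*(post n - (1 - \<alpha> + std_normal_density z*c_hat x D prior z (mm n) i (y \<beta> n) (ah n)))"
  using wcv
 proof eventually_elim
  case (elim n)
  have "m*(p - q) + (m*(q - r) - f*z*Z) + f*(z*Z - m*h) = m*(p - (r + f*h))" for m p q r f Z h :: real by (simp add: algebra_simps)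
  then show ?case unfolding elim by blast
 qed
 ultimately show ?thesis by (simp add: Lim_transform_eventually)
qed

end

section \<open>From sequences to convergence in probability\<close>

text \<open>In the hypothesis the covers may depend on \<open>\<delta>\<close>, in
  \<open>asymp_null\<close> they may not. For each \<open>m\<close> a cover whose measure is within
  \<open>1/real (Suc m)\<close> of the infimum serves all \<open>\<delta>\<close> at once.\<close>

lemma asymp_nullI:
 assumes sub: "\<And>m. E m \<subseteq> space M" and cover: "\<And>\<delta>. 0 < \<delta> \<Longrightarrow> EV m. \<exists>F\<in>sets M. E m \<subseteq> F \<and> measure M F \<le> \<delta>"
 shows "asymp_null M E"
proof -
 let ?C = "\<lambda>m. {F \<in> sets M. E m \<subseteq> F}"
 define r where "r m = (INF F\<in>?C m. measure M F)" for m
 have ne: "?C m \<noteq> {}" for m using sub[of m] by auto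
 have bd: "bdd_below (measure M ` ?C m)" for m by (rule bdd_belowI[of _ 0]) auto
 have "\<exists>F\<in>?C m. measure M F < r m + 1/real (Suc m)" for m
  using cInf_lessD[of "measure M ` ?C m" "r m + 1/real (Suc m)"] ne[of m] by (auto simp: r_def)
 then obtain F where F: "\<And>m. F m \<in> ?C m" "\<And>m. measure M (F m) < r m + 1/real (Suc m)" by metis
 have "(\<lambda>m. measure M (F m)) \<longlonglongrightarrow> 0"
 proof (rule tendstoI)
  fix \<delta> :: real assume \<delta>: "0 < \<delta>"
  have "EV m. 1/real (Suc m) < \<delta>/2"
   using order_tendstoD(2)[OF LIMSEQ_Suc[OF lim_1_over_n], of "\<delta>/2"] \<delta> by simp
  moreover have "EV m. \<exists>F\<in>sets M. E m \<subseteq> F \<and> measure M F \<le> \<delta>/2" by (rule cover) (use \<delta> in simp)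
  ultimately show "EV m. dist (measure M (F m)) 0 < \<delta>"
  proof eventually_elim
   case (elim m)
   then obtain G where G: "G \<in> ?C m" "measure M G \<le> \<delta>/2" by auto
   have "r m \<le> measure M G" unfolding r_def by (rule cINF_lower[OF bd G(1)])
   then show ?case using F(2)[of m] elim(1) G(2) by (simp add: dist_real_def)
  qed
 qed
 then show ?thesis unfolding asymp_null_def using F(1) by auto
qed

text \<open>
 A deterministic statement about all sequences of outcomes along which countably many statistics
 tend to 0 yields a statement in probability: otherwise a diagonal choice of bad outcomes would
 contradict it.
\<close>

lemma (in prob_space) small_op_of_sequences:
 fixes Z :: "'t \<Rightarrow> nat \<Rightarrow> 'a \<Rightarrow> real" and V :: "'a \<Rightarrow> real" and R :: "nat \<Rightarrow> 'a \<Rightarrow> real"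
 assumes T: "countable T" "T \<noteq> {}" and Z[measurable]: "\<And>t m. t \<in> T \<Longrightarrow> Z t m \<in> borel_measurable M" and V[measurable]: "V \<in> borel_measurable M"
  and Z0: "\<And>t \<eta>. t \<in> T \<Longrightarrow> 0 < \<eta> \<Longrightarrow> (\<lambda>m. prob {\<omega>\<in>space M. \<eta> \<le> \<bar>Z t m \<omega>\<bar>}) \<longlonglongrightarrow> 0"
  and V0: "\<And>\<delta>. 0 < \<delta> \<Longrightarrow> \<exists>K. prob {\<omega>\<in>space M. K \<le> \<bar>V \<omega>\<bar>} \<le> \<delta>"
  and R: "\<And>K mm om. filterlim mm at_top sequentially \<Longrightarrow> (\<And>n. om n \<in> space M) \<Longrightarrow> (\<And>t. t \<in> T \<Longrightarrow> (\<lambda>n. Z t (mm n) (om n)) \<longlonglongrightarrow> 0)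
   \<Longrightarrow> (\<And>n. \<bar>V (om n)\<bar> \<le> K) \<Longrightarrow> (\<lambda>n. real (mm n)*R (mm n) (om n)) \<longlonglongrightarrow> 0"
 shows "small_op M R (\<lambda>m. 1/real m)"
 unfolding small_op_def
proof (intro allI impI asymp_nullI)
 fix \<epsilon> \<delta> :: real assume \<epsilon>: "0 < \<epsilon>" and \<delta>: "0 < \<delta>"
 let ?t = "from_nat_into T"
 have tT: "?t n \<in> T" for n by (rule from_nat_into[OF T(2)])
 obtain K where K: "prob {\<omega>\<in>space M. K \<le> \<bar>V \<omega>\<bar>} \<le> \<delta>/2" using V0[of "\<delta>/2"] \<delta> by auto
 \<comment> \<open>Otherwise each \<open>n\<close> has an outcome \<open>om n\<close>, at a sample
   size \<open>mm n \<ge> n\<close>, that is bad although the statistics number 0 to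
   \<open>n\<close> are below \<open>1/real (Suc n)\<close>. Along this sequence every statistic
   tends to 0, which contradicts \<open>R\<close>. The value of \<open>V\<close> is kept below a
   fixed \<open>K\<close> because \<open>V\<close> is only tight and does not tend to 0.\<close>
 have "\<exists>n. \<forall>m\<ge>n. \<forall>\<omega>\<in>space M. \<epsilon>*(1/real m) < \<bar>R m \<omega>\<bar> \<longrightarrow> \<bar>V \<omega>\<bar> \<le> K \<longrightarrow> (\<exists>k\<le>n. 1/real (Suc n) \<le> \<bar>Z (?t k) m \<omega>\<bar>)"
 proof (rule ccontr)
  assume "\<not> ?thesis"
  then have "\<forall>n. \<exists>m \<omega>. n \<le> m \<and> \<omega> \<in> space M \<and> \<epsilon>*(1/real m) < \<bar>R m \<omega>\<bar> \<and> \<bar>V \<omega>\<bar> \<le> K \<and> \<not> (\<exists>k\<le>n. 1/real (Suc n) \<le> \<bar>Z (?t k) m \<omega>\<bar>)"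
   by blast
  then obtain mm om where mo: "\<And>n. n \<le> mm n" "\<And>n. om n \<in> space M" "\<And>n. \<epsilon>*(1/real (mm n)) < \<bar>R (mm n) (om n)\<bar>" "\<And>n. \<bar>V (om n)\<bar> \<le> K"
    "\<And>n. \<not> (\<exists>k\<le>n. 1/real (Suc n) \<le> \<bar>Z (?t k) (mm n) (om n)\<bar>)" by metis
  have mi: "filterlim mm at_top sequentially"
   by (rule filterlim_at_top_mono[OF filterlim_ident]) (use mo(1) in simp)
  have "(\<lambda>n. real (mm n)*R (mm n) (om n)) \<longlonglongrightarrow> 0"
  proof (rule R[OF mi mo(2) _ mo(4)])
   fix t assume "t \<in> T"
   then obtain k where k: "t = ?t k" using from_nat_into_surj[OF T(1)] by metis
   show "(\<lambda>n. Z t (mm n) (om n)) \<longlonglongrightarrow> 0"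
   proof (rule Lim_null_comparison[OF _ LIMSEQ_Suc[OF lim_1_over_n]])
    show "EV n. norm (Z t (mm n) (om n)) \<le> 1/real (Suc n)"
     using eventually_ge_at_top[of k]
    proof eventually_elim
     case (elim n)
     then have "\<not> 1/real (Suc n) \<le> \<bar>Z t (mm n) (om n)\<bar>" using mo(5)[of n] k by blast
     then show ?case unfolding real_norm_def not_le by (rule less_imp_le)
    qed
   qed
  qed
  from tendstoD[OF this \<epsilon>] have "EV n. \<bar>real (mm n)*R (mm n) (om n)\<bar> < \<epsilon>" by simp
  with eventually_gt_at_top[of 0] have "EV n. False"
  proof eventually_elim
   case (elim n)
   then have "0 < mm n" using mo(1)[of n] by linarith
   then show False using mo(3)[of n] elim by (simp add: abs_mult pos_divide_less_eq mult.commute)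
  qed
  then show False by simp
 qed
 then obtain n where n: "\<And>m \<omega>. n \<le> m \<Longrightarrow> \<omega> \<in> space M \<Longrightarrow> \<epsilon>*(1/real m) < \<bar>R m \<omega>\<bar> \<Longrightarrow> \<bar>V \<omega>\<bar> \<le> K \<Longrightarrow> \<exists>k\<le>n. 1/real (Suc n) \<le> \<bar>Z (?t k) m \<omega>\<bar>" by blast
 let ?G = "\<lambda>m k. {\<omega>\<in>space M. 1/real (Suc n) \<le> \<bar>Z (?t k) m \<omega>\<bar>}"
 have "(\<lambda>m. \<Sum>k\<le>n. prob (?G m k)) \<longlonglongrightarrow> (\<Sum>k\<le>n. 0)" by (intro tendsto_sum Z0 tT) simp
 then have "EV m. (\<Sum>k\<le>n. prob (?G m k)) < \<delta>/2" by (intro order_tendstoD(2)) (use \<delta> in auto)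
 with eventually_ge_at_top[of n]
 show "EV m. \<exists>F\<in>events. {\<omega> \<in> space M. \<epsilon>*(1/real m) < \<bar>R m \<omega>\<bar>} \<subseteq> F \<and> prob F \<le> \<delta>"
 proof eventually_elim
  case (elim m)
  have Gm: "?G m k \<in> events" for k using Z[OF tT] by measurable
  let ?F = "(\<Union>k\<le>n. ?G m k) \<union> {\<omega>\<in>space M. K \<le> \<bar>V \<omega>\<bar>}"
  have "prob ?F \<le> prob (\<Union>k\<le>n. ?G m k) + prob {\<omega>\<in>space M. K \<le> \<bar>V \<omega>\<bar>}" using Gm by (intro measure_Un_le) auto
  also have "prob (\<Union>k\<le>n. ?G m k) \<le> (\<Sum>k\<le>n. prob (?G m k))" using Gm by (intro measure_UNION_le) auto
  finally have "prob ?F \<le> \<delta>" using elim K by linarith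
  moreover have "?F \<in> events" using Gm by auto
  moreover have "{\<omega> \<in> space M. \<epsilon>*(1/real m) < \<bar>R m \<omega>\<bar>} \<subseteq> ?F"
  proof
   fix \<omega> assume w: "\<omega> \<in> {\<omega> \<in> space M. \<epsilon>*(1/real m) < \<bar>R m \<omega>\<bar>}"
   show "\<omega> \<in> ?F"
   proof (cases "\<bar>V \<omega>\<bar> \<le> K")
    case True then show ?thesis using n[OF elim(1), of \<omega>] w by auto
   qed (use w in auto)
  qed
  ultimately show ?case by blast
 qed
qed auto

section \<open>Second moments and Chebyshev bounds for the normal errors\<close>

lemma (in prob_space) sum_second_moment:
 assumes ind: "indep_vars (\<lambda>_. borel) G (UNIV :: nat set)" and i1: "\<And>j. integrable M (G j)" and m0: "\<And>j. expectation (G j) = 0"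
  and i2: "\<And>j. integrable M (\<lambda>\<omega>. (G j \<omega>)^2)" and b: "\<And>j. expectation (\<lambda>\<omega>. (G j \<omega>)^2) \<le> C" and c: "\<And>j. \<bar>c j\<bar> \<le> c0"
 shows "integrable M (\<lambda>\<omega>. (\<Sum>j<m. c j*G j \<omega>)^2)" "expectation (\<lambda>\<omega>. (\<Sum>j<m. c j*G j \<omega>)^2) \<le> real m*(c0^2*C)"
proof -
 have cross: "integrable M (\<lambda>\<omega>. G j \<omega>*G k \<omega>) \<and> expectation (\<lambda>\<omega>. G j \<omega>*G k \<omega>) = 0" if "j \<noteq> k" for j k
 proof -
  have s: "indep_vars (\<lambda>_. borel) G {j, k}" by (rule indep_vars_subset[OF ind]) simp
  have "integrable M (\<lambda>\<omega>. \<Prod>i\<in>{j,k}. G i \<omega>)" by (rule indep_vars_integrable[OF _ s i1]) simp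
  moreover have "expectation (\<lambda>\<omega>. \<Prod>i\<in>{j,k}. G i \<omega>) = (\<Prod>i\<in>{j,k}. expectation (G i))" by (rule indep_vars_lebesgue_integral[OF _ s i1]) simp
  ultimately show ?thesis using that m0 by simp
 qed
 have sq: "(\<Sum>j<m. c j*G j \<omega>)^2 = (\<Sum>j<m. \<Sum>k<m. c j*c k*(G j \<omega>*G k \<omega>))" for \<omega>
  by (simp add: power2_eq_square sum_product mult_ac)
 have int: "integrable M (\<lambda>\<omega>. G j \<omega>*G k \<omega>)" for j k
  using cross[of j k] i2[of j] by (cases "j = k") (auto simp: power2_eq_square)
 show "integrable M (\<lambda>\<omega>. (\<Sum>j<m. c j*G j \<omega>)^2)" unfolding sq by (intro Bochner_Integration.integrable_sum integrable_mult_right int)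
 have "expectation (\<lambda>\<omega>. (\<Sum>j<m. c j*G j \<omega>)^2) = (\<Sum>j<m. \<Sum>k<m. c j*c k*expectation (\<lambda>\<omega>. G j \<omega>*G k \<omega>))"
  unfolding sq by (simp add: Bochner_Integration.integral_sum int integrable_mult_right Bochner_Integration.integrable_sum)
 also have "\<dots> = (\<Sum>j<m. (c j)^2*expectation (\<lambda>\<omega>. (G j \<omega>)^2))"
 proof (intro sum.cong refl)
  fix j assume j: "j \<in> {..<m}"
  have "(\<Sum>k<m. c j*c k*expectation (\<lambda>\<omega>. G j \<omega>*G k \<omega>)) = (\<Sum>k<m. if k = j then (c j)^2*expectation (\<lambda>\<omega>. (G j \<omega>)^2) else 0)"
   using cross[of j] by (intro sum.cong) (auto simp: power2_eq_square)
  then show "(\<Sum>k<m. c j*c k*expectation (\<lambda>\<omega>. G j \<omega>*G k \<omega>)) = (c j)^2*expectation (\<lambda>\<omega>. (G j \<omega>)^2)" using j by simp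
 qed
 also have "\<dots> \<le> (\<Sum>j<m. c0^2*C)"
 proof (intro sum_mono mult_mono b)
  fix j show "(c j)^2 \<le> c0^2" using c[of j] abs_le_square_iff[of "c j" c0] by linarith
 qed (auto intro!: integral_nonneg_AE)
 finally show "expectation (\<lambda>\<omega>. (\<Sum>j<m. c j*G j \<omega>)^2) \<le> real m*(c0^2*C)" by simp
qed

text \<open>The second moment of the sum is of order \<open>m\<close>; divided by the square of
  \<open>m powr (3/4)\<close> it leaves \<open>m powr (- 1/2)\<close>.\<close>

lemma (in prob_space) weighted_average_null:
 assumes ind: "indep_vars (\<lambda>_. borel) G (UNIV :: nat set)" and i1: "\<And>j. integrable M (G j)" and m0: "\<And>j. expectation (G j) = 0"
  and i2: "\<And>j. integrable M (\<lambda>\<omega>. (G j \<omega>)^2)" and b: "\<And>j. expectation (\<lambda>\<omega>. (G j \<omega>)^2) \<le> C" and c: "\<And>j. \<bar>c j\<bar> \<le> c0" and \<eta>: "0 < \<eta>"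
 shows "(\<lambda>m. prob {\<omega>\<in>space M. \<eta> \<le> \<bar>(\<Sum>j<m. c j*G j \<omega>)/real m powr (3/4)\<bar>}) \<longlonglongrightarrow> 0"
proof (rule Lim_null_comparison)
 let ?B = "c0^2*C/\<eta>^2"
 have "((\<lambda>r::real. ?B*r powr (- 1/2)) \<longlongrightarrow> ?B*0) at_top" by (intro tendsto_mult tendsto_const) real_asymp
 from filterlim_compose[OF this filterlim_real_sequentially] show "(\<lambda>m. ?B*real m powr (- 1/2)) \<longlonglongrightarrow> 0" by simp
 show "EV m. norm (prob {\<omega>\<in>space M. \<eta> \<le> \<bar>(\<Sum>j<m. c j*G j \<omega>)/real m powr (3/4)\<bar>}) \<le> ?B*real m powr (- 1/2)"
  using eventually_gt_at_top[of 0]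
 proof eventually_elim
  case (elim m)
  have p: "0 < real m powr (3/4)" using elim by simp
  have eq: "{\<omega>\<in>space M. \<eta> \<le> \<bar>(\<Sum>j<m. c j*G j \<omega>)/real m powr (3/4)\<bar>} = {\<omega>\<in>space M. \<bar>\<Sum>j<m. c j*G j \<omega>\<bar> \<ge> \<eta>*real m powr (3/4)}"
   using p by (auto simp: abs_divide pos_le_divide_eq)
  have "prob {\<omega>\<in>space M. \<bar>\<Sum>j<m. c j*G j \<omega>\<bar> \<ge> \<eta>*real m powr (3/4)} \<le> expectation (\<lambda>\<omega>. (\<Sum>j<m. c j*G j \<omega>)^2)/(\<eta>*real m powr (3/4))^2"
   by (rule second_moment_method) (use i1 p \<eta> sum_second_moment(1)[OF ind i1 m0 i2 b c] in auto)
  also have "\<dots> \<le> real m*(c0^2*C)/(\<eta>*real m powr (3/4))^2"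
   by (intro divide_right_mono sum_second_moment(2)[OF ind i1 m0 i2 b c]) simp
  also have "\<dots> = ?B*real m powr (- 1/2)"
  proof -
   have "real m powr (3/4)*real m powr (3/4) = real m*real m powr (1/2)" using elim by (simp add: powr_add[symmetric] powr_mult_base)
   moreover have "real m powr (- 1/2) = 1/real m powr (1/2)" using powr_minus_divide[of "real m" "1/2"] by simp
   moreover have "r*Q/(h*w)^2 = Q/h^2 * v" if "w*w = r * s" "v = 1/s" "0 < r" for r Q h w v s :: real

   proof -
    have e: "(h*w)^2 = h^2*(r * s)" using that(1) by (simp add: power_mult_distrib power2_eq_square)
    show ?thesis unfolding e that(2) using that(3) by simp
   qed
   ultimately show ?thesis using elim by (metis of_nat_0_less_iff)
  qed
  finally show ?case unfolding eq by simp
 qed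
qed

lemma (in prob_space) normal_centred_moments:
 assumes Y: "distributed M lborel Y (\<lambda>u. ennreal (normal_density \<mu> \<sigma> u))" and \<sigma>: "0 < \<sigma>"
 defines "e \<equiv> \<lambda>\<omega>. Y \<omega> - \<mu>"
 shows "integrable M e" "expectation e = 0" "integrable M (\<lambda>\<omega>. (e \<omega>)^2)" "expectation (\<lambda>\<omega>. (e \<omega>)^2) = \<sigma>^2"
  "integrable M (\<lambda>\<omega>. ((e \<omega>)^2 - \<sigma>^2)^2)" "expectation (\<lambda>\<omega>. ((e \<omega>)^2 - \<sigma>^2)^2) = 2*\<sigma>^4" "integrable M (\<lambda>\<omega>. (e \<omega>)^2 - \<sigma>^2)" "expectation (\<lambda>\<omega>. (e \<omega>)^2 - \<sigma>^2) = 0"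
proof -
 have tr: "integrable M (\<lambda>\<omega>. (e \<omega>)^k) \<and> expectation (\<lambda>\<omega>. (e \<omega>)^k) = r" if "has_bochner_integral lborel (\<lambda>x. normal_density \<mu> \<sigma> x*(x - \<mu>)^k) r" for k r
 proof -
  have i: "integrable lborel (\<lambda>x. normal_density \<mu> \<sigma> x*(x - \<mu>)^k)" "(\<integral>x. normal_density \<mu> \<sigma> x*(x - \<mu>)^k \<partial>lborel) = r"
   using that by (auto simp: has_bochner_integral_iff)
  have "integrable M (\<lambda>\<omega>. (Y \<omega> - \<mu>)^k)" using i(1) distributed_integrable[OF Y, of "\<lambda>x. (x - \<mu>)^k"] by simp
  moreover have "expectation (\<lambda>\<omega>. (Y \<omega> - \<mu>)^k) = r" using i(2) distributed_integral[OF Y, of "\<lambda>x. (x - \<mu>)^k"] by simp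
  ultimately show ?thesis by (simp add: e_def)
 qed
 have 1: "integrable M (\<lambda>\<omega>. (e \<omega>)^1) \<and> expectation (\<lambda>\<omega>. (e \<omega>)^1) = 0" using tr[of "2*0 + 1"] normal_moment_odd[OF \<sigma>, of \<mu> 0] by simp
 then show "integrable M e" "expectation e = 0" by simp_all
 have 2: "integrable M (\<lambda>\<omega>. (e \<omega>)^2) \<and> expectation (\<lambda>\<omega>. (e \<omega>)^2) = \<sigma>^2" using tr[of "2*1"] normal_moment_even[OF \<sigma>, of \<mu> 1] by (simp add: power2_eq_square)
 then show i2: "integrable M (\<lambda>\<omega>. (e \<omega>)^2)" and e2: "expectation (\<lambda>\<omega>. (e \<omega>)^2) = \<sigma>^2" by simp_all
 have 4: "integrable M (\<lambda>\<omega>. (e \<omega>)^4) \<and> expectation (\<lambda>\<omega>. (e \<omega>)^4) = 3*\<sigma>^4" using tr[of "2*2"] normal_moment_even[OF \<sigma>, of \<mu> 2]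
  by (simp add: fact_numeral power_divide power_mult[symmetric])
 have sq: "((e \<omega>)^2 - \<sigma>^2)^2 = (e \<omega>)^4 - 2*\<sigma>^2*(e \<omega>)^2 + \<sigma>^4" for \<omega> by (simp add: power2_eq_square power4_eq_xxxx algebra_simps)
 show "integrable M (\<lambda>\<omega>. ((e \<omega>)^2 - \<sigma>^2)^2)" unfolding sq using 4 i2 by simp
 have "expectation (\<lambda>\<omega>. ((e \<omega>)^2 - \<sigma>^2)^2) = 3*\<sigma>^4 - 2*\<sigma>^2*\<sigma>^2 + \<sigma>^4" unfolding sq using 4 i2 e2 by (simp add: prob_space)
 then show "expectation (\<lambda>\<omega>. ((e \<omega>)^2 - \<sigma>^2)^2) = 2*\<sigma>^4" by (simp add: power2_eq_square power4_eq_xxxx)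
 show "integrable M (\<lambda>\<omega>. (e \<omega>)^2 - \<sigma>^2)" using i2 by simp
 show "expectation (\<lambda>\<omega>. (e \<omega>)^2 - \<sigma>^2) = 0" using i2 e2 by (simp add: prob_space)
qed

text \<open>Integrating theta out of a pair leaves the first factor of
  \<open>normal_density_product\<close>.\<close>

lemma model_M1_marginal:
 assumes "model_M1 M \<Theta> Y x D \<beta> A" and A: "0 < A" and D: "\<And>j. 0 < D j"
 shows "prob_space.indep_vars M (\<lambda>_. borel) Y UNIV" "distributed M lborel (Y j) (\<lambda>u. ennreal (normal_density (x j \<bullet> \<beta>) (sqrt (A + D j)) u))"
proof -
 interpret prob_space M using assms(1) by (simp add: model_M1_def)
 have i: "indep_vars (\<lambda>_. borel \<Otimes>\<^sub>M borel) (\<lambda>j \<omega>. (\<Theta> j \<omega>, Y j \<omega>)) UNIV"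
  and d: "distributed M (lborel \<Otimes>\<^sub>M lborel) (\<lambda>\<omega>. (\<Theta> j \<omega>, Y j \<omega>)) (\<lambda>(t, u). ennreal (normal_density (x j \<bullet> \<beta>) (sqrt A) t*normal_density t (sqrt (D j)) u))"
  using assms(1) by (auto simp: model_M1_def)
 have "indep_vars (\<lambda>_. borel) (\<lambda>j \<omega>. snd (\<Theta> j \<omega>, Y j \<omega>)) UNIV" by (rule indep_vars_compose2[OF i]) simp
 then show "indep_vars (\<lambda>_. borel) Y UNIV" by simp
 have "distributed M lborel (Y j) (\<lambda>u. \<integral>\<^sup>+t. (case (t, u) of (t, u) \<Rightarrow> ennreal (normal_density (x j \<bullet> \<beta>) (sqrt A) t*normal_density t (sqrt (D j)) u)) \<partial>lborel)"
  by (rule distr_marginal2[OF _ _ d]) unfold_locales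
 moreover have "(\<integral>\<^sup>+t. ennreal (normal_density (x j \<bullet> \<beta>) (sqrt A) t*normal_density t (sqrt (D j)) u) \<partial>lborel) = ennreal (normal_density (x j \<bullet> \<beta>) (sqrt (A + D j)) u)" for u
 proof -
  let ?N = "normal_density ((1 - D j/(A + D j))*u + D j/(A + D j)*(x j \<bullet> \<beta>)) (sqrt (A*D j/(A + D j)))"
  have "(\<integral>\<^sup>+t. ennreal (normal_density (x j \<bullet> \<beta>) (sqrt A) t*normal_density t (sqrt (D j)) u) \<partial>lborel) = (\<integral>\<^sup>+t. ennreal (normal_density (x j \<bullet> \<beta>) (sqrt (A + D j)) u)*ennreal (?N t) \<partial>lborel)"
   using normal_density_product[OF A D[of j], of _ u "x j \<bullet> \<beta>"] by (intro nn_integral_cong) (simp add: mult.commute ennreal_mult)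
  also have "\<dots> = ennreal (normal_density (x j \<bullet> \<beta>) (sqrt (A + D j)) u)*1"
   using A D[of j] by (subst nn_integral_cmult) (auto simp: nn_integral_normal_density)
  finally show ?thesis by simp
 qed
 ultimately show "distributed M lborel (Y j) (\<lambda>u. ennreal (normal_density (x j \<bullet> \<beta>) (sqrt (A + D j)) u))" by simp
qed

text \<open>Cauchy-Schwarz bounds \<open>(x j \<bullet> v)^2\<close> by the leverage of area
  \<open>j\<close> times the full sum of squares, and the leverages are at most
  \<open>C/real m\<close>. Summed over a fixed number \<open>m0\<close> of areas of full rank, the
  left side is at least a multiple of the squared norm of \<open>v\<close>, so the full sum is at
  least a multiple of \<open>m\<close> times it.\<close>

lemma gram_lower_bound:
 fixes x :: "nat \<Rightarrow> real^'p::finite"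
 assumes R3: "EV m. dim (x ` {..<m}) = CARD('p)" and R4: "(\<lambda>m. SUP j\<in>{..<m}. lev x m j) \<in> O(\<lambda>m. 1/real m)"
 obtains c where "0 < c" "EV m. \<forall>v. c*real m*(norm v)^2 \<le> (\<Sum>j<m. (x j \<bullet> v)^2)"
proof -
 obtain m0 where m0: "dim (x ` {..<m0}) = CARD('p)" using eventually_happens[OF R3] by auto
 have m00: "0 < m0"
 proof (rule ccontr)
  assume "\<not> 0 < m0" then show False using m0 by simp
 qed
 let ?q = "\<lambda>v. \<Sum>j<m0. (x j \<bullet> v)^2"
 \<comment> \<open>The minimum over the unit sphere of the quadratic form of the first
   \<open>m0\<close> areas; by full rank it is positive, and it serves as coercivity
   constant.\<close>
 obtain v0 :: "real^'p" where v0: "norm v0 = 1" "\<And>v. norm v = 1 \<Longrightarrow> ?q v0 \<le> ?q v"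
 proof -
  have ne: "sphere (0::real^'p) 1 \<noteq> {}" by simp
  have "continuous_on (sphere 0 1) ?q" by (intro continuous_intros)
  from continuous_attains_inf[OF compact_sphere ne this] show ?thesis using that by auto
 qed
 have c0: "0 < ?q v0"
 proof -
  have "v0 \<noteq> 0" using v0 by auto
  then obtain j where "j < m0" "x j \<bullet> v0 \<noteq> 0" using full_rank_inner_zero[OF m0] by blast
  then show ?thesis by (intro sum_pos2[of _ j]) auto
 qed
 have low: "?q v0*(norm v)^2 \<le> ?q v" for v
 proof (cases "v = 0")
  case False
  have "?q v0 \<le> ?q (v /\<^sub>R norm v)" by (rule v0(2)) (use False in simp)
  also have "\<dots> = ?q v/(norm v)^2" by (simp add: power_mult_distrib sum_divide_distrib divide_inverse power_inverse mult.commute sum_distrib_left)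
  finally show ?thesis using False by (simp add: pos_le_divide_eq)
 qed simp
 obtain C where C: "0 < C" "EV m. norm (SUP j\<in>{..<m}. lev x m j) \<le> C*norm (1/real m)" using R4 by (elim landau_o.bigE)
 have "EV m. \<forall>v. ?q v0/(C*real m0)*real m*(norm v)^2 \<le> (\<Sum>j<m. (x j \<bullet> v)^2)"
  using R3 C(2) eventually_ge_at_top[of m0]
 proof eventually_elim
  case (elim m)
  have mp: "0 < real m" using elim m00 by simp
  have quad: "w \<bullet> (XtX x m *v v) = (\<Sum>k<m. (x k \<bullet> w)*(x k \<bullet> v))" for w v
   unfolding XtX_eq_wgram wgram_mult inner_sum_right by (intro sum.cong) (auto simp: inner_commute mult.commute)
  have inv: "XtX x m *v (matrix_inv (XtX x m) *v u) = u" for u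
   by (rule pos_def_invertible(1)) (unfold XtX_eq_wgram, rule wgram_pos_def[OF elim(1)], auto)
  show ?case
  proof
   fix v
   let ?S = "\<Sum>k<m. (x k \<bullet> v)^2"
   have "(x j \<bullet> v)^2 \<le> C/real m*?S" if j: "j < m" for j
   proof -
    let ?w = "matrix_inv (XtX x m) *v x j"
    have "x j \<bullet> v = v \<bullet> (XtX x m *v ?w)" unfolding inv by (simp add: inner_commute)
    also have "\<dots> = (\<Sum>k<m. (x k \<bullet> v)*(x k \<bullet> ?w))" by (rule quad)
    finally have "(x j \<bullet> v)^2 \<le> ?S*(\<Sum>k<m. (x k \<bullet> ?w)^2)" using Cauchy_Schwarz_ineq_sum[of "\<lambda>k. x k \<bullet> v" "\<lambda>k. x k \<bullet> ?w" "{..<m}"] by simp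
    also have "(\<Sum>k<m. (x k \<bullet> ?w)^2) = lev x m j" using quad[of ?w ?w] unfolding inv lev_def by (simp add: power2_eq_square inner_commute)
    finally have 1: "(x j \<bullet> v)^2 \<le> ?S*lev x m j" .
    have "lev x m j \<le> C/real m"
    proof -
     have "lev x m j \<le> (SUP j\<in>{..<m}. lev x m j)" by (rule cSUP_upper) (use j in auto)
     then show ?thesis using elim(2) mp by simp
    qed
    then have "?S*lev x m j \<le> ?S*(C/real m)" by (rule mult_left_mono) (simp add: sum_nonneg)
    then show ?thesis using 1 by (simp add: mult.commute)
   qed
   then have "?q v \<le> (\<Sum>j<m0. C/real m*?S)" using elim(3) by (intro sum_mono) auto
   then have "?q v0*(norm v)^2 \<le> real m0*(C/real m*?S)" using low[of v] by simp
   moreover have "q/(C*k)*r*n \<le> S" if "q*n \<le> k*(C/r*S)" "0 < C" "0 < k" "0 < r" for q k r n S :: real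
    using that by (simp add: field_simps)
   ultimately show "?q v0/(C*real m0)*real m*(norm v)^2 \<le> ?S" using C(1) m00 mp by (metis of_nat_0_less_iff)
  qed
 qed
 then show ?thesis using that[of "?q v0/(C*real m0)"] c0 C(1) m00 by simp
qed

theorem theorem1:
  fixes M :: "'w measure"
    and \<Theta> Y :: "nat \<Rightarrow> 'w \<Rightarrow> real"
    and x :: "nat \<Rightarrow> real ^ 'p::finite"
    and D :: "nat \<Rightarrow> real"
    and \<beta>0 :: "real ^ 'p" and A0 :: real
    and prior :: "real \<Rightarrow> real"
    and \<alpha> z :: real
    and i :: nat
    and A_hat A_tilde :: "nat \<Rightarrow> (nat \<Rightarrow> real) \<Rightarrow> real"
    and C lam :: real
  assumes M1: "model_M1 M \<Theta> Y x D \<beta>0 A0" and A0: "0 < A0"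
    and D_pos: "\<And>j. 0 < D j"
    and alpha: "0 < \<alpha>" "\<alpha> < 1"
    and z: "measure (density lborel std_normal_density) {z<..} = \<alpha> / 2"
    and prior_pos: "\<And>a. 0 < a \<Longrightarrow> 0 < prior a"
    and prior_C1: "Ck_on 1 prior {0<..}"
    and proper: "\<forall>\<^sub>F m in sequentially. \<forall>y. posterior_proper x D prior m y"
    and REML: "\<forall>\<^sub>F m in sequentially. \<forall>y. is_REML x D m y (A_hat m y)"
    and AML: "\<forall>\<^sub>F m in sequentially. \<forall>y. is_AML x D z m i y (A_tilde m y)"
    and R1_smooth: "Ck_on 4 (\<lambda>a. ln (h_adj D z i a)) {0<..}"
      "\<forall>\<^sub>F m in sequentially. Ck_on 4 (\<lambda>a. ln (h_YL x D z m i a)) {0<..}"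
    and R1_bounded:
      "\<And>k a. k \<le> 3 \<Longrightarrow> 0 < a \<Longrightarrow> (\<lambda>m. (deriv ^^ k) (\<lambda>a. ln (h_adj D z i a)) a) \<in> O(\<lambda>m::nat. 1)"
      "\<And>k a. k \<le> 3 \<Longrightarrow> 0 < a \<Longrightarrow> (\<lambda>m. (deriv ^^ k) (\<lambda>a. ln (h_YL x D z m i a)) a) \<in> O(\<lambda>m. 1)"
    and R2: "0 < C" "0 < lam"
      "asymp_null M (\<lambda>m. {\<omega> \<in> space M. \<not> \<bar>A_tilde m (\<lambda>j. Y j \<omega>)\<bar> < C * real m powr lam})"
    and R3: "\<forall>\<^sub>F m in sequentially. dim (x ` {..<m}) = CARD('p)"
    and R4: "\<exists>K. \<forall>j k. \<bar>x j $ k\<bar> \<le> K"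
      "(\<lambda>m. SUP j\<in>{..<m}. lev x m j) \<in> O(\<lambda>m. 1 / real m)"
    and R5: "0 < (INF j. D j)" "bdd_above (range D)"
  shows "small_op M
    (\<lambda>m \<omega>. let y = (\<lambda>j. Y j \<omega>) in
       posterior_prob x D prior m y i (interval_N x D z m i y (A_tilde m y)) -
       (1 - \<alpha> + std_normal_density z * c_hat x D prior z m i y (A_hat m y)))
    (\<lambda>m. 1 / real m)"
proof -
 have pM: "prob_space M" using M1 by (simp add: model_M1_def)
 interpret prob_space M by (rule pM)
 define d where "d = (INF j. D j)"
 define dm where "dm = (SUP j. D j)"
 have d0: "0 < d" using R5(1) by (simp add: d_def)
 have Dlo: "d \<le> D j" for j unfolding d_def by (rule cINF_lower) (use D_pos in \<open>auto intro!: bdd_belowI[of _ 0] less_imp_le\<close>)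
 have Dhi: "D j \<le> dm" for j unfolding dm_def by (rule cSUP_upper) (use R5(2) in auto)
 obtain Kx where Kx: "\<And>j k. \<bar>x j $ k\<bar> \<le> Kx" using R4(1) by blast
 define X where "X = real CARD('p)*Kx"
 have X: "norm (x j) \<le> X" for j
 proof -
  have "norm (x j) \<le> (\<Sum>k\<in>UNIV. \<bar>x j $ k\<bar>)" by (rule norm_le_l1_cart)
  also have "\<dots> \<le> (\<Sum>k\<in>(UNIV::'p set). Kx)" by (intro sum_mono Kx)
  finally show ?thesis by (simp add: X_def)
 qed
 have Kx0: "0 \<le> Kx" using order_trans[OF abs_ge_zero Kx] .
 obtain cg where cg: "0 < cg" "EV m. \<forall>v. cg*real m*(norm v)^2 \<le> (\<Sum>j<m. (x j \<bullet> v)^2)"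
  by (rule gram_lower_bound[OF R3 R4(2)])
 note quant = normal_quantile[OF z alpha]
 \<comment> \<open>The countably many arguments at which \<open>regression_sequence\<close> asks for
   the averages to be controlled.\<close>
 define Q where "Q = insert A0 (of_rat ` {0..})"
 have Q0: "0 \<le> q" if "q \<in> Q" for q using that A0 by (auto simp: Q_def)
 define e where "e j \<omega> = Y j \<omega> - x j \<bullet> \<beta>0" for j \<omega>
 \<comment> \<open>\<open>None\<close> selects the centred squares, \<open>Some l\<close> the errors
   themselves, which \<open>cw\<close> weights with coordinate \<open>l\<close> of \<open>x\<close>;
   one family of statistics thus covers both kinds of averages.\<close>
 define G where "G s j \<omega> = (if s = None then (e j \<omega>)^2 - (A0 + D j) else e j \<omega>)" for s :: "'p option" and j \<omega>
 define cw where "cw q k s j = (case s of None \<Rightarrow> 1 | Some l \<Rightarrow> x j $ l)/(q + D j)^k" for q :: real and k :: nat and s j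
 define Z where "Z t m \<omega> = (case t of (q, k, s) \<Rightarrow> (\<Sum>j<m. cw q k s j*G s j \<omega>)/real m powr (3/4))" for t m \<omega>
 define T where "T = Q \<times> {..4::nat} \<times> (UNIV :: 'p option set)"
 note marg = model_M1_marginal[OF M1 A0 D_pos]
 have sp: "0 < sqrt (A0 + D j)" "(sqrt (A0 + D j))^2 = A0 + D j" for j using A0 D_pos[of j] by auto
 note mo = normal_centred_moments[OF marg(2) sp(1), folded e_def, unfolded sp(2)]
 have Ym[measurable]: "Y j \<in> borel_measurable M" for j using distributed_measurable[OF marg(2)] by simp
 have em[measurable]: "e j \<in> borel_measurable M" for j unfolding e_def by measurable
 have Gm[measurable]: "G s j \<in> borel_measurable M" for s j unfolding G_def by measurable
 have Gind: "indep_vars (\<lambda>_. borel) (G s) UNIV" for s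
 proof -
  have "indep_vars (\<lambda>_. borel) (\<lambda>j \<omega>. (\<lambda>u. if s = None then (u - x j \<bullet> \<beta>0)^2 - (A0 + D j) else u - x j \<bullet> \<beta>0) (Y j \<omega>)) UNIV"
   by (rule indep_vars_compose2[OF marg(1)]) measurable
  moreover have "G s = (\<lambda>j \<omega>. if s = None then (Y j \<omega> - x j \<bullet> \<beta>0)^2 - (A0 + D j) else Y j \<omega> - x j \<bullet> \<beta>0)"
   by (cases s) (auto simp: G_def e_def fun_eq_iff)
  ultimately show ?thesis by simp
 qed
 have GN: "G None j = (\<lambda>\<omega>. (e j \<omega>)^2 - (A0 + D j))" and GS: "G (Some l) j = e j" for j l
  by (simp_all add: G_def fun_eq_iff)
 \<comment> \<open>The variance of a centred square is \<open>2*(A0 + D j)^2\<close> and that of an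
   error is \<open>A0 + D j\<close>; \<open>CG\<close> bounds both.\<close>
 define CG where "CG = max (A0 + dm) (2*(A0 + dm)^2)"
 have Gmom: "integrable M (G s j) \<and> expectation (G s j) = 0 \<and> integrable M (\<lambda>\<omega>. (G s j \<omega>)^2) \<and> expectation (\<lambda>\<omega>. (G s j \<omega>)^2) \<le> CG" for s j
 proof (cases s)
  case None
  have "2 * sqrt (A0 + D j)^4 = 2*(A0 + D j)^2" using sp(2)[of j] power_mult[of "sqrt (A0 + D j)" 2 2] by simp
  moreover have "(A0 + D j)^2 \<le> (A0 + dm)^2" using Dhi[of j] D_pos[of j] A0 by (intro power_mono) auto
  ultimately show ?thesis using mo(5-8)[of j] by (auto simp: None GN CG_def)
 next
  case (Some l)
  then show ?thesis using mo(1-4)[of j] Dhi[of j] by (auto simp: GS CG_def)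
 qed
 have cwb: "\<bar>cw q k s j\<bar> \<le> (1 + Kx)/d^k" if "q \<in> Q" for q k s j
 proof -
  have "\<bar>(case s of None \<Rightarrow> 1 | Some l \<Rightarrow> x j $ l)\<bar> \<le> 1 + Kx"
  proof (cases s)
   case (Some l) then show ?thesis using Kx[of j l] by simp
  qed (use Kx0 in simp)
  moreover have "d^k \<le> (q + D j)^k" using Q0[OF that] Dlo[of j] d0 by (intro power_mono) auto
  moreover have "0 < q + D j" using Q0[OF that] D_pos[of j] by linarith
  ultimately show ?thesis unfolding cw_def abs_divide using d0 by (intro frac_le) (auto simp: power_abs)
 qed
 show ?thesis
  unfolding Let_def
 \<comment> \<open>The error of area \<open>i\<close> itself does not average out; it takes the role
   of \<open>V\<close>, which only has to be bounded along each sequence.\<close>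
 proof (rule small_op_of_sequences[where T = T and Z = Z and V = "e i"])
  show "countable T" unfolding T_def Q_def by (intro countable_SIGMA countable_insert countable_image) auto
  show "T \<noteq> {}" by (auto simp: T_def Q_def)
  show "Z t m \<in> borel_measurable M" for t m unfolding Z_def by (cases t) simp
  show "e i \<in> borel_measurable M" by (rule em)
  show "(\<lambda>m. prob {\<omega>\<in>space M. \<eta> \<le> \<bar>Z t m \<omega>\<bar>}) \<longlonglongrightarrow> 0" if t: "t \<in> T" and \<eta>: "0 < \<eta>" for t \<eta>
  proof -
   obtain q k s where t': "t = (q, k, s)" "q \<in> Q" using t by (auto simp: T_def)
   show ?thesis unfolding Z_def t'(1) prod.case
    by (rule weighted_average_null[OF Gind _ _ _ _ cwb[OF t'(2)] \<eta>]) (use Gmom in blast)+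
  qed
  show "\<exists>K. prob {\<omega>\<in>space M. K \<le> \<bar>e i \<omega>\<bar>} \<le> \<delta>" if \<delta>: "0 < \<delta>" for \<delta>
  proof
   \<comment> \<open>Chebyshev's inequality for \<open>e i\<close>, whose variance is
     \<open>A0 + D i\<close>.\<close>
   let ?K = "sqrt ((A0 + D i)/\<delta>)"
   have p: "0 < (A0 + D i)/\<delta>" using A0 D_pos[of i] \<delta> by simp
   have "prob {\<omega>\<in>space M. ?K \<le> \<bar>e i \<omega>\<bar>} \<le> expectation (\<lambda>\<omega>. (e i \<omega>)^2)/?K^2"
    by (rule second_moment_method) (use mo(3) p in auto)
   also have "\<dots> = \<delta>" using mo(4)[of i] p A0 D_pos[of i] \<delta> by simp
   finally show "prob {\<omega>\<in>space M. ?K \<le> \<bar>e i \<omega>\<bar>} \<le> \<delta>" .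
  qed
  fix K :: real and mm :: "nat \<Rightarrow> nat" and om :: "nat \<Rightarrow> 'w"
  assume mm: "filterlim mm at_top sequentially" and Z0: "\<And>t. t \<in> T \<Longrightarrow> (\<lambda>n. Z t (mm n) (om n)) \<longlonglongrightarrow> 0" and eK: "\<And>n. \<bar>e i (om n)\<bar> \<le> K"
  let ?y = "\<lambda>n j. Y j (om n)"
  have y: "(\<lambda>j. x j \<bullet> \<beta>0 + e j (om n)) = ?y n" for n by (simp add: e_def)
  have ck: "prior field_differentiable at A" if "0 < A" for A using prior_C1 that by (auto simp: Ck_on_def)
  interpret posterior_sequence x D d dm X cg A0 mm "\<lambda>n j. e j (om n)" \<beta>0 i z K "\<lambda>n. A_tilde (mm n) (?y n)" "\<lambda>n. A_hat (mm n) (?y n)" prior "deriv prior" \<alpha>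
  proof (unfold_locales, goal_cases)
   case 7
   then show ?case using R3 cg(2) by eventually_elim blast
  next
   case (9 q k)
   then have "(q, k, None) \<in> T" by (auto simp: T_def Q_def)
   from Z0[OF this] show ?case by (simp add: Z_def cw_def G_def)
  next
   case (10 q k l)
   then have "(q, k, Some l) \<in> T" by (auto simp: T_def Q_def)
   from Z0[OF this] show ?case by (simp add: Z_def cw_def G_def mult.commute)
  next
   case 12
   show ?case unfolding y using eventually_compose_filterlim[OF REML mm] by eventually_elim blast
  next
   case 13
   show ?case unfolding y using eventually_compose_filterlim[OF AML mm] by eventually_elim blast
  next
   case 19
   have "EV m. dim (x ` {..<m}) = CARD('p) \<and> posterior_proper x D prior m (\<lambda>_. 0)"
    using R3 proper by eventually_elim blast
   then show ?case by (auto dest: eventually_happens)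
  qed (use d0 Dlo Dhi X cg A0 mm eK prior_pos ck prior_C1 quant in \<open>auto simp: Ck_on_def field_differentiable_derivI\<close>)
  show "(\<lambda>n. real (mm n)*(posterior_prob x D prior (mm n) (?y n) i (interval_N x D z (mm n) i (?y n) (A_tilde (mm n) (?y n))) -
    (1 - \<alpha> + std_normal_density z*c_hat x D prior z (mm n) i (?y n) (A_hat (mm n) (?y n))))) \<longlonglongrightarrow> 0"
   using coverage_sequence unfolding y .
 qed
qed

end
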